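(* Let $(\Omega^1,d)$ be a first order differential calculus over $A$ such that $\Omega^1$ is finitely generated projective as a right $A$-module. Then there is an isomorphism of categories $${}_{B\mathfrak{X}^1}\mathcal{M}\;\cong\;{}^{l}_{A}\mathcal{E}_{A}$$ between the category of left modules over the algebra $B\mathfrak{X}^1$ and the category ${}^{l}_{A}\mathcal{E}_{A}$ of left bimodule connections over the calculus.
   Context: Conventions. $\mathbb{K}$ is a field, $A$ a unital associative $\mathbb{K}$-algebra, $\otimes$ means $\otimes_A$. $A^{op}=\{\overline{a}: a\in A\}$ with $\overline{a}\,\overline{b}=\overline{ba}$; $A^e=A\otimes_{\mathbb{K}}A^{op}$ with elements written $a\overline{b}$. $A$-bimodules are identified with left $A^e$-modules via $(a\overline{b})m=amb$. Summation over repeated dual-basis indices is implicit. $R\star S$ is the free product of algebras, $T_{A^e}(V)$ the tensor algebra of an $A^e$-bimodule $V$, $TV$ the tensor algebra of a vector space $V$. A (first order) differential calculus over $A$ is an $A$-bimodule $\Omega^1$ with a $\mathbb{K}$-linear map $d:A\to\Omega^1$ satisfying $d(ab)=(da)b+a\,db$ (no surjectivity is assumed). Duals. Let $\Omega^1$ be finitely generated projective as a right $A$-module and $\mathfrak{X}^1=\mathrm{Hom}_A(\Omega^1,A)$ (right module maps), with $(axb)(\omega)=a\,x(b\omega)$, be its left dual bimodule, with $\mathrm{ev}:\mathfrak{X}^1\otimes\Omega^1\to A$, $\mathrm{ev}(x\otimes\omega)=x(\omega)$, and $\mathrm{coev}:A\to\Omega^1\otimes\mathfrak{X}^1$, $\mathrm{coev}(1)=\sum_i\omega_i\otimes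 x_i$. The algebra $B(\Omega^1)$. Let $\mathfrak{M}=\mathfrak{X}^1\otimes_{\mathbb{K}}\Omega^1$, elements $x\otimes_{\mathbb{K}}\omega$ written $(x,\omega)$, with $A^e$-bimodule structure $a\overline{a'}(x,\omega)b\overline{b'}=(axb,b'\omega a')$. Put $B(\Omega^1)=T_{A^e}(\mathfrak{M})$, with product $\bullet$. The algebra $B\mathfrak{X}^1$. It is the quotient of $B(\Omega^1)\star T\mathfrak{X}^1$ by the ideal generated by the relations $$a\bullet x=ax,\qquad x\bullet a=xa+\mathrm{ev}(x\otimes da),\qquad x\bullet\overline{a}=\overline{a}\bullet x+(x,da)\qquad (x\in\mathfrak{X}^1,\ a\in A),$$ where $ax,xa\in\mathfrak{X}^1$ denote the bimodule actions. The category ${}^{l}_{A}\mathcal{E}_{A}$. Objects are triples $(M,\nabla,\sigma)$ with $M$ an $A$-bimodule, $\nabla:M\to\Omega^1\otimes M$ a $\mathbb{K}$-linear map and $\sigma:M\otimes\Omega^1\to\Omega^1\otimes M$ a bimodule map with $\nabla(am)=a\nabla(m)+da\otimes m$ and $\nabla(ma)=\nabla(m)a+\sigma(m\otimes da)$ for all $a\in A$, $m\in M$. Morphisms $(M,\nabla_M,\sigma_M)\to(N,\nabla_N,\sigma_N)$ are bimodule maps $f:M\to N$ with $(\mathrm{id}_{\Omega^1}\otimes f)\nabla_M=\nabla_N f$ and $\sigma_N(f\otimes\mathrm{id}_{\Omega^1})=(\mathrm{id}_{\Omega^1}\otimes f)\sigma_M$. *)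

theory Defs
  imports "HOL-Algebra.Module" "HOL-Algebra.QuotRing" "HOL-Algebra.Free_Abelian_Groups"
begin

section \<open>Categories\<close>

text \<open>Hom-sets are indexed by source and target, so they need not be disjoint;
  \<open>Cmp C X Y Z g f\<close> is the composite of \<open>f : X \<rightarrow> Y\<close> followed by \<open>g : Y \<rightarrow> Z\<close>.\<close>

record ('o, 'f) cat =
  Ob  :: "'o set"
  Hom :: "'o \<Rightarrow> 'o \<Rightarrow> 'f set"
  Idt :: "'o \<Rightarrow> 'f"
  Cmp :: "'o \<Rightarrow> 'o \<Rightarrow> 'o \<Rightarrow> 'f \<Rightarrow> 'f \<Rightarrow> 'f"

definition category :: "('o, 'f) cat \<Rightarrow> bool" where
  "category C \<longleftrightarrow>
     (\<forall>X \<in> Ob C. Idt C X \<in> Hom C X X) \<and>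
     (\<forall>X \<in> Ob C. \<forall>Y \<in> Ob C. \<forall>Z \<in> Ob C. \<forall>f \<in> Hom C X Y. \<forall>g \<in> Hom C Y Z.
        Cmp C X Y Z g f \<in> Hom C X Z) \<and>
     (\<forall>X \<in> Ob C. \<forall>Y \<in> Ob C. \<forall>f \<in> Hom C X Y.
        Cmp C X X Y f (Idt C X) = f \<and> Cmp C X Y Y (Idt C Y) f = f) \<and>
     (\<forall>W \<in> Ob C. \<forall>X \<in> Ob C. \<forall>Y \<in> Ob C. \<forall>Z \<in> Ob C.
        \<forall>f \<in> Hom C W X. \<forall>g \<in> Hom C X Y. \<forall>h \<in> Hom C Y Z.
        Cmp C W X Z (Cmp C X Y Z h g) f = Cmp C W Y Z h (Cmp C W X Y g f))"

definition is_functor ::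
  "('o, 'f) cat \<Rightarrow> ('p, 'g) cat \<Rightarrow> ('o \<Rightarrow> 'p) \<Rightarrow> ('o \<Rightarrow> 'o \<Rightarrow> 'f \<Rightarrow> 'g) \<Rightarrow> bool" where
  "is_functor C D F0 F1 \<longleftrightarrow>
     (\<forall>X \<in> Ob C. F0 X \<in> Ob D) \<and>
     (\<forall>X \<in> Ob C. \<forall>Y \<in> Ob C. \<forall>f \<in> Hom C X Y. F1 X Y f \<in> Hom D (F0 X) (F0 Y)) \<and>
     (\<forall>X \<in> Ob C. F1 X X (Idt C X) = Idt D (F0 X)) \<and>
     (\<forall>X \<in> Ob C. \<forall>Y \<in> Ob C. \<forall>Z \<in> Ob C. \<forall>f \<in> Hom C X Y. \<forall>g \<in> Hom C Y Z.
        F1 X Z (Cmp C X Y Z g f) = Cmp D (F0 X) (F0 Y) (F0 Z) (F1 Y Z g) (F1 X Y f))"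

definition isomorphic_categories :: "('o, 'f) cat \<Rightarrow> ('p, 'g) cat \<Rightarrow> bool" where
  "isomorphic_categories C D \<longleftrightarrow>
     category C \<and> category D \<and>
     (\<exists>F0 F1 G0 G1. is_functor C D F0 F1 \<and> is_functor D C G0 G1 \<and>
        (\<forall>X \<in> Ob C. G0 (F0 X) = X) \<and>
        (\<forall>X \<in> Ob C. \<forall>Y \<in> Ob C. \<forall>f \<in> Hom C X Y. G1 (F0 X) (F0 Y) (F1 X Y f) = f) \<and>
        (\<forall>X \<in> Ob D. F0 (G0 X) = X) \<and>
        (\<forall>X \<in> Ob D. \<forall>Y \<in> Ob D. \<forall>f \<in> Hom D X Y. F1 (G0 X) (G0 Y) (G1 X Y f) = f))"


section \<open>Algebras, modules and bimodules\<close>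

text \<open>A \<open>K\<close>-algebra is a ring (possibly zero) that is a \<open>K\<close>-module with bilinear product. The
  library's locale \<^locale>\<open>algebra\<close> cannot be used because it requires commutativity.\<close>

locale unital_algebra = field K + module K A + A: ring A
  for K :: "('k, 'z) ring_scheme" (structure) and A :: "('k, 'a, 'y) module_scheme" (structure) +
  assumes smult_mult_left:
    "\<lbrakk>k \<in> carrier K; a \<in> carrier A; b \<in> carrier A\<rbrakk>
      \<Longrightarrow> (k \<odot>\<^bsub>A\<^esub> a) \<otimes>\<^bsub>A\<^esub> b = k \<odot>\<^bsub>A\<^esub> (a \<otimes>\<^bsub>A\<^esub> b)"
    and smult_mult_right:
    "\<lbrakk>k \<in> carrier K; a \<in> carrier A; b \<in> carrier A\<rbrakk>
      \<Longrightarrow> a \<otimes>\<^bsub>A\<^esub> (k \<odot>\<^bsub>A\<^esub> b) = k \<odot>\<^bsub>A\<^esub> (a \<otimes>\<^bsub>A\<^esub> b)"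

text \<open>The additive group of a module is stored in the \<open>mult\<close> and \<open>one\<close> fields of a
  \<^typ>\<open>'m monoid\<close>, the convention of \<^const>\<open>free_Abelian_group\<close>; \<open>\<boxplus>\<close> is the sum of module
  elements.\<close>

record ('l, 'm) lmod = "'m monoid" +
  lact :: "'l \<Rightarrow> 'm \<Rightarrow> 'm"

record ('l, 'r, 'm) bimod = "('l, 'm) lmod" +
  ract :: "'m \<Rightarrow> 'r \<Rightarrow> 'm"

abbreviation (input) mod_add :: "('m, 'z) monoid_scheme \<Rightarrow> 'm \<Rightarrow> 'm \<Rightarrow> 'm"
    (infixl "\<boxplus>\<index>" 65) where
  "x \<boxplus>\<^bsub>M\<^esub> y \<equiv> x \<otimes>\<^bsub>M\<^esub> y"

locale left_module = R: ring R + M: comm_group M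
  for R :: "('l, 'z) ring_scheme" (structure) and M :: "('l, 'm, 'y) lmod_scheme" (structure) +
  assumes lact_closed: "\<lbrakk>r \<in> carrier R; m \<in> carrier M\<rbrakk> \<Longrightarrow> lact M r m \<in> carrier M"
    and lact_add: "\<lbrakk>r \<in> carrier R; m \<in> carrier M; n \<in> carrier M\<rbrakk>
      \<Longrightarrow> lact M r (m \<boxplus>\<^bsub>M\<^esub> n) = lact M r m \<boxplus>\<^bsub>M\<^esub> lact M r n"
    and add_lact: "\<lbrakk>r \<in> carrier R; s \<in> carrier R; m \<in> carrier M\<rbrakk>
      \<Longrightarrow> lact M (r \<oplus>\<^bsub>R\<^esub> s) m = lact M r m \<boxplus>\<^bsub>M\<^esub> lact M s m"
    and mult_lact: "\<lbrakk>r \<in> carrier R; s \<in> carrier R; m \<in> carrier M\<rbrakk>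
      \<Longrightarrow> lact M (r \<otimes>\<^bsub>R\<^esub> s) m = lact M r (lact M s m)"
    and one_lact: "m \<in> carrier M \<Longrightarrow> lact M \<one>\<^bsub>R\<^esub> m = m"

text \<open>The last axiom makes the two actions of \<open>K\<close> agree, so that bimodules are the left
  \<open>A \<otimes>\<^sub>K A\<^sup>o\<^sup>p\<close>-modules.\<close>

locale bimodule = unital_algebra K A + left_module A M
  for K :: "('k, 'z) ring_scheme" (structure) and A :: "('k, 'a, 'y) module_scheme" (structure)
    and M :: "('a, 'a, 'm, 'x) bimod_scheme" (structure) +
  assumes ract_closed: "\<lbrakk>a \<in> carrier A; m \<in> carrier M\<rbrakk> \<Longrightarrow> ract M m a \<in> carrier M"
    and ract_add: "\<lbrakk>a \<in> carrier A; m \<in> carrier M; n \<in> carrier M\<rbrakk>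
      \<Longrightarrow> ract M (m \<boxplus>\<^bsub>M\<^esub> n) a = ract M m a \<boxplus>\<^bsub>M\<^esub> ract M n a"
    and add_ract: "\<lbrakk>a \<in> carrier A; b \<in> carrier A; m \<in> carrier M\<rbrakk>
      \<Longrightarrow> ract M m (a \<oplus>\<^bsub>A\<^esub> b) = ract M m a \<boxplus>\<^bsub>M\<^esub> ract M m b"
    and mult_ract: "\<lbrakk>a \<in> carrier A; b \<in> carrier A; m \<in> carrier M\<rbrakk>
      \<Longrightarrow> ract M m (a \<otimes>\<^bsub>A\<^esub> b) = ract M (ract M m a) b"
    and one_ract: "m \<in> carrier M \<Longrightarrow> ract M m \<one>\<^bsub>A\<^esub> = m"
    and lact_ract: "\<lbrakk>a \<in> carrier A; b \<in> carrier A; m \<in> carrier M\<rbrakk>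
      \<Longrightarrow> ract M (lact M a m) b = lact M a (ract M m b)"
    and scalar_central: "\<lbrakk>k \<in> carrier K; m \<in> carrier M\<rbrakk>
      \<Longrightarrow> lact M (k \<odot>\<^bsub>A\<^esub> \<one>\<^bsub>A\<^esub>) m = ract M m (k \<odot>\<^bsub>A\<^esub> \<one>\<^bsub>A\<^esub>)"

definition left_homs where
  "left_homs R M N =
     {f \<in> hom M N. \<forall>r \<in> carrier R. \<forall>m \<in> carrier M. f (lact M r m) = lact N r (f m)}"

definition right_homs where
  "right_homs R M N =
     {f \<in> hom M N. \<forall>r \<in> carrier R. \<forall>m \<in> carrier M. f (ract M m r) = ract N (f m) r}"

definition bimod_homs where
  "bimod_homs R M N = left_homs R M N \<inter> right_homs R M N"

definition self_alg :: "('k, 'z) ring_scheme \<Rightarrow> ('k, 'k) module" where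
  "self_alg K = \<lparr>carrier = carrier K, monoid.mult = monoid.mult K, monoid.one = monoid.one K,
     ring.zero = ring.zero K, ring.add = ring.add K, smult = monoid.mult K\<rparr>"

definition self_bimod :: "('a, 'z) ring_scheme \<Rightarrow> ('a, 'a, 'a) bimod" where
  "self_bimod A = \<lparr>carrier = carrier A, monoid.mult = ring.add A, monoid.one = ring.zero A,
     lact = monoid.mult A, ract = monoid.mult A\<rparr>"

definition vect_bimod :: "('k, 'a, 'z) module_scheme \<Rightarrow> ('k, 'k, 'a) bimod" where
  "vect_bimod V = \<lparr>carrier = carrier V, monoid.mult = ring.add V, monoid.one = ring.zero V,
     lact = smult V, ract = (\<lambda>v k. smult V k v)\<rparr>"

text \<open>The vector space underlying an \<open>A\<close>-bimodule.\<close>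

definition kact where
  "kact A M k m = lact M (k \<odot>\<^bsub>A\<^esub> \<one>\<^bsub>A\<^esub>) m"

definition scalars ::
  "('k, 'a, 'z) module_scheme \<Rightarrow> ('a, 'r, 'm, 'y) bimod_scheme \<Rightarrow> ('k, 'k, 'm) bimod" where
  "scalars A M = \<lparr>carrier = carrier M, monoid.mult = monoid.mult M, monoid.one = monoid.one M,
     lact = kact A M, ract = (\<lambda>m k. kact A M k m)\<rparr>"

definition free_bimod :: "('a, 'z) ring_scheme \<Rightarrow> 'i set \<Rightarrow> ('a, 'a, 'i \<Rightarrow> 'a) bimod" where
  "free_bimod A I = \<lparr>
     carrier = {f \<in> I \<rightarrow>\<^sub>E carrier A. finite {i \<in> I. f i \<noteq> \<zero>\<^bsub>A\<^esub>}},
     monoid.mult = (\<lambda>f g. \<lambda>i\<in>I. f i \<oplus>\<^bsub>A\<^esub> g i),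
     monoid.one = (\<lambda>i\<in>I. \<zero>\<^bsub>A\<^esub>),
     lact = (\<lambda>a f. \<lambda>i\<in>I. a \<otimes>\<^bsub>A\<^esub> f i),
     ract = (\<lambda>f a. \<lambda>i\<in>I. f i \<otimes>\<^bsub>A\<^esub> a)\<rparr>"

text \<open>Projective means direct summand of a free right module. Using basis sets inside the
  type of \<open>P\<close> is no restriction: \<open>P\<close> is a quotient of the free module on its own elements, and
  that quotient map splits whenever \<open>P\<close> is projective.\<close>

definition projective_right ::
  "('a, 'z) ring_scheme \<Rightarrow> ('l, 'a, 'm, 'y) bimod_scheme \<Rightarrow> bool" where
  "projective_right A P \<longleftrightarrow>
     (\<exists>(I :: 'm set) s p. s \<in> right_homs A P (free_bimod A I) \<and>
        p \<in> right_homs A (free_bimod A I) P \<and> (\<forall>x \<in> carrier P. p (s x) = x))"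

definition finitely_generated_right ::
  "('a, 'z) ring_scheme \<Rightarrow> ('l, 'a, 'm, 'y) bimod_scheme \<Rightarrow> bool" where
  "finitely_generated_right A P \<longleftrightarrow>
     (\<exists>S. finite S \<and> S \<subseteq> carrier P \<and>
        (\<forall>x \<in> carrier P. \<exists>c \<in> S \<rightarrow> carrier A. x = finprod P (\<lambda>s. ract P s (c s)) S))"


section \<open>Tensor products over a ring\<close>

text \<open>\<open>tensor R M N\<close> is the quotient of the free Abelian group on \<open>M \<times> N\<close> by the usual
  relations. Every map out of a quotient below is defined on cosets as the union, over
  all representatives, of the cosets of the images; that union is a single coset when the map
  is well defined (cf. \<^const>\<open>rcoset_mult\<close>).\<close>

abbreviation tensor_free where
  "tensor_free M N \<equiv> free_Abelian_group (carrier M \<times> carrier N)"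

definition tensor_rels where
  "tensor_rels R M N =
     {frag_of (m \<boxplus>\<^bsub>M\<^esub> m', n) - frag_of (m, n) - frag_of (m', n) | m m' n.
        m \<in> carrier M \<and> m' \<in> carrier M \<and> n \<in> carrier N} \<union>
     {frag_of (m, n \<boxplus>\<^bsub>N\<^esub> n') - frag_of (m, n) - frag_of (m, n') | m n n'.
        m \<in> carrier M \<and> n \<in> carrier N \<and> n' \<in> carrier N} \<union>
     {frag_of (ract M m r, n) - frag_of (m, lact N r n) | m r n.
        m \<in> carrier M \<and> r \<in> carrier R \<and> n \<in> carrier N}"

definition tensor_sub where
  "tensor_sub R M N = generate (tensor_free M N) (tensor_rels R M N)"

definition tensor_class where
  "tensor_class R M N c = tensor_sub R M N #>\<^bsub>tensor_free M N\<^esub> c"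

text \<open>The elementary tensor \<open>m \<otimes> n\<close>.\<close>

definition tens where
  "tens R M N m n = tensor_class R M N (frag_of (m, n))"

text \<open>The map \<open>f \<otimes> g\<close> with target \<open>tensor R M N\<close>.\<close>

definition tensor_map where
  "tensor_map R M N f g C =
     (\<Union>c \<in> C. tensor_class R M N (frag_extend (\<lambda>(m, n). frag_of (f m, g n)) c))"

definition tensor ::
  "('r, 'z) ring_scheme \<Rightarrow> ('l, 'r, 'm, 'y) bimod_scheme \<Rightarrow> ('r, 's, 'n, 'x) bimod_scheme
    \<Rightarrow> ('l, 's, ('m \<times> 'n \<Rightarrow>\<^sub>0 int) set) bimod" where
  "tensor R M N = \<lparr>
     carrier = carrier (tensor_free M N Mod tensor_sub R M N),
     monoid.mult = monoid.mult (tensor_free M N Mod tensor_sub R M N),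
     monoid.one = monoid.one (tensor_free M N Mod tensor_sub R M N),
     lact = (\<lambda>a. tensor_map R M N (lact M a) id),
     ract = (\<lambda>t b. tensor_map R M N id (\<lambda>n. ract N n b) t)\<rparr>"

definition frag_bilinear ::
  "('x \<Rightarrow> 'y \<Rightarrow> 'z) \<Rightarrow> ('x \<Rightarrow>\<^sub>0 int) \<Rightarrow> ('y \<Rightarrow>\<^sub>0 int) \<Rightarrow> ('z \<Rightarrow>\<^sub>0 int)" where
  "frag_bilinear f c d = frag_extend (\<lambda>x. frag_extend (\<lambda>y. frag_of (f x y)) d) c"

definition alg_tensor ::
  "('k, 'z) ring_scheme \<Rightarrow> ('k, 'a, 'y) module_scheme \<Rightarrow> ('k, 'b, 'x) module_scheme
    \<Rightarrow> ('k, ('a \<times> 'b \<Rightarrow>\<^sub>0 int) set) module" where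
  "alg_tensor K R S = (let V = vect_bimod R; W = vect_bimod S in \<lparr>
     carrier = carrier (tensor K V W),
     monoid.mult = (\<lambda>C D. \<Union>c \<in> C. \<Union>d \<in> D. tensor_class K V W
       (frag_bilinear (\<lambda>(r, s) (r', s'). (r \<otimes>\<^bsub>R\<^esub> r', s \<otimes>\<^bsub>S\<^esub> s')) c d)),
     monoid.one = tens K V W \<one>\<^bsub>R\<^esub> \<one>\<^bsub>S\<^esub>,
     ring.zero = monoid.one (tensor K V W),
     ring.add = monoid.mult (tensor K V W),
     smult = lact (tensor K V W)\<rparr>)"

definition op_alg :: "('k, 'a, 'z) module_scheme \<Rightarrow> ('k, 'a, 'z) module_scheme" where
  "op_alg A = A\<lparr>monoid.mult := (\<lambda>a b. b \<otimes>\<^bsub>A\<^esub> a)\<rparr>"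

definition env_alg ::
  "('k, 'z) ring_scheme \<Rightarrow> ('k, 'a) module \<Rightarrow> ('k, ('a \<times> 'a \<Rightarrow>\<^sub>0 int) set) module" where
  "env_alg K A = alg_tensor K A (op_alg A)"

text \<open>The elementary tensor \<open>a \<otimes> b\<close> in \<open>A \<otimes>\<^sub>K A\<^sup>o\<^sup>p\<close>, that is \<open>a b\<close> with a bar over \<open>b\<close>.\<close>

definition env_elt where
  "env_elt K A a b = tens K (vect_bimod A) (vect_bimod (op_alg A)) a b"


section \<open>The tensor algebra of a bimodule\<close>

text \<open>\<open>R \<oplus> \<Oplus>\<^sub>n\<^sub>\<ge>\<^sub>1 V\<^sup>\<otimes>\<^sup>n\<close>, with tensor powers over \<open>R\<close>. A word \<open>[v\<^sub>1, \<dots>, v\<^sub>n]\<close> stands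
  for \<open>v\<^sub>1 \<otimes> \<dots> \<otimes> v\<^sub>n\<close>. The relations are homogeneous in the length of words, so the
  quotient of the free Abelian group on the nonempty words is the direct sum of the tensor powers
  of positive degree. An element of the tensor algebra is a pair of its degree-zero part and its
  positive part.\<close>

definition tpow_words where
  "tpow_words V = {vs. vs \<noteq> [] \<and> set vs \<subseteq> carrier V}"

abbreviation tpow_free where
  "tpow_free V \<equiv> free_Abelian_group (tpow_words V)"

definition tpow_rels where
  "tpow_rels R V =
     {frag_of (us @ [v \<boxplus>\<^bsub>V\<^esub> w] @ ws) - frag_of (us @ [v] @ ws) - frag_of (us @ [w] @ ws) | us v w ws.
        set us \<subseteq> carrier V \<and> v \<in> carrier V \<and> w \<in> carrier V \<and> set ws \<subseteq> carrier V} \<union>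
     {frag_of (us @ [ract V v r, w] @ ws) - frag_of (us @ [v, lact V r w] @ ws) | us v r w ws.
        set us \<subseteq> carrier V \<and> v \<in> carrier V \<and> r \<in> carrier R \<and> w \<in> carrier V \<and> set ws \<subseteq> carrier V}"

definition tpow_sub where
  "tpow_sub R V = generate (tpow_free V) (tpow_rels R V)"

definition tpow_class where
  "tpow_class R V c = tpow_sub R V #>\<^bsub>tpow_free V\<^esub> c"

definition tpow_lact where
  "tpow_lact R V r C =
     (\<Union>c \<in> C. tpow_class R V (frag_extend (\<lambda>vs. frag_of (lact V r (hd vs) # tl vs)) c))"

definition tpow_ract where
  "tpow_ract R V C r =
     (\<Union>c \<in> C. tpow_class R V (frag_extend (\<lambda>vs. frag_of (butlast vs @ [ract V (last vs) r])) c))"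

definition tpow_concat where
  "tpow_concat R V C D = (\<Union>c \<in> C. \<Union>d \<in> D. tpow_class R V (frag_bilinear (@) c d))"

definition tensor_algebra ::
  "('k, 'r, 'z) module_scheme \<Rightarrow> ('r, 'r, 'v, 'y) bimod_scheme
    \<Rightarrow> ('k, 'r \<times> ('v list \<Rightarrow>\<^sub>0 int) set) module" where
  "tensor_algebra R V = (let P = tpow_free V Mod tpow_sub R V in \<lparr>
     carrier = carrier R \<times> carrier P,
     monoid.mult = (\<lambda>(r, C) (s, D). (r \<otimes>\<^bsub>R\<^esub> s,
       tpow_lact R V r D \<otimes>\<^bsub>P\<^esub> tpow_ract R V C s \<otimes>\<^bsub>P\<^esub> tpow_concat R V C D)),
     monoid.one = (\<one>\<^bsub>R\<^esub>, \<one>\<^bsub>P\<^esub>),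
     ring.zero = (\<zero>\<^bsub>R\<^esub>, \<one>\<^bsub>P\<^esub>),
     ring.add = (\<lambda>(r, C) (s, D). (r \<oplus>\<^bsub>R\<^esub> s, C \<otimes>\<^bsub>P\<^esub> D)),
     smult = (\<lambda>k (r, C). (k \<odot>\<^bsub>R\<^esub> r, tpow_lact R V (k \<odot>\<^bsub>R\<^esub> \<one>\<^bsub>R\<^esub>) C))\<rparr>)"

text \<open>The inclusions of \<open>R\<close> and \<open>V\<close> as the components of degree 0 and 1.\<close>

definition deg0 where
  "deg0 R V r = (r, tpow_sub R V)"

definition deg1 where
  "deg1 R V v = (\<zero>\<^bsub>R\<^esub>, tpow_class R V (frag_of [v]))"


section \<open>The free product of algebras\<close>

text \<open>The free product is the quotient of \<open>T(R \<oplus> S)\<close>, the tensor algebra over \<open>K\<close> of the vector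
  space \<open>R \<oplus> S\<close>, by the ideal that identifies products and units of \<open>R\<close> and \<open>S\<close> with those of
  \<open>T(R \<oplus> S)\<close>.\<close>

definition dsum_vect ::
  "('k, 'a, 'y) module_scheme \<Rightarrow> ('k, 'b, 'x) module_scheme \<Rightarrow> ('k, 'k, 'a \<times> 'b) bimod" where
  "dsum_vect R S = \<lparr>
     carrier = carrier (add_monoid R \<times>\<times> add_monoid S),
     monoid.mult = monoid.mult (add_monoid R \<times>\<times> add_monoid S),
     monoid.one = monoid.one (add_monoid R \<times>\<times> add_monoid S),
     lact = (\<lambda>k (r, s). (k \<odot>\<^bsub>R\<^esub> r, k \<odot>\<^bsub>S\<^esub> s)),
     ract = (\<lambda>(r, s) k. (k \<odot>\<^bsub>R\<^esub> r, k \<odot>\<^bsub>S\<^esub> s))\<rparr>"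

definition pre_free_product where
  "pre_free_product K R S = tensor_algebra (self_alg K) (dsum_vect R S)"

definition pre_inl where
  "pre_inl K R S r = deg1 (self_alg K) (dsum_vect R S) (r, \<zero>\<^bsub>S\<^esub>)"

definition pre_inr where
  "pre_inr K R S s = deg1 (self_alg K) (dsum_vect R S) (\<zero>\<^bsub>R\<^esub>, s)"

definition free_product_ideal where
  "free_product_ideal K R S = (let T = pre_free_product K R S in Idl\<^bsub>T\<^esub>
     ({pre_inl K R S r \<otimes>\<^bsub>T\<^esub> pre_inl K R S r' \<ominus>\<^bsub>T\<^esub> pre_inl K R S (r \<otimes>\<^bsub>R\<^esub> r') | r r'.
         r \<in> carrier R \<and> r' \<in> carrier R} \<union>
      {pre_inr K R S s \<otimes>\<^bsub>T\<^esub> pre_inr K R S s' \<ominus>\<^bsub>T\<^esub> pre_inr K R S (s \<otimes>\<^bsub>S\<^esub> s') | s s'.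
         s \<in> carrier S \<and> s' \<in> carrier S} \<union>
      {pre_inl K R S \<one>\<^bsub>R\<^esub> \<ominus>\<^bsub>T\<^esub> \<one>\<^bsub>T\<^esub>, pre_inr K R S \<one>\<^bsub>S\<^esub> \<ominus>\<^bsub>T\<^esub> \<one>\<^bsub>T\<^esub>}))"

definition free_product where
  "free_product K R S = pre_free_product K R S Quot free_product_ideal K R S"

definition fp_inl where
  "fp_inl K R S r = free_product_ideal K R S +>\<^bsub>pre_free_product K R S\<^esub> pre_inl K R S r"

definition fp_inr where
  "fp_inr K R S s = free_product_ideal K R S +>\<^bsub>pre_free_product K R S\<^esub> pre_inr K R S s"


section \<open>Differential calculi and the algebra of vector fields\<close>

locale differential_calculus = bimodule K A \<Omega>
  for K :: "('k, 'z) ring_scheme" (structure) and A :: "('k, 'a) module" (structure)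
    and \<Omega> :: "('a, 'a, 'w) bimod" (structure) +
  fixes d :: "'a \<Rightarrow> 'w"
  assumes d_closed: "a \<in> carrier A \<Longrightarrow> d a \<in> carrier \<Omega>"
    and d_add: "\<lbrakk>a \<in> carrier A; b \<in> carrier A\<rbrakk> \<Longrightarrow> d (a \<oplus>\<^bsub>A\<^esub> b) = d a \<boxplus>\<^bsub>\<Omega>\<^esub> d b"
    and d_smult: "\<lbrakk>k \<in> carrier K; a \<in> carrier A\<rbrakk> \<Longrightarrow> d (k \<odot>\<^bsub>A\<^esub> a) = kact A \<Omega> k (d a)"
    and d_mult: "\<lbrakk>a \<in> carrier A; b \<in> carrier A\<rbrakk>
      \<Longrightarrow> d (a \<otimes>\<^bsub>A\<^esub> b) = ract \<Omega> (d a) b \<boxplus>\<^bsub>\<Omega>\<^esub> lact \<Omega> a (d b)"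

text \<open>The bimodule of right module maps \<open>\<Omega> \<rightarrow> A\<close>, represented by functions that are
  \<^const>\<open>undefined\<close> outside the carrier of \<open>\<Omega>\<close>.\<close>

definition left_dual ::
  "('a, 'z) ring_scheme \<Rightarrow> ('a, 'a, 'w, 'y) bimod_scheme \<Rightarrow> ('a, 'a, 'w \<Rightarrow> 'a) bimod" where
  "left_dual A \<Omega> = \<lparr>
     carrier = right_homs A \<Omega> (self_bimod A) \<inter> extensional (carrier \<Omega>),
     monoid.mult = (\<lambda>x y. \<lambda>\<omega>\<in>carrier \<Omega>. x \<omega> \<oplus>\<^bsub>A\<^esub> y \<omega>),
     monoid.one = (\<lambda>\<omega>\<in>carrier \<Omega>. \<zero>\<^bsub>A\<^esub>),
     lact = (\<lambda>a x. \<lambda>\<omega>\<in>carrier \<Omega>. a \<otimes>\<^bsub>A\<^esub> x \<omega>),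
     ract = (\<lambda>x b. \<lambda>\<omega>\<in>carrier \<Omega>. x (lact \<Omega> b \<omega>))\<rparr>"

text \<open>The \<open>A \<otimes>\<^sub>K A\<^sup>o\<^sup>p\<close>-bimodule \<open>\<MM> = \<XX> \<otimes>\<^sub>K \<Omega>\<close>, where \<open>\<XX>\<close> is the left dual of \<open>\<Omega>\<close>.\<close>

definition MM ::
  "('k, 'z) ring_scheme \<Rightarrow> ('k, 'a) module \<Rightarrow> ('a, 'a, 'w) bimod
    \<Rightarrow> (('a \<times> 'a \<Rightarrow>\<^sub>0 int) set, ('a \<times> 'a \<Rightarrow>\<^sub>0 int) set, (('w \<Rightarrow> 'a) \<times> 'w \<Rightarrow>\<^sub>0 int) set) bimod" where
  "MM K A \<Omega> = (let X = left_dual A \<Omega>; V = scalars A X; W = scalars A \<Omega> in \<lparr>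
     carrier = carrier (tensor K V W),
     monoid.mult = monoid.mult (tensor K V W),
     monoid.one = monoid.one (tensor K V W),
     lact = (\<lambda>E C. \<Union>e \<in> E. \<Union>c \<in> C. tensor_class K V W
       (frag_bilinear (\<lambda>(a, a') (x, \<omega>). (lact X a x, ract \<Omega> \<omega> a')) e c)),
     ract = (\<lambda>C E. \<Union>c \<in> C. \<Union>e \<in> E. tensor_class K V W
       (frag_bilinear (\<lambda>(x, \<omega>) (b, b'). (ract X x b, lact \<Omega> b' \<omega>)) c e))\<rparr>)"

definition MM_elt where
  "MM_elt K A \<Omega> x \<omega> = tens K (scalars A (left_dual A \<Omega>)) (scalars A \<Omega>) x \<omega>"

definition B_alg where
  "B_alg K A \<Omega> = tensor_algebra (env_alg K A) (MM K A \<Omega>)"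

definition TX_alg where
  "TX_alg K A \<Omega> = tensor_algebra (self_alg K) (scalars A (left_dual A \<Omega>))"

definition BX_pre where
  "BX_pre K A \<Omega> = free_product K (B_alg K A \<Omega>) (TX_alg K A \<Omega>)"

text \<open>The images in the free product of \<open>a\<close>, of \<open>a\<close> with a bar, of \<open>(x, \<omega>)\<close> and of \<open>x\<close>.\<close>

definition gen_A where
  "gen_A K A \<Omega> a = fp_inl K (B_alg K A \<Omega>) (TX_alg K A \<Omega>)
     (deg0 (env_alg K A) (MM K A \<Omega>) (env_elt K A a \<one>\<^bsub>A\<^esub>))"

definition gen_Aop where
  "gen_Aop K A \<Omega> a = fp_inl K (B_alg K A \<Omega>) (TX_alg K A \<Omega>)
     (deg0 (env_alg K A) (MM K A \<Omega>) (env_elt K A \<one>\<^bsub>A\<^esub> a))"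

definition gen_M where
  "gen_M K A \<Omega> x \<omega> = fp_inl K (B_alg K A \<Omega>) (TX_alg K A \<Omega>)
     (deg1 (env_alg K A) (MM K A \<Omega>) (MM_elt K A \<Omega> x \<omega>))"

definition gen_X where
  "gen_X K A \<Omega> x = fp_inr K (B_alg K A \<Omega>) (TX_alg K A \<Omega>)
     (deg1 (self_alg K) (scalars A (left_dual A \<Omega>)) x)"

text \<open>In the second relation \<open>x (d a)\<close> is \<open>ev (x \<otimes> d a)\<close>.\<close>

definition BX_ideal where
  "BX_ideal K A \<Omega> d = (let P = BX_pre K A \<Omega>; X = left_dual A \<Omega> in Idl\<^bsub>P\<^esub>
     ({gen_A K A \<Omega> a \<otimes>\<^bsub>P\<^esub> gen_X K A \<Omega> x \<ominus>\<^bsub>P\<^esub> gen_X K A \<Omega> (lact X a x) | a x.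
         a \<in> carrier A \<and> x \<in> carrier X} \<union>
      {gen_X K A \<Omega> x \<otimes>\<^bsub>P\<^esub> gen_A K A \<Omega> a
         \<ominus>\<^bsub>P\<^esub> (gen_X K A \<Omega> (ract X x a) \<oplus>\<^bsub>P\<^esub> gen_A K A \<Omega> (x (d a))) | a x.
         a \<in> carrier A \<and> x \<in> carrier X} \<union>
      {gen_X K A \<Omega> x \<otimes>\<^bsub>P\<^esub> gen_Aop K A \<Omega> a
         \<ominus>\<^bsub>P\<^esub> (gen_Aop K A \<Omega> a \<otimes>\<^bsub>P\<^esub> gen_X K A \<Omega> x \<oplus>\<^bsub>P\<^esub> gen_M K A \<Omega> x (d a)) | a x.
         a \<in> carrier A \<and> x \<in> carrier X}))"

definition BX where
  "BX K A \<Omega> d = BX_pre K A \<Omega> Quot BX_ideal K A \<Omega> d"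


section \<open>The two categories\<close>

text \<open>Objects are the modules whose carrier is a subset of the type \<open>'m\<close>, which is arbitrary and
  serves as the universe. For equality of objects and morphisms to be the intended one, all
  operations are required to be \<^const>\<open>undefined\<close> outside the carriers.\<close>

definition ext_lmod :: "('l, 'z) ring_scheme \<Rightarrow> ('l, 'm, 'y) lmod_scheme \<Rightarrow> bool" where
  "ext_lmod R M \<longleftrightarrow>
     (\<lambda>(m, n). m \<boxplus>\<^bsub>M\<^esub> n) \<in> extensional (carrier M \<times> carrier M) \<and>
     (\<lambda>(r, m). lact M r m) \<in> extensional (carrier R \<times> carrier M)"

definition ext_bimod :: "('a, 'z) ring_scheme \<Rightarrow> ('a, 'a, 'm, 'y) bimod_scheme \<Rightarrow> bool" where
  "ext_bimod A M \<longleftrightarrow> ext_lmod A M \<and>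
     (\<lambda>(m, a). ract M m a) \<in> extensional (carrier M \<times> carrier A)"

definition lmod_cat :: "('b, 'z) ring_scheme \<Rightarrow> (('b, 'm) lmod, 'm \<Rightarrow> 'm) cat" where
  "lmod_cat B = \<lparr>
     Ob = {M. left_module B M \<and> ext_lmod B M},
     Hom = (\<lambda>M N. left_homs B M N \<inter> extensional (carrier M)),
     Idt = (\<lambda>M. \<lambda>m\<in>carrier M. m),
     Cmp = (\<lambda>M N L g f. compose (carrier M) g f)\<rparr>"

type_synonym ('a, 'w, 'm) conn =
  "('a, 'a, 'm) bimod \<times> ('m \<Rightarrow> ('w \<times> 'm \<Rightarrow>\<^sub>0 int) set) \<times>
     (('m \<times> 'w \<Rightarrow>\<^sub>0 int) set \<Rightarrow> ('w \<times> 'm \<Rightarrow>\<^sub>0 int) set)"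

definition bimodule_connection ::
  "('k, 'z) ring_scheme \<Rightarrow> ('k, 'a) module \<Rightarrow> ('a, 'a, 'w) bimod \<Rightarrow> ('a \<Rightarrow> 'w)
    \<Rightarrow> ('a, 'w, 'm) conn \<Rightarrow> bool" where
  "bimodule_connection K A \<Omega> d = (\<lambda>(M, nabla, \<sigma>).
     (let \<Omega>M = tensor A \<Omega> M; M\<Omega> = tensor A M \<Omega> in
       bimodule K A M \<and>
       nabla \<in> hom M \<Omega>M \<and>
       (\<forall>k \<in> carrier K. \<forall>m \<in> carrier M. nabla (kact A M k m) = kact A \<Omega>M k (nabla m)) \<and>
       \<sigma> \<in> bimod_homs A M\<Omega> \<Omega>M \<and>
       (\<forall>a \<in> carrier A. \<forall>m \<in> carrier M.
          nabla (lact M a m) = lact \<Omega>M a (nabla m) \<boxplus>\<^bsub>\<Omega>M\<^esub> tens A \<Omega> M (d a) m) \<and>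
       (\<forall>a \<in> carrier A. \<forall>m \<in> carrier M.
          nabla (ract M m a) = ract \<Omega>M (nabla m) a \<boxplus>\<^bsub>\<Omega>M\<^esub> \<sigma> (tens A M \<Omega> m (d a)))))"

definition conn_homs ::
  "('k, 'a) module \<Rightarrow> ('a, 'a, 'w) bimod \<Rightarrow> ('a, 'w, 'm) conn \<Rightarrow> ('a, 'w, 'm) conn
    \<Rightarrow> ('m \<Rightarrow> 'm) set" where
  "conn_homs A \<Omega> = (\<lambda>(M, nabla, \<sigma>) (N, nabla', \<sigma>').
     {f \<in> bimod_homs A M N.
        (\<forall>m \<in> carrier M. tensor_map A \<Omega> N id f (nabla m) = nabla' (f m)) \<and>
        (\<forall>t \<in> carrier (tensor A M \<Omega>).
           \<sigma>' (tensor_map A N \<Omega> f id t) = tensor_map A \<Omega> N id f (\<sigma> t))})"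

definition conn_cat ::
  "('k, 'z) ring_scheme \<Rightarrow> ('k, 'a) module \<Rightarrow> ('a, 'a, 'w) bimod \<Rightarrow> ('a \<Rightarrow> 'w)
    \<Rightarrow> (('a, 'w, 'm) conn, 'm \<Rightarrow> 'm) cat" where
  "conn_cat K A \<Omega> d = \<lparr>
     Ob = {(M, nabla, \<sigma>). bimodule_connection K A \<Omega> d (M, nabla, \<sigma>) \<and> ext_bimod A M \<and>
        nabla \<in> extensional (carrier M) \<and> \<sigma> \<in> extensional (carrier (tensor A M \<Omega>))},
     Hom = (\<lambda>(M, nabla, \<sigma>) (N, nabla', \<sigma>').
        conn_homs A \<Omega> (M, nabla, \<sigma>) (N, nabla', \<sigma>') \<inter> extensional (carrier M)),
     Idt = (\<lambda>(M, _). \<lambda>m\<in>carrier M. m),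
     Cmp = (\<lambda>(M, _) _ _ g f. compose (carrier M) g f)\<rparr>"

end

theory Submission
  imports Defs "HOL-Algebra.Subrings"
begin

text \<open>Write \<open>X\<close> for the left dual of \<open>\<Omega>\<close>. A left module over the algebra of vector fields is an Abelian
  group \<open>M\<close> together with additive endomorphisms \<open>\<alpha> a\<close>, \<open>\<beta> a\<close>, \<open>\<mu> x \<omega>\<close> and \<open>\<xi> x\<close> that satisfy the
  defining relations. The maps \<open>\<alpha>\<close> and \<open>\<beta>\<close> make \<open>M\<close> an \<open>A\<close>-bimodule, and the relations
  \<open>\<alpha> a \<xi> x = \<xi> (a x)\<close> and \<open>\<alpha> a \<mu> x \<omega> = \<mu> (a x) \<omega>\<close> say that \<open>x \<mapsto> \<xi> x m\<close> and \<open>x \<mapsto> \<mu> x \<omega> m\<close> are left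
  \<open>A\<close>-linear maps \<open>X \<rightarrow> M\<close>. Since \<open>\<Omega>\<close> has a finite dual basis \<open>(\<omega>\<^sub>i, x\<^sub>i)\<close>, evaluation identifies
  \<open>\<Omega> \<otimes> M\<close> with these linear maps, with inverse \<open>\<theta> \<mapsto> \<Sum>\<^sub>i \<omega>\<^sub>i \<otimes> \<theta> x\<^sub>i\<close>. Hence \<open>\<xi>\<close> and \<open>\<mu>\<close> amount to maps
  \<open>\<nabla> : M \<rightarrow> \<Omega> \<otimes> M\<close> and \<open>\<sigma> : M \<otimes> \<Omega> \<rightarrow> \<Omega> \<otimes> M\<close>, and evaluation at an arbitrary \<open>x\<close> turns the Leibniz rules
  and the bimodule property of \<open>\<sigma>\<close> into the remaining relations.\<close>


text \<open>The algebra is a coset construction over cosets: a quotient of a free product of two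
  tensor algebras, one of them over an enveloping algebra. No normal form of its elements is ever
  used. Two facts replace it. \<open>BX_universal\<close> extends operators that satisfy the
  relations to a ring homomorphism, and \<open>BX_generated\<close> makes every additive map that
  commutes with the generators linear. Both are proved layer by layer.

  The universal properties are stated for arbitrary target rings, because the target is the ring of
  additive endomorphisms of \<open>M\<close>, where the scalars need not be central. Agreement of
  the two images of the scalars takes the place of \<open>K\<close>-linearity.

  An isomorphism of categories demands equality of objects, so structures are compared as functions,
  including their values outside the carriers. The dual basis is a choice, but an element of
  \<Omega> \<otimes> M is determined by its evaluations, so the functors do not depend on
  it.\<close>

section \<open>Formal integer combinations and their bilinear extensions\<close>

lemma frag_extend_fun_add:
  "frag_extend (\<lambda>x. f x + g x) c = frag_extend f c + frag_extend g c"
  by (simp add: frag_extend_def frag_cmul_distrib2 sum.distrib)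

lemma frag_extend_fun_diff:
  "frag_extend (\<lambda>x. f x - g x) c = frag_extend f c - frag_extend g c"
  using frag_extend_fun_add[of "\<lambda>x. f x - g x" g c] by simp

lemma keys_diff_subset:
  "Poly_Mapping.keys c \<subseteq> S \<Longrightarrow> Poly_Mapping.keys d \<subseteq> S \<Longrightarrow> Poly_Mapping.keys (c - d) \<subseteq> S"
  using keys_diff[of c d] by blast

lemma keys_frag_extend_of:
  assumes "Poly_Mapping.keys c \<subseteq> S" "\<And>s. s \<in> S \<Longrightarrow> f s \<in> T"
  shows "Poly_Mapping.keys (frag_extend (\<lambda>s. frag_of (f s)) c) \<subseteq> T"
  using keys_frag_extend[of "\<lambda>s. frag_of (f s)" c] assms by auto

lemma keys_frag_bilinear:
  assumes "Poly_Mapping.keys c \<subseteq> S" "Poly_Mapping.keys d \<subseteq> T"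
    and "\<And>s t. s \<in> S \<Longrightarrow> t \<in> T \<Longrightarrow> f s t \<in> U"
  shows "Poly_Mapping.keys (frag_bilinear f c d) \<subseteq> U"
proof -
  have "Poly_Mapping.keys (frag_extend (\<lambda>y. frag_of (f x y)) d) \<subseteq> U"
    if "x \<in> Poly_Mapping.keys c" for x
    using that assms by (intro keys_frag_extend_of[of d T]) auto
  then show ?thesis
    unfolding frag_bilinear_def
    using keys_frag_extend[of "\<lambda>x. frag_extend (\<lambda>y. frag_of (f x y)) d" c] by blast
qed

lemma frag_bilinear_of [simp]: "frag_bilinear f (frag_of s) (frag_of t) = frag_of (f s t)"
  by (simp add: frag_bilinear_def)

lemma frag_bilinear_diff_left:
  "frag_bilinear f (c - c') d = frag_bilinear f c d - frag_bilinear f c' d"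
  by (simp add: frag_bilinear_def frag_extend_diff)

lemma frag_bilinear_diff_right:
  "frag_bilinear f c (d - d') = frag_bilinear f c d - frag_bilinear f c d'"
  by (simp add: frag_bilinear_def frag_extend_diff frag_extend_fun_diff)

lemma frag_bilinear_add_left:
  "frag_bilinear f (c + c') d = frag_bilinear f c d + frag_bilinear f c' d"
  by (simp add: frag_bilinear_def frag_extend_add)

lemma frag_bilinear_add_right:
  "frag_bilinear f c (d + d') = frag_bilinear f c d + frag_bilinear f c d'"
  by (simp add: frag_bilinear_def frag_extend_add frag_extend_fun_add)

lemma frag_bilinear_zero [simp]: "frag_bilinear f 0 d = 0" "frag_bilinear f c 0 = 0"
  using frag_bilinear_diff_left[of f c c d] frag_bilinear_diff_right[of f c d d] by simp_all


lemmas frag_induct = free_Abelian_group_induct [consumes 1, case_names zero diff of]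


section \<open>Abelian groups given by generators and relations\<close>

text \<open>Tensor products over a ring and tensor powers both have this form
  (\<open>tensor_class_eq\<close>, \<open>tpow_class_eq\<close>), so well-definedness, induction on
  generators and the universal property are settled once for an arbitrary presentation.\<close>

definition pres_sub :: "'s set \<Rightarrow> ('s \<Rightarrow>\<^sub>0 int) set \<Rightarrow> ('s \<Rightarrow>\<^sub>0 int) set" where
  "pres_sub S R = generate (free_Abelian_group S) R"

definition pres :: "'s set \<Rightarrow> ('s \<Rightarrow>\<^sub>0 int) set \<Rightarrow> ('s \<Rightarrow>\<^sub>0 int) set monoid" where
  "pres S R = free_Abelian_group S Mod pres_sub S R"

definition pres_class :: "'s set \<Rightarrow> ('s \<Rightarrow>\<^sub>0 int) set \<Rightarrow> ('s \<Rightarrow>\<^sub>0 int) \<Rightarrow> ('s \<Rightarrow>\<^sub>0 int) set" where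
  "pres_class S R c = pres_sub S R #>\<^bsub>free_Abelian_group S\<^esub> c"

text \<open>The assumption places the relators in the free group on \<open>S\<close>, which is what
  makes \<open>pres_sub S R\<close> a subgroup.\<close>

locale presentation =
  fixes S :: "'s set" and R :: "('s \<Rightarrow>\<^sub>0 int) set"
  assumes rels: "\<And>r. r \<in> R \<Longrightarrow> Poly_Mapping.keys r \<subseteq> S"
begin

abbreviation "F \<equiv> free_Abelian_group S"
abbreviation "P \<equiv> pres S R"
abbreviation "cl \<equiv> pres_class S R"
abbreviation "gen s \<equiv> cl (frag_of s)"

sublocale F: comm_group F
  by (rule abelian_free_Abelian_group)

lemma subgroup_pres_sub: "subgroup (pres_sub S R) F"
  unfolding pres_sub_def by (intro F.generate_is_subgroup) (auto dest: rels)

lemma normal_pres_sub: "pres_sub S R \<lhd> F"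
  using subgroup_pres_sub F.normal_iff_subgroup by blast

sublocale comm_group P
  unfolding pres_def by (intro F.abelian_FactGroup subgroup_pres_sub)

lemma class_hom: "cl \<in> hom F P"
  unfolding pres_class_def[abs_def] pres_def by (rule normal.r_coset_hom_Mod[OF normal_pres_sub])

lemma class_closed [simp]: "Poly_Mapping.keys c \<subseteq> S \<Longrightarrow> cl c \<in> carrier P"
  using class_hom by (simp add: hom_def Pi_iff)

lemma carrier_pres: "carrier P = cl ` {c. Poly_Mapping.keys c \<subseteq> S}"
  by (auto simp: pres_def carrier_FactGroup pres_class_def)

lemma class_add:
  "Poly_Mapping.keys c \<subseteq> S \<Longrightarrow> Poly_Mapping.keys d \<subseteq> S \<Longrightarrow> cl (c + d) = cl c \<otimes>\<^bsub>P\<^esub> cl d"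
  using hom_mult[OF class_hom, of c d] by simp

lemma class_zero: "cl 0 = \<one>\<^bsub>P\<^esub>"
  using hom_one[OF class_hom] F.is_group is_group by simp

lemma one_pres: "\<one>\<^bsub>P\<^esub> = pres_sub S R"
  by (simp add: pres_def)

lemma class_eq_one: "Poly_Mapping.keys c \<subseteq> S \<Longrightarrow> cl c = \<one>\<^bsub>P\<^esub> \<longleftrightarrow> c \<in> pres_sub S R"
  unfolding one_pres pres_class_def
  using F.coset_join2[OF _ subgroup_pres_sub, of c] F.rcos_self[OF _ subgroup_pres_sub, of c] by auto

lemma class_rel: "r \<in> R \<Longrightarrow> cl r = \<one>\<^bsub>P\<^esub>"
  by (simp add: class_eq_one rels) (simp add: pres_sub_def generate.incl)

lemma class_minus: "Poly_Mapping.keys c \<subseteq> S \<Longrightarrow> cl (- c) = inv\<^bsub>P\<^esub> (cl c)"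
  using class_add[of "- c" c] by (simp add: class_zero inv_equality[symmetric])

lemma class_diff:
  "Poly_Mapping.keys c \<subseteq> S \<Longrightarrow> Poly_Mapping.keys d \<subseteq> S \<Longrightarrow> cl (c - d) = cl c \<otimes>\<^bsub>P\<^esub> inv\<^bsub>P\<^esub> (cl d)"
  using class_add[of c "- d"] by (simp add: class_minus)

lemma class_diff_rel:
  assumes "c - d \<in> R" "Poly_Mapping.keys c \<subseteq> S" "Poly_Mapping.keys d \<subseteq> S"
  shows "cl c = cl d"
proof -
  have "cl c \<otimes>\<^bsub>P\<^esub> inv\<^bsub>P\<^esub> (cl d) = \<one>\<^bsub>P\<^esub>"
    using class_rel[OF assms(1)] assms(2,3) by (simp add: class_diff)
  then show ?thesis
    using inv_equality[of "cl c" "inv\<^bsub>P\<^esub> (cl d)"] assms(2,3) by simp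
qed

lemma class_add_rel:
  assumes "c - d - e \<in> R" "Poly_Mapping.keys c \<subseteq> S" "Poly_Mapping.keys d \<subseteq> S"
    "Poly_Mapping.keys e \<subseteq> S"
  shows "cl c = cl d \<otimes>\<^bsub>P\<^esub> cl e"
proof -
  have "Poly_Mapping.keys (d + e) \<subseteq> S"
    using keys_add[of d e] assms(3,4) by blast
  with class_diff_rel[of c "d + e"] assms show ?thesis
    by (simp add: class_add diff_diff_eq)
qed

lemma class_mem:
  assumes "Poly_Mapping.keys c \<subseteq> S" "c' \<in> cl c"
  shows "Poly_Mapping.keys c' \<subseteq> S" "cl c' = cl c"
proof -
  have c': "c' \<in> pres_sub S R #>\<^bsub>F\<^esub> c"
    using assms(2) by (simp add: pres_class_def)
  show "Poly_Mapping.keys c' \<subseteq> S"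
    using subgroup.elemrcos_carrier[OF subgroup_pres_sub F.is_group _ c'] assms(1) by simp
  show "cl c' = cl c"
    unfolding pres_class_def
    by (rule F.repr_independence[symmetric, OF c' _ subgroup_pres_sub]) (simp add: assms(1))
qed

lemma class_self: "Poly_Mapping.keys c \<subseteq> S \<Longrightarrow> c \<in> cl c"
  unfolding pres_class_def by (rule F.rcos_self) (simp_all add: subgroup_pres_sub)

text \<open>This links the unions over representatives that define maps on cosets with ordinary
  well-definedness: a family of sets that is constant on a coset has that constant as its
  union.\<close>

lemma UN_class:
  assumes "Poly_Mapping.keys c \<subseteq> S"
    and "\<And>c'. Poly_Mapping.keys c' \<subseteq> S \<Longrightarrow> cl c' = cl c \<Longrightarrow> f c' = f c"
  shows "(\<Union>x\<in>cl c. f x) = f c"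
proof -
  have "(\<Union>x\<in>cl c. f x) = (\<Union>x\<in>cl c. f c)"
    by (rule SUP_cong) (simp_all add: assms(2)[OF class_mem[OF assms(1)]])
  also have "\<dots> = f c"
    using class_self[OF assms(1)] by auto
  finally show ?thesis .
qed

lemma pres_induct [consumes 1, case_names diff one gen]:
  assumes "x \<in> carrier P"
    and diff: "\<And>x y. x \<in> carrier P \<Longrightarrow> y \<in> carrier P \<Longrightarrow> Q x \<Longrightarrow> Q y \<Longrightarrow> Q (x \<otimes>\<^bsub>P\<^esub> inv\<^bsub>P\<^esub> y)"
    and one: "Q \<one>\<^bsub>P\<^esub>"
    and gen: "\<And>s. s \<in> S \<Longrightarrow> Q (gen s)"
  shows "Q x"
proof -
  obtain c where c: "Poly_Mapping.keys c \<subseteq> S" "x = cl c"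
    using assms(1) by (auto simp: carrier_pres)
  have "Q (cl c)"
    using c(1)
  proof (induction c rule: frag_induct)
    case zero show ?case using one by (simp only: class_zero)
  next
    case (diff x y) then show ?case
      using assms(2)[of "cl x" "cl y"] by (simp only: class_diff class_closed)
  next
    case (of a) then show ?case by (rule gen)
  qed
  then show ?thesis by (simp only: c)
qed

text \<open>The workhorse for identities in quotients. An identity in several variables is proved by
  freezing all but one of them, observing that both sides are additive in that one, and passing to
  generators.\<close>

lemma hom_eqI:
  assumes h: "h \<in> hom P G" and h': "h' \<in> hom P G" and G: "group G"
    and "\<And>s. s \<in> S \<Longrightarrow> h (gen s) = h' (gen s)" and x: "x \<in> carrier P"
  shows "h x = h' x"
proof -
  interpret h: group_hom P G h using h G is_group by (simp add: group_hom_def group_hom_axioms_def)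
  interpret h': group_hom P G h' using h' G is_group by (simp add: group_hom_def group_hom_axioms_def)
  show ?thesis
    using x by (induction rule: pres_induct) (simp_all add: assms(4))
qed

text \<open>The kernel of \<open>h\<close> is a subgroup that contains the relators, hence contains
  all of \<open>pres_sub S R\<close>.\<close>

lemma hom_from_pres:
  assumes "h \<in> hom F G" "group G" "\<And>r. r \<in> R \<Longrightarrow> h r = \<one>\<^bsub>G\<^esub>"
  obtains g where "g \<in> hom P G" "\<And>c. Poly_Mapping.keys c \<subseteq> S \<Longrightarrow> g (cl c) = h c"
proof -
  interpret h: group_hom F G h
    using assms(1,2) F.is_group by (simp add: group_hom_def group_hom_axioms_def)
  have "pres_sub S R \<subseteq> kernel F G h"
    unfolding pres_sub_def
    by (intro F.generate_subgroup_incl h.subgroup_kernel) (auto simp: kernel_def assms(3) dest: subsetD[OF rels])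
  then have ker: "h c = \<one>\<^bsub>G\<^esub>" if "c \<in> pres_sub S R" for c
    using that by (auto simp: kernel_def)
  have eq: "h x = h y" if x: "x \<in> carrier F" and y: "y \<in> carrier F"
    and xy: "pres_sub S R #>\<^bsub>F\<^esub> x = pres_sub S R #>\<^bsub>F\<^esub> y" for x y
  proof -
    have "cl (x - y) = \<one>\<^bsub>P\<^esub>"
      using x y xy by (simp add: class_diff) (simp add: pres_class_def[symmetric])
    moreover have "Poly_Mapping.keys (x - y) \<subseteq> S"
      using x y keys_diff[of x y] by auto
    ultimately have "h (x - y) = \<one>\<^bsub>G\<^esub>"
      by (simp add: class_eq_one ker)
    moreover have "h x = h ((x - y) \<otimes>\<^bsub>F\<^esub> y)"
      by simp
    moreover have "\<dots> = h (x - y) \<otimes>\<^bsub>G\<^esub> h y"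
      using \<open>Poly_Mapping.keys (x - y) \<subseteq> S\<close> y by (intro h.hom_mult) simp_all
    ultimately show ?thesis using y by simp
  qed
  obtain g where "g \<in> hom (F Mod pres_sub S R) G"
    "\<And>x. x \<in> carrier F \<Longrightarrow> g (pres_sub S R #>\<^bsub>F\<^esub> x) = h x"
    using FactGroup_universal[OF assms(1) normal_pres_sub eq] by metis
  then show ?thesis
    using that[of g] by (simp add: pres_def pres_class_def)
qed

text \<open>The relators are tested on every homomorphism \<open>h\<close> that extends
  \<open>f\<close>, because the extension is only obtained inside the proof. It is unique on the
  free group, so this is one condition and not many.\<close>

lemma lift_exists:
  assumes G: "comm_group G" and f: "\<And>s. s \<in> S \<Longrightarrow> f s \<in> carrier G"
    and fR: "\<And>h r. h \<in> hom F G \<Longrightarrow> (\<And>s. s \<in> S \<Longrightarrow> h (frag_of s) = f s) \<Longrightarrow> r \<in> R \<Longrightarrow> h r = \<one>\<^bsub>G\<^esub>"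
  shows "\<exists>g. g \<in> hom P G \<and> (\<forall>s\<in>S. g (gen s) = f s)"
proof -
  interpret G: comm_group G by fact
  have "f ` S \<subseteq> carrier G" using f by auto
  then obtain h where h: "h \<in> hom F G" "\<And>s. s \<in> S \<Longrightarrow> h (frag_of s) = f s"
    using G.free_Abelian_group_universal by metis
  obtain g where "g \<in> hom P G" "\<And>c. Poly_Mapping.keys c \<subseteq> S \<Longrightarrow> g (cl c) = h c"
    using hom_from_pres[OF h(1) G.is_group] fR h by metis
  then show ?thesis
    using h(2) by (intro exI[of _ g]) auto
qed

end

text \<open>The universal property yields some homomorphism \<open>k\<close>. The point is that the
  union over representatives coincides with it, so that maps defined by such unions are
  homomorphisms as they stand.\<close>

lemma pres_map:
  assumes "presentation S R" "presentation S' R'"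
    and f: "\<And>s. s \<in> S \<Longrightarrow> f s \<in> S'"
    and fR: "\<And>r. r \<in> R \<Longrightarrow>
      pres_class S' R' (frag_extend (\<lambda>s. frag_of (f s)) r) = \<one>\<^bsub>pres S' R'\<^esub>"
  defines "g \<equiv> \<lambda>C. \<Union>c\<in>C. pres_class S' R' (frag_extend (\<lambda>s. frag_of (f s)) c)"
  shows "g \<in> hom (pres S R) (pres S' R')"
    and "\<And>s. s \<in> S \<Longrightarrow> g (pres_class S R (frag_of s)) = pres_class S' R' (frag_of (f s))"
proof -
  interpret P: presentation S R by fact
  interpret P': presentation S' R' by fact
  define h where "h c = pres_class S' R' (frag_extend (\<lambda>s. frag_of (f s)) c)" for c
  have hom: "h \<in> hom (free_Abelian_group S) (pres S' R')"
    unfolding h_def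
    by (rule homI) (simp_all add: keys_frag_extend_of[where S=S] f frag_extend_add P'.class_add)
  obtain k where k: "k \<in> hom (pres S R) (pres S' R')"
    "\<And>c. Poly_Mapping.keys c \<subseteq> S \<Longrightarrow> k (pres_class S R c) = h c"
    using P.hom_from_pres[OF hom P'.is_group] fR unfolding h_def by metis
  have gk: "g (pres_class S R c) = h c" if "Poly_Mapping.keys c \<subseteq> S" for c
    unfolding g_def h_def[symmetric] using that
    by (rule P.UN_class) (metis k(2) that)
  have "g x = k x" if "x \<in> carrier (pres S R)" for x
    using that by (auto simp: P.carrier_pres gk k)
  then show "g \<in> hom (pres S R) (pres S' R')"
    using k(1) P.m_closed by (auto simp: hom_def Pi_iff)
  show "g (pres_class S R (frag_of s)) = pres_class S' R' (frag_of (f s))" if "s \<in> S" for s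
    using that by (simp add: gk h_def)
qed

text \<open>Relators are tested only against a single generator in the other variable. Additivity
  extends this to all formal combinations (\<open>zl\<close>, \<open>zr\<close>), after which the
  value depends on the two cosets alone.\<close>

lemma pres_bilinear:
  assumes "presentation S R" "presentation S' R'" "presentation T Q"
    and f: "\<And>s t. s \<in> S \<Longrightarrow> t \<in> S' \<Longrightarrow> f s t \<in> T"
    and fR: "\<And>r t. r \<in> R \<Longrightarrow> t \<in> S' \<Longrightarrow> pres_class T Q (frag_bilinear f r (frag_of t)) = \<one>\<^bsub>pres T Q\<^esub>"
    and fR': "\<And>s r. s \<in> S \<Longrightarrow> r \<in> R' \<Longrightarrow> pres_class T Q (frag_bilinear f (frag_of s) r) = \<one>\<^bsub>pres T Q\<^esub>"
  defines "g \<equiv> \<lambda>C D. \<Union>c\<in>C. \<Union>d\<in>D. pres_class T Q (frag_bilinear f c d)"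
  shows "\<And>D. D \<in> carrier (pres S' R') \<Longrightarrow> (\<lambda>C. g C D) \<in> hom (pres S R) (pres T Q)"
    and "\<And>C. C \<in> carrier (pres S R) \<Longrightarrow> g C \<in> hom (pres S' R') (pres T Q)"
    and "\<And>s t. s \<in> S \<Longrightarrow> t \<in> S' \<Longrightarrow>
      g (pres_class S R (frag_of s)) (pres_class S' R' (frag_of t)) = pres_class T Q (frag_of (f s t))"
proof -
  interpret P: presentation S R by fact
  interpret P': presentation S' R' by fact
  interpret N: presentation T Q by fact
  let ?N = "pres T Q"
  define b where "b c d = pres_class T Q (frag_bilinear f c d)" for c d
  have keys: "Poly_Mapping.keys (frag_bilinear f c d) \<subseteq> T"
    if "Poly_Mapping.keys c \<subseteq> S" "Poly_Mapping.keys d \<subseteq> S'" for c d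
    using keys_frag_bilinear[OF that, of f T] f by blast
  have homl: "(\<lambda>c. b c d) \<in> hom (free_Abelian_group S) ?N" if "Poly_Mapping.keys d \<subseteq> S'" for d
    using that unfolding b_def
    by (intro homI) (simp_all add: keys frag_bilinear_add_left N.class_add)
  have homr: "b c \<in> hom (free_Abelian_group S') ?N" if "Poly_Mapping.keys c \<subseteq> S" for c
    using that unfolding b_def
    by (intro homI) (simp_all add: keys frag_bilinear_add_right N.class_add)
  have zl: "b r d = \<one>\<^bsub>?N\<^esub>" if "r \<in> R" "Poly_Mapping.keys d \<subseteq> S'" for r d
    using that(2)
  proof (induction d rule: frag_induct)
    case (diff x y) then show ?case
      using that(1) by (simp add: b_def frag_bilinear_diff_right N.class_diff keys P.rels)
  qed (simp_all add: b_def N.class_zero fR that)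
  have zr: "b c r = \<one>\<^bsub>?N\<^esub>" if "r \<in> R'" "Poly_Mapping.keys c \<subseteq> S" for r c
    using that(2)
  proof (induction c rule: frag_induct)
    case (diff x y) then show ?case
      using that(1) by (simp add: b_def frag_bilinear_diff_left N.class_diff keys P'.rels)
  qed (simp_all add: b_def N.class_zero fR' that)
  have bl: "b c d = b c' d"
    if "Poly_Mapping.keys c \<subseteq> S" "Poly_Mapping.keys c' \<subseteq> S" "Poly_Mapping.keys d \<subseteq> S'"
      "pres_class S R c = pres_class S R c'" for c c' d
    using P.hom_from_pres[OF homl[OF that(3)] N.is_group zl[OF _ that(3)]] that(1,2,4) by metis
  have br: "b c d = b c d'"
    if "Poly_Mapping.keys c \<subseteq> S" "Poly_Mapping.keys d \<subseteq> S'" "Poly_Mapping.keys d' \<subseteq> S'"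
      "pres_class S' R' d = pres_class S' R' d'" for c d d'
    using P'.hom_from_pres[OF homr[OF that(1)] N.is_group zr[OF _ that(1)]] that(2,3,4) by metis
  have gb: "g (pres_class S R c) (pres_class S' R' d) = b c d"
    if c: "Poly_Mapping.keys c \<subseteq> S" and d: "Poly_Mapping.keys d \<subseteq> S'" for c d
  proof -
    \<comment> \<open>The inner union is collapsed for every representative of the first coset; the
      outer union then ranges over sets that agree by \<open>bl\<close>.\<close>
    have 1: "(\<Union>d\<in>pres_class S' R' d. b c' d) = b c' d" if "Poly_Mapping.keys c' \<subseteq> S" for c'
      using d by (rule P'.UN_class) (use br d that in blast)
    have "(\<Union>c\<in>pres_class S R c. \<Union>d\<in>pres_class S' R' d. b c d) = (\<Union>d\<in>pres_class S' R' d. b c d)"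
      using c by (rule P.UN_class) (simp add: 1 c, rule bl, use c d in auto)
    with 1[OF c] show ?thesis unfolding g_def b_def by simp
  qed
  show "(\<lambda>C. g C D) \<in> hom (pres S R) (pres T Q)" if D: "D \<in> carrier (pres S' R')" for D
  proof -
    obtain d where d: "Poly_Mapping.keys d \<subseteq> S'" "D = pres_class S' R' d"
      using D by (auto simp: P'.carrier_pres)
    obtain k where "k \<in> hom (pres S R) ?N"
      "\<And>c. Poly_Mapping.keys c \<subseteq> S \<Longrightarrow> k (pres_class S R c) = b c d"
      using P.hom_from_pres[OF homl[OF d(1)] N.is_group zl[OF _ d(1)]] by metis
    moreover from this have "g x D = k x" if "x \<in> carrier (pres S R)" for x
      using that d by (auto simp: P.carrier_pres gb)
    ultimately show ?thesis
      using P.m_closed by (auto simp: hom_def Pi_iff)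
  qed
  show "g C \<in> hom (pres S' R') (pres T Q)" if C: "C \<in> carrier (pres S R)" for C
  proof -
    obtain c where c: "Poly_Mapping.keys c \<subseteq> S" "C = pres_class S R c"
      using C by (auto simp: P.carrier_pres)
    obtain k where "k \<in> hom (pres S' R') ?N"
      "\<And>d. Poly_Mapping.keys d \<subseteq> S' \<Longrightarrow> k (pres_class S' R' d) = b c d"
      using P'.hom_from_pres[OF homr[OF c(1)] N.is_group zr[OF _ c(1)]] by metis
    moreover from this have "g C x = k x" if "x \<in> carrier (pres S' R')" for x
      using that c by (auto simp: P'.carrier_pres gb)
    ultimately show ?thesis
      using P'.m_closed by (auto simp: hom_def Pi_iff)
  qed
  show "g (pres_class S R (frag_of s)) (pres_class S' R' (frag_of t)) = pres_class T Q (frag_of (f s t))"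
    if "s \<in> S" "t \<in> S'" for s t
    using that by (simp add: gb b_def)
qed

section \<open>Homomorphisms of Abelian groups\<close>

text \<open>Bimodules and algebras are records with more fields than a group. Their group laws are
  transported from the underlying quotient by comparing the three group fields.\<close>

lemma comm_group_cong:
  assumes "comm_group G" "carrier H = carrier G" "monoid.mult H = monoid.mult G"
    "monoid.one H = monoid.one G"
  shows "comm_group H"
proof -
  interpret comm_group G by fact
  show ?thesis
    by (rule comm_groupI) (auto simp: assms(2-) m_ac intro: bexI[of _ "inv\<^bsub>G\<^esub> _"])
qed

lemma hom_cong:
  assumes "carrier G' = carrier G" "monoid.mult G' = monoid.mult G"
    "carrier H' = carrier H" "monoid.mult H' = monoid.mult H"
  shows "hom G' H' = hom G H"
  by (simp add: hom_def assms)

lemma hom_restrict: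
  assumes "group G"
  shows "restrict h (carrier G) \<in> hom G H \<longleftrightarrow> h \<in> hom G H"
proof -
  interpret group G by fact
  show ?thesis by (auto simp: hom_def Pi_iff)
qed

lemma hom_ident: "(\<lambda>x. x) \<in> hom G G"
  by (simp add: hom_def)

lemma hom_compose': "f \<in> hom G H \<Longrightarrow> g \<in> hom H I \<Longrightarrow> (\<lambda>x. g (f x)) \<in> hom G I"
  by (auto simp: hom_def Pi_iff)

lemma (in comm_group) mult_inv_inv:
  "x \<in> carrier G \<Longrightarrow> y \<in> carrier G \<Longrightarrow> x \<otimes> y \<otimes> inv x \<otimes> inv y = \<one>"
  using r_inv[of "x \<otimes> y"] by (simp add: inv_mult m_assoc)

lemma (in comm_group) hom_mult_pointwise:
  "f \<in> hom H G \<Longrightarrow> g \<in> hom H G \<Longrightarrow> (\<lambda>x. f x \<otimes> g x) \<in> hom H G"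
  by (auto simp: hom_def Pi_iff m_ac)

lemma (in comm_group) hom_one_pointwise: "(\<lambda>x. \<one>) \<in> hom H G"
  by (auto simp: hom_def)

lemma (in comm_group) hom_finprod_pointwise:
  assumes "group H" "\<And>i. i \<in> I \<Longrightarrow> f i \<in> hom H G"
  shows "(\<lambda>x. finprod G (\<lambda>i. f i x) I) \<in> hom H G"
  using assms(2)
proof (induction I rule: infinite_finite_induct)
  case (insert i I)
  interpret H: group H by fact
  have "(\<lambda>x. f i x \<otimes> finprod G (\<lambda>i. f i x) I) \<in> hom H G"
    using insert by (intro hom_mult_pointwise) auto
  moreover have "x \<in> carrier H \<Longrightarrow>
      finprod G (\<lambda>i. f i x) (insert i I) = f i x \<otimes> finprod G (\<lambda>i. f i x) I" for x
    using insert by (intro finprod_insert) (auto simp: hom_def Pi_iff)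
  ultimately show ?case
    by (auto simp: hom_def Pi_iff)
qed (simp_all add: hom_one_pointwise)

text \<open>An infinite index set is allowed, since both products are then the neutral element by
  convention.\<close>

lemma hom_finprod:
  assumes "comm_group G" "comm_group H" "h \<in> hom G H" "\<And>i. i \<in> I \<Longrightarrow> f i \<in> carrier G"
  shows "h (finprod G f I) = finprod H (\<lambda>i. h (f i)) I"
proof -
  interpret G: comm_group G by fact
  interpret H: comm_group H by fact
  show ?thesis
    using assms(4)
  proof (induction I rule: infinite_finite_induct)
    case (insert i I)
    then show ?case
      using assms(3)
      by (simp add: G.finprod_insert H.finprod_insert Pi_iff hom_mult[OF assms(3)] hom_in_carrier)
  qed (use assms(3) G.is_group H.is_group hom_one in auto)
qed


section \<open>Tensor products\<close>

definition balanced where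
  "balanced R M N G f \<longleftrightarrow>
     (\<forall>m\<in>carrier M. \<forall>n\<in>carrier N. f m n \<in> carrier G) \<and>
     (\<forall>m\<in>carrier M. \<forall>m'\<in>carrier M. \<forall>n\<in>carrier N. f (m \<boxplus>\<^bsub>M\<^esub> m') n = f m n \<boxplus>\<^bsub>G\<^esub> f m' n) \<and>
     (\<forall>m\<in>carrier M. \<forall>n\<in>carrier N. \<forall>n'\<in>carrier N. f m (n \<boxplus>\<^bsub>N\<^esub> n') = f m n \<boxplus>\<^bsub>G\<^esub> f m n') \<and>
     (\<forall>m\<in>carrier M. \<forall>r\<in>carrier R. \<forall>n\<in>carrier N. f (ract M m r) n = f m (lact N r n))"

text \<open>The induced homomorphism is unique only on the carrier of the tensor product, so a total
  function is picked by choice.\<close>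

definition tensor_lift where
  "tensor_lift R M N G f = (SOME h. h \<in> hom (tensor R M N) G \<and>
     (\<forall>m\<in>carrier M. \<forall>n\<in>carrier N. h (tens R M N m n) = f m n))"

lemma tensor_class_eq: "tensor_class R M N = pres_class (carrier M \<times> carrier N) (tensor_rels R M N)"
  by (simp add: fun_eq_iff tensor_class_def tensor_sub_def pres_class_def pres_sub_def)

lemma carrier_tensor:
    "carrier (tensor R M N) = carrier (pres (carrier M \<times> carrier N) (tensor_rels R M N))"
  and mult_tensor:
    "monoid.mult (tensor R M N) = monoid.mult (pres (carrier M \<times> carrier N) (tensor_rels R M N))"
  and one_tensor:
    "monoid.one (tensor R M N) = monoid.one (pres (carrier M \<times> carrier N) (tensor_rels R M N))"
  by (simp_all add: tensor_def pres_def tensor_sub_def pres_sub_def)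

lemmas tensor_simps = carrier_tensor mult_tensor one_tensor

lemma tens_eq:
  "tens R M N m n = pres_class (carrier M \<times> carrier N) (tensor_rels R M N) (frag_of (m, n))"
  by (simp add: tens_def tensor_class_eq)

text \<open>Only the data that occur in the relators are required. This lets the same locale serve
  tensor products of bimodules over \<open>A\<close> and of vector spaces over
  \<open>K\<close>.\<close>

locale balanced_pair = M: comm_group M + N: comm_group N
  for R :: "('r, 'z) ring_scheme" and M :: "('l, 'r, 'm, 'y) bimod_scheme"
    and N :: "('r, 's, 'n, 'x) bimod_scheme" +
  assumes ract_M_closed: "r \<in> carrier R \<Longrightarrow> m \<in> carrier M \<Longrightarrow> ract M m r \<in> carrier M"
    and lact_N_closed: "r \<in> carrier R \<Longrightarrow> n \<in> carrier N \<Longrightarrow> lact N r n \<in> carrier N"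
begin

abbreviation "MN \<equiv> tensor R M N"
abbreviation "tn \<equiv> tens R M N"

sublocale pres: presentation "carrier M \<times> carrier N" "tensor_rels R M N"
proof
  fix r assume "r \<in> tensor_rels R M N"
  then show "Poly_Mapping.keys r \<subseteq> carrier M \<times> carrier N"
    unfolding tensor_rels_def
    by (elim UnE CollectE exE conjE; hypsubst; intro keys_diff_subset)
      (simp_all add: ract_M_closed lact_N_closed)
qed

lemma comm_group_tensor: "comm_group MN"
  by (rule comm_group_cong[OF pres.comm_group_axioms]) (simp_all add: tensor_simps)

sublocale T: comm_group MN
  by (rule comm_group_tensor)

lemma hom_tensor_eq: "hom MN G = hom (pres (carrier M \<times> carrier N) (tensor_rels R M N)) G"
  by (rule hom_cong) (simp_all add: tensor_simps)

lemma tens_closed [simp, intro]: "m \<in> carrier M \<Longrightarrow> n \<in> carrier N \<Longrightarrow> tn m n \<in> carrier MN"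
  by (simp add: tens_eq carrier_tensor)

lemma tens_add_left:
  "m \<in> carrier M \<Longrightarrow> m' \<in> carrier M \<Longrightarrow> n \<in> carrier N \<Longrightarrow>
    tn (m \<boxplus>\<^bsub>M\<^esub> m') n = tn m n \<boxplus>\<^bsub>MN\<^esub> tn m' n"
  unfolding tens_eq mult_tensor
  by (rule pres.class_add_rel) (auto simp: tensor_rels_def)

lemma tens_add_right:
  "m \<in> carrier M \<Longrightarrow> n \<in> carrier N \<Longrightarrow> n' \<in> carrier N \<Longrightarrow>
    tn m (n \<boxplus>\<^bsub>N\<^esub> n') = tn m n \<boxplus>\<^bsub>MN\<^esub> tn m n'"
  unfolding tens_eq mult_tensor
  by (rule pres.class_add_rel) (auto simp: tensor_rels_def)

lemma tens_balanced:
  "m \<in> carrier M \<Longrightarrow> r \<in> carrier R \<Longrightarrow> n \<in> carrier N \<Longrightarrow>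
    tn (ract M m r) n = tn m (lact N r n)"
  unfolding tens_eq mult_tensor
  by (rule pres.class_diff_rel) (auto simp: tensor_rels_def ract_M_closed lact_N_closed)

lemma tens_hom_left: "n \<in> carrier N \<Longrightarrow> (\<lambda>m. tn m n) \<in> hom M MN"
  by (rule homI) (simp_all add: tens_add_left)

lemma tens_hom_right: "m \<in> carrier M \<Longrightarrow> tn m \<in> hom N MN"
  by (rule homI) (simp_all add: tens_add_right)

lemma tensor_hom_eqI:
  assumes "h \<in> hom MN G" "h' \<in> hom MN G" "group G"
    and "\<And>m n. m \<in> carrier M \<Longrightarrow> n \<in> carrier N \<Longrightarrow> h (tn m n) = h' (tn m n)"
    and "x \<in> carrier MN"
  shows "h x = h' x"
  using assms pres.hom_eqI[of h G h' x] by (auto simp: hom_tensor_eq tens_eq carrier_tensor)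

lemma tensor_induct [consumes 1, case_names diff one tens]:
  assumes "x \<in> carrier MN"
    and "\<And>x y. x \<in> carrier MN \<Longrightarrow> y \<in> carrier MN \<Longrightarrow> Q x \<Longrightarrow> Q y \<Longrightarrow> Q (x \<boxplus>\<^bsub>MN\<^esub> inv\<^bsub>MN\<^esub> y)"
    and "Q \<one>\<^bsub>MN\<^esub>"
    and "\<And>m n. m \<in> carrier M \<Longrightarrow> n \<in> carrier N \<Longrightarrow> Q (tn m n)"
  shows "Q x"
proof -
  have "inv\<^bsub>MN\<^esub> y = inv\<^bsub>pres (carrier M \<times> carrier N) (tensor_rels R M N)\<^esub> y" for y
    by (simp add: m_inv_def tensor_simps)
  then show ?thesis
    using assms pres.pres_induct[of x Q] by (auto simp: tensor_simps tens_eq)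
qed

lemma tensor_lift_exists:
  assumes G: "comm_group G" and f: "balanced R M N G f"
  shows "\<exists>h. h \<in> hom MN G \<and> (\<forall>m\<in>carrier M. \<forall>n\<in>carrier N. h (tn m n) = f m n)"
proof -
  interpret G: comm_group G by fact
  have "\<exists>g. g \<in> hom pres.P G \<and> (\<forall>s\<in>carrier M \<times> carrier N. g (pres.gen s) = case_prod f s)"
  proof (rule pres.lift_exists[OF G])
    fix h r
    assume h: "h \<in> hom pres.F G" and hf: "\<And>s. s \<in> carrier M \<times> carrier N \<Longrightarrow> h (frag_of s) = case_prod f s"
      and r: "r \<in> tensor_rels R M N"
    interpret h: group_hom pres.F G h
      using h by (simp add: group_hom_def group_hom_axioms_def)
    have diff: "h (x - y) = h x \<boxplus>\<^bsub>G\<^esub> inv\<^bsub>G\<^esub> (h y)"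
      if "Poly_Mapping.keys x \<subseteq> carrier M \<times> carrier N" "Poly_Mapping.keys y \<subseteq> carrier M \<times> carrier N" for x y
      using h.hom_mult[of x "- y"] h.hom_inv[of y] that by simp
    show "h r = \<one>\<^bsub>G\<^esub>"
      using r f unfolding tensor_rels_def balanced_def
      by (auto simp: diff keys_diff_subset hf ract_M_closed lact_N_closed G.mult_inv_inv)
  qed (use f in \<open>auto simp: balanced_def\<close>)
  then show ?thesis
    by (auto simp: hom_tensor_eq tens_eq)
qed

lemma
  assumes "comm_group G" "balanced R M N G f"
  shows tensor_lift_hom: "tensor_lift R M N G f \<in> hom MN G"
    and tensor_lift_tens:
      "m \<in> carrier M \<Longrightarrow> n \<in> carrier N \<Longrightarrow> tensor_lift R M N G f (tn m n) = f m n"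
  using someI_ex[OF tensor_lift_exists[OF assms]] unfolding tensor_lift_def by auto

end

text \<open>The linearity assumptions send each relator to a relator of the same kind, so no
  computation inside the target quotient is needed.\<close>

lemma
  assumes "balanced_pair R M N" "balanced_pair R M' N'"
    and f: "f \<in> hom M M'" "\<And>m r. m \<in> carrier M \<Longrightarrow> r \<in> carrier R \<Longrightarrow> f (ract M m r) = ract M' (f m) r"
    and g: "g \<in> hom N N'" "\<And>n r. n \<in> carrier N \<Longrightarrow> r \<in> carrier R \<Longrightarrow> g (lact N r n) = lact N' r (g n)"
  shows tensor_map_hom: "tensor_map R M' N' f g \<in> hom (tensor R M N) (tensor R M' N')"
    and tensor_map_tens: "m \<in> carrier M \<Longrightarrow> n \<in> carrier N \<Longrightarrow>
      tensor_map R M' N' f g (tens R M N m n) = tens R M' N' (f m) (g n)"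
proof -
  interpret A: balanced_pair R M N by fact
  interpret B: balanced_pair R M' N' by fact
  have fc: "f m \<in> carrier M'" if "m \<in> carrier M" for m using f(1) that by (auto simp: hom_def)
  have gc: "g n \<in> carrier N'" if "n \<in> carrier N" for n using g(1) that by (auto simp: hom_def)
  have fg: "(case s of (m, n) \<Rightarrow> (f m, g n)) \<in> carrier M' \<times> carrier N'" if "s \<in> carrier M \<times> carrier N" for s
    using that fc gc by auto
  have rel: "B.pres.cl (frag_extend (\<lambda>s. frag_of (case s of (m, n) \<Rightarrow> (f m, g n))) r) = \<one>\<^bsub>B.pres.P\<^esub>"
    if r: "r \<in> tensor_rels R M N" for r
  proof -
    have "frag_extend (\<lambda>s. frag_of (case s of (m, n) \<Rightarrow> (f m, g n))) r \<in> tensor_rels R M' N'"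
      using r unfolding tensor_rels_def
      apply (auto simp: frag_extend_diff f(2) g(2) fc gc hom_mult[OF f(1)] hom_mult[OF g(1)])
        apply (use fc gc in blast)+
      done
    then show ?thesis by (rule B.pres.class_rel)
  qed
  have "tensor_map R M' N' f g = (\<lambda>C. \<Union>c\<in>C. B.pres.cl (frag_extend (\<lambda>s. frag_of (case s of (m, n) \<Rightarrow> (f m, g n))) c))"
    by (simp add: tensor_map_def fun_eq_iff tensor_class_eq case_prod_unfold)
  with pres_map[OF A.pres.presentation_axioms B.pres.presentation_axioms fg rel]
  show "tensor_map R M' N' f g \<in> hom (tensor R M N) (tensor R M' N')"
    and "m \<in> carrier M \<Longrightarrow> n \<in> carrier N \<Longrightarrow>
      tensor_map R M' N' f g (tens R M N m n) = tens R M' N' (f m) (g n)"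
    by (auto simp: A.hom_tensor_eq hom_cong[OF refl refl carrier_tensor mult_tensor] tens_eq)
qed

section \<open>Algebras and vector spaces\<close>

lemma ring_cong:
  assumes "ring R" "carrier S = carrier R" "monoid.mult S = monoid.mult R"
    "monoid.one S = monoid.one R" "ring.add S = ring.add R" "ring.zero S = ring.zero R"
  shows "ring S"
proof -
  interpret ring R by fact
  show ?thesis
    by (rule ringI, rule abelian_groupI)
      (auto simp: assms(2-) a_ac m_assoc l_distr r_distr intro!: monoidI intro: bexI[of _ "\<ominus>\<^bsub>R\<^esub> _"] l_neg)
qed

lemma (in ring) comm_group_add_monoid: "comm_group (add_monoid R)"
  by (rule a_comm_group)

context unital_algebra
begin

lemma scalar_one_mult:
  "k \<in> carrier K \<Longrightarrow> a \<in> carrier A \<Longrightarrow> (k \<odot>\<^bsub>A\<^esub> \<one>\<^bsub>A\<^esub>) \<otimes>\<^bsub>A\<^esub> a = k \<odot>\<^bsub>A\<^esub> a"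
  "k \<in> carrier K \<Longrightarrow> a \<in> carrier A \<Longrightarrow> a \<otimes>\<^bsub>A\<^esub> (k \<odot>\<^bsub>A\<^esub> \<one>\<^bsub>A\<^esub>) = k \<odot>\<^bsub>A\<^esub> a"
  by (simp_all add: smult_mult_left smult_mult_right)

lemma unital_algebra_self_alg: "unital_algebra K (self_alg K)"
proof -
  have r: "ring (self_alg K)"
    by (rule ring_cong[OF ring_axioms]) (simp_all add: self_alg_def)
  show ?thesis
  proof (intro unital_algebra.intro moduleI unital_algebra_axioms.intro r field_axioms)
    show "cring K" by (rule is_cring)
    show "abelian_group (self_alg K)" using r by (rule ring.is_abelian_group)
  qed (auto simp: self_alg_def m_ac l_distr r_distr)
qed

end

lemma self_alg_simps [simp]:
  "carrier (self_alg K) = carrier K" "monoid.mult (self_alg K) = monoid.mult K"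
  "monoid.one (self_alg K) = monoid.one K" "ring.add (self_alg K) = ring.add K"
  "ring.zero (self_alg K) = ring.zero K" "smult (self_alg K) = monoid.mult K"
  by (simp_all add: self_alg_def)

text \<open>A vector space is made a bimodule by letting both actions coincide, so that the tensor
  algebra of a bimodule also covers the tensor algebra over \<open>K\<close>. Commutativity of
  \<open>K\<close> enters through \<open>comm\<close>, which gives both the right action law and the
  commuting of the two actions.\<close>

lemma bimodule_self_algI:
  assumes alg: "unital_algebra K (self_alg K)" and V: "comm_group V"
    and "\<And>k v. k \<in> carrier K \<Longrightarrow> v \<in> carrier V \<Longrightarrow> lact V k v \<in> carrier V"
    and "\<And>k v w. k \<in> carrier K \<Longrightarrow> v \<in> carrier V \<Longrightarrow> w \<in> carrier V \<Longrightarrow>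
      lact V k (v \<boxplus>\<^bsub>V\<^esub> w) = lact V k v \<boxplus>\<^bsub>V\<^esub> lact V k w"
    and "\<And>k l v. k \<in> carrier K \<Longrightarrow> l \<in> carrier K \<Longrightarrow> v \<in> carrier V \<Longrightarrow>
      lact V (k \<oplus>\<^bsub>K\<^esub> l) v = lact V k v \<boxplus>\<^bsub>V\<^esub> lact V l v"
    and "\<And>k l v. k \<in> carrier K \<Longrightarrow> l \<in> carrier K \<Longrightarrow> v \<in> carrier V \<Longrightarrow>
      lact V (k \<otimes>\<^bsub>K\<^esub> l) v = lact V k (lact V l v)"
    and "\<And>v. v \<in> carrier V \<Longrightarrow> lact V \<one>\<^bsub>K\<^esub> v = v"
    and "\<And>k v. k \<in> carrier K \<Longrightarrow> v \<in> carrier V \<Longrightarrow> ract V v k = lact V k v"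
  shows "bimodule K (self_alg K) V"
proof -
  interpret unital_algebra K "self_alg K" by fact
  interpret V: comm_group V by fact
  have comm: "lact V k (lact V l v) = lact V l (lact V k v)"
    if "k \<in> carrier K" "l \<in> carrier K" "v \<in> carrier V" for k l v
    using assms(6)[of k l v] assms(6)[of l k v] that m_comm[of k l] by simp
  show ?thesis
    by unfold_locales (simp_all add: assms comm)
qed

context bimodule
begin

abbreviation "ka \<equiv> kact A M"

lemma kact_closed: "k \<in> carrier K \<Longrightarrow> m \<in> carrier M \<Longrightarrow> ka k m \<in> carrier M"
  by (simp add: kact_def lact_closed)

lemma kact_ract: "k \<in> carrier K \<Longrightarrow> m \<in> carrier M \<Longrightarrow> ka k m = ract M m (k \<odot>\<^bsub>A\<^esub> \<one>\<^bsub>A\<^esub>)"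
  by (simp add: kact_def scalar_central)

lemma kact_add:
  "k \<in> carrier K \<Longrightarrow> m \<in> carrier M \<Longrightarrow> n \<in> carrier M \<Longrightarrow> ka k (m \<boxplus>\<^bsub>M\<^esub> n) = ka k m \<boxplus>\<^bsub>M\<^esub> ka k n"
  by (simp add: kact_def lact_add)

lemma add_kact:
  "k \<in> carrier K \<Longrightarrow> l \<in> carrier K \<Longrightarrow> m \<in> carrier M \<Longrightarrow> ka (k \<oplus>\<^bsub>K\<^esub> l) m = ka k m \<boxplus>\<^bsub>M\<^esub> ka l m"
  by (simp add: kact_def add_lact smult_l_distr)

lemma mult_kact:
  "k \<in> carrier K \<Longrightarrow> l \<in> carrier K \<Longrightarrow> m \<in> carrier M \<Longrightarrow> ka (k \<otimes>\<^bsub>K\<^esub> l) m = ka k (ka l m)"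
  by (simp add: kact_def mult_lact[symmetric] smult_assoc1 smult_mult_left)

lemma one_kact: "m \<in> carrier M \<Longrightarrow> ka \<one>\<^bsub>K\<^esub> m = m"
  by (simp add: kact_def one_lact)

lemma lact_smult:
  "k \<in> carrier K \<Longrightarrow> a \<in> carrier A \<Longrightarrow> m \<in> carrier M \<Longrightarrow> lact M (k \<odot>\<^bsub>A\<^esub> a) m = ka k (lact M a m)"
  by (simp add: kact_def mult_lact[symmetric] scalar_one_mult)

lemma lact_kact:
  "k \<in> carrier K \<Longrightarrow> a \<in> carrier A \<Longrightarrow> m \<in> carrier M \<Longrightarrow> lact M a (ka k m) = ka k (lact M a m)"
  by (simp add: kact_def mult_lact[symmetric] scalar_one_mult)

lemma ract_smult:
  "k \<in> carrier K \<Longrightarrow> a \<in> carrier A \<Longrightarrow> m \<in> carrier M \<Longrightarrow> ract M m (k \<odot>\<^bsub>A\<^esub> a) = ka k (ract M m a)"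
  by (simp add: kact_ract ract_closed mult_ract[symmetric] scalar_one_mult)

lemma ract_kact:
  "k \<in> carrier K \<Longrightarrow> a \<in> carrier A \<Longrightarrow> m \<in> carrier M \<Longrightarrow> ract M (ka k m) a = ka k (ract M m a)"
  by (simp add: kact_ract ract_closed mult_ract[symmetric] scalar_one_mult)

lemma bimodule_scalars: "bimodule K (self_alg K) (scalars A M)"
proof (rule bimodule_self_algI[OF unital_algebra_self_alg])
  show "comm_group (scalars A M)"
    by (rule comm_group_cong[OF M.comm_group_axioms]) (simp_all add: scalars_def)
qed (simp_all add: scalars_def kact_closed kact_add add_kact mult_kact one_kact)

end

lemma scalars_simps [simp]:
  "carrier (scalars A M) = carrier M" "monoid.mult (scalars A M) = monoid.mult M"
  "monoid.one (scalars A M) = monoid.one M" "lact (scalars A M) = kact A M"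
  "ract (scalars A M) m k = kact A M k m"
  by (simp_all add: scalars_def)

lemma vect_bimod_simps [simp]:
  "carrier (vect_bimod A) = carrier A" "monoid.mult (vect_bimod A) = ring.add A"
  "monoid.one (vect_bimod A) = ring.zero A" "lact (vect_bimod A) = smult A"
  "ract (vect_bimod A) a k = smult A k a"
  by (simp_all add: vect_bimod_def)

lemma op_alg_simps [simp]:
  "carrier (op_alg A) = carrier A" "monoid.mult (op_alg A) a b = monoid.mult A b a"
  "monoid.one (op_alg A) = monoid.one A" "ring.add (op_alg A) = ring.add A"
  "ring.zero (op_alg A) = ring.zero A" "smult (op_alg A) = smult A"
  by (simp_all add: op_alg_def)

lemma dsum_vect_simps [simp]:
  "carrier (dsum_vect R S) = carrier R \<times> carrier S"
  "monoid.mult (dsum_vect R S) (r, s) (r', s') = (r \<oplus>\<^bsub>R\<^esub> r', s \<oplus>\<^bsub>S\<^esub> s')"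
  "monoid.one (dsum_vect R S) = (\<zero>\<^bsub>R\<^esub>, \<zero>\<^bsub>S\<^esub>)"
  "lact (dsum_vect R S) k (r, s) = (k \<odot>\<^bsub>R\<^esub> r, k \<odot>\<^bsub>S\<^esub> s)"
  "ract (dsum_vect R S) (r, s) k = (k \<odot>\<^bsub>R\<^esub> r, k \<odot>\<^bsub>S\<^esub> s)"
  by (simp_all add: dsum_vect_def)

context unital_algebra
begin

lemma bimodule_vect_bimod: "bimodule K (self_alg K) (vect_bimod A)"
proof (rule bimodule_self_algI[OF unital_algebra_self_alg])
  show "comm_group (vect_bimod A)"
    by (rule comm_group_cong[OF A.comm_group_add_monoid]) (simp_all add: vect_bimod_def)
qed (simp_all add: smult_l_distr smult_r_distr smult_assoc1)

lemma unital_algebra_op_alg: "unital_algebra K (op_alg A)"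
proof -
  have r: "ring (op_alg A)"
    by (rule ringI, rule abelian_groupI)
      (auto simp: M.a_ac A.m_assoc A.l_distr A.r_distr intro!: monoidI intro: bexI[of _ "\<ominus>\<^bsub>A\<^esub> _"] M.l_neg)
  show ?thesis
  proof (intro unital_algebra.intro moduleI unital_algebra_axioms.intro r field_axioms)
    show "cring K" by (rule is_cring)
    show "abelian_group (op_alg A)" using r by (rule ring.is_abelian_group)
  qed (auto simp: smult_l_distr smult_r_distr smult_assoc1 smult_mult_left smult_mult_right)
qed

end

lemma bimodule_dsum_vect:
  assumes "unital_algebra K R" "unital_algebra K S"
  shows "bimodule K (self_alg K) (dsum_vect R S)"
proof -
  interpret R: unital_algebra K R by fact
  interpret S: unital_algebra K S by fact
  show ?thesis
  proof (rule bimodule_self_algI[OF R.unital_algebra_self_alg])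
    show "comm_group (dsum_vect R S)"
      by (rule comm_groupI)
        (auto simp: R.M.a_ac S.M.a_ac intro!: R.M.l_neg S.M.l_neg
          bexI[of _ "\<ominus>\<^bsub>R\<^esub> _"] bexI[of _ "\<ominus>\<^bsub>S\<^esub> _"])
  qed (auto simp: R.smult_l_distr R.smult_r_distr R.smult_assoc1
      S.smult_l_distr S.smult_r_distr S.smult_assoc1)
qed

lemma balanced_pair_bimodules:
  assumes "bimodule K A M" "bimodule K A N"
  shows "balanced_pair A M N"
proof -
  interpret M: bimodule K A M by fact
  interpret N: bimodule K A N by fact
  show ?thesis by unfold_locales (simp_all add: M.ract_closed N.lact_closed)
qed

lemma balanced_pair_vect:
  assumes "bimodule K (self_alg K) M" "bimodule K (self_alg K) N"
  shows "balanced_pair K M N"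
proof -
  interpret M: bimodule K "self_alg K" M by fact
  interpret N: bimodule K "self_alg K" N by fact
  show ?thesis using M.ract_closed N.lact_closed by unfold_locales simp_all
qed

text \<open>Two \<open>K\<close>-bilinear maps, applied to the first and to the second components,
  act on tensors. The multiplication of a tensor product of algebras and the left and right actions
  on \<open>MM\<close> are the three instances. Each kind of relator in either argument goes to a
  relator of the same kind, because scalars can be pulled out of \<open>p\<close> on the right and
  out of \<open>q\<close> on the left.\<close>

lemma
  assumes "balanced_pair K V1 W1" "balanced_pair K V2 W2" "balanced_pair K V3 W3"
    and p: "\<And>v v'. v \<in> carrier V1 \<Longrightarrow> v' \<in> carrier V2 \<Longrightarrow> p v v' \<in> carrier V3"
      "\<And>v w v'. v \<in> carrier V1 \<Longrightarrow> w \<in> carrier V1 \<Longrightarrow> v' \<in> carrier V2 \<Longrightarrow>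
        p (v \<boxplus>\<^bsub>V1\<^esub> w) v' = p v v' \<boxplus>\<^bsub>V3\<^esub> p w v'"
      "\<And>v w v'. v \<in> carrier V2 \<Longrightarrow> w \<in> carrier V2 \<Longrightarrow> v' \<in> carrier V1 \<Longrightarrow>
        p v' (v \<boxplus>\<^bsub>V2\<^esub> w) = p v' v \<boxplus>\<^bsub>V3\<^esub> p v' w"
      "\<And>v v' k. v \<in> carrier V1 \<Longrightarrow> v' \<in> carrier V2 \<Longrightarrow> k \<in> carrier K \<Longrightarrow>
        p (ract V1 v k) v' = ract V3 (p v v') k"
      "\<And>v v' k. v \<in> carrier V1 \<Longrightarrow> v' \<in> carrier V2 \<Longrightarrow> k \<in> carrier K \<Longrightarrow>
        p v (ract V2 v' k) = ract V3 (p v v') k"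
    and q: "\<And>w w'. w \<in> carrier W1 \<Longrightarrow> w' \<in> carrier W2 \<Longrightarrow> q w w' \<in> carrier W3"
      "\<And>v w v'. v \<in> carrier W1 \<Longrightarrow> w \<in> carrier W1 \<Longrightarrow> v' \<in> carrier W2 \<Longrightarrow>
        q (v \<boxplus>\<^bsub>W1\<^esub> w) v' = q v v' \<boxplus>\<^bsub>W3\<^esub> q w v'"
      "\<And>v w v'. v \<in> carrier W2 \<Longrightarrow> w \<in> carrier W2 \<Longrightarrow> v' \<in> carrier W1 \<Longrightarrow>
        q v' (v \<boxplus>\<^bsub>W2\<^esub> w) = q v' v \<boxplus>\<^bsub>W3\<^esub> q v' w"
      "\<And>v v' k. v \<in> carrier W1 \<Longrightarrow> v' \<in> carrier W2 \<Longrightarrow> k \<in> carrier K \<Longrightarrow>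
        q (lact W1 k v) v' = lact W3 k (q v v')"
      "\<And>v v' k. v \<in> carrier W1 \<Longrightarrow> v' \<in> carrier W2 \<Longrightarrow> k \<in> carrier K \<Longrightarrow>
        q v (lact W2 k v') = lact W3 k (q v v')"
    and g: "g = (\<lambda>C D. \<Union>c\<in>C. \<Union>d\<in>D. tensor_class K V3 W3
      (frag_bilinear (\<lambda>(v, w) (v', w'). (p v v', q w w')) c d))"
  shows tensor_bilinear_hom_left:
      "D \<in> carrier (tensor K V2 W2) \<Longrightarrow> (\<lambda>C. g C D) \<in> hom (tensor K V1 W1) (tensor K V3 W3)"
    and tensor_bilinear_hom_right:
      "C \<in> carrier (tensor K V1 W1) \<Longrightarrow> g C \<in> hom (tensor K V2 W2) (tensor K V3 W3)"
    and tensor_bilinear_tens: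
      "v \<in> carrier V1 \<Longrightarrow> w \<in> carrier W1 \<Longrightarrow> v' \<in> carrier V2 \<Longrightarrow> w' \<in> carrier W2 \<Longrightarrow>
        g (tens K V1 W1 v w) (tens K V2 W2 v' w') = tens K V3 W3 (p v v') (q w w')"
proof -
  interpret X: balanced_pair K V1 W1 by fact
  interpret Y: balanced_pair K V2 W2 by fact
  interpret Z: balanced_pair K V3 W3 by fact
  define f where "f = (\<lambda>(v, w) (v', w'). (p v v', q w w'))"
  have f: "f s t \<in> carrier V3 \<times> carrier W3"
    if "s \<in> carrier V1 \<times> carrier W1" "t \<in> carrier V2 \<times> carrier W2" for s t
    using that p(1) q(1) by (auto simp: f_def)
  have relI: "Z.pres.cl r = \<one>\<^bsub>Z.pres.P\<^esub>" if "r \<in> tensor_rels K V3 W3" for r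
    using that by (rule Z.pres.class_rel)
  have l: "Z.pres.cl (frag_bilinear f r (frag_of t)) = \<one>\<^bsub>Z.pres.P\<^esub>"
    if r: "r \<in> tensor_rels K V1 W1" and t: "t \<in> carrier V2 \<times> carrier W2" for r t
  proof (rule relI)
    obtain v' w' where t': "t = (v', w')" "v' \<in> carrier V2" "w' \<in> carrier W2" using t by auto
    show "frag_bilinear f r (frag_of t) \<in> tensor_rels K V3 W3"
      using r t' unfolding tensor_rels_def
      apply (elim UnE CollectE exE conjE)
        apply (rule UnI1, rule UnI1)
        apply (simp add: frag_bilinear_diff_left f_def p q)
        apply (use p(1) q(1) in blast)
       apply (rule UnI1, rule UnI2)
       apply (simp add: frag_bilinear_diff_left f_def p q)
       apply (use p(1) q(1) in blast)
      apply (rule UnI2)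
      apply (simp add: frag_bilinear_diff_left f_def p q)
      apply (use p(1) q(1) in blast)
      done
  qed
  have r: "Z.pres.cl (frag_bilinear f (frag_of t) r) = \<one>\<^bsub>Z.pres.P\<^esub>"
    if t: "t \<in> carrier V1 \<times> carrier W1" and r: "r \<in> tensor_rels K V2 W2" for r t
  proof (rule relI)
    obtain v' w' where t': "t = (v', w')" "v' \<in> carrier V1" "w' \<in> carrier W1" using t by auto
    show "frag_bilinear f (frag_of t) r \<in> tensor_rels K V3 W3"
      using r t' unfolding tensor_rels_def
      apply (elim UnE CollectE exE conjE)
        apply (rule UnI1, rule UnI1)
        apply (simp add: frag_bilinear_diff_right f_def p q)
        apply (use p(1) q(1) in blast)
       apply (rule UnI1, rule UnI2)
       apply (simp add: frag_bilinear_diff_right f_def p q)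
       apply (use p(1) q(1) in blast)
      apply (rule UnI2)
      apply (simp add: frag_bilinear_diff_right f_def p q)
      apply (use p(1) q(1) in blast)
      done
  qed
  have g': "g = (\<lambda>C D. \<Union>c\<in>C. \<Union>d\<in>D. Z.pres.cl (frag_bilinear f c d))"
    by (simp add: g f_def tensor_class_eq)
  note B = pres_bilinear[OF X.pres.presentation_axioms Y.pres.presentation_axioms
      Z.pres.presentation_axioms f l r]
  show "D \<in> carrier (tensor K V2 W2) \<Longrightarrow> (\<lambda>C. g C D) \<in> hom (tensor K V1 W1) (tensor K V3 W3)"
    unfolding g' using B(1)[of D] by (simp add: hom_def tensor_simps)
  show "C \<in> carrier (tensor K V1 W1) \<Longrightarrow> g C \<in> hom (tensor K V2 W2) (tensor K V3 W3)"
    unfolding g' using B(2)[of C] by (simp add: hom_def tensor_simps)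
  show "v \<in> carrier V1 \<Longrightarrow> w \<in> carrier W1 \<Longrightarrow> v' \<in> carrier V2 \<Longrightarrow> w' \<in> carrier W2 \<Longrightarrow>
      g (tens K V1 W1 v w) (tens K V2 W2 v' w') = tens K V3 W3 (p v v') (q w w')"
    unfolding g' using B(3)[of "(v, w)" "(v', w')"] by (simp add: tens_eq f_def)
qed

section \<open>Tensor products of algebras\<close>

locale tensor_of_algebras = R: unital_algebra K R + S: unital_algebra K S
  for K :: "('k, 'z) ring_scheme" and R :: "('k, 'a, 'y) module_scheme"
    and S :: "('k, 'b, 'x) module_scheme"
begin

abbreviation "V \<equiv> vect_bimod R"
abbreviation "W \<equiv> vect_bimod S"
abbreviation "T \<equiv> alg_tensor K R S"
abbreviation "el \<equiv> tens K V W"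

sublocale pair: balanced_pair K V W
  by (rule balanced_pair_vect[OF R.bimodule_vect_bimod S.bimodule_vect_bimod])

lemma alg_tensor_simps:
  "carrier T = carrier (tensor K V W)" "ring.add T = monoid.mult (tensor K V W)"
  "ring.zero T = monoid.one (tensor K V W)" "monoid.one T = el \<one>\<^bsub>R\<^esub> \<one>\<^bsub>S\<^esub>"
  "smult T = lact (tensor K V W)"
  by (simp_all add: alg_tensor_def Let_def)

lemma mult_alg_tensor:
  "monoid.mult T = (\<lambda>C D. \<Union>c \<in> C. \<Union>d \<in> D. tensor_class K V W
       (frag_bilinear (\<lambda>(r, s) (r', s'). (r \<otimes>\<^bsub>R\<^esub> r', s \<otimes>\<^bsub>S\<^esub> s')) c d))"
  by (simp add: alg_tensor_def Let_def)

lemma mult_hom_left: "D \<in> carrier T \<Longrightarrow> (\<lambda>C. C \<otimes>\<^bsub>T\<^esub> D) \<in> hom (tensor K V W) (tensor K V W)"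
  and mult_hom_right: "C \<in> carrier T \<Longrightarrow> (\<lambda>D. C \<otimes>\<^bsub>T\<^esub> D) \<in> hom (tensor K V W) (tensor K V W)"
  and mult_el: "r \<in> carrier R \<Longrightarrow> s \<in> carrier S \<Longrightarrow> r' \<in> carrier R \<Longrightarrow> s' \<in> carrier S \<Longrightarrow>
    el r s \<otimes>\<^bsub>T\<^esub> el r' s' = el (r \<otimes>\<^bsub>R\<^esub> r') (s \<otimes>\<^bsub>S\<^esub> s')"
  using tensor_bilinear_hom_left[OF pair.balanced_pair_axioms pair.balanced_pair_axioms
      pair.balanced_pair_axioms _ _ _ _ _ _ _ _ _ _ mult_alg_tensor, of D]
    tensor_bilinear_hom_right[OF pair.balanced_pair_axioms pair.balanced_pair_axioms
      pair.balanced_pair_axioms _ _ _ _ _ _ _ _ _ _ mult_alg_tensor, of C]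
    tensor_bilinear_tens[OF pair.balanced_pair_axioms pair.balanced_pair_axioms
      pair.balanced_pair_axioms _ _ _ _ _ _ _ _ _ _ mult_alg_tensor, of r s r' s']
  by (simp_all add: alg_tensor_simps R.A.l_distr R.A.r_distr S.A.l_distr S.A.r_distr
      R.smult_mult_left R.smult_mult_right S.smult_mult_left S.smult_mult_right)

lemma el_closed [simp]: "r \<in> carrier R \<Longrightarrow> s \<in> carrier S \<Longrightarrow> el r s \<in> carrier T"
  by (simp add: alg_tensor_simps)

lemma mult_closed: "C \<in> carrier T \<Longrightarrow> D \<in> carrier T \<Longrightarrow> C \<otimes>\<^bsub>T\<^esub> D \<in> carrier T"
  using mult_hom_right[of C] by (simp add: hom_def Pi_iff alg_tensor_simps)

lemma hom_el_eqI:
  assumes "h \<in> hom (tensor K V W) G" "h' \<in> hom (tensor K V W) G" "group G"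
    and "\<And>r s. r \<in> carrier R \<Longrightarrow> s \<in> carrier S \<Longrightarrow> h (el r s) = h' (el r s)"
    and "x \<in> carrier T"
  shows "h x = h' x"
  using assms pair.tensor_hom_eqI[of h G h' x] by (simp add: alg_tensor_simps)

text \<open>Both sides are additive in each variable, so the variables are reduced to elementary
  tensors one at a time: the third with two elementary factors fixed, then the second, then the
  first.\<close>

lemma mult_assoc:
  assumes "C \<in> carrier T" "D \<in> carrier T" "E \<in> carrier T"
  shows "(C \<otimes>\<^bsub>T\<^esub> D) \<otimes>\<^bsub>T\<^esub> E = C \<otimes>\<^bsub>T\<^esub> (D \<otimes>\<^bsub>T\<^esub> E)"
proof -
  note I = hom_el_eqI[OF _ _ pair.T.is_group]
  note H = hom_compose' mult_hom_left mult_hom_right mult_closed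
  have 1: "(el r s \<otimes>\<^bsub>T\<^esub> el r' s') \<otimes>\<^bsub>T\<^esub> E = el r s \<otimes>\<^bsub>T\<^esub> (el r' s' \<otimes>\<^bsub>T\<^esub> E)"
    if "r \<in> carrier R" "s \<in> carrier S" "r' \<in> carrier R" "s' \<in> carrier S" for r s r' s'
  proof (rule I[where h = "\<lambda>E. (el r s \<otimes>\<^bsub>T\<^esub> el r' s') \<otimes>\<^bsub>T\<^esub> E"
        and h' = "\<lambda>E. el r s \<otimes>\<^bsub>T\<^esub> (el r' s' \<otimes>\<^bsub>T\<^esub> E)"])
    show "(\<lambda>E. el r s \<otimes>\<^bsub>T\<^esub> (el r' s' \<otimes>\<^bsub>T\<^esub> E)) \<in> hom pair.MN pair.MN"
      using that by (intro hom_compose'[OF mult_hom_right mult_hom_right]) simp_all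
  qed (use that assms in \<open>simp_all add: mult_hom_right mult_closed mult_el R.A.m_assoc S.A.m_assoc\<close>)
  have 2: "(el r s \<otimes>\<^bsub>T\<^esub> D) \<otimes>\<^bsub>T\<^esub> E = el r s \<otimes>\<^bsub>T\<^esub> (D \<otimes>\<^bsub>T\<^esub> E)"
    if "r \<in> carrier R" "s \<in> carrier S" for r s
  proof (rule I[where h = "\<lambda>D. (el r s \<otimes>\<^bsub>T\<^esub> D) \<otimes>\<^bsub>T\<^esub> E"
        and h' = "\<lambda>D. el r s \<otimes>\<^bsub>T\<^esub> (D \<otimes>\<^bsub>T\<^esub> E)"])
    show "(\<lambda>D. (el r s \<otimes>\<^bsub>T\<^esub> D) \<otimes>\<^bsub>T\<^esub> E) \<in> hom pair.MN pair.MN"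
      using that assms by (intro hom_compose'[OF mult_hom_right mult_hom_left]) simp_all
    show "(\<lambda>D. el r s \<otimes>\<^bsub>T\<^esub> (D \<otimes>\<^bsub>T\<^esub> E)) \<in> hom pair.MN pair.MN"
      using that assms by (intro hom_compose'[OF mult_hom_left mult_hom_right]) simp_all
  qed (use that assms 1 in simp_all)
  show ?thesis
  proof (rule I[where h = "\<lambda>C. (C \<otimes>\<^bsub>T\<^esub> D) \<otimes>\<^bsub>T\<^esub> E" and h' = "\<lambda>C. C \<otimes>\<^bsub>T\<^esub> (D \<otimes>\<^bsub>T\<^esub> E)"])
    show "(\<lambda>C. (C \<otimes>\<^bsub>T\<^esub> D) \<otimes>\<^bsub>T\<^esub> E) \<in> hom pair.MN pair.MN"
      using assms by (intro hom_compose'[OF mult_hom_left mult_hom_left]) simp_all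
  qed (use assms 2 in \<open>simp_all add: mult_hom_left mult_closed\<close>)
qed

lemma ring_alg_tensor: "ring T"
proof (rule ringI)
  show "abelian_group T"
    by (rule comm_group_abelian_groupI, rule comm_group_cong[OF pair.comm_group_tensor])
      (simp_all add: alg_tensor_simps)
  show "monoid T"
  proof (rule monoidI)
    show "\<one>\<^bsub>T\<^esub> \<otimes>\<^bsub>T\<^esub> x = x" if "x \<in> carrier T" for x
      by (rule hom_el_eqI[where h = "\<lambda>x. \<one>\<^bsub>T\<^esub> \<otimes>\<^bsub>T\<^esub> x" and h' = "\<lambda>x. x", OF mult_hom_right hom_ident pair.T.is_group _ that])
        (simp_all add: alg_tensor_simps(4) mult_el)
    show "x \<otimes>\<^bsub>T\<^esub> \<one>\<^bsub>T\<^esub> = x" if "x \<in> carrier T" for x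
      by (rule hom_el_eqI[where h = "\<lambda>x. x \<otimes>\<^bsub>T\<^esub> \<one>\<^bsub>T\<^esub>" and h' = "\<lambda>x. x", OF mult_hom_left hom_ident pair.T.is_group _ that])
        (simp_all add: alg_tensor_simps(4) mult_el)
  qed (simp_all add: mult_closed mult_assoc, simp add: alg_tensor_simps)
qed (use hom_mult[OF mult_hom_left] hom_mult[OF mult_hom_right] in \<open>simp_all add: alg_tensor_simps\<close>)

lemma
  assumes "k \<in> carrier K"
  shows smult_hom: "smult T k \<in> hom (tensor K V W) (tensor K V W)"
    and smult_el: "r \<in> carrier R \<Longrightarrow> s \<in> carrier S \<Longrightarrow> smult T k (el r s) = el (k \<odot>\<^bsub>R\<^esub> r) s"
proof -
  have eq: "smult T k = tensor_map K V W (lact V k) id"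
    by (simp add: alg_tensor_simps tensor_def)
  have f: "lact V k \<in> hom V V"
    using assms by (intro homI) (simp_all add: R.smult_r_distr)
  have f': "lact V k (ract V m r) = ract V (lact V k m) r" if "m \<in> carrier V" "r \<in> carrier K" for m r
    using assms that by (simp add: R.smult_assoc1[symmetric] R.m_comm)
  have g: "id \<in> hom W W" by (simp add: hom_def)
  show "smult T k \<in> hom (tensor K V W) (tensor K V W)"
    unfolding eq using f f' g
    by (rule tensor_map_hom[OF pair.balanced_pair_axioms pair.balanced_pair_axioms]) simp_all
  show "smult T k (el r s) = el (k \<odot>\<^bsub>R\<^esub> r) s" if "r \<in> carrier R" "s \<in> carrier S"
    unfolding eq using tensor_map_tens[OF pair.balanced_pair_axioms pair.balanced_pair_axioms f f' g, of r s] that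
    by simp
qed

lemma unital_algebra_alg_tensor: "unital_algebra K T"
proof -
  interpret T: ring T by (rule ring_alg_tensor)
  note I = hom_el_eqI[OF _ _ pair.T.is_group]
  have sm: "smult T k x \<in> carrier T" if "k \<in> carrier K" "x \<in> carrier T" for k x
    using smult_hom[OF that(1)] that(2) by (simp add: hom_def Pi_iff alg_tensor_simps)
  have left: "(k \<odot>\<^bsub>T\<^esub> x) \<otimes>\<^bsub>T\<^esub> y = k \<odot>\<^bsub>T\<^esub> (x \<otimes>\<^bsub>T\<^esub> y)"
    if k: "k \<in> carrier K" and xy: "x \<in> carrier T" "y \<in> carrier T" for k x y
  proof -
    have 1: "(k \<odot>\<^bsub>T\<^esub> el r s) \<otimes>\<^bsub>T\<^esub> y = k \<odot>\<^bsub>T\<^esub> (el r s \<otimes>\<^bsub>T\<^esub> y)"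
      if "r \<in> carrier R" "s \<in> carrier S" for r s
      by (rule I[where h = "\<lambda>y. (k \<odot>\<^bsub>T\<^esub> el r s) \<otimes>\<^bsub>T\<^esub> y" and h' = "\<lambda>y. k \<odot>\<^bsub>T\<^esub> (el r s \<otimes>\<^bsub>T\<^esub> y)",
            OF mult_hom_right hom_compose'[OF mult_hom_right smult_hom]])
        (use k xy that in \<open>simp_all add: sm mult_el smult_el R.smult_mult_left\<close>)
    show ?thesis
      by (rule I[where h = "\<lambda>x. (k \<odot>\<^bsub>T\<^esub> x) \<otimes>\<^bsub>T\<^esub> y" and h' = "\<lambda>x. k \<odot>\<^bsub>T\<^esub> (x \<otimes>\<^bsub>T\<^esub> y)",
            OF hom_compose'[OF smult_hom mult_hom_left] hom_compose'[OF mult_hom_left smult_hom]])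
        (use k xy 1 in simp_all)
  qed
  have right: "x \<otimes>\<^bsub>T\<^esub> (k \<odot>\<^bsub>T\<^esub> y) = k \<odot>\<^bsub>T\<^esub> (x \<otimes>\<^bsub>T\<^esub> y)"
    if k: "k \<in> carrier K" and xy: "x \<in> carrier T" "y \<in> carrier T" for k x y
  proof -
    have 1: "el r s \<otimes>\<^bsub>T\<^esub> (k \<odot>\<^bsub>T\<^esub> y) = k \<odot>\<^bsub>T\<^esub> (el r s \<otimes>\<^bsub>T\<^esub> y)"
      if "r \<in> carrier R" "s \<in> carrier S" for r s
      by (rule I[where h = "\<lambda>y. el r s \<otimes>\<^bsub>T\<^esub> (k \<odot>\<^bsub>T\<^esub> y)" and h' = "\<lambda>y. k \<odot>\<^bsub>T\<^esub> (el r s \<otimes>\<^bsub>T\<^esub> y)",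
            OF hom_compose'[OF smult_hom mult_hom_right] hom_compose'[OF mult_hom_right smult_hom]])
        (use k xy that in \<open>simp_all add: sm mult_el smult_el R.smult_mult_right\<close>)
    show ?thesis
      by (rule I[where h = "\<lambda>x. x \<otimes>\<^bsub>T\<^esub> (k \<odot>\<^bsub>T\<^esub> y)" and h' = "\<lambda>x. k \<odot>\<^bsub>T\<^esub> (x \<otimes>\<^bsub>T\<^esub> y)",
            OF mult_hom_left hom_compose'[OF mult_hom_left smult_hom]])
        (use k xy 1 sm in simp_all)
  qed
  show ?thesis
  proof (intro unital_algebra.intro moduleI unital_algebra_axioms.intro T.ring_axioms R.field_axioms left right)
    show "cring K" by (rule R.is_cring)
    show "abelian_group T" by (rule T.is_abelian_group)
    show "k \<odot>\<^bsub>T\<^esub> (x \<oplus>\<^bsub>T\<^esub> y) = k \<odot>\<^bsub>T\<^esub> x \<oplus>\<^bsub>T\<^esub> k \<odot>\<^bsub>T\<^esub> y"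
      if "k \<in> carrier K" "x \<in> carrier T" "y \<in> carrier T" for k x y
      using hom_mult[OF smult_hom] that by (simp add: alg_tensor_simps)
    show "(k \<oplus>\<^bsub>K\<^esub> l) \<odot>\<^bsub>T\<^esub> x = k \<odot>\<^bsub>T\<^esub> x \<oplus>\<^bsub>T\<^esub> l \<odot>\<^bsub>T\<^esub> x"
      if "k \<in> carrier K" "l \<in> carrier K" "x \<in> carrier T" for k l x
      by (rule I[where h = "\<lambda>x. (k \<oplus>\<^bsub>K\<^esub> l) \<odot>\<^bsub>T\<^esub> x" and h' = "\<lambda>x. k \<odot>\<^bsub>T\<^esub> x \<oplus>\<^bsub>T\<^esub> l \<odot>\<^bsub>T\<^esub> x"])
        (use that pair.T.hom_mult_pointwise[OF smult_hom smult_hom] pair.tens_add_left in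
          \<open>simp_all add: smult_hom alg_tensor_simps(2) smult_el R.smult_l_distr\<close>)
    show "(k \<otimes>\<^bsub>K\<^esub> l) \<odot>\<^bsub>T\<^esub> x = k \<odot>\<^bsub>T\<^esub> (l \<odot>\<^bsub>T\<^esub> x)"
      if "k \<in> carrier K" "l \<in> carrier K" "x \<in> carrier T" for k l x
      by (rule I[where h = "\<lambda>x. (k \<otimes>\<^bsub>K\<^esub> l) \<odot>\<^bsub>T\<^esub> x" and h' = "\<lambda>x. k \<odot>\<^bsub>T\<^esub> (l \<odot>\<^bsub>T\<^esub> x)",
            OF smult_hom hom_compose'[OF smult_hom smult_hom]])
        (use that in \<open>simp_all add: smult_el R.smult_assoc1\<close>)
    show "\<one>\<^bsub>K\<^esub> \<odot>\<^bsub>T\<^esub> x = x" if "x \<in> carrier T" for x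
      by (rule I[where h = "\<lambda>x. \<one>\<^bsub>K\<^esub> \<odot>\<^bsub>T\<^esub> x" and h' = "\<lambda>x. x", OF smult_hom hom_ident])
        (use that in \<open>simp_all add: smult_el\<close>)
  qed (use sm in simp_all)
qed

text \<open>The map \<open>\<alpha> r \<otimes> \<beta> s\<close> is balanced over \<open>K\<close>
  by \<open>scal\<close> and multiplicative by \<open>comm\<close>. Since \<open>E\<close> is only a
  ring, \<open>scal\<close> plays the part of \<open>K\<close>-linearity of the two
  homomorphisms.\<close>

lemma alg_tensor_universal:
  assumes "ring E" and a: "\<alpha> \<in> ring_hom R E" and b: "\<beta> \<in> ring_hom S E"
    and comm: "\<And>r s. r \<in> carrier R \<Longrightarrow> s \<in> carrier S \<Longrightarrow> \<alpha> r \<otimes>\<^bsub>E\<^esub> \<beta> s = \<beta> s \<otimes>\<^bsub>E\<^esub> \<alpha> r"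
    and scal: "\<And>k. k \<in> carrier K \<Longrightarrow> \<alpha> (k \<odot>\<^bsub>R\<^esub> \<one>\<^bsub>R\<^esub>) = \<beta> (k \<odot>\<^bsub>S\<^esub> \<one>\<^bsub>S\<^esub>)"
  shows "\<exists>f \<in> ring_hom T E. \<forall>r\<in>carrier R. \<forall>s\<in>carrier S. f (el r s) = \<alpha> r \<otimes>\<^bsub>E\<^esub> \<beta> s"
proof -
  interpret E: ring E by fact
  note ac = ring_hom_closed[OF a] and bc = ring_hom_closed[OF b]
  have bal: "balanced K V W (add_monoid E) (\<lambda>r s. \<alpha> r \<otimes>\<^bsub>E\<^esub> \<beta> s)"
    unfolding balanced_def
  proof (intro conjI ballI)
    fix m k n assume m: "m \<in> carrier V" and k: "k \<in> carrier K" and n: "n \<in> carrier W"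
    have "\<alpha> (k \<odot>\<^bsub>R\<^esub> m) = \<alpha> m \<otimes>\<^bsub>E\<^esub> \<alpha> (k \<odot>\<^bsub>R\<^esub> \<one>\<^bsub>R\<^esub>)"
      using m k ring_hom_mult[OF a, of m "k \<odot>\<^bsub>R\<^esub> \<one>\<^bsub>R\<^esub>"] by (simp add: R.scalar_one_mult)
    moreover have "\<beta> (k \<odot>\<^bsub>S\<^esub> n) = \<beta> (k \<odot>\<^bsub>S\<^esub> \<one>\<^bsub>S\<^esub>) \<otimes>\<^bsub>E\<^esub> \<beta> n"
      using n k ring_hom_mult[OF b, of "k \<odot>\<^bsub>S\<^esub> \<one>\<^bsub>S\<^esub>" n] by (simp add: S.scalar_one_mult)
    ultimately show "\<alpha> (ract V m k) \<otimes>\<^bsub>E\<^esub> \<beta> n = \<alpha> m \<otimes>\<^bsub>E\<^esub> \<beta> (lact W k n)"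
      using m k n by (simp add: scal E.m_assoc ac bc)
  qed (simp_all add: ac bc ring_hom_add[OF a] ring_hom_add[OF b] E.l_distr E.r_distr)
  define f where "f = tensor_lift K V W (add_monoid E) (\<lambda>r s. \<alpha> r \<otimes>\<^bsub>E\<^esub> \<beta> s)"
  have f: "f \<in> hom (tensor K V W) (add_monoid E)"
    and fe: "\<And>r s. r \<in> carrier R \<Longrightarrow> s \<in> carrier S \<Longrightarrow> f (el r s) = \<alpha> r \<otimes>\<^bsub>E\<^esub> \<beta> s"
    unfolding f_def
    using pair.tensor_lift_hom[OF E.comm_group_add_monoid bal]
      pair.tensor_lift_tens[OF E.comm_group_add_monoid bal] by simp_all
  have fc: "f x \<in> carrier E" if "x \<in> carrier T" for x
    using hom_in_carrier[OF f, of x] that by (simp add: alg_tensor_simps)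
  have lm: "(\<lambda>x. x \<otimes>\<^bsub>E\<^esub> c) \<in> hom (add_monoid E) (add_monoid E)"
    and rm: "(\<lambda>x. c \<otimes>\<^bsub>E\<^esub> x) \<in> hom (add_monoid E) (add_monoid E)" if "c \<in> carrier E" for c
    using that by (auto simp: hom_def E.l_distr E.r_distr)
  have mult: "f (x \<otimes>\<^bsub>T\<^esub> y) = f x \<otimes>\<^bsub>E\<^esub> f y" if x: "x \<in> carrier T" and y: "y \<in> carrier T" for x y
  proof -
    have 1: "f (el r s \<otimes>\<^bsub>T\<^esub> y) = f (el r s) \<otimes>\<^bsub>E\<^esub> f y" if rs: "r \<in> carrier R" "s \<in> carrier S" for r s
    proof (rule hom_el_eqI[where h = "\<lambda>y. f (el r s \<otimes>\<^bsub>T\<^esub> y)" and h' = "\<lambda>y. f (el r s) \<otimes>\<^bsub>E\<^esub> f y",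
            OF hom_compose'[OF mult_hom_right f] hom_compose'[OF f rm] _ _ y])
      fix r' s' assume rs': "r' \<in> carrier R" "s' \<in> carrier S"
      \<comment> \<open>Only the two middle factors have to trade places, which is the commutation
        hypothesis.\<close>
      have "\<alpha> r \<otimes>\<^bsub>E\<^esub> \<alpha> r' \<otimes>\<^bsub>E\<^esub> (\<beta> s \<otimes>\<^bsub>E\<^esub> \<beta> s') = \<alpha> r \<otimes>\<^bsub>E\<^esub> (\<alpha> r' \<otimes>\<^bsub>E\<^esub> \<beta> s) \<otimes>\<^bsub>E\<^esub> \<beta> s'"
        using rs rs' by (simp add: E.m_assoc ac bc)
      also have "\<dots> = \<alpha> r \<otimes>\<^bsub>E\<^esub> \<beta> s \<otimes>\<^bsub>E\<^esub> (\<alpha> r' \<otimes>\<^bsub>E\<^esub> \<beta> s')"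
        unfolding comm[OF rs'(1) rs(2)] using rs rs' by (simp add: E.m_assoc ac bc)
      finally show "f (el r s \<otimes>\<^bsub>T\<^esub> el r' s') = f (el r s) \<otimes>\<^bsub>E\<^esub> f (el r' s')"
        using rs rs' by (simp add: mult_el fe ring_hom_mult[OF a] ring_hom_mult[OF b])
    qed (use rs in \<open>simp_all add: fc\<close>)
    show ?thesis
      by (rule hom_el_eqI[where h = "\<lambda>x. f (x \<otimes>\<^bsub>T\<^esub> y)" and h' = "\<lambda>x. f x \<otimes>\<^bsub>E\<^esub> f y",
            OF hom_compose'[OF mult_hom_left f] hom_compose'[OF f lm] _ _ x])
        (use y 1 in \<open>simp_all add: fc\<close>)
  qed
  have "f \<in> ring_hom T E"
    using fc mult hom_mult[OF f]
    by (intro ring_hom_memI)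
      (simp_all add: alg_tensor_simps fe ring_hom_one[OF a] ring_hom_one[OF b])
  with fe show ?thesis by blast
qed

lemma alg_tensor_induct [consumes 1, case_names minus el]:
  assumes "x \<in> carrier T"
    and minus: "\<And>x y. x \<in> carrier T \<Longrightarrow> y \<in> carrier T \<Longrightarrow> Q x \<Longrightarrow> Q y \<Longrightarrow> Q (x \<ominus>\<^bsub>T\<^esub> y)"
    and el: "\<And>r s. r \<in> carrier R \<Longrightarrow> s \<in> carrier S \<Longrightarrow> Q (el r s)"
  shows "Q x"
proof -
  interpret T: ring T by (rule ring_alg_tensor)
  have inv: "inv\<^bsub>pair.MN\<^esub> y = \<ominus>\<^bsub>T\<^esub> y" for y
    by (simp add: a_inv_def m_inv_def alg_tensor_simps)
  \<comment> \<open>The induction rule has no case for zero, because zero is the difference of an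
    elementary tensor with itself.\<close>
  have zero: "Q \<one>\<^bsub>pair.MN\<^esub>"
    using minus[of "el \<one>\<^bsub>R\<^esub> \<one>\<^bsub>S\<^esub>" "el \<one>\<^bsub>R\<^esub> \<one>\<^bsub>S\<^esub>"] el[of "\<one>\<^bsub>R\<^esub>" "\<one>\<^bsub>S\<^esub>"]
    by (simp add: T.r_neg a_minus_def) (simp add: alg_tensor_simps)
  show ?thesis
    using assms(1) unfolding alg_tensor_simps(1)
    by (induction rule: pair.tensor_induct)
      (use minus el zero in \<open>simp_all add: inv a_minus_def alg_tensor_simps\<close>)
qed

end


section \<open>The dual bimodule\<close>

lemma left_dual_simps:
  "monoid.mult (left_dual A M) = (\<lambda>x y. \<lambda>\<omega>\<in>carrier M. x \<omega> \<oplus>\<^bsub>A\<^esub> y \<omega>)"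
  "monoid.one (left_dual A M) = (\<lambda>\<omega>\<in>carrier M. \<zero>\<^bsub>A\<^esub>)"
  "lact (left_dual A M) a x = (\<lambda>\<omega>\<in>carrier M. a \<otimes>\<^bsub>A\<^esub> x \<omega>)"
  "ract (left_dual A M) x b = (\<lambda>\<omega>\<in>carrier M. x (lact M b \<omega>))"
  by (simp_all add: left_dual_def)

lemma left_dual_iff:
  "x \<in> carrier (left_dual A M) \<longleftrightarrow> x \<in> extensional (carrier M) \<and>
     (\<forall>m\<in>carrier M. x m \<in> carrier A) \<and>
     (\<forall>m\<in>carrier M. \<forall>n\<in>carrier M. x (m \<boxplus>\<^bsub>M\<^esub> n) = x m \<oplus>\<^bsub>A\<^esub> x n) \<and>
     (\<forall>a\<in>carrier A. \<forall>m\<in>carrier M. x (ract M m a) = x m \<otimes>\<^bsub>A\<^esub> a)"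
  by (auto simp: left_dual_def right_homs_def hom_def self_bimod_def)

lemma left_dual_eqI:
  "x \<in> carrier (left_dual A M) \<Longrightarrow> y \<in> carrier (left_dual A M) \<Longrightarrow>
    (\<And>m. m \<in> carrier M \<Longrightarrow> x m = y m) \<Longrightarrow> x = y"
  unfolding left_dual_iff by (blast intro: extensionalityI)

lemma (in bimodule) bimodule_left_dual: "bimodule K A (left_dual A M)"
proof -
  let ?X = "left_dual A M"
  note [simp] = left_dual_simps
  have ring: "ring A" by (rule A.ring_axioms)
  have grp: "comm_group ?X"
  proof (rule comm_groupI)
    fix x y assume xy: "x \<in> carrier ?X" "y \<in> carrier ?X"
    show "x \<boxplus>\<^bsub>?X\<^esub> y \<in> carrier ?X"
      using xy unfolding left_dual_iff by (simp add: ract_closed A.l_distr M.a_ac)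
    show "x \<boxplus>\<^bsub>?X\<^esub> y = y \<boxplus>\<^bsub>?X\<^esub> x"
      using xy unfolding left_dual_iff by (simp add: M.a_ac cong: restrict_cong)
    fix z assume "z \<in> carrier ?X"
    then show "x \<boxplus>\<^bsub>?X\<^esub> y \<boxplus>\<^bsub>?X\<^esub> z = x \<boxplus>\<^bsub>?X\<^esub> (y \<boxplus>\<^bsub>?X\<^esub> z)"
      using xy unfolding left_dual_iff by (simp add: M.a_ac cong: restrict_cong)
  next
    show "\<one>\<^bsub>?X\<^esub> \<in> carrier ?X"
      unfolding left_dual_iff by (simp add: ract_closed)
    fix x assume x: "x \<in> carrier ?X"
    show "\<one>\<^bsub>?X\<^esub> \<boxplus>\<^bsub>?X\<^esub> x = x"
      using x unfolding left_dual_iff by (auto intro!: extensionalityI[of _ "carrier M"])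
    have "(\<lambda>m\<in>carrier M. \<ominus>\<^bsub>A\<^esub> x m) \<in> carrier ?X"
      using x unfolding left_dual_iff by (simp add: ract_closed M.minus_add A.l_minus M.a_ac)
    moreover have "(\<lambda>m\<in>carrier M. \<ominus>\<^bsub>A\<^esub> x m) \<boxplus>\<^bsub>?X\<^esub> x = \<one>\<^bsub>?X\<^esub>"
      using x unfolding left_dual_iff by (simp add: M.l_neg cong: restrict_cong)
    ultimately show "\<exists>y\<in>carrier ?X. y \<boxplus>\<^bsub>?X\<^esub> x = \<one>\<^bsub>?X\<^esub>" by blast
  qed
  show ?thesis
  proof (intro bimodule.intro left_module.intro bimodule_axioms.intro left_module_axioms.intro
      unital_algebra_axioms ring grp)
    fix k x assume k: "k \<in> carrier K" and x: "x \<in> carrier ?X"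
    \<comment> \<open>Centrality of scalars in the bimodule and right linearity of \<open>x\<close>
      give x(k m) = x(m k) = x(m) k, and the scalar \<open>k\<close> is central in
      \<open>A\<close>.\<close>
    show "lact ?X (k \<odot>\<^bsub>A\<^esub> \<one>\<^bsub>A\<^esub>) x = ract ?X x (k \<odot>\<^bsub>A\<^esub> \<one>\<^bsub>A\<^esub>)"
      using k x unfolding left_dual_iff
      by (simp add: scalar_central scalar_one_mult cong: restrict_cong)
  next
    fix a b x assume abx: "a \<in> carrier A" "b \<in> carrier A" "x \<in> carrier ?X"
    then show "lact ?X (a \<oplus>\<^bsub>A\<^esub> b) x = lact ?X a x \<boxplus>\<^bsub>?X\<^esub> lact ?X b x"
      "lact ?X (a \<otimes>\<^bsub>A\<^esub> b) x = lact ?X a (lact ?X b x)"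
      "ract ?X x (a \<oplus>\<^bsub>A\<^esub> b) = ract ?X x a \<boxplus>\<^bsub>?X\<^esub> ract ?X x b"
      "ract ?X x (a \<otimes>\<^bsub>A\<^esub> b) = ract ?X (ract ?X x a) b"
      "ract ?X (lact ?X a x) b = lact ?X a (ract ?X x b)"
      unfolding left_dual_iff
      by (simp_all add: A.l_distr A.m_assoc lact_closed add_lact mult_lact cong: restrict_cong)
  next
    fix a x y assume axy: "a \<in> carrier A" "x \<in> carrier ?X" "y \<in> carrier ?X"
    then show "lact ?X a (x \<boxplus>\<^bsub>?X\<^esub> y) = lact ?X a x \<boxplus>\<^bsub>?X\<^esub> lact ?X a y"
      "ract ?X (x \<boxplus>\<^bsub>?X\<^esub> y) a = ract ?X x a \<boxplus>\<^bsub>?X\<^esub> ract ?X y a"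
      unfolding left_dual_iff by (simp_all add: A.r_distr lact_closed cong: restrict_cong)
  next
    fix a x assume "a \<in> carrier A" "x \<in> carrier ?X"
    then show "lact ?X a x \<in> carrier ?X" "ract ?X x a \<in> carrier ?X"
      unfolding left_dual_iff
      by (simp_all add: A.r_distr lact_closed ract_closed lact_add lact_ract[symmetric] A.m_assoc)
  next
    fix x assume "x \<in> carrier ?X"
    then show "lact ?X \<one>\<^bsub>A\<^esub> x = x" "ract ?X x \<one>\<^bsub>A\<^esub> = x"
      unfolding left_dual_iff by (auto simp: one_lact intro!: extensionalityI[of _ "carrier M"])
  qed
qed

section \<open>Tensor algebras\<close>

lemma tpow_class_eq: "tpow_class R V = pres_class (tpow_words V) (tpow_rels R V)"
  by (simp add: fun_eq_iff tpow_class_def tpow_sub_def pres_class_def pres_sub_def)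

lemma tpow_group_eq: "tpow_free V Mod tpow_sub R V = pres (tpow_words V) (tpow_rels R V)"
  by (simp add: pres_def tpow_sub_def pres_sub_def)

text \<open>The positive part of the tensor algebra, packaged with its two actions so that its laws
  can be stated as the bimodule axioms and reused as rewrite rules.\<close>

definition tpow ::
  "('r, 'z) ring_scheme \<Rightarrow> ('r, 'r, 'v, 'y) bimod_scheme \<Rightarrow> ('r, 'r, ('v list \<Rightarrow>\<^sub>0 int) set) bimod" where
  "tpow R V = (let P = pres (tpow_words V) (tpow_rels R V) in
     \<lparr>carrier = carrier P, monoid.mult = monoid.mult P, monoid.one = monoid.one P,
      lact = tpow_lact R V, ract = tpow_ract R V\<rparr>)"

lemma tpow_simps [simp]:
  "carrier (tpow R V) = carrier (pres (tpow_words V) (tpow_rels R V))"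
  "monoid.mult (tpow R V) = monoid.mult (pres (tpow_words V) (tpow_rels R V))"
  "monoid.one (tpow R V) = monoid.one (pres (tpow_words V) (tpow_rels R V))"
  "lact (tpow R V) = tpow_lact R V" "ract (tpow R V) = tpow_ract R V"
  by (simp_all add: tpow_def Let_def)

lemma tpow_rel_addI:
  "set us \<subseteq> carrier V \<Longrightarrow> v \<in> carrier V \<Longrightarrow> w \<in> carrier V \<Longrightarrow> set ws \<subseteq> carrier V \<Longrightarrow>
    frag_of (us @ [v \<boxplus>\<^bsub>V\<^esub> w] @ ws) - frag_of (us @ [v] @ ws) - frag_of (us @ [w] @ ws) \<in> tpow_rels R V"
  unfolding tpow_rels_def by blast

lemma tpow_rel_balancedI:
  "set us \<subseteq> carrier V \<Longrightarrow> v \<in> carrier V \<Longrightarrow> r \<in> carrier R \<Longrightarrow> w \<in> carrier V \<Longrightarrow> set ws \<subseteq> carrier V \<Longrightarrow>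
    frag_of (us @ [ract V v r, w] @ ws) - frag_of (us @ [v, lact V r w] @ ws) \<in> tpow_rels R V"
  unfolding tpow_rels_def by blast

lemma tpow_relE:
  assumes "x \<in> tpow_rels R V"
  obtains (add) us v w ws where "set us \<subseteq> carrier V" "v \<in> carrier V" "w \<in> carrier V" "set ws \<subseteq> carrier V"
      "x = frag_of (us @ [v \<boxplus>\<^bsub>V\<^esub> w] @ ws) - frag_of (us @ [v] @ ws) - frag_of (us @ [w] @ ws)"
    | (balanced) us v r w ws where "set us \<subseteq> carrier V" "v \<in> carrier V" "r \<in> carrier R"
      "w \<in> carrier V" "set ws \<subseteq> carrier V"
      "x = frag_of (us @ [ract V v r, w] @ ws) - frag_of (us @ [v, lact V r w] @ ws)"
  using assms unfolding tpow_rels_def by blast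

context bimodule
begin

abbreviation "words \<equiv> tpow_words M"
abbreviation "P \<equiv> pres words (tpow_rels A M)"
abbreviation "wd vs \<equiv> pres_class words (tpow_rels A M) (frag_of vs)"

lemma words_iff: "vs \<in> words \<longleftrightarrow> vs \<noteq> [] \<and> set vs \<subseteq> carrier M"
  by (simp add: tpow_words_def)

lemma presentation_tpow: "presentation words (tpow_rels A M)"
proof
  fix r assume "r \<in> tpow_rels A M"
  then show "Poly_Mapping.keys r \<subseteq> words"
    by (cases rule: tpow_relE; simp only:; intro keys_diff_subset)
      (simp_all add: words_iff lact_closed ract_closed)
qed

sublocale pw: presentation words "tpow_rels A M"
  by (rule presentation_tpow)

lemma wd_add:
  "set us \<subseteq> carrier M \<Longrightarrow> v \<in> carrier M \<Longrightarrow> w \<in> carrier M \<Longrightarrow> set ws \<subseteq> carrier M \<Longrightarrow>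
    wd (us @ (v \<boxplus>\<^bsub>M\<^esub> w) # ws) = wd (us @ v # ws) \<boxplus>\<^bsub>P\<^esub> wd (us @ w # ws)"
  using tpow_rel_addI[of us M v w ws A] by (intro pw.class_add_rel) (simp_all add: words_iff)

lemma wd_balanced:
  "set us \<subseteq> carrier M \<Longrightarrow> v \<in> carrier M \<Longrightarrow> r \<in> carrier A \<Longrightarrow> w \<in> carrier M \<Longrightarrow> set ws \<subseteq> carrier M \<Longrightarrow>
    wd (us @ ract M v r # w # ws) = wd (us @ v # lact M r w # ws)"
  using tpow_rel_balancedI[of us M v r A w ws]
  by (intro pw.class_diff_rel) (simp_all add: words_iff lact_closed ract_closed)

text \<open>The action changes the first letter only. If that letter takes part in a relator,
  additivity of the action or the commuting of the two actions shows that the image is again a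
  relator; otherwise only the prefix \<open>us\<close> of the relator is altered.\<close>

lemma
  assumes r: "r \<in> carrier A"
  shows tpow_lact_hom: "tpow_lact A M r \<in> hom P P"
    and tpow_lact_wd: "v \<in> carrier M \<Longrightarrow> set vs \<subseteq> carrier M \<Longrightarrow>
      tpow_lact A M r (wd (v # vs)) = wd (lact M r v # vs)"
proof -
  define f where "f vs = lact M r (hd vs) # tl vs" for vs
  have f: "f vs \<in> words" if "vs \<in> words" for vs
    using that r by (cases vs) (auto simp: f_def words_iff lact_closed)
  have rel: "pw.cl (frag_extend (\<lambda>s. frag_of (f s)) x) = \<one>\<^bsub>P\<^esub>" if "x \<in> tpow_rels A M" for x
    using that
  proof (cases rule: tpow_relE)
    case (add us v w ws)
    have "frag_extend (\<lambda>s. frag_of (f s)) x \<in> tpow_rels A M"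
    proof (cases us)
      case Nil
      then show ?thesis
        using tpow_rel_addI[of "[]" M "lact M r v" "lact M r w" ws A] add r
        by (simp add: f_def frag_extend_diff lact_add lact_closed)
    next
      case (Cons u us')
      then show ?thesis
        using tpow_rel_addI[of "lact M r u # us'" M v w ws A] add r
        by (simp add: f_def frag_extend_diff lact_closed)
    qed
    then show ?thesis by (rule pw.class_rel)
  next
    case (balanced us v s w ws)
    have "frag_extend (\<lambda>s. frag_of (f s)) x \<in> tpow_rels A M"
    proof (cases us)
      case Nil
      then show ?thesis
        using tpow_rel_balancedI[of "[]" M "lact M r v" s A w ws] balanced r
        by (simp add: f_def frag_extend_diff lact_ract lact_closed)
    next
      case (Cons u us')
      then show ?thesis
        using tpow_rel_balancedI[of "lact M r u # us'" M v s A w ws] balanced r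
        by (simp add: f_def frag_extend_diff lact_closed)
    qed
    then show ?thesis by (rule pw.class_rel)
  qed
  have eq: "tpow_lact A M r = (\<lambda>C. \<Union>c\<in>C. pw.cl (frag_extend (\<lambda>s. frag_of (f s)) c))"
    by (simp add: fun_eq_iff tpow_lact_def tpow_class_eq f_def)
  note m = pres_map[OF presentation_tpow presentation_tpow f rel]
  show "tpow_lact A M r \<in> hom P P"
    unfolding eq by (rule m(1))
  show "tpow_lact A M r (wd (v # vs)) = wd (lact M r v # vs)"
    if "v \<in> carrier M" "set vs \<subseteq> carrier M"
    unfolding eq using m(2)[of "v # vs"] that by (simp add: f_def words_iff)
qed

lemma
  assumes r: "r \<in> carrier A"
  shows tpow_ract_hom: "(\<lambda>C. tpow_ract A M C r) \<in> hom P P"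
    and tpow_ract_wd: "v \<in> carrier M \<Longrightarrow> set vs \<subseteq> carrier M \<Longrightarrow>
      tpow_ract A M (wd (vs @ [v])) r = wd (vs @ [ract M v r])"
proof -
  define f where "f vs = butlast vs @ [ract M (last vs) r]" for vs
  have f: "f vs \<in> words" if "vs \<in> words" for vs
    using that r by (cases vs rule: rev_cases) (auto simp: f_def words_iff ract_closed)
  have rel: "pw.cl (frag_extend (\<lambda>s. frag_of (f s)) x) = \<one>\<^bsub>P\<^esub>" if "x \<in> tpow_rels A M" for x
    using that
  proof (cases rule: tpow_relE)
    case (add us v w ws)
    have "frag_extend (\<lambda>s. frag_of (f s)) x \<in> tpow_rels A M"
    proof (cases ws rule: rev_cases)
      case Nil
      then show ?thesis
        using tpow_rel_addI[of us M "ract M v r" "ract M w r" "[]" A] add r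
        by (simp add: f_def frag_extend_diff ract_add ract_closed)
    next
      case (snoc ws' u)
      then show ?thesis
        using tpow_rel_addI[of us M v w "ws' @ [ract M u r]" A] add r
        by (simp add: f_def frag_extend_diff ract_closed butlast_append)
    qed
    then show ?thesis by (rule pw.class_rel)
  next
    case (balanced us v s w ws)
    have "frag_extend (\<lambda>s. frag_of (f s)) x \<in> tpow_rels A M"
    proof (cases ws rule: rev_cases)
      case Nil
      then show ?thesis
        using tpow_rel_balancedI[of us M v s A "ract M w r" "[]"] balanced r
        by (simp add: f_def frag_extend_diff lact_ract ract_closed butlast_append)
    next
      case (snoc ws' u)
      then show ?thesis
        using tpow_rel_balancedI[of us M v s A w "ws' @ [ract M u r]"] balanced r
        by (simp add: f_def frag_extend_diff ract_closed butlast_append)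
    qed
    then show ?thesis by (rule pw.class_rel)
  qed
  have eq: "tpow_ract A M C r = (\<Union>c\<in>C. pw.cl (frag_extend (\<lambda>s. frag_of (f s)) c))" for C
    by (simp add: tpow_ract_def tpow_class_eq f_def)
  note m = pres_map[OF presentation_tpow presentation_tpow f rel]
  show "(\<lambda>C. tpow_ract A M C r) \<in> hom P P"
    unfolding eq by (rule m(1))
  show "tpow_ract A M (wd (vs @ [v])) r = wd (vs @ [ract M v r])"
    if "v \<in> carrier M" "set vs \<subseteq> carrier M"
    unfolding eq using m(2)[of "vs @ [v]"] that by (simp add: f_def words_iff)
qed

lemma
  shows tpow_concat_hom_left: "D \<in> carrier P \<Longrightarrow> (\<lambda>C. tpow_concat A M C D) \<in> hom P P"
    and tpow_concat_hom_right: "C \<in> carrier P \<Longrightarrow> tpow_concat A M C \<in> hom P P"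
    and tpow_concat_wd: "us \<in> words \<Longrightarrow> vs \<in> words \<Longrightarrow> tpow_concat A M (wd us) (wd vs) = wd (us @ vs)"
proof -
  have f: "us @ vs \<in> words" if "us \<in> words" "vs \<in> words" for us vs
    using that by (simp add: words_iff)
  have l: "pw.cl (frag_bilinear (@) x (frag_of ts)) = \<one>\<^bsub>P\<^esub>"
    if x: "x \<in> tpow_rels A M" and t: "ts \<in> words" for x ts
  proof (rule pw.class_rel)
    show "frag_bilinear (@) x (frag_of ts) \<in> tpow_rels A M"
      using x
    proof (cases rule: tpow_relE)
      case (add us v w ws)
      then show ?thesis
        using tpow_rel_addI[of us M v w "ws @ ts" A] t
        by (simp add: frag_bilinear_diff_left words_iff)
    next
      case (balanced us v r w ws)
      then show ?thesis
        using tpow_rel_balancedI[of us M v r A w "ws @ ts"] t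
        by (simp add: frag_bilinear_diff_left words_iff)
    qed
  qed
  have r: "pw.cl (frag_bilinear (@) (frag_of ts) x) = \<one>\<^bsub>P\<^esub>"
    if t: "ts \<in> words" and x: "x \<in> tpow_rels A M" for x ts
  proof (rule pw.class_rel)
    show "frag_bilinear (@) (frag_of ts) x \<in> tpow_rels A M"
      using x
    proof (cases rule: tpow_relE)
      case (add us v w ws)
      then show ?thesis
        using tpow_rel_addI[of "ts @ us" M v w ws A] t
        by (simp add: frag_bilinear_diff_right words_iff)
    next
      case (balanced us v r w ws)
      then show ?thesis
        using tpow_rel_balancedI[of "ts @ us" M v r A w ws] t
        by (simp add: frag_bilinear_diff_right words_iff)
    qed
  qed
  have eq: "tpow_concat A M = (\<lambda>C D. \<Union>c\<in>C. \<Union>d\<in>D. pw.cl (frag_bilinear (@) c d))"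
    by (simp add: fun_eq_iff tpow_concat_def tpow_class_eq)
  note b = pres_bilinear[OF presentation_tpow presentation_tpow presentation_tpow f l r]
  show "D \<in> carrier P \<Longrightarrow> (\<lambda>C. tpow_concat A M C D) \<in> hom P P"
    unfolding eq by (rule b(1))
  show "C \<in> carrier P \<Longrightarrow> tpow_concat A M C \<in> hom P P"
    unfolding eq by (rule b(2))
  show "us \<in> words \<Longrightarrow> vs \<in> words \<Longrightarrow> tpow_concat A M (wd us) (wd vs) = wd (us @ vs)"
    unfolding eq by (rule b(3))
qed

lemma hom_wd_eqI:
  assumes "h \<in> hom P G" "h' \<in> hom P G" "group G" "x \<in> carrier P"
    and "\<And>v vs. v \<in> carrier M \<Longrightarrow> set vs \<subseteq> carrier M \<Longrightarrow> h (wd (v # vs)) = h' (wd (v # vs))"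
  shows "h x = h' x"
proof (rule pw.hom_eqI[OF assms(1-3) _ assms(4)])
  show "h (wd s) = h' (wd s)" if "s \<in> words" for s
    using that assms(5) by (cases s) (auto simp: words_iff)
qed

text \<open>Words are split at the end here and at the front in \<open>hom_wd_eqI\<close>, because
  each action is computed on the letter that it changes.\<close>

lemma hom_wd_eqI':
  assumes "h \<in> hom P G" "h' \<in> hom P G" "group G" "x \<in> carrier P"
    and "\<And>v vs. v \<in> carrier M \<Longrightarrow> set vs \<subseteq> carrier M \<Longrightarrow> h (wd (vs @ [v])) = h' (wd (vs @ [v]))"
  shows "h x = h' x"
proof (rule pw.hom_eqI[OF assms(1-3) _ assms(4)])
  show "h (wd s) = h' (wd s)" if "s \<in> words" for s
    using that assms(5) by (cases s rule: rev_cases) (auto simp: words_iff)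
qed

lemma tpow_lact_closed: "r \<in> carrier A \<Longrightarrow> C \<in> carrier P \<Longrightarrow> tpow_lact A M r C \<in> carrier P"
  using tpow_lact_hom[of r] by (simp add: hom_def Pi_iff)

lemma tpow_ract_closed: "r \<in> carrier A \<Longrightarrow> C \<in> carrier P \<Longrightarrow> tpow_ract A M C r \<in> carrier P"
  using tpow_ract_hom[of r] by (simp add: hom_def Pi_iff)

lemma tpow_concat_closed: "C \<in> carrier P \<Longrightarrow> D \<in> carrier P \<Longrightarrow> tpow_concat A M C D \<in> carrier P"
  using tpow_concat_hom_right[of C] by (simp add: hom_def Pi_iff)

text \<open>A scalar on a letter can be read as a right multiplication, carried over the tensor
  sign, and read as a left multiplication of the next letter. Repeating this moves it to the end of
  the word, which is why scalars act alike from both sides on tensor powers.\<close>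

lemma wd_scalar_move:
  assumes "k \<in> carrier K"
  shows "set us \<subseteq> carrier M \<Longrightarrow> v \<in> carrier M \<Longrightarrow> set vs \<subseteq> carrier M \<Longrightarrow>
    wd (us @ ka k v # vs) =
      wd (butlast (us @ v # vs) @ [ract M (last (us @ v # vs)) (k \<odot>\<^bsub>A\<^esub> \<one>\<^bsub>A\<^esub>)])"
proof (induction vs arbitrary: us v)
  case Nil
  then show ?case using assms by (simp add: kact_ract butlast_append)
next
  case (Cons w vs)
  have "wd (us @ ka k v # w # vs) = wd (us @ v # ka k w # vs)"
    using Cons.prems assms wd_balanced[of us v "k \<odot>\<^bsub>A\<^esub> \<one>\<^bsub>A\<^esub>" w vs]
    by (simp add: kact_ract[of k v]) (simp add: kact_def)
  with Cons.IH[of "us @ [v]" w] Cons.prems show ?case by (simp add: butlast_append)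
qed

lemma bimodule_tpow: "bimodule K A (tpow A M)"
proof -
  note G = pw.is_group
  note L = hom_mult[OF tpow_lact_hom] and Q = hom_mult[OF tpow_ract_hom]
  have grp: "comm_group (tpow A M)"
    by (rule comm_group_cong[OF pw.comm_group_axioms]) simp_all
  have ring: "ring A" by (rule A.ring_axioms)
  show ?thesis
  proof (intro bimodule.intro left_module.intro bimodule_axioms.intro left_module_axioms.intro
      unital_algebra_axioms ring grp)
    fix k x assume k: "k \<in> carrier K" and x: "x \<in> carrier (tpow A M)"
    have "tpow_lact A M (k \<odot>\<^bsub>A\<^esub> \<one>\<^bsub>A\<^esub>) x = tpow_ract A M x (k \<odot>\<^bsub>A\<^esub> \<one>\<^bsub>A\<^esub>)"
    proof (rule hom_wd_eqI[OF tpow_lact_hom tpow_ract_hom G])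
      fix v vs assume v: "v \<in> carrier M" "set vs \<subseteq> carrier M"
      have eq: "v # vs = butlast (v # vs) @ [last (v # vs)]" by (rule append_butlast_last_id[symmetric]) simp
      have "set (butlast (v # vs)) \<subseteq> carrier M" "last (v # vs) \<in> carrier M"
        using v by (auto dest: in_set_butlastD)
      then have "tpow_ract A M (wd (v # vs)) (k \<odot>\<^bsub>A\<^esub> \<one>\<^bsub>A\<^esub>)
          = wd (butlast (v # vs) @ [ract M (last (v # vs)) (k \<odot>\<^bsub>A\<^esub> \<one>\<^bsub>A\<^esub>)])"
        using k tpow_ract_wd[of "k \<odot>\<^bsub>A\<^esub> \<one>\<^bsub>A\<^esub>" "last (v # vs)" "butlast (v # vs)"] by (simp only: eq[symmetric]) simp
      then show "tpow_lact A M (k \<odot>\<^bsub>A\<^esub> \<one>\<^bsub>A\<^esub>) (wd (v # vs)) = tpow_ract A M (wd (v # vs)) (k \<odot>\<^bsub>A\<^esub> \<one>\<^bsub>A\<^esub>)"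
        using wd_scalar_move[OF k, of "[]" v vs] k v by (simp add: tpow_lact_wd kact_def)
    qed (use k x in simp_all)
    then show "lact (tpow A M) (k \<odot>\<^bsub>A\<^esub> \<one>\<^bsub>A\<^esub>) x = ract (tpow A M) x (k \<odot>\<^bsub>A\<^esub> \<one>\<^bsub>A\<^esub>)" by simp
  next
    fix a b x assume a: "a \<in> carrier A" and b: "b \<in> carrier A" and x: "x \<in> carrier (tpow A M)"
    have "tpow_lact A M (a \<oplus>\<^bsub>A\<^esub> b) x = tpow_lact A M a x \<boxplus>\<^bsub>P\<^esub> tpow_lact A M b x"
      by (rule hom_wd_eqI[OF tpow_lact_hom pw.hom_mult_pointwise[OF tpow_lact_hom tpow_lact_hom] G])
        (use a b x wd_add[of "[]"] in \<open>simp_all add: tpow_lact_wd add_lact lact_closed\<close>)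
    then show "lact (tpow A M) (a \<oplus>\<^bsub>A\<^esub> b) x = lact (tpow A M) a x \<boxplus>\<^bsub>tpow A M\<^esub> lact (tpow A M) b x" by simp
    have "tpow_lact A M (a \<otimes>\<^bsub>A\<^esub> b) x = tpow_lact A M a (tpow_lact A M b x)"
      by (rule hom_wd_eqI[OF tpow_lact_hom hom_compose'[OF tpow_lact_hom tpow_lact_hom] G])
        (use a b x in \<open>simp_all add: tpow_lact_wd mult_lact lact_closed\<close>)
    then show "lact (tpow A M) (a \<otimes>\<^bsub>A\<^esub> b) x = lact (tpow A M) a (lact (tpow A M) b x)" by simp
    have "tpow_ract A M x (a \<oplus>\<^bsub>A\<^esub> b) = tpow_ract A M x a \<boxplus>\<^bsub>P\<^esub> tpow_ract A M x b"
      by (rule hom_wd_eqI'[OF tpow_ract_hom pw.hom_mult_pointwise[OF tpow_ract_hom tpow_ract_hom] G])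
        (use a b x wd_add[of _ _ _ "[]"] in \<open>simp_all add: tpow_ract_wd add_ract ract_closed\<close>)
    then show "ract (tpow A M) x (a \<oplus>\<^bsub>A\<^esub> b) = ract (tpow A M) x a \<boxplus>\<^bsub>tpow A M\<^esub> ract (tpow A M) x b" by simp
    have "tpow_ract A M x (a \<otimes>\<^bsub>A\<^esub> b) = tpow_ract A M (tpow_ract A M x a) b"
      by (rule hom_wd_eqI'[OF tpow_ract_hom hom_compose'[OF tpow_ract_hom tpow_ract_hom] G])
        (use a b x in \<open>simp_all add: tpow_ract_wd mult_ract ract_closed\<close>)
    then show "ract (tpow A M) x (a \<otimes>\<^bsub>A\<^esub> b) = ract (tpow A M) (ract (tpow A M) x a) b" by simp
    have "tpow_ract A M (tpow_lact A M a x) b = tpow_lact A M a (tpow_ract A M x b)"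
    proof (rule hom_wd_eqI[OF hom_compose'[OF tpow_lact_hom tpow_ract_hom]
          hom_compose'[OF tpow_ract_hom tpow_lact_hom] G])
      fix v vs assume v: "v \<in> carrier M" "set vs \<subseteq> carrier M"
      show "tpow_ract A M (tpow_lact A M a (wd (v # vs))) b = tpow_lact A M a (tpow_ract A M (wd (v # vs)) b)"
      \<comment> \<open>Only in a word of one letter do the two actions meet, and there the bimodule
        law of \<open>M\<close> applies; in a longer word they touch different letters.\<close>
      proof (cases vs rule: rev_cases)
        case Nil
        then show ?thesis
          using v a b tpow_ract_wd[OF b, of _ "[]"] by (simp add: tpow_lact_wd lact_closed ract_closed lact_ract)
      next
        case (snoc ws w)
        then show ?thesis
          using v a b tpow_ract_wd[OF b, of w "_ # ws"] by (simp add: tpow_lact_wd lact_closed ract_closed)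
      qed
    qed (use a b x in simp_all)
    then show "ract (tpow A M) (lact (tpow A M) a x) b = lact (tpow A M) a (ract (tpow A M) x b)" by simp
  next
    fix x assume x: "x \<in> carrier (tpow A M)"
    have "tpow_lact A M \<one>\<^bsub>A\<^esub> x = x"
      by (rule hom_wd_eqI[OF tpow_lact_hom hom_ident G]) (use x in \<open>simp_all add: tpow_lact_wd one_lact\<close>)
    then show "lact (tpow A M) \<one>\<^bsub>A\<^esub> x = x" by simp
    have "tpow_ract A M x \<one>\<^bsub>A\<^esub> = x"
      by (rule hom_wd_eqI'[OF tpow_ract_hom hom_ident G]) (use x in \<open>simp_all add: tpow_ract_wd one_ract\<close>)
    then show "ract (tpow A M) x \<one>\<^bsub>A\<^esub> = x" by simp
  qed (simp_all add: tpow_lact_closed tpow_ract_closed L Q)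
qed

lemma tpow_lact_concat:
  assumes "r \<in> carrier A" "C \<in> carrier P" "D \<in> carrier P"
  shows "tpow_lact A M r (tpow_concat A M C D) = tpow_concat A M (tpow_lact A M r C) D"
proof -
  have 1: "tpow_lact A M r (tpow_concat A M (wd (v # vs)) D) = tpow_concat A M (tpow_lact A M r (wd (v # vs))) D"
    if "v \<in> carrier M" "set vs \<subseteq> carrier M" for v vs
    by (rule hom_wd_eqI[where x = D, OF hom_compose'[OF tpow_concat_hom_right tpow_lact_hom] tpow_concat_hom_right pw.is_group])
      (use assms that in \<open>simp_all add: tpow_lact_wd tpow_concat_wd words_iff lact_closed\<close>)
  show ?thesis
    by (rule hom_wd_eqI[where x = C, OF hom_compose'[OF tpow_concat_hom_left tpow_lact_hom]
          hom_compose'[OF tpow_lact_hom tpow_concat_hom_left] pw.is_group])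
      (use assms 1 in \<open>simp_all\<close>)
qed

lemma tpow_ract_concat:
  assumes "r \<in> carrier A" "C \<in> carrier P" "D \<in> carrier P"
  shows "tpow_ract A M (tpow_concat A M C D) r = tpow_concat A M C (tpow_ract A M D r)"
proof -
  have 1: "tpow_ract A M (tpow_concat A M (wd (v # vs)) D) r = tpow_concat A M (wd (v # vs)) (tpow_ract A M D r)"
    if v: "v \<in> carrier M" "set vs \<subseteq> carrier M" for v vs
  proof (rule hom_wd_eqI'[where x = D, OF hom_compose'[OF tpow_concat_hom_right tpow_ract_hom]
          hom_compose'[OF tpow_ract_hom tpow_concat_hom_right] pw.is_group])
    fix w ws assume "w \<in> carrier M" "set ws \<subseteq> carrier M"
    then show "tpow_ract A M (tpow_concat A M (wd (v # vs)) (wd (ws @ [w]))) r =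
        tpow_concat A M (wd (v # vs)) (tpow_ract A M (wd (ws @ [w])) r)"
      using assms v tpow_ract_wd[of r w "v # vs @ ws"]
      by (simp add: tpow_ract_wd tpow_concat_wd words_iff ract_closed)
  qed (use assms v in \<open>simp_all add: words_iff\<close>)
  show ?thesis
    by (rule hom_wd_eqI[where x = C, OF hom_compose'[OF tpow_concat_hom_left tpow_ract_hom]
          tpow_concat_hom_left pw.is_group])
      (use assms 1 in \<open>simp_all add: tpow_ract_closed\<close>)
qed

text \<open>This matches the two bracketings of a triple product whose middle factor has degree zero
  and whose outer factors are positive.\<close>

lemma tpow_concat_balanced:
  assumes "r \<in> carrier A" "C \<in> carrier P" "D \<in> carrier P"
  shows "tpow_concat A M (tpow_ract A M C r) D = tpow_concat A M C (tpow_lact A M r D)"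
proof -
  have 1: "tpow_concat A M (tpow_ract A M (wd (vs @ [v])) r) D = tpow_concat A M (wd (vs @ [v])) (tpow_lact A M r D)"
    if "v \<in> carrier M" "set vs \<subseteq> carrier M" for v vs
    by (rule hom_wd_eqI[where x = D, OF tpow_concat_hom_right
          hom_compose'[OF tpow_lact_hom tpow_concat_hom_right] pw.is_group])
      (use assms that in \<open>simp_all add: tpow_lact_wd tpow_ract_wd tpow_concat_wd words_iff lact_closed ract_closed wd_balanced\<close>)
  show ?thesis
    by (rule hom_wd_eqI'[where x = C, OF hom_compose'[OF tpow_ract_hom tpow_concat_hom_left]
          tpow_concat_hom_left pw.is_group])
      (use assms 1 in \<open>simp_all add: tpow_lact_closed\<close>)
qed

lemma tpow_concat_assoc:
  assumes "C \<in> carrier P" "D \<in> carrier P" "E \<in> carrier P"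
  shows "tpow_concat A M (tpow_concat A M C D) E = tpow_concat A M C (tpow_concat A M D E)"
proof -
  let ?c = "tpow_concat A M"
  have 1: "?c (?c (wd us) (wd vs)) E = ?c (wd us) (?c (wd vs) E)"
    if "us \<in> words" "vs \<in> words" for us vs
    by (rule pw.hom_eqI[where x = E, OF tpow_concat_hom_right
          hom_compose'[OF tpow_concat_hom_right tpow_concat_hom_right] pw.is_group])
      (use assms that in \<open>simp_all add: tpow_concat_wd words_iff\<close>)
  have 2: "?c (?c (wd us) D) E = ?c (wd us) (?c D E)" if "us \<in> words" for us
    by (rule pw.hom_eqI[where x = D, OF hom_compose'[OF tpow_concat_hom_right tpow_concat_hom_left]
          hom_compose'[OF tpow_concat_hom_left tpow_concat_hom_right] pw.is_group])
      (use assms that 1 in \<open>simp_all\<close>)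
  show ?thesis
    by (rule pw.hom_eqI[where x = C, OF hom_compose'[OF tpow_concat_hom_left tpow_concat_hom_left]
          tpow_concat_hom_left pw.is_group])
      (use assms 2 in \<open>simp_all add: tpow_concat_closed\<close>)
qed


section \<open>The tensor algebra as a ring, its generators and its universal property\<close>

abbreviation "TA \<equiv> tensor_algebra A M"

lemmas tpow_action_rules =
  bimodule_tpow[THEN bimodule.axioms(2), THEN left_module.lact_add, unfolded tpow_simps]
  bimodule_tpow[THEN bimodule.axioms(2), THEN left_module.add_lact, unfolded tpow_simps]
  bimodule_tpow[THEN bimodule.axioms(2), THEN left_module.mult_lact, unfolded tpow_simps]
  bimodule_tpow[THEN bimodule.axioms(2), THEN left_module.one_lact, unfolded tpow_simps]
  bimodule_tpow[THEN bimodule.ract_add, unfolded tpow_simps]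
  bimodule_tpow[THEN bimodule.add_ract, unfolded tpow_simps]
  bimodule_tpow[THEN bimodule.mult_ract, unfolded tpow_simps]
  bimodule_tpow[THEN bimodule.one_ract, unfolded tpow_simps]
  bimodule_tpow[THEN bimodule.lact_ract, unfolded tpow_simps]
  bimodule_tpow[THEN bimodule.scalar_central, unfolded tpow_simps]

lemma tpow_concat_add:
  "C \<in> carrier P \<Longrightarrow> D \<in> carrier P \<Longrightarrow> E \<in> carrier P \<Longrightarrow>
    tpow_concat A M (C \<boxplus>\<^bsub>P\<^esub> D) E = tpow_concat A M C E \<boxplus>\<^bsub>P\<^esub> tpow_concat A M D E"
  "C \<in> carrier P \<Longrightarrow> D \<in> carrier P \<Longrightarrow> E \<in> carrier P \<Longrightarrow>
    tpow_concat A M E (C \<boxplus>\<^bsub>P\<^esub> D) = tpow_concat A M E C \<boxplus>\<^bsub>P\<^esub> tpow_concat A M E D"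
  using hom_mult[OF tpow_concat_hom_left[of E], of C D] hom_mult[OF tpow_concat_hom_right[of E], of C D]
  by simp_all

lemma tpow_action_one:
  "a \<in> carrier A \<Longrightarrow> tpow_lact A M a \<one>\<^bsub>P\<^esub> = \<one>\<^bsub>P\<^esub>"
  "a \<in> carrier A \<Longrightarrow> tpow_ract A M \<one>\<^bsub>P\<^esub> a = \<one>\<^bsub>P\<^esub>"
  "C \<in> carrier P \<Longrightarrow> tpow_concat A M \<one>\<^bsub>P\<^esub> C = \<one>\<^bsub>P\<^esub>"
  "C \<in> carrier P \<Longrightarrow> tpow_concat A M C \<one>\<^bsub>P\<^esub> = \<one>\<^bsub>P\<^esub>"
  using hom_one[OF tpow_lact_hom[of a]] hom_one[OF tpow_ract_hom[of a]]
    hom_one[OF tpow_concat_hom_left[of C]] hom_one[OF tpow_concat_hom_right[of C]]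
  by (simp_all add: pw.is_group)

lemma tpow_action_zero:
  "C \<in> carrier P \<Longrightarrow> tpow_lact A M \<zero>\<^bsub>A\<^esub> C = \<one>\<^bsub>P\<^esub>"
  "C \<in> carrier P \<Longrightarrow> tpow_ract A M C \<zero>\<^bsub>A\<^esub> = \<one>\<^bsub>P\<^esub>"
  using tpow_action_rules(2)[of "\<zero>\<^bsub>A\<^esub>" "\<zero>\<^bsub>A\<^esub>" C] tpow_action_rules(6)[of "\<zero>\<^bsub>A\<^esub>" "\<zero>\<^bsub>A\<^esub>" C]
    tpow_lact_closed[of "\<zero>\<^bsub>A\<^esub>" C] tpow_ract_closed[of "\<zero>\<^bsub>A\<^esub>" C]
  by simp_all

lemma tensor_algebra_simps:
  "carrier TA = carrier A \<times> carrier P"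
  "(r, C) \<otimes>\<^bsub>TA\<^esub> (s, D) = (r \<otimes>\<^bsub>A\<^esub> s,
       tpow_lact A M r D \<boxplus>\<^bsub>P\<^esub> tpow_ract A M C s \<boxplus>\<^bsub>P\<^esub> tpow_concat A M C D)"
  "\<one>\<^bsub>TA\<^esub> = (\<one>\<^bsub>A\<^esub>, \<one>\<^bsub>P\<^esub>)" "\<zero>\<^bsub>TA\<^esub> = (\<zero>\<^bsub>A\<^esub>, \<one>\<^bsub>P\<^esub>)"
  "(r, C) \<oplus>\<^bsub>TA\<^esub> (s, D) = (r \<oplus>\<^bsub>A\<^esub> s, C \<boxplus>\<^bsub>P\<^esub> D)"
  "smult TA k (r, C) = (k \<odot>\<^bsub>A\<^esub> r, tpow_lact A M (k \<odot>\<^bsub>A\<^esub> \<one>\<^bsub>A\<^esub>) C)"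
  by (simp_all add: tensor_algebra_def tpow_group_eq Let_def)

text \<open>Expanding a product of pairs gives one term for each choice of degree-zero or positive
  part. Associativity then splits into one law for each combination: the bimodule laws of the tensor
  powers, the compatibility of concatenation with the actions, and the associativity of
  concatenation.\<close>

lemma ring_tensor_algebra: "ring TA"
proof -
  note closed = tpow_lact_closed tpow_ract_closed tpow_concat_closed
  note simps = tensor_algebra_simps closed tpow_action_rules(1-9) tpow_concat_add tpow_action_one
    tpow_action_zero tpow_lact_concat tpow_ract_concat tpow_concat_balanced tpow_concat_assoc
  show ?thesis
  proof (rule ringI)
    show "abelian_group TA"
    proof (rule abelian_groupI)
      fix x assume "x \<in> carrier TA"
      then show "\<exists>y\<in>carrier TA. y \<oplus>\<^bsub>TA\<^esub> x = \<zero>\<^bsub>TA\<^esub>"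
        by (intro bexI[of _ "(\<ominus>\<^bsub>A\<^esub> fst x, inv\<^bsub>P\<^esub> (snd x))"])
          (auto simp: tensor_algebra_simps M.l_neg)
    qed (auto simp: tensor_algebra_simps M.a_ac pw.m_ac)
    show "monoid TA"
    proof (rule monoidI)
      fix x y z assume "x \<in> carrier TA" "y \<in> carrier TA" "z \<in> carrier TA"
      then show "x \<otimes>\<^bsub>TA\<^esub> y \<otimes>\<^bsub>TA\<^esub> z = x \<otimes>\<^bsub>TA\<^esub> (y \<otimes>\<^bsub>TA\<^esub> z)"
        by (auto simp: simps A.m_assoc pw.m_ac)
    qed (auto simp: simps)
  next
    fix x y z assume "x \<in> carrier TA" "y \<in> carrier TA" "z \<in> carrier TA"
    then show "(x \<oplus>\<^bsub>TA\<^esub> y) \<otimes>\<^bsub>TA\<^esub> z = x \<otimes>\<^bsub>TA\<^esub> z \<oplus>\<^bsub>TA\<^esub> y \<otimes>\<^bsub>TA\<^esub> z"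
      "z \<otimes>\<^bsub>TA\<^esub> (x \<oplus>\<^bsub>TA\<^esub> y) = z \<otimes>\<^bsub>TA\<^esub> x \<oplus>\<^bsub>TA\<^esub> z \<otimes>\<^bsub>TA\<^esub> y"
      by (auto simp: simps A.l_distr A.r_distr pw.m_ac)
  qed
qed

lemma unital_algebra_tensor_algebra: "unital_algebra K TA"
proof -
  interpret T: ring TA by (rule ring_tensor_algebra)
  note closed = tpow_lact_closed tpow_ract_closed tpow_concat_closed
  note simps = tensor_algebra_simps closed tpow_action_rules(1-9) tpow_concat_add
    tpow_lact_concat tpow_ract_concat tpow_concat_balanced
  show ?thesis
  proof (intro unital_algebra.intro moduleI unital_algebra_axioms.intro T.ring_axioms field_axioms)
    show "cring K" by (rule is_cring)
    show "abelian_group TA" by (rule T.is_abelian_group)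
    fix k x assume k: "k \<in> carrier K" and x: "x \<in> carrier TA"
    show "k \<odot>\<^bsub>TA\<^esub> x \<in> carrier TA"
      using k x by (auto simp: simps)
    fix y assume y: "y \<in> carrier TA"
    show "k \<odot>\<^bsub>TA\<^esub> (x \<oplus>\<^bsub>TA\<^esub> y) = k \<odot>\<^bsub>TA\<^esub> x \<oplus>\<^bsub>TA\<^esub> k \<odot>\<^bsub>TA\<^esub> y"
      using k x y by (auto simp: simps smult_r_distr)
    obtain r C s D where rs: "x = (r, C)" "y = (s, D)" "r \<in> carrier A" "s \<in> carrier A"
      "C \<in> carrier P" "D \<in> carrier P"
      using x y by (auto simp: tensor_algebra_simps)
    \<comment> \<open>All scalar multiplications are expressed through this element, which is
      central in \<open>A\<close> and acts alike from both sides. Bilinearity of the product thus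
      follows from the laws for the actions of \<open>A\<close>.\<close>
    define l where "l = k \<odot>\<^bsub>A\<^esub> \<one>\<^bsub>A\<^esub>"
    have l: "l \<in> carrier A" using k by (simp add: l_def)
    have kl: "k \<odot>\<^bsub>A\<^esub> a = l \<otimes>\<^bsub>A\<^esub> a" "a \<otimes>\<^bsub>A\<^esub> l = l \<otimes>\<^bsub>A\<^esub> a" if "a \<in> carrier A" for a
      using k that by (simp_all add: l_def scalar_one_mult)
    have lC: "tpow_ract A M X l = tpow_lact A M l X" if "X \<in> carrier P" for X
      using tpow_action_rules(10)[OF k that] by (simp add: l_def)
    have lr: "tpow_lact A M r (tpow_lact A M l X) = tpow_lact A M l (tpow_lact A M r X)"
      if "X \<in> carrier P" for X
      using rs l that by (simp add: tpow_action_rules(3)[symmetric] kl)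
    have ls: "tpow_ract A M X (l \<otimes>\<^bsub>A\<^esub> s) = tpow_lact A M l (tpow_ract A M X s)" if "X \<in> carrier P" for X
      using rs l that by (simp add: tpow_action_rules(7) lC tpow_action_rules(9))
    have cl: "tpow_concat A M C (tpow_lact A M l D) = tpow_lact A M l (tpow_concat A M C D)"
      using rs l by (simp add: tpow_concat_balanced[symmetric] lC tpow_lact_concat)
    have ksm: "smult TA k (a, X) = (l \<otimes>\<^bsub>A\<^esub> a, tpow_lact A M l X)" if "a \<in> carrier A" for a X
      using that by (simp add: tensor_algebra_simps kl l_def[symmetric])
    show "(k \<odot>\<^bsub>TA\<^esub> x) \<otimes>\<^bsub>TA\<^esub> y = k \<odot>\<^bsub>TA\<^esub> (x \<otimes>\<^bsub>TA\<^esub> y)"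
      using rs l unfolding rs(1,2) by (simp add: ksm tensor_algebra_simps(2) simps(1) closed
          tpow_action_rules tpow_lact_concat A.m_assoc)
    have "l \<otimes>\<^bsub>A\<^esub> (r \<otimes>\<^bsub>A\<^esub> s) = r \<otimes>\<^bsub>A\<^esub> (l \<otimes>\<^bsub>A\<^esub> s)"
      using rs l by (simp add: A.m_assoc[symmetric] kl(2))
    then show "x \<otimes>\<^bsub>TA\<^esub> (k \<odot>\<^bsub>TA\<^esub> y) = k \<odot>\<^bsub>TA\<^esub> (x \<otimes>\<^bsub>TA\<^esub> y)"
      using rs l unfolding rs(1,2) by (simp add: ksm tensor_algebra_simps(2) closed
          tpow_action_rules(1) lr ls cl)
  next
    fix k l x assume k: "k \<in> carrier K" and l: "l \<in> carrier K" and x: "x \<in> carrier TA"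
    then show "(k \<oplus>\<^bsub>K\<^esub> l) \<odot>\<^bsub>TA\<^esub> x = k \<odot>\<^bsub>TA\<^esub> x \<oplus>\<^bsub>TA\<^esub> l \<odot>\<^bsub>TA\<^esub> x"
      by (auto simp: simps smult_l_distr)
    show "(k \<otimes>\<^bsub>K\<^esub> l) \<odot>\<^bsub>TA\<^esub> x = k \<odot>\<^bsub>TA\<^esub> (l \<odot>\<^bsub>TA\<^esub> x)"
    proof -
      have "(k \<otimes>\<^bsub>K\<^esub> l) \<odot>\<^bsub>A\<^esub> \<one>\<^bsub>A\<^esub> = (k \<odot>\<^bsub>A\<^esub> \<one>\<^bsub>A\<^esub>) \<otimes>\<^bsub>A\<^esub> (l \<odot>\<^bsub>A\<^esub> \<one>\<^bsub>A\<^esub>)"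
        using k l by (simp add: smult_assoc1 smult_mult_left)
      then show ?thesis
        using k l x by (auto simp: tensor_algebra_simps tpow_action_rules(3) smult_assoc1)
    qed
  next
    fix x assume "x \<in> carrier TA"
    then show "\<one>\<^bsub>K\<^esub> \<odot>\<^bsub>TA\<^esub> x = x"
      by (auto simp: tensor_algebra_simps tpow_action_rules)
  qed
qed

lemma deg0_eq: "deg0 A M r = (r, \<one>\<^bsub>P\<^esub>)"
  by (simp add: deg0_def pw.one_pres tpow_sub_def pres_sub_def)

lemma deg1_eq: "deg1 A M v = (\<zero>\<^bsub>A\<^esub>, wd [v])"
  by (simp add: deg1_def tpow_class_eq)

lemma deg0_ring_hom: "deg0 A M \<in> ring_hom A TA"
  by (rule ring_hom_memI) (simp_all add: deg0_eq tensor_algebra_simps tpow_action_one)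

lemma smult_one_deg0: "k \<in> carrier K \<Longrightarrow> k \<odot>\<^bsub>TA\<^esub> \<one>\<^bsub>TA\<^esub> = deg0 A M (k \<odot>\<^bsub>A\<^esub> \<one>\<^bsub>A\<^esub>)"
  by (simp add: tensor_algebra_simps deg0_eq tpow_action_one)

lemma deg1_closed: "v \<in> carrier M \<Longrightarrow> deg1 A M v \<in> carrier TA"
  by (simp add: deg1_eq tensor_algebra_simps words_iff)

lemma deg1_add:
  "v \<in> carrier M \<Longrightarrow> w \<in> carrier M \<Longrightarrow> deg1 A M (v \<boxplus>\<^bsub>M\<^esub> w) = deg1 A M v \<oplus>\<^bsub>TA\<^esub> deg1 A M w"
  using wd_add[of "[]" v w "[]"] by (simp add: deg1_eq tensor_algebra_simps)

lemma deg0_deg1: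
  "r \<in> carrier A \<Longrightarrow> v \<in> carrier M \<Longrightarrow> deg0 A M r \<otimes>\<^bsub>TA\<^esub> deg1 A M v = deg1 A M (lact M r v)"
  by (simp add: deg0_eq deg1_eq tensor_algebra_simps tpow_action_one tpow_action_zero words_iff
      tpow_lact_wd lact_closed)

lemma deg1_deg0:
  "r \<in> carrier A \<Longrightarrow> v \<in> carrier M \<Longrightarrow> deg1 A M v \<otimes>\<^bsub>TA\<^esub> deg0 A M r = deg1 A M (ract M v r)"
  using tpow_ract_wd[of r v "[]"]
  by (simp add: deg0_eq deg1_eq tensor_algebra_simps tpow_action_one tpow_action_zero words_iff ract_closed)

text \<open>A word is the product of its letters in degree one, classes of words generate the
  positive part additively, and the degree-zero part is added at the end.\<close>

lemma tensor_algebra_generated: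
  assumes S: "subring S TA" and "\<And>r. r \<in> carrier A \<Longrightarrow> deg0 A M r \<in> S"
    and "\<And>v. v \<in> carrier M \<Longrightarrow> deg1 A M v \<in> S"
  shows "carrier TA \<subseteq> S"
proof
  interpret T: ring TA by (rule ring_tensor_algebra)
  note S' = subringE[OF S]
  have inv: "\<ominus>\<^bsub>TA\<^esub> (\<zero>\<^bsub>A\<^esub>, C) = (\<zero>\<^bsub>A\<^esub>, inv\<^bsub>P\<^esub> C)" if "C \<in> carrier P" for C
    using that by (intro T.minus_equality[symmetric] T.minus_equality) (simp_all add: tensor_algebra_simps)
  have pos: "(\<zero>\<^bsub>A\<^esub>, C) \<in> S" if "C \<in> carrier P" for C
    using that
  proof (induction C rule: pw.pres_induct)
    case (diff x y)
    then show ?case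
      using S'(7)[of "(\<zero>\<^bsub>A\<^esub>, x)" "(\<zero>\<^bsub>A\<^esub>, inv\<^bsub>P\<^esub> y)"] S'(5)[of "(\<zero>\<^bsub>A\<^esub>, y)"] inv[of y]
      by (simp add: tensor_algebra_simps)
  next
    case one
    then show ?case using S'(2) by (simp add: tensor_algebra_simps)
  next
    case (gen vs)
    have "vs \<noteq> []" "set vs \<subseteq> carrier M" using gen by (simp_all add: words_iff)
    then show ?case
    proof (induction vs rule: list_nonempty_induct)
      case (single v)
      then show ?case using assms(3)[of v] by (simp add: deg1_eq)
    next
      case (cons v vs)
      have "(\<zero>\<^bsub>A\<^esub>, wd [v]) \<otimes>\<^bsub>TA\<^esub> (\<zero>\<^bsub>A\<^esub>, wd vs) = (\<zero>\<^bsub>A\<^esub>, wd (v # vs))"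
        using cons by (simp add: tensor_algebra_simps tpow_action_zero words_iff tpow_concat_wd)
      then show ?case
        using cons S'(6)[of "(\<zero>\<^bsub>A\<^esub>, wd [v])" "(\<zero>\<^bsub>A\<^esub>, wd vs)"] assms(3)[of v] by (simp add: deg1_eq)
    qed
  qed
  fix x assume "x \<in> carrier TA"
  then obtain r C where x: "x = (r, C)" "r \<in> carrier A" "C \<in> carrier P"
    by (auto simp: tensor_algebra_simps)
  have "deg0 A M r \<oplus>\<^bsub>TA\<^esub> (\<zero>\<^bsub>A\<^esub>, C) = x"
    using x by (simp add: deg0_eq tensor_algebra_simps)
  then show "x \<in> S"
    using S'(7)[of "deg0 A M r" "(\<zero>\<^bsub>A\<^esub>, C)"] assms(2)[OF x(2)] pos[OF x(3)] by simp
qed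

text \<open>On a word the map must be the product of the values of \<open>g\<close>. Additivity of
  \<open>g\<close> kills the first kind of relator, and \<open>gl\<close> with \<open>gr\<close>
  kills the second, since both of its terms give g(v) f(r) g(w) between the same outer
  factors.\<close>

lemma tensor_algebra_universal:
  assumes "ring E" and f: "f \<in> ring_hom A E"
    and gc: "\<And>v. v \<in> carrier M \<Longrightarrow> g v \<in> carrier E"
    and ga: "\<And>v w. v \<in> carrier M \<Longrightarrow> w \<in> carrier M \<Longrightarrow> g (v \<boxplus>\<^bsub>M\<^esub> w) = g v \<oplus>\<^bsub>E\<^esub> g w"
    and gl: "\<And>r v. r \<in> carrier A \<Longrightarrow> v \<in> carrier M \<Longrightarrow> g (lact M r v) = f r \<otimes>\<^bsub>E\<^esub> g v"
    and gr: "\<And>r v. r \<in> carrier A \<Longrightarrow> v \<in> carrier M \<Longrightarrow> g (ract M v r) = g v \<otimes>\<^bsub>E\<^esub> f r"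
  shows "\<exists>F \<in> ring_hom TA E. (\<forall>r\<in>carrier A. F (deg0 A M r) = f r) \<and>
    (\<forall>v\<in>carrier M. F (deg1 A M v) = g v)"
proof -
  interpret E: ring E by fact
  note fc = ring_hom_closed[OF f]
  \<comment> \<open>Folding down to the unit also gives a value to the empty list. The words
    themselves are nonempty, but the parts \<open>us\<close> and \<open>ws\<close> around a relator
    may be empty.\<close>
  define p where "p vs = foldr (\<lambda>v y. g v \<otimes>\<^bsub>E\<^esub> y) vs \<one>\<^bsub>E\<^esub>" for vs
  have p_simps [simp]: "p [] = \<one>\<^bsub>E\<^esub>" "p (v # vs) = g v \<otimes>\<^bsub>E\<^esub> p vs" for v vs
    by (simp_all add: p_def)
  have pc: "p vs \<in> carrier E" if "set vs \<subseteq> carrier M" for vs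
    using that by (induction vs) (simp_all add: gc)
  have p_append: "p (us @ vs) = p us \<otimes>\<^bsub>E\<^esub> p vs" if "set us \<subseteq> carrier M" "set vs \<subseteq> carrier M" for us vs
    using that by (induction us) (simp_all add: gc pc E.m_assoc)
  note aE = E.comm_group_add_monoid
  have ex: "\<exists>h. h \<in> hom P (add_monoid E) \<and> (\<forall>vs\<in>words. h (wd vs) = p vs)"
  proof (rule pw.lift_exists[OF aE])
    show "p vs \<in> carrier (add_monoid E)" if "vs \<in> words" for vs
      using that by (simp add: words_iff pc)
  next
    fix h x
    assume h: "h \<in> hom pw.F (add_monoid E)" and hp: "\<And>vs. vs \<in> words \<Longrightarrow> h (frag_of vs) = p vs"
      and x: "x \<in> tpow_rels A M"
    interpret h: group_hom pw.F "add_monoid E" h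
      using h E.a_group by (simp add: group_hom_def group_hom_axioms_def)
    have diff: "h (a - b) = h a \<ominus>\<^bsub>E\<^esub> h b"
      if "Poly_Mapping.keys a \<subseteq> words" "Poly_Mapping.keys b \<subseteq> words" for a b
      using h.hom_mult[of a "- b"] h.hom_inv[of b] that by (simp add: a_minus_def a_inv_def)
    have kd: "Poly_Mapping.keys (a - b) \<subseteq> words"
      if "Poly_Mapping.keys a \<subseteq> words" "Poly_Mapping.keys b \<subseteq> words" for a b :: "'m list \<Rightarrow>\<^sub>0 int"
      using that by (rule keys_diff_subset)
    show "h x = \<one>\<^bsub>add_monoid E\<^esub>"
      using x
    proof (cases rule: tpow_relE)
      case (add us v w ws)
      have "h x = p us \<otimes>\<^bsub>E\<^esub> (g (v \<boxplus>\<^bsub>M\<^esub> w) \<otimes>\<^bsub>E\<^esub> p ws) \<ominus>\<^bsub>E\<^esub> p us \<otimes>\<^bsub>E\<^esub> (g v \<otimes>\<^bsub>E\<^esub> p ws) \<ominus>\<^bsub>E\<^esub> p us \<otimes>\<^bsub>E\<^esub> (g w \<otimes>\<^bsub>E\<^esub> p ws)"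
        using add unfolding add(5) by (simp add: diff kd hp words_iff p_append)
      also have "\<dots> = \<zero>\<^bsub>E\<^esub>"
        using add by (simp add: ga E.l_distr E.r_distr gc pc a_minus_def E.add.mult_inv_inv[simplified])
      finally show ?thesis by simp
    next
      case (balanced us v r w ws)
      have "h x = p us \<otimes>\<^bsub>E\<^esub> (g (ract M v r) \<otimes>\<^bsub>E\<^esub> (g w \<otimes>\<^bsub>E\<^esub> p ws)) \<ominus>\<^bsub>E\<^esub> p us \<otimes>\<^bsub>E\<^esub> (g v \<otimes>\<^bsub>E\<^esub> (g (lact M r w) \<otimes>\<^bsub>E\<^esub> p ws))"
        using balanced unfolding balanced(6)
        by (simp add: diff kd hp words_iff p_append ract_closed lact_closed)
      also have "\<dots> = \<zero>\<^bsub>E\<^esub>"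
        using balanced by (simp add: gl gr E.m_assoc gc pc fc a_minus_def E.r_neg)
      finally show ?thesis by simp
    qed
  qed
  then obtain h where h: "h \<in> hom P (add_monoid E)" and hp: "\<And>vs. vs \<in> words \<Longrightarrow> h (wd vs) = p vs"
    by blast
  have hc: "h C \<in> carrier E" if "C \<in> carrier P" for C
    using hom_in_carrier[OF h that] by simp
  have ha: "h (C \<boxplus>\<^bsub>P\<^esub> D) = h C \<oplus>\<^bsub>E\<^esub> h D" if "C \<in> carrier P" "D \<in> carrier P" for C D
    using hom_mult[OF h that] by simp
  have h1: "h \<one>\<^bsub>P\<^esub> = \<zero>\<^bsub>E\<^esub>"
    using hom_one[OF h pw.is_group] E.a_group by simp
  have lm: "(\<lambda>x. x \<otimes>\<^bsub>E\<^esub> c) \<in> hom (add_monoid E) (add_monoid E)"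
    and rm: "(\<lambda>x. c \<otimes>\<^bsub>E\<^esub> x) \<in> hom (add_monoid E) (add_monoid E)" if "c \<in> carrier E" for c
    using that by (auto simp: hom_def E.l_distr E.r_distr)
  have hl: "h (tpow_lact A M r C) = f r \<otimes>\<^bsub>E\<^esub> h C" if "r \<in> carrier A" "C \<in> carrier P" for r C
    by (rule hom_wd_eqI[where x = C, OF hom_compose'[OF tpow_lact_hom h] hom_compose'[OF h rm] E.a_group])
      (use that in \<open>simp_all add: fc tpow_lact_wd hp words_iff lact_closed gl E.m_assoc gc pc\<close>)
  have hr: "h (tpow_ract A M C r) = h C \<otimes>\<^bsub>E\<^esub> f r" if "r \<in> carrier A" "C \<in> carrier P" for r C
    by (rule hom_wd_eqI'[where x = C, OF hom_compose'[OF tpow_ract_hom h] hom_compose'[OF h lm] E.a_group])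
      (use that in \<open>simp_all add: fc tpow_ract_wd hp words_iff ract_closed gr E.m_assoc gc pc p_append\<close>)
  have hcc: "h (tpow_concat A M C D) = h C \<otimes>\<^bsub>E\<^esub> h D" if "C \<in> carrier P" "D \<in> carrier P" for C D
  proof -
    have 1: "h (tpow_concat A M (wd us) D) = h (wd us) \<otimes>\<^bsub>E\<^esub> h D" if "us \<in> words" for us
      by (rule pw.hom_eqI[where x = D, OF hom_compose'[OF tpow_concat_hom_right h] hom_compose'[OF h rm] E.a_group])
        (use that \<open>D \<in> carrier P\<close> in \<open>simp_all add: hp tpow_concat_wd words_iff pc p_append\<close>)
    show ?thesis
      by (rule pw.hom_eqI[where x = C, OF hom_compose'[OF tpow_concat_hom_left h] hom_compose'[OF h lm] E.a_group])
        (use that 1 in \<open>simp_all add: hc\<close>)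
  qed
  define F where "F = (\<lambda>(r, C). f r \<oplus>\<^bsub>E\<^esub> h C)"
  have "F \<in> ring_hom TA E"
  proof (rule ring_hom_memI)
    fix x y assume "x \<in> carrier TA" "y \<in> carrier TA"
    then show "F (x \<otimes>\<^bsub>TA\<^esub> y) = F x \<otimes>\<^bsub>E\<^esub> F y" "F (x \<oplus>\<^bsub>TA\<^esub> y) = F x \<oplus>\<^bsub>E\<^esub> F y"
      by (auto simp: F_def tensor_algebra_simps ha hl hr hcc ring_hom_mult[OF f] ring_hom_add[OF f] hc fc
          tpow_lact_closed tpow_ract_closed tpow_concat_closed E.l_distr E.r_distr E.a_ac)
  qed (auto simp: F_def tensor_algebra_simps hc fc h1 ring_hom_one[OF f])
  moreover have "F (deg0 A M r) = f r" if "r \<in> carrier A" for r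
    using that by (simp add: F_def deg0_eq h1 fc)
  moreover have "F (deg1 A M v) = g v" if "v \<in> carrier M" for v
  proof -
    have "f \<zero>\<^bsub>A\<^esub> = \<zero>\<^bsub>E\<^esub>"
      using ring_hom_add[OF f, of "\<zero>\<^bsub>A\<^esub>" "\<zero>\<^bsub>A\<^esub>"] fc[of "\<zero>\<^bsub>A\<^esub>"] by simp
    then show ?thesis
      using that by (simp add: F_def deg1_eq hp words_iff gc)
  qed
  ultimately show ?thesis by blast
qed

end

section \<open>Quotients of rings\<close>

lemma (in ring) subring_vimage:
  assumes "ring E" "h \<in> ring_hom R E" "subring S E"
  shows "subring {x \<in> carrier R. h x \<in> S} R"
proof -
  interpret h: ring_hom_ring R E h by (rule ring_hom_ringI2[OF ring_axioms assms(1,2)])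
  show ?thesis
    using subringE[OF assms(3)] by (intro subringI) (auto simp: h.hom_a_inv)
qed

lemma (in ring) carrier_Quot: "carrier (R Quot I) = (+>) I ` carrier R"
  by (auto simp: FactRing_def A_RCOSETS_def')

text \<open>Generation of a quotient is a statement about preimages of subrings, which are again
  subrings. The premise gives the preimage a name, so that the argument can be continued one layer
  down.\<close>

lemma (in ring) Quot_generated:
  assumes "ideal I R" "subring S (R Quot I)"
    and "\<And>U. subring U R \<Longrightarrow> U = {x \<in> carrier R. I +> x \<in> S} \<Longrightarrow> carrier R \<subseteq> U"
  shows "carrier (R Quot I) \<subseteq> S"
  using assms(3)[OF subring_vimage[OF ideal.quotient_is_ring[OF assms(1)] ideal.rcos_ring_hom[OF assms(1)] assms(2)] refl]
  by (auto simp: carrier_Quot)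

text \<open>The kernel of \<open>h\<close> is an ideal, so killing the generators \<open>X\<close>
  is enough to kill the ideal that they generate.\<close>

lemma (in ring) Quot_universal:
  assumes E: "ring E" and h: "h \<in> ring_hom R E" and X: "X \<subseteq> carrier R"
    and zero: "\<And>x. x \<in> X \<Longrightarrow> h x = \<zero>\<^bsub>E\<^esub>"
  shows "\<exists>g \<in> ring_hom (R Quot Idl X) E. \<forall>x\<in>carrier R. g (Idl X +> x) = h x"
proof -
  interpret h: ring_hom_ring R E h by (rule ring_hom_ringI2[OF ring_axioms E h])
  interpret I: ideal "Idl X" R by (rule genideal_ideal[OF X])
  interpret Q: ring_hom_ring R "R Quot Idl X" "(+>) (Idl X)" by (rule I.rcos_ring_hom_ring)
  have "Idl X \<subseteq> a_kernel R E h"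
  proof (rule genideal_minimal[OF h.kernel_is_ideal], rule subsetI)
    show "x \<in> a_kernel R E h" if "x \<in> X" for x
      using X that zero[OF that] unfolding a_kernel_def' by blast
  qed
  then have ker: "h x = \<zero>\<^bsub>E\<^esub>" if "x \<in> Idl X" for x
    using that unfolding a_kernel_def' by blast
  have eq: "h x = h y" if xy: "x \<in> carrier R" "y \<in> carrier R" "Idl X +> x = Idl X +> y" for x y
  proof -
    have "h (x \<ominus> y) = \<zero>\<^bsub>E\<^esub>"
      by (rule ker, rule iffD2[OF quotient_eq_iff_same_a_r_cos[OF I.is_ideal xy(1,2)] xy(3)])
    then show ?thesis
      using xy(1,2) h.S.minus_equality[of "h x" "\<ominus>\<^bsub>E\<^esub> h y"] by (simp add: a_minus_def h.hom_a_inv)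
  qed
  define g where "g C = h (SOME x. x \<in> carrier R \<and> C = Idl X +> x)" for C
  have g: "g (Idl X +> x) = h x" if "x \<in> carrier R" for x
    unfolding g_def
  proof (rule someI2[of _ x])
    show "h y = h x" if "y \<in> carrier R \<and> Idl X +> x = Idl X +> y" for y
      by (rule eq) (use that \<open>x \<in> carrier R\<close> in simp_all)
  qed (simp add: that)
  have "g \<in> ring_hom (R Quot Idl X) E"
  proof (rule ring_hom_memI)
    fix C D assume "C \<in> carrier (R Quot Idl X)" "D \<in> carrier (R Quot Idl X)"
    then obtain x y where xy: "x \<in> carrier R" "y \<in> carrier R" "C = Idl X +> x" "D = Idl X +> y"
      by (auto simp: carrier_Quot)
    show "g (C \<otimes>\<^bsub>R Quot Idl X\<^esub> D) = g C \<otimes>\<^bsub>E\<^esub> g D"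
      using xy by (simp add: g flip: Q.hom_mult)
    show "g (C \<oplus>\<^bsub>R Quot Idl X\<^esub> D) = g C \<oplus>\<^bsub>E\<^esub> g D"
      using xy by (simp add: g flip: Q.hom_add)
  next
    show "g C \<in> carrier E" if "C \<in> carrier (R Quot Idl X)" for C
      using that by (auto simp: carrier_Quot g)
  qed (simp add: g flip: Q.hom_one)
  with g show ?thesis by blast
qed


section \<open>Free products of algebras\<close>

locale free_product_of_algebras = R: unital_algebra K R + S: unital_algebra K S
  for K :: "('k, 'z) ring_scheme" and R :: "('k, 'a, 'y) module_scheme"
    and S :: "('k, 'b, 'x) module_scheme"
begin

abbreviation "V \<equiv> dsum_vect R S"
abbreviation "T \<equiv> pre_free_product K R S"
abbreviation "FP \<equiv> free_product K R S"
abbreviation "il \<equiv> pre_inl K R S"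
abbreviation "ir \<equiv> pre_inr K R S"
abbreviation "pr \<equiv> (+>\<^bsub>T\<^esub>) (free_product_ideal K R S)"

definition rels where
  "rels = {il r \<otimes>\<^bsub>T\<^esub> il r' \<ominus>\<^bsub>T\<^esub> il (r \<otimes>\<^bsub>R\<^esub> r') | r r'. r \<in> carrier R \<and> r' \<in> carrier R} \<union>
      {ir s \<otimes>\<^bsub>T\<^esub> ir s' \<ominus>\<^bsub>T\<^esub> ir (s \<otimes>\<^bsub>S\<^esub> s') | s s'. s \<in> carrier S \<and> s' \<in> carrier S} \<union>
      {il \<one>\<^bsub>R\<^esub> \<ominus>\<^bsub>T\<^esub> \<one>\<^bsub>T\<^esub>, ir \<one>\<^bsub>S\<^esub> \<ominus>\<^bsub>T\<^esub> \<one>\<^bsub>T\<^esub>}"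

lemma ideal_eq: "free_product_ideal K R S = Idl\<^bsub>T\<^esub> rels"
  by (simp add: free_product_ideal_def rels_def Let_def)

sublocale V: bimodule K "self_alg K" V
  by (rule bimodule_dsum_vect[OF R.unital_algebra_axioms S.unital_algebra_axioms])

sublocale T: ring T
  unfolding pre_free_product_def by (rule V.ring_tensor_algebra)

abbreviation "d0 \<equiv> deg0 (self_alg K) V"
abbreviation "d1 \<equiv> deg1 (self_alg K) V"

lemma d0_hom: "d0 \<in> ring_hom (self_alg K) T"
  unfolding pre_free_product_def by (rule V.deg0_ring_hom)

lemma il_eq: "il r = d1 (r, \<zero>\<^bsub>S\<^esub>)" and ir_eq: "ir s = d1 (\<zero>\<^bsub>R\<^esub>, s)"
  by (simp_all add: pre_inl_def pre_inr_def)

lemma il_closed [simp]: "r \<in> carrier R \<Longrightarrow> il r \<in> carrier T"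
  and ir_closed [simp]: "s \<in> carrier S \<Longrightarrow> ir s \<in> carrier T"
  by (simp_all add: il_eq ir_eq pre_free_product_def V.deg1_closed)

lemma il_add: "r \<in> carrier R \<Longrightarrow> r' \<in> carrier R \<Longrightarrow> il (r \<oplus>\<^bsub>R\<^esub> r') = il r \<oplus>\<^bsub>T\<^esub> il r'"
  and ir_add: "s \<in> carrier S \<Longrightarrow> s' \<in> carrier S \<Longrightarrow> ir (s \<oplus>\<^bsub>S\<^esub> s') = ir s \<oplus>\<^bsub>T\<^esub> ir s'"
  using V.deg1_add[of "(r, \<zero>\<^bsub>S\<^esub>)" "(r', \<zero>\<^bsub>S\<^esub>)"] V.deg1_add[of "(\<zero>\<^bsub>R\<^esub>, s)" "(\<zero>\<^bsub>R\<^esub>, s')"]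
  by (simp_all add: il_eq ir_eq pre_free_product_def)

lemma d1_split: "r \<in> carrier R \<Longrightarrow> s \<in> carrier S \<Longrightarrow> d1 (r, s) = il r \<oplus>\<^bsub>T\<^esub> ir s"
  using V.deg1_add[of "(r, \<zero>\<^bsub>S\<^esub>)" "(\<zero>\<^bsub>R\<^esub>, s)"]
  by (simp add: il_eq ir_eq pre_free_product_def)

lemma d0_il: "k \<in> carrier K \<Longrightarrow> r \<in> carrier R \<Longrightarrow> d0 k \<otimes>\<^bsub>T\<^esub> il r = il (k \<odot>\<^bsub>R\<^esub> r)"
  and d0_ir: "k \<in> carrier K \<Longrightarrow> s \<in> carrier S \<Longrightarrow> d0 k \<otimes>\<^bsub>T\<^esub> ir s = ir (k \<odot>\<^bsub>S\<^esub> s)"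
  using V.deg0_deg1[of k "(r, \<zero>\<^bsub>S\<^esub>)"] V.deg0_deg1[of k "(\<zero>\<^bsub>R\<^esub>, s)"]
  by (simp_all add: il_eq ir_eq pre_free_product_def)

lemma rels_subset: "rels \<subseteq> carrier T"
  by (auto simp: rels_def)

lemma ideal_FP: "ideal (free_product_ideal K R S) T"
  unfolding ideal_eq by (rule T.genideal_ideal[OF rels_subset])

lemma ring_FP: "ring FP"
  unfolding free_product_def by (rule ideal.quotient_is_ring[OF ideal_FP])

sublocale FP: ring FP
  by (rule ring_FP)

sublocale pr: ring_hom_ring T FP pr
  unfolding free_product_def by (rule ideal.rcos_ring_hom_ring[OF ideal_FP])

lemma pr_eqI: "x \<in> carrier T \<Longrightarrow> y \<in> carrier T \<Longrightarrow> x \<ominus>\<^bsub>T\<^esub> y \<in> rels \<Longrightarrow> pr x = pr y"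
  using T.quotient_eq_iff_same_a_r_cos[OF ideal_FP, of x y] T.genideal_self[OF rels_subset]
  unfolding ideal_eq by blast

lemma fp_inl_eq: "fp_inl K R S r = pr (il r)" and fp_inr_eq: "fp_inr K R S s = pr (ir s)"
  by (simp_all add: fp_inl_def fp_inr_def)

lemma fp_inl_ring_hom: "fp_inl K R S \<in> ring_hom R FP"
proof (rule ring_hom_memI)
  fix r r' assume r: "r \<in> carrier R" "r' \<in> carrier R"
  have "pr (il r \<otimes>\<^bsub>T\<^esub> il r') = pr (il (r \<otimes>\<^bsub>R\<^esub> r'))"
    by (rule pr_eqI) (use r in \<open>auto simp: rels_def\<close>)
  then show "fp_inl K R S (r \<otimes>\<^bsub>R\<^esub> r') = fp_inl K R S r \<otimes>\<^bsub>FP\<^esub> fp_inl K R S r'"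
    using r by (simp add: fp_inl_eq)
next
  have "pr (il \<one>\<^bsub>R\<^esub>) = pr \<one>\<^bsub>T\<^esub>"
    by (rule pr_eqI) (auto simp: rels_def)
  then show "fp_inl K R S \<one>\<^bsub>R\<^esub> = \<one>\<^bsub>FP\<^esub>" by (simp add: fp_inl_eq)
qed (simp_all add: fp_inl_eq il_add)

lemma fp_inr_ring_hom: "fp_inr K R S \<in> ring_hom S FP"
proof (rule ring_hom_memI)
  fix r r' assume r: "r \<in> carrier S" "r' \<in> carrier S"
  have "pr (ir r \<otimes>\<^bsub>T\<^esub> ir r') = pr (ir (r \<otimes>\<^bsub>S\<^esub> r'))"
    by (rule pr_eqI) (use r in \<open>auto simp: rels_def\<close>)
  then show "fp_inr K R S (r \<otimes>\<^bsub>S\<^esub> r') = fp_inr K R S r \<otimes>\<^bsub>FP\<^esub> fp_inr K R S r'"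
    using r by (simp add: fp_inr_eq)
next
  have "pr (ir \<one>\<^bsub>S\<^esub>) = pr \<one>\<^bsub>T\<^esub>"
    by (rule pr_eqI) (auto simp: rels_def)
  then show "fp_inr K R S \<one>\<^bsub>S\<^esub> = \<one>\<^bsub>FP\<^esub>" by (simp add: fp_inr_eq)
qed (simp_all add: fp_inr_eq ir_add)

text \<open>The scalars of the tensor algebra sit in degree zero. Multiplying such a scalar by the
  image of the unit of a factor changes nothing in the quotient, while in the tensor algebra the
  product is the corresponding multiple of that unit.\<close>

lemma pr_d0:
  assumes "k \<in> carrier K"
  shows "pr (d0 k) = fp_inl K R S (k \<odot>\<^bsub>R\<^esub> \<one>\<^bsub>R\<^esub>)" "pr (d0 k) = fp_inr K R S (k \<odot>\<^bsub>S\<^esub> \<one>\<^bsub>S\<^esub>)"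
proof -
  have c: "d0 k \<in> carrier T" using ring_hom_closed[OF d0_hom] assms by simp
  have "pr (d0 k) = pr (d0 k) \<otimes>\<^bsub>FP\<^esub> pr (il \<one>\<^bsub>R\<^esub>)"
    using c ring_hom_one[OF fp_inl_ring_hom] by (simp add: fp_inl_eq)
  then show "pr (d0 k) = fp_inl K R S (k \<odot>\<^bsub>R\<^esub> \<one>\<^bsub>R\<^esub>)"
    using c assms by (simp add: fp_inl_eq d0_il flip: pr.hom_mult)
  have "pr (d0 k) = pr (d0 k) \<otimes>\<^bsub>FP\<^esub> pr (ir \<one>\<^bsub>S\<^esub>)"
    using c ring_hom_one[OF fp_inr_ring_hom] by (simp add: fp_inr_eq)
  then show "pr (d0 k) = fp_inr K R S (k \<odot>\<^bsub>S\<^esub> \<one>\<^bsub>S\<^esub>)"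
    using c assms by (simp add: fp_inr_eq d0_ir flip: pr.hom_mult)
qed

lemma free_product_generated:
  assumes S: "subring U FP" and l: "\<And>r. r \<in> carrier R \<Longrightarrow> fp_inl K R S r \<in> U"
    and r: "\<And>s. s \<in> carrier S \<Longrightarrow> fp_inr K R S s \<in> U"
  shows "carrier FP \<subseteq> U"
  unfolding free_product_def
proof (rule T.Quot_generated[OF ideal_FP])
  show "subring U (T Quot free_product_ideal K R S)"
    using S unfolding free_product_def .
  fix W assume W: "subring W T" "W = {x \<in> carrier T. pr x \<in> U}"
  note W' = subringE[OF W(1)]
  have "carrier (tensor_algebra (self_alg K) V) \<subseteq> W"
  proof (rule V.tensor_algebra_generated)
    show "subring W (tensor_algebra (self_alg K) V)"
      using W(1) unfolding pre_free_product_def .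
    show "d0 k \<in> W" if "k \<in> carrier (self_alg K)" for k
      using that ring_hom_closed[OF d0_hom that] l[of "k \<odot>\<^bsub>R\<^esub> \<one>\<^bsub>R\<^esub>"] by (simp add: W(2) pr_d0)
    show "d1 v \<in> W" if "v \<in> carrier V" for v
      using that W'(7) l r by (cases v) (simp add: d1_split W(2) fp_inl_eq fp_inr_eq)
  qed
  then show "carrier T \<subseteq> W" unfolding pre_free_product_def .
qed

text \<open>The pair \<open>(r, s)\<close> is sent to \<open>f r \<oplus> g s\<close> and extended
  to the tensor algebra. The hypothesis \<open>fg\<close> makes the two homomorphisms agree on
  scalars, which is what a common map of \<open>K\<close> into \<open>E\<close> requires.\<close>

lemma free_product_universal:
  assumes E: "ring E" and f: "f \<in> ring_hom R E" and g: "g \<in> ring_hom S E"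
    and fg: "\<And>k. k \<in> carrier K \<Longrightarrow> f (k \<odot>\<^bsub>R\<^esub> \<one>\<^bsub>R\<^esub>) = g (k \<odot>\<^bsub>S\<^esub> \<one>\<^bsub>S\<^esub>)"
  shows "\<exists>h \<in> ring_hom FP E. (\<forall>r\<in>carrier R. h (fp_inl K R S r) = f r) \<and>
    (\<forall>s\<in>carrier S. h (fp_inr K R S s) = g s)"
proof -
  interpret E: ring E by fact
  interpret f: ring_hom_ring R E f by (rule ring_hom_ringI2[OF R.A.ring_axioms E f])
  interpret g: ring_hom_ring S E g by (rule ring_hom_ringI2[OF S.A.ring_axioms E g])
  \<comment> \<open>The common image of the scalars, used in degree zero. Its values commute with
    the images of \<open>f\<close> and of \<open>g\<close>, as the two parts of \<open>fk\<close>
    and \<open>gk\<close> record, and this provides the conditions on both actions.\<close>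
  define c where "c k = f (k \<odot>\<^bsub>R\<^esub> \<one>\<^bsub>R\<^esub>)" for k
  have c: "c \<in> ring_hom (self_alg K) E"
    by (rule ring_hom_memI) (simp_all add: c_def R.smult_l_distr R.smult_assoc1 R.smult_mult_left
        flip: f.hom_mult)
  have fk: "f (k \<odot>\<^bsub>R\<^esub> r) = c k \<otimes>\<^bsub>E\<^esub> f r" "f (k \<odot>\<^bsub>R\<^esub> r) = f r \<otimes>\<^bsub>E\<^esub> c k"
    if "k \<in> carrier K" "r \<in> carrier R" for k r
    using that by (simp_all add: c_def R.scalar_one_mult flip: f.hom_mult)
  have gk: "g (k \<odot>\<^bsub>S\<^esub> r) = c k \<otimes>\<^bsub>E\<^esub> g r" "g (k \<odot>\<^bsub>S\<^esub> r) = g r \<otimes>\<^bsub>E\<^esub> c k"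
    if "k \<in> carrier K" "r \<in> carrier S" for k r
    using that by (simp_all add: c_def fg S.scalar_one_mult flip: g.hom_mult)
  note cc = ring_hom_closed[OF c, simplified]
  have "\<exists>F \<in> ring_hom V.TA E. (\<forall>r\<in>carrier (self_alg K). F (d0 r) = c r) \<and>
    (\<forall>v\<in>carrier V. F (d1 v) = (case v of (r, s) \<Rightarrow> f r \<oplus>\<^bsub>E\<^esub> g s))"
    by (rule V.tensor_algebra_universal[OF E c])
      (auto simp: E.a_ac E.l_distr E.r_distr cc fk(1) gk(1), simp add: fk(1)[symmetric] fk(2) gk(1)[symmetric] gk(2))
  then obtain F where F: "F \<in> ring_hom T E"
    and Fd1: "\<And>r s. r \<in> carrier R \<Longrightarrow> s \<in> carrier S \<Longrightarrow> F (d1 (r, s)) = f r \<oplus>\<^bsub>E\<^esub> g s"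
    unfolding pre_free_product_def by fastforce
  interpret F: ring_hom_ring T E F by (rule ring_hom_ringI2[OF T.ring_axioms E F])
  have Fl: "F (il r) = f r" if "r \<in> carrier R" for r
    using that by (simp add: il_eq Fd1)
  have Fr: "F (ir s) = g s" if "s \<in> carrier S" for s
    using that by (simp add: ir_eq Fd1)
  have "F x = \<zero>\<^bsub>E\<^esub>" if "x \<in> rels" for x
    using that unfolding rels_def
    by (auto simp: a_minus_def F.hom_a_inv Fl Fr E.r_neg)
  from T.Quot_universal[OF E F rels_subset this]
  obtain h where h: "h \<in> ring_hom FP E" "\<And>x. x \<in> carrier T \<Longrightarrow> h (pr x) = F x"
    unfolding free_product_def ideal_eq by blast
  then show ?thesis
    by (intro bexI[of _ h]) (simp_all add: fp_inl_eq fp_inr_eq Fl Fr)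
qed

end


section \<open>Endomorphism rings and modules\<close>

text \<open>Endomorphisms are taken extensional so that the ring axioms hold as equations of
  functions and not merely on the carrier.\<close>

definition End_ring :: "('m, 'z) monoid_scheme \<Rightarrow> ('m \<Rightarrow> 'm) ring" where
  "End_ring M = \<lparr>carrier = hom M M \<inter> extensional (carrier M),
     monoid.mult = (\<lambda>f g. compose (carrier M) f g), monoid.one = (\<lambda>m\<in>carrier M. m),
     ring.zero = (\<lambda>m\<in>carrier M. \<one>\<^bsub>M\<^esub>), ring.add = (\<lambda>f g. \<lambda>m\<in>carrier M. f m \<otimes>\<^bsub>M\<^esub> g m)\<rparr>"

lemma End_ring_simps:
  "f \<in> carrier (End_ring M) \<longleftrightarrow> f \<in> hom M M \<and> f \<in> extensional (carrier M)"
  "m \<in> carrier M \<Longrightarrow> (f \<otimes>\<^bsub>End_ring M\<^esub> g) m = f (g m)"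
  "m \<in> carrier M \<Longrightarrow> \<one>\<^bsub>End_ring M\<^esub> m = m"
  "m \<in> carrier M \<Longrightarrow> \<zero>\<^bsub>End_ring M\<^esub> m = \<one>\<^bsub>M\<^esub>"
  "m \<in> carrier M \<Longrightarrow> (f \<oplus>\<^bsub>End_ring M\<^esub> g) m = f m \<otimes>\<^bsub>M\<^esub> g m"
  by (simp_all add: End_ring_def compose_eq)

lemma End_ring_eqI:
  "f \<in> carrier (End_ring M) \<Longrightarrow> g \<in> carrier (End_ring M) \<Longrightarrow> (\<And>m. m \<in> carrier M \<Longrightarrow> f m = g m) \<Longrightarrow> f = g"
  by (auto simp: End_ring_simps intro: extensionalityI)

lemma (in comm_group) ring_End_ring: "ring (End_ring G)"
proof -
  let ?E = "End_ring G"
  have hom: "f \<in> hom G G" if "f \<in> carrier ?E" for f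
    using that by (simp add: End_ring_simps)
  have res: "restrict f (carrier G) \<in> carrier ?E" if "f \<in> hom G G" for f
    using that by (simp add: End_ring_simps hom_restrict is_group)
  have mc: "f \<otimes>\<^bsub>?E\<^esub> g \<in> carrier ?E" if "f \<in> carrier ?E" "g \<in> carrier ?E" for f g
    using res[OF hom_compose'[OF hom[OF that(2)] hom[OF that(1)]]] by (simp add: End_ring_def compose_def)
  have ac: "f \<oplus>\<^bsub>?E\<^esub> g \<in> carrier ?E" if "f \<in> carrier ?E" "g \<in> carrier ?E" for f g
    using res[OF hom_mult_pointwise[OF hom[OF that(1)] hom[OF that(2)]]] by (simp add: End_ring_def)
  have oc: "\<one>\<^bsub>?E\<^esub> \<in> carrier ?E" "\<zero>\<^bsub>?E\<^esub> \<in> carrier ?E"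
    using res[of "\<lambda>m. m"] res[OF hom_one_pointwise] by (simp_all add: End_ring_def hom_def)
  have ev: "f m \<in> carrier G" if "f \<in> carrier ?E" "m \<in> carrier G" for f m
    using hom_in_carrier[OF hom] that .
  have evm: "f (m \<otimes> n) = f m \<otimes> f n" if "f \<in> carrier ?E" "m \<in> carrier G" "n \<in> carrier G" for f m n
    using hom_mult[OF hom] that .
  have nc: "(\<lambda>m\<in>carrier G. inv (f m)) \<in> carrier ?E" if "f \<in> carrier ?E" for f
    by (rule res, rule homI) (simp_all add: that ev evm inv_mult)
  note E = End_ring_eqI[where M = G]
  show ?thesis
  proof (rule ringI)
    show "abelian_group ?E"
    proof (rule abelian_groupI)
      fix f assume f: "f \<in> carrier ?E"
      show "\<zero>\<^bsub>?E\<^esub> \<oplus>\<^bsub>?E\<^esub> f = f"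
        by (rule E) (simp_all add: f ac oc End_ring_simps(4,5) ev)
      show "\<exists>g\<in>carrier ?E. g \<oplus>\<^bsub>?E\<^esub> f = \<zero>\<^bsub>?E\<^esub>"
        by (rule bexI[OF _ nc[OF f]], rule E) (simp_all add: f nc[OF f] ac oc End_ring_simps(4,5) ev)
      fix g assume g: "g \<in> carrier ?E"
      show "f \<oplus>\<^bsub>?E\<^esub> g = g \<oplus>\<^bsub>?E\<^esub> f"
        by (rule E) (simp_all add: f g ac End_ring_simps(5) ev m_ac)
      fix h assume h: "h \<in> carrier ?E"
      show "f \<oplus>\<^bsub>?E\<^esub> g \<oplus>\<^bsub>?E\<^esub> h = f \<oplus>\<^bsub>?E\<^esub> (g \<oplus>\<^bsub>?E\<^esub> h)"
        by (rule E) (simp_all add: f g h ac End_ring_simps(5) ev m_ac)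
    qed (simp_all add: ac oc)
    show "monoid ?E"
    proof (rule monoidI)
      fix f assume f: "f \<in> carrier ?E"
      show "\<one>\<^bsub>?E\<^esub> \<otimes>\<^bsub>?E\<^esub> f = f"
        by (rule E) (simp_all add: f mc oc End_ring_simps(2,3) ev)
      show "f \<otimes>\<^bsub>?E\<^esub> \<one>\<^bsub>?E\<^esub> = f"
        by (rule E) (simp_all add: f mc oc End_ring_simps(2,3))
      fix g h assume gh: "g \<in> carrier ?E" "h \<in> carrier ?E"
      show "f \<otimes>\<^bsub>?E\<^esub> g \<otimes>\<^bsub>?E\<^esub> h = f \<otimes>\<^bsub>?E\<^esub> (g \<otimes>\<^bsub>?E\<^esub> h)"
        by (rule E) (simp_all add: f gh mc End_ring_simps(2) ev)
    qed (simp_all add: mc oc)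
    fix f g h assume fgh: "f \<in> carrier ?E" "g \<in> carrier ?E" "h \<in> carrier ?E"
    show "(f \<oplus>\<^bsub>?E\<^esub> g) \<otimes>\<^bsub>?E\<^esub> h = f \<otimes>\<^bsub>?E\<^esub> h \<oplus>\<^bsub>?E\<^esub> g \<otimes>\<^bsub>?E\<^esub> h"
      by (rule E) (simp_all add: fgh mc ac End_ring_simps(2,5) ev)
    show "h \<otimes>\<^bsub>?E\<^esub> (f \<oplus>\<^bsub>?E\<^esub> g) = h \<otimes>\<^bsub>?E\<^esub> f \<oplus>\<^bsub>?E\<^esub> h \<otimes>\<^bsub>?E\<^esub> g"
      by (rule E) (simp_all add: fgh mc ac End_ring_simps(2,5) ev evm)
  qed
qed

definition end_of :: "('l, 'm, 'y) lmod_scheme \<Rightarrow> 'l \<Rightarrow> 'm \<Rightarrow> 'm" where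
  "end_of M r = (\<lambda>m\<in>carrier M. lact M r m)"

lemma (in left_module) end_of_ring_hom: "end_of M \<in> ring_hom R (End_ring M)"
proof -
  interpret E: ring "End_ring M" by (rule M.ring_End_ring)
  have c: "end_of M r \<in> carrier (End_ring M)" if "r \<in> carrier R" for r
    using that by (auto simp: End_ring_simps end_of_def hom_def lact_closed lact_add)
  show ?thesis
  proof (rule ring_hom_memI)
    fix r s assume "r \<in> carrier R" "s \<in> carrier R"
    then show "end_of M (r \<otimes>\<^bsub>R\<^esub> s) = end_of M r \<otimes>\<^bsub>End_ring M\<^esub> end_of M s"
      "end_of M (r \<oplus>\<^bsub>R\<^esub> s) = end_of M r \<oplus>\<^bsub>End_ring M\<^esub> end_of M s"
      by (auto intro!: End_ring_eqI c E.m_closed E.a_closed)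
        (simp_all add: End_ring_simps(2,5) end_of_def mult_lact add_lact lact_closed)
  next
    show "end_of M \<one>\<^bsub>R\<^esub> = \<one>\<^bsub>End_ring M\<^esub>"
      by (auto intro!: End_ring_eqI c) (simp add: End_ring_simps end_of_def one_lact)
  qed (rule c)
qed

lemma left_module_of_ring_hom:
  assumes "ring R" "comm_group M" "h \<in> ring_hom R (End_ring M)"
    and "\<And>r m. r \<in> carrier R \<Longrightarrow> m \<in> carrier M \<Longrightarrow> lact M r m = h r m"
  shows "left_module R M"
proof -
  interpret M: comm_group M by fact
  interpret h: ring_hom_ring R "End_ring M" h
    by (rule ring_hom_ringI2[OF assms(1) M.ring_End_ring assms(3)])
  have hc: "h r \<in> hom M M" if "r \<in> carrier R" for r
    using h.hom_closed[OF that] by (simp add: End_ring_simps)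
  have hm: "h r m \<in> carrier M" if "r \<in> carrier R" "m \<in> carrier M" for r m
    using hc[OF that(1)] that(2) by (auto simp: hom_def)
  show ?thesis
    by unfold_locales (simp_all add: assms(4) hm hom_mult[OF hc] End_ring_simps)
qed

section \<open>The algebra of vector fields by generators and relations\<close>

context differential_calculus
begin

abbreviation "X \<equiv> left_dual A \<Omega>"
abbreviation "Env \<equiv> env_alg K A"
abbreviation "MMo \<equiv> MM K A \<Omega>"
abbreviation "VX \<equiv> scalars A X"
abbreviation "V\<Omega> \<equiv> scalars A \<Omega>"
abbreviation "ee \<equiv> env_elt K A"
abbreviation "me \<equiv> MM_elt K A \<Omega>"

sublocale X: bimodule K A X
  by (rule bimodule_left_dual)

sublocale sX: bimodule K "self_alg K" VX
  by (rule X.bimodule_scalars)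

lemma bimodule_V\<Omega>: "bimodule K (self_alg K) V\<Omega>"
  by (rule bimodule_scalars)

sublocale env: tensor_of_algebras K A "op_alg A"
  by (intro tensor_of_algebras.intro unital_algebra_axioms unital_algebra_op_alg)

sublocale mp: balanced_pair K VX V\<Omega>
  by (rule balanced_pair_vect[OF sX.bimodule_axioms bimodule_V\<Omega>])

lemma MM_simps:
  "carrier MMo = carrier (tensor K VX V\<Omega>)" "monoid.mult MMo = monoid.mult (tensor K VX V\<Omega>)"
  "monoid.one MMo = monoid.one (tensor K VX V\<Omega>)"
  by (simp_all add: MM_def Let_def)

lemma MM_lact_eq: "lact MMo = (\<lambda>E C. \<Union>e \<in> E. \<Union>c \<in> C. tensor_class K VX V\<Omega>
       (frag_bilinear (\<lambda>(a, a') (x, \<omega>). (lact X a x, ract \<Omega> \<omega> a')) e c))"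
  and MM_ract_eq: "ract MMo = (\<lambda>C E. \<Union>c \<in> C. \<Union>e \<in> E. tensor_class K VX V\<Omega>
       (frag_bilinear (\<lambda>(x, \<omega>) (b, b'). (ract X x b, lact \<Omega> b' \<omega>)) c e))"
  by (simp_all add: MM_def Let_def)

lemma env_eq: "Env = alg_tensor K A (op_alg A)"
  by (simp add: env_alg_def)

lemma ee_eq: "ee a b = tens K (vect_bimod A) (vect_bimod (op_alg A)) a b"
  by (simp add: env_elt_def)

lemma me_eq: "me x \<omega> = tens K VX V\<Omega> x \<omega>"
  by (simp add: MM_elt_def)

abbreviation "EG \<equiv> tensor K (vect_bimod A) (vect_bimod (op_alg A))"
abbreviation "MG \<equiv> tensor K VX V\<Omega>"

lemma carrier_Env: "carrier Env = carrier EG"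
  by (simp add: env_eq env.alg_tensor_simps)

lemma
  shows MM_lact_hom: "E \<in> carrier Env \<Longrightarrow> lact MMo E \<in> hom MG MG"
    and MM_lact_hom': "C \<in> carrier MMo \<Longrightarrow> (\<lambda>E. lact MMo E C) \<in> hom EG MG"
    and MM_lact_me: "a \<in> carrier A \<Longrightarrow> b \<in> carrier A \<Longrightarrow> x \<in> carrier X \<Longrightarrow> \<omega> \<in> carrier \<Omega> \<Longrightarrow>
      lact MMo (ee a b) (me x \<omega>) = me (lact X a x) (ract \<Omega> \<omega> b)"
proof -
  note prem = env.pair.balanced_pair_axioms mp.balanced_pair_axioms mp.balanced_pair_axioms _ _ _ _ _ _ _ _ _ _ MM_lact_eq
  note c = X.lact_closed X.add_lact X.lact_add X.lact_smult X.lact_kact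
    ract_closed add_ract ract_add ract_smult ract_kact
  show "E \<in> carrier Env \<Longrightarrow> lact MMo E \<in> hom MG MG"
    by (rule tensor_bilinear_hom_right[OF prem]) (simp_all add: c carrier_Env)
  show "C \<in> carrier MMo \<Longrightarrow> (\<lambda>E. lact MMo E C) \<in> hom EG MG"
    by (rule tensor_bilinear_hom_left[OF prem]) (simp_all add: c MM_simps)
  show "a \<in> carrier A \<Longrightarrow> b \<in> carrier A \<Longrightarrow> x \<in> carrier X \<Longrightarrow> \<omega> \<in> carrier \<Omega> \<Longrightarrow>
      lact MMo (ee a b) (me x \<omega>) = me (lact X a x) (ract \<Omega> \<omega> b)"
    unfolding ee_eq me_eq
    by (rule tensor_bilinear_tens[OF prem]) (simp_all add: c)
qed

lemma
  shows MM_ract_hom: "E \<in> carrier Env \<Longrightarrow> (\<lambda>C. ract MMo C E) \<in> hom MG MG"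
    and MM_ract_hom': "C \<in> carrier MMo \<Longrightarrow> ract MMo C \<in> hom EG MG"
    and MM_ract_me: "a \<in> carrier A \<Longrightarrow> b \<in> carrier A \<Longrightarrow> x \<in> carrier X \<Longrightarrow> \<omega> \<in> carrier \<Omega> \<Longrightarrow>
      ract MMo (me x \<omega>) (ee a b) = me (ract X x a) (lact \<Omega> b \<omega>)"
proof -
  note prem = mp.balanced_pair_axioms env.pair.balanced_pair_axioms mp.balanced_pair_axioms _ _ _ _ _ _ _ _ _ _ MM_ract_eq
  note c = X.ract_closed X.add_ract X.ract_add X.ract_smult X.ract_kact
    lact_closed add_lact lact_add lact_smult lact_kact
  show "E \<in> carrier Env \<Longrightarrow> (\<lambda>C. ract MMo C E) \<in> hom MG MG"
    by (rule tensor_bilinear_hom_left[OF prem]) (simp_all add: c carrier_Env)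
  show "C \<in> carrier MMo \<Longrightarrow> ract MMo C \<in> hom EG MG"
    by (rule tensor_bilinear_hom_right[OF prem]) (simp_all add: c MM_simps)
  show "a \<in> carrier A \<Longrightarrow> b \<in> carrier A \<Longrightarrow> x \<in> carrier X \<Longrightarrow> \<omega> \<in> carrier \<Omega> \<Longrightarrow>
      ract MMo (me x \<omega>) (ee a b) = me (ract X x a) (lact \<Omega> b \<omega>)"
    unfolding ee_eq me_eq
    by (rule tensor_bilinear_tens[OF prem]) (simp_all add: c)
qed

lemma me_closed: "x \<in> carrier X \<Longrightarrow> \<omega> \<in> carrier \<Omega> \<Longrightarrow> me x \<omega> \<in> carrier MMo"
  by (simp add: me_eq MM_simps)

lemma ee_closed: "a \<in> carrier A \<Longrightarrow> b \<in> carrier A \<Longrightarrow> ee a b \<in> carrier Env"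
  using env.el_closed[of a b] by (simp add: ee_eq env_eq)

lemma mult_ee: "a \<in> carrier A \<Longrightarrow> b \<in> carrier A \<Longrightarrow> a' \<in> carrier A \<Longrightarrow> b' \<in> carrier A \<Longrightarrow>
    ee a b \<otimes>\<^bsub>Env\<^esub> ee a' b' = ee (a \<otimes>\<^bsub>A\<^esub> a') (b' \<otimes>\<^bsub>A\<^esub> b)"
  using env.mult_el[of a b a' b'] by (simp add: ee_eq env_eq)

lemma one_Env: "\<one>\<^bsub>Env\<^esub> = ee \<one>\<^bsub>A\<^esub> \<one>\<^bsub>A\<^esub>"
  by (simp add: ee_eq env_eq env.alg_tensor_simps)

lemma Env_hom_eqI:
  assumes "h \<in> hom EG G" "h' \<in> hom EG G" "group G"
    and "\<And>a b. a \<in> carrier A \<Longrightarrow> b \<in> carrier A \<Longrightarrow> h (ee a b) = h' (ee a b)"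
    and "x \<in> carrier Env"
  shows "h x = h' x"
  by (rule env.hom_el_eqI[OF assms(1-3)]) (use assms(4,5) in \<open>simp_all add: ee_eq env_eq\<close>)

lemma MM_hom_eqI:
  assumes "h \<in> hom MG G" "h' \<in> hom MG G" "group G"
    and "\<And>x \<omega>. x \<in> carrier X \<Longrightarrow> \<omega> \<in> carrier \<Omega> \<Longrightarrow> h (me x \<omega>) = h' (me x \<omega>)"
    and "C \<in> carrier MMo"
  shows "h C = h' C"
  by (rule mp.tensor_hom_eqI[OF assms(1-3)]) (use assms(4,5) in \<open>simp_all add: me_eq MM_simps\<close>)

lemma MM_lact_closed: "E \<in> carrier Env \<Longrightarrow> C \<in> carrier MMo \<Longrightarrow> lact MMo E C \<in> carrier MMo"
  using hom_in_carrier[OF MM_lact_hom, of E C] by (simp add: MM_simps)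

lemma MM_ract_closed: "E \<in> carrier Env \<Longrightarrow> C \<in> carrier MMo \<Longrightarrow> ract MMo C E \<in> carrier MMo"
  using hom_in_carrier[OF MM_ract_hom, of E C] by (simp add: MM_simps)

lemma unital_algebra_Env: "unital_algebra K Env"
  unfolding env_eq by (rule env.unital_algebra_alg_tensor)

text \<open>Every law is additive in each of its arguments. Those that involve two elements of the
  enveloping algebra are reduced to elementary tensors in \<open>C\<close>, then in
  \<open>F\<close>, then in \<open>E\<close>, where they are laws of the left dual and of
  \<open>\<Omega>\<close>.\<close>

lemma bimodule_MM: "bimodule K Env MMo"
proof -
  interpret Env: unital_algebra K Env by (rule unital_algebra_Env)
  note G = mp.T.is_group
  note H = MM_lact_hom MM_lact_hom' MM_ract_hom MM_ract_hom'
  have add_Env: "monoid.mult EG = ring.add Env"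
    by (simp add: env_eq env.alg_tensor_simps)
  have mult_hom_left: "D \<in> carrier Env \<Longrightarrow> (\<lambda>C. C \<otimes>\<^bsub>Env\<^esub> D) \<in> hom EG EG"
    and mult_hom_right: "D \<in> carrier Env \<Longrightarrow> (\<lambda>C. D \<otimes>\<^bsub>Env\<^esub> C) \<in> hom EG EG" for D
    unfolding env_eq by (rule env.mult_hom_left env.mult_hom_right; assumption)+
  have grp: "comm_group MMo"
    by (rule comm_group_cong[OF mp.comm_group_tensor]) (simp_all add: MM_simps)
  note c = ee_closed me_closed MM_lact_closed MM_ract_closed
  note d = X.lact_closed X.ract_closed X.mult_lact X.mult_ract X.lact_ract
    lact_closed ract_closed mult_lact mult_ract lact_ract
  have ring: "ring Env" by (rule Env.A.ring_axioms)
  show ?thesis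
  proof (intro bimodule.intro left_module.intro bimodule_axioms.intro left_module_axioms.intro
      Env.unital_algebra_axioms ring grp MM_lact_closed MM_ract_closed)
    fix k C assume k: "k \<in> carrier K" and C: "C \<in> carrier MMo"
    \<comment> \<open>With the scalar placed in the first factor, both sides act only on the
      component in the left dual, and centrality is inherited from there.\<close>
    have kE: "k \<odot>\<^bsub>Env\<^esub> \<one>\<^bsub>Env\<^esub> = ee (k \<odot>\<^bsub>A\<^esub> \<one>\<^bsub>A\<^esub>) \<one>\<^bsub>A\<^esub>"
      using env.smult_el[OF k, of "\<one>\<^bsub>A\<^esub>" "\<one>\<^bsub>A\<^esub>"] by (simp add: env_eq env.alg_tensor_simps(4) ee_eq)
    show "lact MMo (k \<odot>\<^bsub>Env\<^esub> \<one>\<^bsub>Env\<^esub>) C = ract MMo C (k \<odot>\<^bsub>Env\<^esub> \<one>\<^bsub>Env\<^esub>)"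
      unfolding kE
      by (rule MM_hom_eqI[where C = C, OF MM_lact_hom MM_ract_hom G])
        (use k C in \<open>simp_all add: c MM_lact_me MM_ract_me one_lact one_ract X.scalar_central\<close>)
  next
    fix E C D assume E: "E \<in> carrier Env" and C: "C \<in> carrier MMo" and D: "D \<in> carrier MMo"
    show "lact MMo E (C \<boxplus>\<^bsub>MMo\<^esub> D) = lact MMo E C \<boxplus>\<^bsub>MMo\<^esub> lact MMo E D"
      using hom_mult[OF MM_lact_hom[OF E]] C D by (simp add: MM_simps)
    show "ract MMo (C \<boxplus>\<^bsub>MMo\<^esub> D) E = ract MMo C E \<boxplus>\<^bsub>MMo\<^esub> ract MMo D E"
      using hom_mult[OF MM_ract_hom[OF E]] C D by (simp add: MM_simps)
  next
    fix E F C assume E: "E \<in> carrier Env" and F: "F \<in> carrier Env" and C: "C \<in> carrier MMo"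
    show "lact MMo (E \<oplus>\<^bsub>Env\<^esub> F) C = lact MMo E C \<boxplus>\<^bsub>MMo\<^esub> lact MMo F C"
      using hom_mult[OF MM_lact_hom'[OF C], of E F] E F by (simp add: MM_simps carrier_Env add_Env)
    show "ract MMo C (E \<oplus>\<^bsub>Env\<^esub> F) = ract MMo C E \<boxplus>\<^bsub>MMo\<^esub> ract MMo C F"
      using hom_mult[OF MM_ract_hom'[OF C], of E F] E F by (simp add: MM_simps carrier_Env add_Env)
    show "lact MMo (E \<otimes>\<^bsub>Env\<^esub> F) C = lact MMo E (lact MMo F C)"
    proof -
      have 1: "lact MMo (ee a b \<otimes>\<^bsub>Env\<^esub> ee a' b') C = lact MMo (ee a b) (lact MMo (ee a' b') C)"
        if ab: "a \<in> carrier A" "b \<in> carrier A" "a' \<in> carrier A" "b' \<in> carrier A" for a b a' b'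
        by (rule MM_hom_eqI[where C = C, OF MM_lact_hom hom_compose'[OF MM_lact_hom MM_lact_hom] G])
          (use ab C in \<open>simp_all add: c mult_ee MM_lact_me d\<close>)
      have 2: "lact MMo (ee a b \<otimes>\<^bsub>Env\<^esub> F) C = lact MMo (ee a b) (lact MMo F C)"
        if ab: "a \<in> carrier A" "b \<in> carrier A" for a b
        by (rule Env_hom_eqI[where x = F, OF hom_compose'[OF mult_hom_right MM_lact_hom'] hom_compose'[OF MM_lact_hom' MM_lact_hom] G])
          (use ab F C 1 in \<open>simp_all add: c\<close>)
      show ?thesis
        by (rule Env_hom_eqI[where x = E, OF hom_compose'[OF mult_hom_left MM_lact_hom'] MM_lact_hom' G])
          (use E F C 2 in \<open>simp_all add: c\<close>)
    qed
    show "ract MMo C (E \<otimes>\<^bsub>Env\<^esub> F) = ract MMo (ract MMo C E) F"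
    proof -
      have 1: "ract MMo C (ee a b \<otimes>\<^bsub>Env\<^esub> ee a' b') = ract MMo (ract MMo C (ee a b)) (ee a' b')"
        if ab: "a \<in> carrier A" "b \<in> carrier A" "a' \<in> carrier A" "b' \<in> carrier A" for a b a' b'
        by (rule MM_hom_eqI[where C = C, OF MM_ract_hom hom_compose'[OF MM_ract_hom MM_ract_hom] G])
          (use ab C in \<open>simp_all add: c mult_ee MM_ract_me d\<close>)
      have 2: "ract MMo C (ee a b \<otimes>\<^bsub>Env\<^esub> F) = ract MMo (ract MMo C (ee a b)) F"
        if ab: "a \<in> carrier A" "b \<in> carrier A" for a b
        by (rule Env_hom_eqI[where x = F, OF hom_compose'[OF mult_hom_right MM_ract_hom'] MM_ract_hom' G])
          (use ab F C 1 in \<open>simp_all add: c\<close>)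
      show ?thesis
        by (rule Env_hom_eqI[where x = E, OF hom_compose'[OF mult_hom_left MM_ract_hom'] hom_compose'[OF MM_ract_hom' MM_ract_hom] G])
          (use E F C 2 in \<open>simp_all add: c\<close>)
    qed
    show "ract MMo (lact MMo E C) F = lact MMo E (ract MMo C F)"
    proof -
      have 1: "ract MMo (lact MMo (ee a b) C) (ee a' b') = lact MMo (ee a b) (ract MMo C (ee a' b'))"
        if ab: "a \<in> carrier A" "b \<in> carrier A" "a' \<in> carrier A" "b' \<in> carrier A" for a b a' b'
        by (rule MM_hom_eqI[where C = C, OF hom_compose'[OF MM_lact_hom MM_ract_hom] hom_compose'[OF MM_ract_hom MM_lact_hom] G])
          (use ab C in \<open>simp_all add: c MM_ract_me MM_lact_me d\<close>)
      have 2: "ract MMo (lact MMo (ee a b) C) F = lact MMo (ee a b) (ract MMo C F)"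
        if ab: "a \<in> carrier A" "b \<in> carrier A" for a b
        by (rule Env_hom_eqI[where x = F, OF MM_ract_hom' hom_compose'[OF MM_ract_hom' MM_lact_hom] G])
          (use ab F C 1 in \<open>simp_all add: c\<close>)
      show ?thesis
        by (rule Env_hom_eqI[where x = E, OF hom_compose'[OF MM_lact_hom' MM_ract_hom] MM_lact_hom' G])
          (use E F C 2 in \<open>simp_all add: c\<close>)
    qed
  next
    fix C assume C: "C \<in> carrier MMo"
    show "lact MMo \<one>\<^bsub>Env\<^esub> C = C"
      unfolding one_Env by (rule MM_hom_eqI[where C = C, OF MM_lact_hom hom_ident G])
        (use C in \<open>simp_all add: c MM_lact_me one_ract X.one_lact\<close>)
    show "ract MMo C \<one>\<^bsub>Env\<^esub> = C"
      unfolding one_Env by (rule MM_hom_eqI[where C = C, OF MM_ract_hom hom_ident G])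
        (use C in \<open>simp_all add: c MM_ract_me one_lact X.one_ract\<close>)
  qed
qed

end

text \<open>The defining relations in an arbitrary ring, stated for generators and free of tensor
  products. Two rings are put into this form: the algebra of vector fields itself, and the
  endomorphism ring of the additive group that carries a connection. Compatibility of
  \<open>\<mu>\<close> and \<open>\<xi>\<close> with the scalars is a consequence and not an
  axiom.\<close>

locale vector_field_rep = differential_calculus K A \<Omega> d + E: ring E
  for K :: "('k, 'z) ring_scheme" and A :: "('k, 'a) module" and \<Omega> :: "('a, 'a, 'w) bimod"
    and d :: "'a \<Rightarrow> 'w" and E :: "('e, 'u) ring_scheme" +
  fixes \<alpha> :: "'a \<Rightarrow> 'e" and \<beta> :: "'a \<Rightarrow> 'e" and \<mu> :: "('w \<Rightarrow> 'a) \<Rightarrow> 'w \<Rightarrow> 'e"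
    and \<xi> :: "('w \<Rightarrow> 'a) \<Rightarrow> 'e"
  assumes alpha: "\<alpha> \<in> ring_hom A E" and beta: "\<beta> \<in> ring_hom (op_alg A) E"
    and alpha_beta: "a \<in> carrier A \<Longrightarrow> b \<in> carrier A \<Longrightarrow> \<alpha> a \<otimes>\<^bsub>E\<^esub> \<beta> b = \<beta> b \<otimes>\<^bsub>E\<^esub> \<alpha> a"
    and alpha_scalar: "k \<in> carrier K \<Longrightarrow> \<alpha> (k \<odot>\<^bsub>A\<^esub> \<one>\<^bsub>A\<^esub>) = \<beta> (k \<odot>\<^bsub>A\<^esub> \<one>\<^bsub>A\<^esub>)"
    and mu_closed: "x \<in> carrier (left_dual A \<Omega>) \<Longrightarrow> \<omega> \<in> carrier \<Omega> \<Longrightarrow> \<mu> x \<omega> \<in> carrier E"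
    and mu_add_left: "x \<in> carrier (left_dual A \<Omega>) \<Longrightarrow> y \<in> carrier (left_dual A \<Omega>) \<Longrightarrow> \<omega> \<in> carrier \<Omega> \<Longrightarrow>
      \<mu> (x \<boxplus>\<^bsub>left_dual A \<Omega>\<^esub> y) \<omega> = \<mu> x \<omega> \<oplus>\<^bsub>E\<^esub> \<mu> y \<omega>"
    and mu_add_right: "x \<in> carrier (left_dual A \<Omega>) \<Longrightarrow> \<omega> \<in> carrier \<Omega> \<Longrightarrow> \<eta> \<in> carrier \<Omega> \<Longrightarrow>
      \<mu> x (\<omega> \<boxplus>\<^bsub>\<Omega>\<^esub> \<eta>) = \<mu> x \<omega> \<oplus>\<^bsub>E\<^esub> \<mu> x \<eta>"
    and alpha_mu: "a \<in> carrier A \<Longrightarrow> x \<in> carrier (left_dual A \<Omega>) \<Longrightarrow> \<omega> \<in> carrier \<Omega> \<Longrightarrow>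
      \<alpha> a \<otimes>\<^bsub>E\<^esub> \<mu> x \<omega> = \<mu> (lact (left_dual A \<Omega>) a x) \<omega>"
    and beta_mu: "a \<in> carrier A \<Longrightarrow> x \<in> carrier (left_dual A \<Omega>) \<Longrightarrow> \<omega> \<in> carrier \<Omega> \<Longrightarrow>
      \<beta> a \<otimes>\<^bsub>E\<^esub> \<mu> x \<omega> = \<mu> x (ract \<Omega> \<omega> a)"
    and mu_alpha: "a \<in> carrier A \<Longrightarrow> x \<in> carrier (left_dual A \<Omega>) \<Longrightarrow> \<omega> \<in> carrier \<Omega> \<Longrightarrow>
      \<mu> x \<omega> \<otimes>\<^bsub>E\<^esub> \<alpha> a = \<mu> (ract (left_dual A \<Omega>) x a) \<omega>"
    and mu_beta: "a \<in> carrier A \<Longrightarrow> x \<in> carrier (left_dual A \<Omega>) \<Longrightarrow> \<omega> \<in> carrier \<Omega> \<Longrightarrow>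
      \<mu> x \<omega> \<otimes>\<^bsub>E\<^esub> \<beta> a = \<mu> x (lact \<Omega> a \<omega>)"
    and xi_closed: "x \<in> carrier (left_dual A \<Omega>) \<Longrightarrow> \<xi> x \<in> carrier E"
    and xi_add: "x \<in> carrier (left_dual A \<Omega>) \<Longrightarrow> y \<in> carrier (left_dual A \<Omega>) \<Longrightarrow>
      \<xi> (x \<boxplus>\<^bsub>left_dual A \<Omega>\<^esub> y) = \<xi> x \<oplus>\<^bsub>E\<^esub> \<xi> y"
    and alpha_xi: "a \<in> carrier A \<Longrightarrow> x \<in> carrier (left_dual A \<Omega>) \<Longrightarrow>
      \<alpha> a \<otimes>\<^bsub>E\<^esub> \<xi> x = \<xi> (lact (left_dual A \<Omega>) a x)"
    and xi_alpha: "a \<in> carrier A \<Longrightarrow> x \<in> carrier (left_dual A \<Omega>) \<Longrightarrow>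
      \<xi> x \<otimes>\<^bsub>E\<^esub> \<alpha> a = \<xi> (ract (left_dual A \<Omega>) x a) \<oplus>\<^bsub>E\<^esub> \<alpha> (x (d a))"
    and xi_beta: "a \<in> carrier A \<Longrightarrow> x \<in> carrier (left_dual A \<Omega>) \<Longrightarrow>
      \<xi> x \<otimes>\<^bsub>E\<^esub> \<beta> a = \<beta> a \<otimes>\<^bsub>E\<^esub> \<xi> x \<oplus>\<^bsub>E\<^esub> \<mu> x (d a)"

section \<open>Relations and generators of the algebra of vector fields\<close>

context differential_calculus
begin

abbreviation "B \<equiv> B_alg K A \<Omega>"
abbreviation "TX \<equiv> TX_alg K A \<Omega>"
abbreviation "Pre \<equiv> BX_pre K A \<Omega>"
abbreviation "BXA \<equiv> BX K A \<Omega> d"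

interpretation mm: bimodule K Env MMo
  by (rule bimodule_MM)

lemma unital_algebra_B: "unital_algebra K B"
  unfolding B_alg_def by (rule mm.unital_algebra_tensor_algebra)

lemma unital_algebra_TX: "unital_algebra K TX"
  unfolding TX_alg_def by (rule sX.unital_algebra_tensor_algebra)

interpretation fp: free_product_of_algebras K B TX
  by (intro free_product_of_algebras.intro unital_algebra_B unital_algebra_TX)

lemma ring_B: "ring B" and ring_TX: "ring TX" and ring_Env: "ring Env"
  using unital_algebra_B unital_algebra_TX unital_algebra_Env unital_algebra.axioms(3) by blast+

lemma ring_Pre: "ring Pre"
  unfolding BX_pre_def by (rule fp.ring_FP)

abbreviation "inB \<equiv> fp_inl K B TX"
abbreviation "inTX \<equiv> fp_inr K B TX"

lemma inB_hom: "inB \<in> ring_hom B Pre" and inTX_hom: "inTX \<in> ring_hom TX Pre"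
  unfolding BX_pre_def by (rule fp.fp_inl_ring_hom fp.fp_inr_ring_hom)+

abbreviation "e0 \<equiv> deg0 Env MMo"
abbreviation "e1 \<equiv> deg1 Env MMo"

lemma e0_hom: "e0 \<in> ring_hom Env B"
  unfolding B_alg_def by (rule mm.deg0_ring_hom)

lemma e1_closed: "C \<in> carrier MMo \<Longrightarrow> e1 C \<in> carrier B"
  unfolding B_alg_def by (rule mm.deg1_closed)

lemma ee_add:
  "a \<in> carrier A \<Longrightarrow> a' \<in> carrier A \<Longrightarrow> b \<in> carrier A \<Longrightarrow> ee (a \<oplus>\<^bsub>A\<^esub> a') b = ee a b \<oplus>\<^bsub>Env\<^esub> ee a' b"
  "a \<in> carrier A \<Longrightarrow> b \<in> carrier A \<Longrightarrow> b' \<in> carrier A \<Longrightarrow> ee a (b \<oplus>\<^bsub>A\<^esub> b') = ee a b \<oplus>\<^bsub>Env\<^esub> ee a b'"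
  using env.pair.tens_add_left[of a a' b] env.pair.tens_add_right[of a b b']
  by (simp_all add: ee_eq env_eq env.alg_tensor_simps)

lemma ring_hom_comp: "f \<in> ring_hom R S \<Longrightarrow> g \<in> ring_hom S T \<Longrightarrow> (\<lambda>x. g (f x)) \<in> ring_hom R T"
  using ring_hom_trans[of f R S g T] by (simp add: o_def)

lemma gen_A_hom: "gen_A K A \<Omega> \<in> ring_hom A Pre"
proof -
  have "(\<lambda>a. ee a \<one>\<^bsub>A\<^esub>) \<in> ring_hom A Env"
    by (rule ring_hom_memI) (simp_all add: ee_closed mult_ee ee_add one_Env)
  from ring_hom_comp[OF ring_hom_comp[OF this e0_hom] inB_hom] show ?thesis
    by (simp add: gen_A_def[abs_def])
qed

lemma gen_Aop_hom: "gen_Aop K A \<Omega> \<in> ring_hom (op_alg A) Pre"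
proof -
  have "(\<lambda>a. ee \<one>\<^bsub>A\<^esub> a) \<in> ring_hom (op_alg A) Env"
    by (rule ring_hom_memI) (simp_all add: ee_closed mult_ee ee_add one_Env)
  from ring_hom_comp[OF ring_hom_comp[OF this e0_hom] inB_hom] show ?thesis
    by (simp add: gen_Aop_def[abs_def])
qed

lemma gen_M_closed: "x \<in> carrier X \<Longrightarrow> \<omega> \<in> carrier \<Omega> \<Longrightarrow> gen_M K A \<Omega> x \<omega> \<in> carrier Pre"
  unfolding gen_M_def by (intro ring_hom_closed[OF inB_hom] e1_closed me_closed)

lemma gen_X_closed: "x \<in> carrier X \<Longrightarrow> gen_X K A \<Omega> x \<in> carrier Pre"
  unfolding gen_X_def TX_alg_def
  by (intro ring_hom_closed[OF inTX_hom[unfolded TX_alg_def]] sX.deg1_closed) simp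

definition BX_rels where
  "BX_rels =
     {gen_A K A \<Omega> a \<otimes>\<^bsub>Pre\<^esub> gen_X K A \<Omega> x \<ominus>\<^bsub>Pre\<^esub> gen_X K A \<Omega> (lact X a x) | a x.
         a \<in> carrier A \<and> x \<in> carrier X} \<union>
      {gen_X K A \<Omega> x \<otimes>\<^bsub>Pre\<^esub> gen_A K A \<Omega> a
         \<ominus>\<^bsub>Pre\<^esub> (gen_X K A \<Omega> (ract X x a) \<oplus>\<^bsub>Pre\<^esub> gen_A K A \<Omega> (x (d a))) | a x.
         a \<in> carrier A \<and> x \<in> carrier X} \<union>
      {gen_X K A \<Omega> x \<otimes>\<^bsub>Pre\<^esub> gen_Aop K A \<Omega> a
         \<ominus>\<^bsub>Pre\<^esub> (gen_Aop K A \<Omega> a \<otimes>\<^bsub>Pre\<^esub> gen_X K A \<Omega> x \<oplus>\<^bsub>Pre\<^esub> gen_M K A \<Omega> x (d a)) | a x.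
         a \<in> carrier A \<and> x \<in> carrier X}"

lemma BX_ideal_eq: "BX_ideal K A \<Omega> d = Idl\<^bsub>Pre\<^esub> BX_rels"
  by (simp add: BX_ideal_def BX_rels_def Let_def)

lemma eval_closed: "x \<in> carrier X \<Longrightarrow> \<omega> \<in> carrier \<Omega> \<Longrightarrow> x \<omega> \<in> carrier A"
  unfolding left_dual_iff by blast

interpretation Pre: ring Pre
  by (rule ring_Pre)

lemmas gen_A_closed = ring_hom_closed[OF gen_A_hom]
lemmas gen_Aop_closed = ring_hom_closed[OF gen_Aop_hom, simplified]

lemma BX_rels_subset: "BX_rels \<subseteq> carrier Pre"
  unfolding BX_rels_def
  by (auto simp: gen_A_closed gen_Aop_closed gen_M_closed gen_X_closed eval_closed d_closed
      X.lact_closed X.ract_closed)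

lemma ideal_BX: "ideal (BX_ideal K A \<Omega> d) Pre"
  unfolding BX_ideal_eq by (rule Pre.genideal_ideal[OF BX_rels_subset])

lemma ring_BX: "ring BXA"
  unfolding BX_def by (rule ideal.quotient_is_ring[OF ideal_BX])

abbreviation "cls \<equiv> (+>\<^bsub>Pre\<^esub>) (BX_ideal K A \<Omega> d)"

interpretation cls: ring_hom_ring Pre BXA cls
  unfolding BX_def by (rule ideal.rcos_ring_hom_ring[OF ideal_BX])

lemma cls_eqI: "x \<in> carrier Pre \<Longrightarrow> y \<in> carrier Pre \<Longrightarrow> x \<ominus>\<^bsub>Pre\<^esub> y \<in> BX_rels \<Longrightarrow> cls x = cls y"
  using Pre.quotient_eq_iff_same_a_r_cos[OF ideal_BX, of x y] Pre.genideal_self[OF BX_rels_subset]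
  unfolding BX_ideal_eq by blast

abbreviation "gA a \<equiv> cls (gen_A K A \<Omega> a)"
abbreviation "gB a \<equiv> cls (gen_Aop K A \<Omega> a)"
abbreviation "gM x \<omega> \<equiv> cls (gen_M K A \<Omega> x \<omega>)"
abbreviation "gX x \<equiv> cls (gen_X K A \<Omega> x)"

lemma gen_A_eq: "gen_A K A \<Omega> a = inB (e0 (ee a \<one>\<^bsub>A\<^esub>))"
  and gen_Aop_eq: "gen_Aop K A \<Omega> a = inB (e0 (ee \<one>\<^bsub>A\<^esub> a))"
  and gen_M_eq: "gen_M K A \<Omega> x \<omega> = inB (e1 (me x \<omega>))"
  and gen_X_eq: "gen_X K A \<Omega> x = inTX (deg1 (self_alg K) VX x)"
  by (simp_all add: gen_A_def gen_Aop_def gen_M_def gen_X_def)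

lemma inB_ee_me:
  assumes "a \<in> carrier A" "b \<in> carrier A" "x \<in> carrier X" "\<omega> \<in> carrier \<Omega>"
  shows "inB (e0 (ee a b)) \<otimes>\<^bsub>Pre\<^esub> gen_M K A \<Omega> x \<omega> = gen_M K A \<Omega> (lact X a x) (ract \<Omega> \<omega> b)"
    and "gen_M K A \<Omega> x \<omega> \<otimes>\<^bsub>Pre\<^esub> inB (e0 (ee a b)) = gen_M K A \<Omega> (ract X x a) (lact \<Omega> b \<omega>)"
proof -
  have c: "e0 (ee a b) \<in> carrier B" "e1 (me x \<omega>) \<in> carrier B"
    using assms by (simp_all add: ring_hom_closed[OF e0_hom] ee_closed e1_closed me_closed)
  show "inB (e0 (ee a b)) \<otimes>\<^bsub>Pre\<^esub> gen_M K A \<Omega> x \<omega> = gen_M K A \<Omega> (lact X a x) (ract \<Omega> \<omega> b)"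
    unfolding gen_M_eq ring_hom_mult[OF inB_hom c, symmetric]
    using assms mm.deg0_deg1[of "ee a b" "me x \<omega>", folded B_alg_def]
    by (simp add: ee_closed me_closed MM_lact_me)
  show "gen_M K A \<Omega> x \<omega> \<otimes>\<^bsub>Pre\<^esub> inB (e0 (ee a b)) = gen_M K A \<Omega> (ract X x a) (lact \<Omega> b \<omega>)"
    unfolding gen_M_eq ring_hom_mult[OF inB_hom c(2,1), symmetric]
    using assms mm.deg1_deg0[of "ee a b" "me x \<omega>", folded B_alg_def]
    by (simp add: ee_closed me_closed MM_ract_me)
qed

lemma gen_M_add:
  "x \<in> carrier X \<Longrightarrow> y \<in> carrier X \<Longrightarrow> \<omega> \<in> carrier \<Omega> \<Longrightarrow>
    gen_M K A \<Omega> (x \<boxplus>\<^bsub>X\<^esub> y) \<omega> = gen_M K A \<Omega> x \<omega> \<oplus>\<^bsub>Pre\<^esub> gen_M K A \<Omega> y \<omega>"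
  "x \<in> carrier X \<Longrightarrow> \<omega> \<in> carrier \<Omega> \<Longrightarrow> \<eta> \<in> carrier \<Omega> \<Longrightarrow>
    gen_M K A \<Omega> x (\<omega> \<boxplus>\<^bsub>\<Omega>\<^esub> \<eta>) = gen_M K A \<Omega> x \<omega> \<oplus>\<^bsub>Pre\<^esub> gen_M K A \<Omega> x \<eta>"
proof -
  have *: "inB (e1 (C \<boxplus>\<^bsub>MMo\<^esub> D)) = inB (e1 C) \<oplus>\<^bsub>Pre\<^esub> inB (e1 D)"
    if "C \<in> carrier MMo" "D \<in> carrier MMo" for C D
    using that ring_hom_add[OF inB_hom e1_closed e1_closed]
      mm.deg1_add[OF that, folded B_alg_def] by simp
  show "x \<in> carrier X \<Longrightarrow> y \<in> carrier X \<Longrightarrow> \<omega> \<in> carrier \<Omega> \<Longrightarrow>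
      gen_M K A \<Omega> (x \<boxplus>\<^bsub>X\<^esub> y) \<omega> = gen_M K A \<Omega> x \<omega> \<oplus>\<^bsub>Pre\<^esub> gen_M K A \<Omega> y \<omega>"
    using *[of "me x \<omega>" "me y \<omega>"] mp.tens_add_left[of x y \<omega>] me_closed
    by (simp add: gen_M_eq me_eq MM_simps)
  show "x \<in> carrier X \<Longrightarrow> \<omega> \<in> carrier \<Omega> \<Longrightarrow> \<eta> \<in> carrier \<Omega> \<Longrightarrow>
      gen_M K A \<Omega> x (\<omega> \<boxplus>\<^bsub>\<Omega>\<^esub> \<eta>) = gen_M K A \<Omega> x \<omega> \<oplus>\<^bsub>Pre\<^esub> gen_M K A \<Omega> x \<eta>"
    using *[of "me x \<omega>" "me x \<eta>"] mp.tens_add_right[of x \<omega> \<eta>] me_closed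
    by (simp add: gen_M_eq me_eq MM_simps)
qed

lemma gen_X_add:
  "x \<in> carrier X \<Longrightarrow> y \<in> carrier X \<Longrightarrow> gen_X K A \<Omega> (x \<boxplus>\<^bsub>X\<^esub> y) = gen_X K A \<Omega> x \<oplus>\<^bsub>Pre\<^esub> gen_X K A \<Omega> y"
  using ring_hom_add[OF inTX_hom, of "deg1 (self_alg K) VX x" "deg1 (self_alg K) VX y"]
    sX.deg1_add[of x y, folded TX_alg_def] sX.deg1_closed[of x, folded TX_alg_def]
    sX.deg1_closed[of y, folded TX_alg_def]
  by (simp add: gen_X_eq)

text \<open>The Leibniz rule for the product of the unit with itself gives d 1 = d 1 + d 1, hence d
  1 = 0, and \<open>K\<close>-linearity extends this to all scalars.\<close>

lemma d_scalar: "k \<in> carrier K \<Longrightarrow> d (k \<odot>\<^bsub>A\<^esub> \<one>\<^bsub>A\<^esub>) = \<one>\<^bsub>\<Omega>\<^esub>"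
proof -
  have "d \<one>\<^bsub>A\<^esub> = d \<one>\<^bsub>A\<^esub> \<boxplus>\<^bsub>\<Omega>\<^esub> d \<one>\<^bsub>A\<^esub>"
    using d_mult[of "\<one>\<^bsub>A\<^esub>" "\<one>\<^bsub>A\<^esub>"] by (simp add: one_lact one_ract d_closed)
  then have d1: "d \<one>\<^bsub>A\<^esub> = \<one>\<^bsub>\<Omega>\<^esub>"
    using d_closed[of "\<one>\<^bsub>A\<^esub>"] by simp
  assume k: "k \<in> carrier K"
  have "ka k \<one>\<^bsub>\<Omega>\<^esub> = ka k \<one>\<^bsub>\<Omega>\<^esub> \<boxplus>\<^bsub>\<Omega>\<^esub> ka k \<one>\<^bsub>\<Omega>\<^esub>"
    using kact_add[OF k, of "\<one>\<^bsub>\<Omega>\<^esub>" "\<one>\<^bsub>\<Omega>\<^esub>"] by simp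
  then show ?thesis
    using d_smult[OF k, of "\<one>\<^bsub>A\<^esub>"] kact_closed[OF k, of "\<one>\<^bsub>\<Omega>\<^esub>"] by (simp add: d1)
qed

lemmas gen_closed = gen_A_closed gen_Aop_closed gen_M_closed gen_X_closed eval_closed d_closed
  X.lact_closed X.ract_closed lact_closed ract_closed

lemma vector_field_rep_BX: "vector_field_rep K A \<Omega> d BXA gA gB gM gX"
proof (intro vector_field_rep.intro vector_field_rep_axioms.intro differential_calculus_axioms ring_BX)
  show "gA \<in> ring_hom A BXA" by (rule ring_hom_comp[OF gen_A_hom cls.homh])
  show "gB \<in> ring_hom (op_alg A) BXA" by (rule ring_hom_comp[OF gen_Aop_hom cls.homh])
  have ee: "inB (e0 (ee a b)) \<otimes>\<^bsub>Pre\<^esub> inB (e0 (ee a' b')) = inB (e0 (ee (a \<otimes>\<^bsub>A\<^esub> a') (b' \<otimes>\<^bsub>A\<^esub> b)))"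
    if "a \<in> carrier A" "b \<in> carrier A" "a' \<in> carrier A" "b' \<in> carrier A" for a b a' b'
    using that by (simp add: ring_hom_closed[OF e0_hom] ee_closed mult_ee
        ring_hom_mult[OF inB_hom, symmetric] ring_hom_mult[OF e0_hom, symmetric])
  fix a b assume ab: "a \<in> carrier A" "b \<in> carrier A"
  have "gen_A K A \<Omega> a \<otimes>\<^bsub>Pre\<^esub> gen_Aop K A \<Omega> b = gen_Aop K A \<Omega> b \<otimes>\<^bsub>Pre\<^esub> gen_A K A \<Omega> a"
    using ab by (simp add: gen_A_eq gen_Aop_eq ee)
  then show "gA a \<otimes>\<^bsub>BXA\<^esub> gB b = gB b \<otimes>\<^bsub>BXA\<^esub> gA a"
    using ab by (simp add: gen_closed flip: cls.hom_mult)
next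
  fix k assume "k \<in> carrier K"
  then show "gA (k \<odot>\<^bsub>A\<^esub> \<one>\<^bsub>A\<^esub>) = gB (k \<odot>\<^bsub>A\<^esub> \<one>\<^bsub>A\<^esub>)"
    \<comment> \<open>The enveloping algebra is a tensor product over \<open>K\<close>, so a scalar
      may be moved from the first factor to the second.\<close>
    using env.pair.tens_balanced[of "\<one>\<^bsub>A\<^esub>" k "\<one>\<^bsub>A\<^esub>"] by (simp add: gen_A_eq gen_Aop_eq ee_eq)
next
  fix x y \<omega> assume "x \<in> carrier X" "y \<in> carrier X" "\<omega> \<in> carrier \<Omega>"
  then show "gM (x \<boxplus>\<^bsub>X\<^esub> y) \<omega> = gM x \<omega> \<oplus>\<^bsub>BXA\<^esub> gM y \<omega>"
    by (simp add: gen_M_add gen_closed)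
next
  fix x \<omega> \<eta> assume "x \<in> carrier X" "\<omega> \<in> carrier \<Omega>" "\<eta> \<in> carrier \<Omega>"
  then show "gM x (\<omega> \<boxplus>\<^bsub>\<Omega>\<^esub> \<eta>) = gM x \<omega> \<oplus>\<^bsub>BXA\<^esub> gM x \<eta>"
    by (simp add: gen_M_add gen_closed)
next
  fix a x \<omega> assume axw: "a \<in> carrier A" "x \<in> carrier X" "\<omega> \<in> carrier \<Omega>"
  show "gA a \<otimes>\<^bsub>BXA\<^esub> gM x \<omega> = gM (lact X a x) \<omega>"
    using axw inB_ee_me(1)[of a "\<one>\<^bsub>A\<^esub>" x \<omega>] gen_A_closed[of a]
    by (simp add: gen_closed one_ract gen_A_eq flip: cls.hom_mult)
  show "gB a \<otimes>\<^bsub>BXA\<^esub> gM x \<omega> = gM x (ract \<Omega> \<omega> a)"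
    using axw inB_ee_me(1)[of "\<one>\<^bsub>A\<^esub>" a x \<omega>] gen_Aop_closed[of a]
    by (simp add: gen_closed X.one_lact gen_Aop_eq flip: cls.hom_mult)
  show "gM x \<omega> \<otimes>\<^bsub>BXA\<^esub> gA a = gM (ract X x a) \<omega>"
    using axw inB_ee_me(2)[of a "\<one>\<^bsub>A\<^esub>" x \<omega>] gen_A_closed[of a]
    by (simp add: gen_closed one_lact gen_A_eq flip: cls.hom_mult)
  show "gM x \<omega> \<otimes>\<^bsub>BXA\<^esub> gB a = gM x (lact \<Omega> a \<omega>)"
    using axw inB_ee_me(2)[of "\<one>\<^bsub>A\<^esub>" a x \<omega>] gen_Aop_closed[of a]
    by (simp add: gen_closed X.one_ract gen_Aop_eq flip: cls.hom_mult)
next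
  fix x y assume "x \<in> carrier X" "y \<in> carrier X"
  then show "gX (x \<boxplus>\<^bsub>X\<^esub> y) = gX x \<oplus>\<^bsub>BXA\<^esub> gX y"
    by (simp add: gen_X_add gen_closed)
next
  fix a x assume ax: "a \<in> carrier A" "x \<in> carrier X"
  have "cls (gen_A K A \<Omega> a \<otimes>\<^bsub>Pre\<^esub> gen_X K A \<Omega> x) = gX (lact X a x)"
    by (rule cls_eqI) (use ax gen_closed in \<open>auto simp: BX_rels_def\<close>)
  then show "gA a \<otimes>\<^bsub>BXA\<^esub> gX x = gX (lact X a x)"
    using ax by (simp add: gen_closed)
  have "cls (gen_X K A \<Omega> x \<otimes>\<^bsub>Pre\<^esub> gen_A K A \<Omega> a) = cls (gen_X K A \<Omega> (ract X x a) \<oplus>\<^bsub>Pre\<^esub> gen_A K A \<Omega> (x (d a)))"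
    by (rule cls_eqI) (use ax gen_closed in \<open>auto simp: BX_rels_def\<close>)
  then show "gX x \<otimes>\<^bsub>BXA\<^esub> gA a = gX (ract X x a) \<oplus>\<^bsub>BXA\<^esub> gA (x (d a))"
    using ax by (simp add: gen_closed)
  have "cls (gen_X K A \<Omega> x \<otimes>\<^bsub>Pre\<^esub> gen_Aop K A \<Omega> a)
      = cls (gen_Aop K A \<Omega> a \<otimes>\<^bsub>Pre\<^esub> gen_X K A \<Omega> x \<oplus>\<^bsub>Pre\<^esub> gen_M K A \<Omega> x (d a))"
    by (rule cls_eqI) (use ax gen_closed in \<open>auto simp: BX_rels_def\<close>)
  then show "gX x \<otimes>\<^bsub>BXA\<^esub> gB a = gB a \<otimes>\<^bsub>BXA\<^esub> gX x \<oplus>\<^bsub>BXA\<^esub> gM x (d a)"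
    using ax by (simp add: gen_closed)
qed (simp_all add: gen_M_closed gen_X_closed)

text \<open>The subring is pulled back along every layer of the construction: \<open>W\<close> in
  the free product, \<open>W1\<close> and \<open>W2\<close> in the two tensor algebras,
  \<open>W0\<close> in the enveloping algebra. Each preimage is a subring, so at each layer only the
  generators of that layer are to be found in it.\<close>

lemma BX_generated:
  assumes U: "subring U BXA"
    and gA: "\<And>a. a \<in> carrier A \<Longrightarrow> gA a \<in> U" and gB: "\<And>a. a \<in> carrier A \<Longrightarrow> gB a \<in> U"
    and gM: "\<And>x \<omega>. x \<in> carrier X \<Longrightarrow> \<omega> \<in> carrier \<Omega> \<Longrightarrow> gM x \<omega> \<in> U"
    and gX: "\<And>x. x \<in> carrier X \<Longrightarrow> gX x \<in> U"
  shows "carrier BXA \<subseteq> U"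
  unfolding BX_def
proof (rule Pre.Quot_generated[OF ideal_BX])
  show "subring U (Pre Quot BX_ideal K A \<Omega> d)"
    using U unfolding BX_def .
  fix W assume W: "subring W Pre" "W = {x \<in> carrier Pre. cls x \<in> U}"
  \<comment> \<open>The scalars of \<open>TX\<close> have no generator of their own. In the free
    product they coincide with those of \<open>B\<close>, and the latter come from
    \<open>A\<close>.\<close>
  have scal: "inB (k \<odot>\<^bsub>B\<^esub> \<one>\<^bsub>B\<^esub>) = gen_A K A \<Omega> (k \<odot>\<^bsub>A\<^esub> \<one>\<^bsub>A\<^esub>)" if "k \<in> carrier K" for k
    using that mm.smult_one_deg0[OF that, folded B_alg_def] env.smult_el[OF that, of "\<one>\<^bsub>A\<^esub>" "\<one>\<^bsub>A\<^esub>"]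
    by (simp add: gen_A_eq env_eq[symmetric] ee_eq[symmetric] one_Env)
  define W1 where "W1 = {b \<in> carrier B. inB b \<in> W}"
  have W1: "subring W1 B"
    unfolding W1_def by (rule ring.subring_vimage[OF ring_B ring_Pre inB_hom W(1)])
  define W0 where "W0 = {e \<in> carrier Env. e0 e \<in> W1}"
  have W0: "subring W0 Env"
    unfolding W0_def by (rule ring.subring_vimage[OF ring_Env ring_B e0_hom W1])
  have W0_ee: "ee a b \<in> W0" if "a \<in> carrier A" "b \<in> carrier A" for a b
  proof -
    have "ee a \<one>\<^bsub>A\<^esub> \<in> W0" "ee \<one>\<^bsub>A\<^esub> b \<in> W0"
      using that gA[of a] gB[of b] gen_A_closed[of a] gen_Aop_closed[of b]
      by (simp_all add: W0_def W1_def W(2) gen_A_eq gen_Aop_eq ring_hom_closed[OF e0_hom] ee_closed)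
    then show ?thesis
      using subringE(6)[OF W0, of "ee a \<one>\<^bsub>A\<^esub>" "ee \<one>\<^bsub>A\<^esub> b"] that by (simp add: mult_ee)
  qed
  have W0_all: "e \<in> W0" if "e \<in> carrier Env" for e
    using that unfolding env_eq
  proof (induction rule: env.alg_tensor_induct)
    case (minus x y)
    then show ?case
      using subringE(5,7)[OF W0] unfolding a_minus_def env_eq by blast
  next
    case (el r s)
    then show ?case using W0_ee[of r s] by (simp add: ee_eq)
  qed
  have W1_M: "e1 C \<in> W1" if "C \<in> carrier MMo" for C
  proof -
    have Mi: "inv\<^bsub>mp.MN\<^esub> y = inv\<^bsub>MMo\<^esub> y" for y
      by (simp add: m_inv_def MM_simps)
    have e1_hom: "e1 \<in> hom MMo (add_monoid B)"
      using mm.deg1_add[folded B_alg_def] by (intro homI) (simp_all add: e1_closed)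
    interpret e1: group_hom MMo "add_monoid B" e1
      using e1_hom mm.M.is_group ring.comm_group_add_monoid[OF ring_B]
      by (simp add: group_hom_def group_hom_axioms_def comm_group_def)
    show ?thesis
      using that unfolding MM_simps(1)
    proof (induction rule: mp.tensor_induct)
      case (diff x y)
      then have "e1 (x \<boxplus>\<^bsub>MMo\<^esub> inv\<^bsub>MMo\<^esub> y) = e1 x \<oplus>\<^bsub>B\<^esub> \<ominus>\<^bsub>B\<^esub> (e1 y)"
        by (simp add: MM_simps[symmetric] a_inv_def)
      then show ?case
        using diff subringE(5,7)[OF W1] by (simp add: Mi MM_simps)
    next
      case one
      then show ?case
        using subringE(2)[OF W1] e1.hom_one by (simp add: MM_simps)
    next
      case (tens x \<omega>)
      then show ?case
        using gM[of x \<omega>] gen_M_closed[of x \<omega>] e1_closed[OF me_closed[of x \<omega>]]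
        by (simp add: W1_def W(2) gen_M_eq me_eq)
    qed
  qed
  have W1_all: "carrier B \<subseteq> W1"
    unfolding B_alg_def
  proof (rule mm.tensor_algebra_generated)
    show "subring W1 (tensor_algebra Env MMo)" using W1 unfolding B_alg_def .
    show "e0 r \<in> W1" if "r \<in> carrier Env" for r using W0_all[OF that] by (simp add: W0_def)
  qed (rule W1_M)
  define W2 where "W2 = {b \<in> carrier TX. inTX b \<in> W}"
  have W2: "subring W2 TX"
    unfolding W2_def by (rule ring.subring_vimage[OF ring_TX ring_Pre inTX_hom W(1)])
  have W2_all: "carrier TX \<subseteq> W2"
    unfolding TX_alg_def
  proof (rule sX.tensor_algebra_generated)
    show "subring W2 (tensor_algebra (self_alg K) VX)" using W2 unfolding TX_alg_def .
    show "deg0 (self_alg K) VX k \<in> W2" if "k \<in> carrier (self_alg K)" for k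
    proof -
      have k: "k \<in> carrier K" using that by simp
      have "deg0 (self_alg K) VX k = k \<odot>\<^bsub>TX\<^esub> \<one>\<^bsub>TX\<^esub>"
        using sX.smult_one_deg0[OF k] k by (simp add: TX_alg_def)
      moreover have "inTX (k \<odot>\<^bsub>TX\<^esub> \<one>\<^bsub>TX\<^esub>) = gen_A K A \<Omega> (k \<odot>\<^bsub>A\<^esub> \<one>\<^bsub>A\<^esub>)"
        using fp.pr_d0[OF k] scal[OF k] by simp
      ultimately show ?thesis
        using gA[of "k \<odot>\<^bsub>A\<^esub> \<one>\<^bsub>A\<^esub>"] gen_A_closed[of "k \<odot>\<^bsub>A\<^esub> \<one>\<^bsub>A\<^esub>"] k
        by (simp add: W2_def W(2))
    qed
    show "deg1 (self_alg K) VX v \<in> W2" if "v \<in> carrier VX" for v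
      using that gX[of v] gen_X_closed[of v] sX.deg1_closed[OF that]
      by (simp add: W2_def W(2) gen_X_eq) (simp add: TX_alg_def)
  qed
  show "carrier Pre \<subseteq> W"
    unfolding BX_pre_def
  proof (rule fp.free_product_generated)
    show "subring W fp.FP" using W(1) unfolding BX_pre_def .
  qed (use W1_all W2_all in \<open>auto simp: W1_def W2_def\<close>)
qed

end

section \<open>The universal property of the algebra of vector fields\<close>

context vector_field_rep
begin

interpretation mm: bimodule K Env MMo
  by (rule bimodule_MM)

interpretation fp: free_product_of_algebras K B TX
  by (intro free_product_of_algebras.intro unital_algebra_B unital_algebra_TX)

text \<open>Each layer of the construction contributes its universal property.
  \<open>\<alpha>\<close> and \<open>\<beta>\<close> determine the map on the enveloping algebra,
  \<open>\<mu>\<close> the map on \<open>MM\<close>, and together they give the map on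
  \<open>B\<close>; \<open>\<xi>\<close> gives the map on \<open>TX\<close>. The relations of
  \<open>BX_rels\<close> are then exactly what is needed to leave the free product.\<close>

lemma BX_universal:
  "\<exists>h \<in> ring_hom BXA E. (\<forall>a\<in>carrier A. h (gA a) = \<alpha> a) \<and> (\<forall>a\<in>carrier A. h (gB a) = \<beta> a) \<and>
     (\<forall>x\<in>carrier X. \<forall>\<omega>\<in>carrier \<Omega>. h (gM x \<omega>) = \<mu> x \<omega>) \<and> (\<forall>x\<in>carrier X. h (gX x) = \<xi> x)"
proof -
  note ac = ring_hom_closed[OF alpha] and bc = ring_hom_closed[OF beta, simplified]
  have a1: "\<alpha> \<one>\<^bsub>A\<^esub> = \<one>\<^bsub>E\<^esub>" and b1: "\<beta> \<one>\<^bsub>A\<^esub> = \<one>\<^bsub>E\<^esub>"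
    using ring_hom_one[OF alpha] ring_hom_one[OF beta] by simp_all
  have "\<exists>f \<in> ring_hom env.T E. \<forall>r\<in>carrier A. \<forall>s\<in>carrier (op_alg A). f (env.el r s) = \<alpha> r \<otimes>\<^bsub>E\<^esub> \<beta> s"
    by (rule env.alg_tensor_universal[OF E.ring_axioms alpha beta]) (simp_all add: alpha_beta alpha_scalar)
  then obtain f where f: "f \<in> ring_hom Env E"
    and fe: "\<And>a b. a \<in> carrier A \<Longrightarrow> b \<in> carrier A \<Longrightarrow> f (ee a b) = \<alpha> a \<otimes>\<^bsub>E\<^esub> \<beta> b"
    by (auto simp: env_eq ee_eq)
  note fc = ring_hom_closed[OF f]
  have aE: "comm_group (add_monoid E)" by (rule E.comm_group_add_monoid)
  have bal: "balanced K VX V\<Omega> (add_monoid E) \<mu>"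
    unfolding balanced_def
  proof (intro conjI ballI)
    fix x k \<omega> assume x: "x \<in> carrier VX" and k: "k \<in> carrier K" and w: "\<omega> \<in> carrier V\<Omega>"
    \<comment> \<open>Since \<open>\<alpha>\<close> and \<open>\<beta>\<close> agree on scalars,
      multiplying by either one moves a scalar from \<open>x\<close> to \<open>\<omega>\<close>.
      This is the balancing condition over \<open>K\<close>.\<close>
    have "\<mu> x \<omega> \<otimes>\<^bsub>E\<^esub> \<alpha> (k \<odot>\<^bsub>A\<^esub> \<one>\<^bsub>A\<^esub>) = \<mu> x \<omega> \<otimes>\<^bsub>E\<^esub> \<beta> (k \<odot>\<^bsub>A\<^esub> \<one>\<^bsub>A\<^esub>)"
      using k by (simp add: alpha_scalar)
    then show "\<mu> (ract VX x k) \<omega> = \<mu> x (lact V\<Omega> k \<omega>)"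
      using x k w by (simp add: mu_alpha mu_beta kact_def X.scalar_central)
  qed (simp_all add: mu_closed mu_add_left mu_add_right)
  define g where "g = tensor_lift K VX V\<Omega> (add_monoid E) \<mu>"
  have g: "g \<in> hom MG (add_monoid E)"
    and gm: "\<And>x \<omega>. x \<in> carrier X \<Longrightarrow> \<omega> \<in> carrier \<Omega> \<Longrightarrow> g (me x \<omega>) = \<mu> x \<omega>"
    unfolding g_def using mp.tensor_lift_hom[OF aE bal] mp.tensor_lift_tens[OF aE bal]
    by (simp_all add: me_eq)
  have gc: "g C \<in> carrier E" if "C \<in> carrier MMo" for C
    using hom_in_carrier[OF g, of C] that by (simp add: MM_simps)
  have lm: "(\<lambda>x. x \<otimes>\<^bsub>E\<^esub> c) \<in> hom (add_monoid E) (add_monoid E)"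
    and rm: "(\<lambda>x. c \<otimes>\<^bsub>E\<^esub> x) \<in> hom (add_monoid E) (add_monoid E)" if "c \<in> carrier E" for c
    using that by (auto simp: hom_def E.l_distr E.r_distr)
  have fh: "f \<in> hom EG (add_monoid E)"
    using ring_hom_add[OF f] fc by (intro homI) (simp_all add: env_eq env.alg_tensor_simps)
  have gl: "g (lact MMo e C) = f e \<otimes>\<^bsub>E\<^esub> g C" if e: "e \<in> carrier Env" and C: "C \<in> carrier MMo" for e C
  proof -
    have 1: "g (lact MMo (ee a b) C) = f (ee a b) \<otimes>\<^bsub>E\<^esub> g C" if ab: "a \<in> carrier A" "b \<in> carrier A" for a b
    proof (rule MM_hom_eqI[where C = C, OF hom_compose'[OF MM_lact_hom g] hom_compose'[OF g rm] E.a_group])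
      fix x \<omega> assume xw: "x \<in> carrier X" "\<omega> \<in> carrier \<Omega>"
      show "g (lact MMo (ee a b) (me x \<omega>)) = f (ee a b) \<otimes>\<^bsub>E\<^esub> g (me x \<omega>)"
        using ab xw by (simp add: MM_lact_me gm fe X.lact_closed ract_closed E.m_assoc ac bc mu_closed beta_mu alpha_mu)
    qed (use ab C in \<open>simp_all add: ee_closed fc\<close>)
    show ?thesis
      by (rule Env_hom_eqI[where x = e, OF hom_compose'[OF MM_lact_hom' g] hom_compose'[OF fh lm] E.a_group])
        (use e C 1 in \<open>simp_all add: gc\<close>)
  qed
  have gr: "g (ract MMo C e) = g C \<otimes>\<^bsub>E\<^esub> f e" if e: "e \<in> carrier Env" and C: "C \<in> carrier MMo" for e C
  proof -
    have 1: "g (ract MMo C (ee a b)) = g C \<otimes>\<^bsub>E\<^esub> f (ee a b)" if ab: "a \<in> carrier A" "b \<in> carrier A" for a b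
    proof (rule MM_hom_eqI[where C = C, OF hom_compose'[OF MM_ract_hom g] hom_compose'[OF g lm] E.a_group])
      fix x \<omega> assume xw: "x \<in> carrier X" "\<omega> \<in> carrier \<Omega>"
      show "g (ract MMo (me x \<omega>) (ee a b)) = g (me x \<omega>) \<otimes>\<^bsub>E\<^esub> f (ee a b)"
        using ab xw by (simp add: MM_ract_me gm fe X.ract_closed lact_closed ac bc mu_closed mu_beta mu_alpha
            E.m_assoc[symmetric])
    qed (use ab C in \<open>simp_all add: ee_closed fc\<close>)
    show ?thesis
      by (rule Env_hom_eqI[where x = e, OF hom_compose'[OF MM_ract_hom' g] hom_compose'[OF fh rm] E.a_group])
        (use e C 1 in \<open>simp_all add: gc\<close>)
  qed
  have "\<exists>F \<in> ring_hom mm.TA E. (\<forall>r\<in>carrier Env. F (e0 r) = f r) \<and> (\<forall>v\<in>carrier MMo. F (e1 v) = g v)"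
    by (rule mm.tensor_algebra_universal[OF E.ring_axioms f])
      (use hom_mult[OF g] in \<open>simp_all add: gc gl gr, simp add: MM_simps\<close>)
  then obtain F where F: "F \<in> ring_hom B E" and Fe: "\<And>r. r \<in> carrier Env \<Longrightarrow> F (e0 r) = f r"
    and FM: "\<And>C. C \<in> carrier MMo \<Longrightarrow> F (e1 C) = g C"
    unfolding B_alg_def by blast
  define c where "c k = \<alpha> (k \<odot>\<^bsub>A\<^esub> \<one>\<^bsub>A\<^esub>)" for k
  have c: "c \<in> ring_hom (self_alg K) E"
  proof (rule ring_hom_memI)
    fix k l assume kl: "k \<in> carrier (self_alg K)" "l \<in> carrier (self_alg K)"
    have "(k \<otimes>\<^bsub>K\<^esub> l) \<odot>\<^bsub>A\<^esub> \<one>\<^bsub>A\<^esub> = (k \<odot>\<^bsub>A\<^esub> \<one>\<^bsub>A\<^esub>) \<otimes>\<^bsub>A\<^esub> (l \<odot>\<^bsub>A\<^esub> \<one>\<^bsub>A\<^esub>)"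
      using kl by (simp add: smult_assoc1 smult_mult_left)
    then show "c (k \<otimes>\<^bsub>self_alg K\<^esub> l) = c k \<otimes>\<^bsub>E\<^esub> c l"
      using kl by (simp add: c_def ring_hom_mult[OF alpha])
    show "c (k \<oplus>\<^bsub>self_alg K\<^esub> l) = c k \<oplus>\<^bsub>E\<^esub> c l"
      using kl by (simp add: c_def smult_l_distr ring_hom_add[OF alpha])
  qed (simp_all add: c_def ac a1)
  have a0: "\<alpha> \<zero>\<^bsub>A\<^esub> = \<zero>\<^bsub>E\<^esub>"
    using ring_hom_add[OF alpha, of "\<zero>\<^bsub>A\<^esub>" "\<zero>\<^bsub>A\<^esub>"] ac[of "\<zero>\<^bsub>A\<^esub>"] by simp
  have x0: "x \<one>\<^bsub>\<Omega>\<^esub> = \<zero>\<^bsub>A\<^esub>" if x: "x \<in> carrier X" for x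
  proof -
    have "x (\<one>\<^bsub>\<Omega>\<^esub> \<boxplus>\<^bsub>\<Omega>\<^esub> \<one>\<^bsub>\<Omega>\<^esub>) = x \<one>\<^bsub>\<Omega>\<^esub> \<oplus>\<^bsub>A\<^esub> x \<one>\<^bsub>\<Omega>\<^esub>"
      using x unfolding left_dual_iff by blast
    then show ?thesis using eval_closed[OF x, of "\<one>\<^bsub>\<Omega>\<^esub>"] by simp
  qed
  \<comment> \<open>\<open>\<xi>\<close> is \<open>K\<close>-linear because \<open>d\<close> vanishes on the scalars.\<close>
  have xi_scal: "\<xi> (ract X x (k \<odot>\<^bsub>A\<^esub> \<one>\<^bsub>A\<^esub>)) = \<xi> x \<otimes>\<^bsub>E\<^esub> \<alpha> (k \<odot>\<^bsub>A\<^esub> \<one>\<^bsub>A\<^esub>)"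
    if "k \<in> carrier K" "x \<in> carrier X" for k x
    using that by (simp add: xi_alpha d_scalar x0 a0 xi_closed X.ract_closed)
  have "\<exists>F \<in> ring_hom sX.TA E. (\<forall>k\<in>carrier (self_alg K). F (deg0 (self_alg K) VX k) = c k) \<and>
      (\<forall>x\<in>carrier VX. F (deg1 (self_alg K) VX x) = \<xi> x)"
  proof (rule sX.tensor_algebra_universal[OF E.ring_axioms c])
    fix k x assume kx: "k \<in> carrier (self_alg K)" "x \<in> carrier VX"
    then show "\<xi> (lact VX k x) = c k \<otimes>\<^bsub>E\<^esub> \<xi> x"
      by (simp add: kact_def c_def alpha_xi)
    show "\<xi> (ract VX x k) = \<xi> x \<otimes>\<^bsub>E\<^esub> c k"
      using kx by (simp add: X.kact_ract c_def xi_scal)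
  qed (simp_all add: xi_closed xi_add)
  then obtain F' where F': "F' \<in> ring_hom TX E" and Fk: "\<And>k. k \<in> carrier K \<Longrightarrow> F' (deg0 (self_alg K) VX k) = c k"
    and FX: "\<And>x. x \<in> carrier X \<Longrightarrow> F' (deg1 (self_alg K) VX x) = \<xi> x"
    unfolding TX_alg_def by auto
  \<comment> \<open>The condition for leaving the two factors: their scalars, which reach
    \<open>B\<close> through the enveloping algebra and \<open>TX\<close> in degree zero, must have
    the same image.\<close>
  have "F (k \<odot>\<^bsub>B\<^esub> \<one>\<^bsub>B\<^esub>) = F' (k \<odot>\<^bsub>TX\<^esub> \<one>\<^bsub>TX\<^esub>)" if k: "k \<in> carrier K" for k
  proof -
    have kE: "k \<odot>\<^bsub>Env\<^esub> \<one>\<^bsub>Env\<^esub> = ee (k \<odot>\<^bsub>A\<^esub> \<one>\<^bsub>A\<^esub>) \<one>\<^bsub>A\<^esub>"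
      using env.smult_el[OF k, of "\<one>\<^bsub>A\<^esub>" "\<one>\<^bsub>A\<^esub>"] by (simp add: env_eq env.alg_tensor_simps(4) ee_eq)
    have "F (k \<odot>\<^bsub>B\<^esub> \<one>\<^bsub>B\<^esub>) = c k"
      using mm.smult_one_deg0[OF k, folded B_alg_def] k by (simp add: kE Fe ee_closed fe b1 c_def ac)
    moreover have "F' (k \<odot>\<^bsub>TX\<^esub> \<one>\<^bsub>TX\<^esub>) = c k"
      using sX.smult_one_deg0[OF k, folded TX_alg_def] k by (simp add: Fk)
    ultimately show ?thesis by simp
  qed
  from fp.free_product_universal[OF E.ring_axioms F F' this]
  obtain H where H: "H \<in> ring_hom Pre E"
    and Hl: "\<And>b. b \<in> carrier B \<Longrightarrow> H (inB b) = F b" and Hr: "\<And>b. b \<in> carrier TX \<Longrightarrow> H (inTX b) = F' b"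
    unfolding BX_pre_def by blast
  note e0c = ring_hom_closed[OF e0_hom]
  have HA: "H (gen_A K A \<Omega> a) = \<alpha> a" if "a \<in> carrier A" for a
    using that by (simp add: gen_A_eq Hl e0c ee_closed Fe fe b1 ac)
  have HB: "H (gen_Aop K A \<Omega> a) = \<beta> a" if "a \<in> carrier A" for a
    using that by (simp add: gen_Aop_eq Hl e0c ee_closed Fe fe a1 bc)
  have HM: "H (gen_M K A \<Omega> x \<omega>) = \<mu> x \<omega>" if "x \<in> carrier X" "\<omega> \<in> carrier \<Omega>" for x \<omega>
    using that by (simp add: gen_M_eq Hl e1_closed me_closed FM gm)
  have HX: "H (gen_X K A \<Omega> x) = \<xi> x" if "x \<in> carrier X" for x
    using that sX.deg1_closed[of x, folded TX_alg_def] by (simp add: gen_X_eq Hr FX)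
  interpret H: ring_hom_ring Pre E H by (rule ring_hom_ringI2[OF ring_Pre E.ring_axioms H])
  have "H z = \<zero>\<^bsub>E\<^esub>" if "z \<in> BX_rels" for z
    using that unfolding BX_rels_def
    by (auto simp: a_minus_def H.hom_a_inv gen_closed HA HB HM HX alpha_xi xi_alpha xi_beta
        E.r_neg ac bc xi_closed mu_closed)
  from H.R.Quot_universal[OF E.ring_axioms H BX_rels_subset this]
  obtain h where h: "h \<in> ring_hom BXA E" "\<And>z. z \<in> carrier Pre \<Longrightarrow> h (cls z) = H z"
    unfolding BX_def BX_ideal_eq by blast
  then show ?thesis
    by (intro bexI[of _ h]) (simp_all add: gen_closed HA HB HM HX)
qed

end

section \<open>Tensor products of bimodules\<close>

lemma
  assumes M: "bimodule K A M" and N: "bimodule K A N" and a: "a \<in> carrier A"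
  shows lact_tensor_hom: "lact (tensor A M N) a \<in> hom (tensor A M N) (tensor A M N)"
    and lact_tens: "m \<in> carrier M \<Longrightarrow> n \<in> carrier N \<Longrightarrow>
      lact (tensor A M N) a (tens A M N m n) = tens A M N (lact M a m) n"
proof -
  interpret M: bimodule K A M by fact
  have eq: "lact (tensor A M N) a = tensor_map A M N (lact M a) id"
    by (simp add: tensor_def)
  note bp = balanced_pair_bimodules[OF M N]
  have f: "lact M a \<in> hom M M" by (rule homI) (simp_all add: a M.lact_closed M.lact_add)
  have f': "lact M a (ract M m r) = ract M (lact M a m) r" if "m \<in> carrier M" "r \<in> carrier A" for m r
    using that a by (simp add: M.lact_ract)
  have g: "id \<in> hom N N" by (simp add: hom_def)
  show "lact (tensor A M N) a \<in> hom (tensor A M N) (tensor A M N)"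
    unfolding eq by (rule tensor_map_hom[OF bp bp f f' g]) simp_all
  show "lact (tensor A M N) a (tens A M N m n) = tens A M N (lact M a m) n"
    if "m \<in> carrier M" "n \<in> carrier N"
    unfolding eq using tensor_map_tens[OF bp bp f f' g _ that] by simp
qed

lemma
  assumes M: "bimodule K A M" and N: "bimodule K A N" and a: "a \<in> carrier A"
  shows ract_tensor_hom: "(\<lambda>t. ract (tensor A M N) t a) \<in> hom (tensor A M N) (tensor A M N)"
    and ract_tens: "m \<in> carrier M \<Longrightarrow> n \<in> carrier N \<Longrightarrow>
      ract (tensor A M N) (tens A M N m n) a = tens A M N m (ract N n a)"
proof -
  interpret N: bimodule K A N by fact
  have eq: "(\<lambda>t. ract (tensor A M N) t a) = tensor_map A M N id (\<lambda>n. ract N n a)"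
    "ract (tensor A M N) t a = tensor_map A M N id (\<lambda>n. ract N n a) t" for t
    by (simp_all add: tensor_def)
  note bp = balanced_pair_bimodules[OF M N]
  have f: "(\<lambda>n. ract N n a) \<in> hom N N" by (rule homI) (simp_all add: a N.ract_closed N.ract_add)
  have f': "ract N (lact N r m) a = lact N r (ract N m a)" if "m \<in> carrier N" "r \<in> carrier A" for m r
    using that a by (simp add: N.lact_ract)
  have g: "id \<in> hom M M" by (simp add: hom_def)
  show "(\<lambda>t. ract (tensor A M N) t a) \<in> hom (tensor A M N) (tensor A M N)"
    unfolding eq(1) by (rule tensor_map_hom[OF bp bp g _ f f']) simp_all
  show "ract (tensor A M N) (tens A M N m n) a = tens A M N m (ract N n a)"
    if "m \<in> carrier M" "n \<in> carrier N"
    unfolding eq(2) using tensor_map_tens[OF bp bp g _ f f' that] by simp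
qed

lemma bimod_homsD:
  assumes "f \<in> bimod_homs A M N"
  shows "f \<in> hom M N"
    and "a \<in> carrier A \<Longrightarrow> m \<in> carrier M \<Longrightarrow> f (lact M a m) = lact N a (f m)"
    and "a \<in> carrier A \<Longrightarrow> m \<in> carrier M \<Longrightarrow> f (ract M m a) = ract N (f m) a"
  using assms by (auto simp: bimod_homs_def left_homs_def right_homs_def)

lemma
  assumes L: "bimodule K A L" and M: "bimodule K A M" and N: "bimodule K A N"
    and f: "f \<in> bimod_homs A M N"
  shows tensor_map_right_hom: "tensor_map A L N id f \<in> hom (tensor A L M) (tensor A L N)"
    and tensor_map_right_tens: "l \<in> carrier L \<Longrightarrow> m \<in> carrier M \<Longrightarrow>
      tensor_map A L N id f (tens A L M l m) = tens A L N l (f m)"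
    and tensor_map_left_hom: "tensor_map A N L f id \<in> hom (tensor A M L) (tensor A N L)"
    and tensor_map_left_tens: "l \<in> carrier L \<Longrightarrow> m \<in> carrier M \<Longrightarrow>
      tensor_map A N L f id (tens A M L m l) = tens A N L (f m) l"
proof -
  have g: "id \<in> hom L L" by (simp add: hom_def)
  note f' = bimod_homsD[OF f]
  note bp = balanced_pair_bimodules
  show "tensor_map A L N id f \<in> hom (tensor A L M) (tensor A L N)"
    by (rule tensor_map_hom[OF bp[OF L M] bp[OF L N] g _ f'(1)]) (simp_all add: f'(2))
  show "tensor_map A N L f id \<in> hom (tensor A M L) (tensor A N L)"
    by (rule tensor_map_hom[OF bp[OF M L] bp[OF N L] f'(1) _ g]) (simp_all add: f'(3))
  show "tensor_map A L N id f (tens A L M l m) = tens A L N l (f m)" if "l \<in> carrier L" "m \<in> carrier M"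
    using tensor_map_tens[OF bp[OF L M] bp[OF L N] g _ f'(1) f'(2) that] by simp
  show "tensor_map A N L f id (tens A M L m l) = tens A N L (f m) l" if "l \<in> carrier L" "m \<in> carrier M"
    using tensor_map_tens[OF bp[OF M L] bp[OF N L] f'(1) f'(3) g _ that(2,1)] by simp
qed


section \<open>Dual bases\<close>

locale calculus_with_dual_basis = differential_calculus K A \<Omega> d
  for K :: "('k, 'z) ring_scheme" and A :: "('k, 'a) module" and \<Omega> :: "('a, 'a, 'w) bimod"
    and d :: "'a \<Rightarrow> 'w" +
  fixes J :: "'i set" and w :: "'i \<Rightarrow> 'w" and xs :: "'i \<Rightarrow> 'w \<Rightarrow> 'a"
  assumes finite_J: "finite J"
    and w_closed: "i \<in> J \<Longrightarrow> w i \<in> carrier \<Omega>"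
    and xs_closed: "i \<in> J \<Longrightarrow> xs i \<in> carrier (left_dual A \<Omega>)"
    and dual_basis: "\<omega> \<in> carrier \<Omega> \<Longrightarrow> \<omega> = finprod \<Omega> (\<lambda>i. ract \<Omega> (w i) (xs i \<omega>)) J"

text \<open>The free module that has \<open>\<Omega>\<close> as a summand may have infinite rank. A
  finite generating set of \<open>\<Omega>\<close> involves only finitely many coordinates, and all
  others vanish on \<open>\<Omega>\<close>. The projections \<open>p\<close> of the remaining unit
  vectors, with the corresponding coordinates of \<open>s\<close>, form a dual basis.\<close>

lemma (in differential_calculus) dual_basis_exists:
  assumes fg: "finitely_generated_right A \<Omega>" and pr: "projective_right A \<Omega>"
  shows "\<exists>(J :: 'w set) w xs. calculus_with_dual_basis K A \<Omega> d J w xs"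
proof -
  obtain S where S: "finite S" "S \<subseteq> carrier \<Omega>"
    and gen: "\<And>x. x \<in> carrier \<Omega> \<Longrightarrow> \<exists>c \<in> S \<rightarrow> carrier A. x = finprod \<Omega> (\<lambda>s. ract \<Omega> s (c s)) S"
    using fg unfolding finitely_generated_right_def by blast
  obtain I :: "'w set" and s p where s: "s \<in> right_homs A \<Omega> (free_bimod A I)"
    and p: "p \<in> right_homs A (free_bimod A I) \<Omega>" and ps: "\<And>x. x \<in> carrier \<Omega> \<Longrightarrow> p (s x) = x"
    using pr unfolding projective_right_def by blast
  let ?F = "free_bimod A I"
  have F_simps: "carrier ?F = {f \<in> I \<rightarrow>\<^sub>E carrier A. finite {i \<in> I. f i \<noteq> \<zero>\<^bsub>A\<^esub>}}"
    "monoid.mult ?F f g = (\<lambda>i\<in>I. f i \<oplus>\<^bsub>A\<^esub> g i)" "monoid.one ?F = (\<lambda>i\<in>I. \<zero>\<^bsub>A\<^esub>)"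
    "ract ?F f a = (\<lambda>i\<in>I. f i \<otimes>\<^bsub>A\<^esub> a)" for f g a
    by (simp_all add: free_bimod_def)
  have sh: "s \<in> hom \<Omega> ?F" and sr: "\<And>a x. a \<in> carrier A \<Longrightarrow> x \<in> carrier \<Omega> \<Longrightarrow> s (ract \<Omega> x a) = ract ?F (s x) a"
    using s by (auto simp: right_homs_def)
  have ph: "p \<in> hom ?F \<Omega>" and pr: "\<And>a f. a \<in> carrier A \<Longrightarrow> f \<in> carrier ?F \<Longrightarrow> p (ract ?F f a) = ract \<Omega> (p f) a"
    using p by (auto simp: right_homs_def)
  have sF: "s x \<in> carrier ?F" if "x \<in> carrier \<Omega>" for x
    using hom_in_carrier[OF sh that] .
  have sA: "s x i \<in> carrier A" if "x \<in> carrier \<Omega>" "i \<in> I" for x i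
    using sF[OF that(1)] that(2) by (auto simp: F_simps PiE_def)
  \<comment> \<open>The joint support of the images of the finitely many generators.\<close>
  define J where "J = (\<Union>g\<in>S. {i \<in> I. s g i \<noteq> \<zero>\<^bsub>A\<^esub>})"
  have J: "finite J" "J \<subseteq> I"
    using S sF by (auto simp: J_def F_simps)
  define coord where "coord i = (\<lambda>x\<in>carrier \<Omega>. s x i)" for i
  have s_add: "s (x \<boxplus>\<^bsub>\<Omega>\<^esub> y) i = s x i \<oplus>\<^bsub>A\<^esub> s y i" if "x \<in> carrier \<Omega>" "y \<in> carrier \<Omega>" "i \<in> I" for x y i
    using hom_mult[OF sh that(1,2)] that(3) by (simp add: F_simps)
  have s_ract: "s (ract \<Omega> x a) i = s x i \<otimes>\<^bsub>A\<^esub> a" if "x \<in> carrier \<Omega>" "a \<in> carrier A" "i \<in> I" for x a i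
    using sr[OF that(2,1)] that(3) by (simp add: F_simps)
  have coord_closed: "coord i \<in> carrier (left_dual A \<Omega>)" if "i \<in> I" for i
    using that by (simp add: left_dual_iff coord_def sA s_add s_ract ract_closed)
  have coord_hom: "(\<lambda>x. s x i) \<in> hom \<Omega> (add_monoid A)" if "i \<in> I" for i
    using that by (intro homI) (simp_all add: sA s_add)
  \<comment> \<open>A coordinate is right linear, so it vanishes on \<open>\<Omega>\<close> as soon
    as it vanishes on the generators.\<close>
  have supp: "s x i = \<zero>\<^bsub>A\<^esub>" if x: "x \<in> carrier \<Omega>" and i: "i \<in> I - J" for x i
  proof -
    obtain c where c: "c \<in> S \<rightarrow> carrier A" "x = finprod \<Omega> (\<lambda>s. ract \<Omega> s (c s)) S"
      using gen[OF x] by blast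
    have "s x i = finprod (add_monoid A) (\<lambda>g. s (ract \<Omega> g (c g)) i) S"
      unfolding c(2) using i S c(1)
      by (intro hom_finprod[OF M.comm_group_axioms A.comm_group_add_monoid coord_hom])
        (auto intro!: ract_closed)
    also have "\<dots> = finprod (add_monoid A) (\<lambda>g. \<zero>\<^bsub>A\<^esub>) S"
    proof (rule comm_monoid.finprod_cong')
      show "comm_monoid (add_monoid A)"
        using A.comm_group_add_monoid by (simp add: comm_group_def)
      fix g assume g: "g \<in> S"
      have "s g i = \<zero>\<^bsub>A\<^esub>" using g i by (auto simp: J_def)
      then show "s (ract \<Omega> g (c g)) i = \<zero>\<^bsub>A\<^esub>"
        using g S c i s_ract[of g "c g" i] by (auto simp: Pi_iff subset_iff)
    qed simp_all
    also have "\<dots> = \<zero>\<^bsub>A\<^esub>"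
      using comm_monoid.finprod_one[of "add_monoid A"] A.comm_group_add_monoid by (simp add: comm_group_def)
    finally show ?thesis .
  qed
  define e where "e i = (\<lambda>j\<in>I. if j = i then \<one>\<^bsub>A\<^esub> else \<zero>\<^bsub>A\<^esub>)" for i
  have eF: "e i \<in> carrier ?F" for i
  proof -
    have "{j \<in> I. e i j \<noteq> \<zero>\<^bsub>A\<^esub>} \<subseteq> {i}" by (auto simp: e_def)
    then have "finite {j \<in> I. e i j \<noteq> \<zero>\<^bsub>A\<^esub>}" by (rule finite_subset) simp
    then show ?thesis by (auto simp: F_simps) (auto simp: e_def)
  qed
  have FI: "f \<in> carrier ?F" if "f \<in> extensional I" "\<And>i. i \<in> I \<Longrightarrow> f i \<in> carrier A"
    "finite {i \<in> I. f i \<noteq> \<zero>\<^bsub>A\<^esub>}" for f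
    using that by (simp add: F_simps PiE_iff)
  have FD: "f \<in> extensional I" "i \<in> I \<Longrightarrow> f i \<in> carrier A" "finite {i \<in> I. f i \<noteq> \<zero>\<^bsub>A\<^esub>}"
    if "f \<in> carrier ?F" for f i
    using that by (simp_all add: F_simps PiE_iff)
  \<comment> \<open>The group structure of the free module is needed to form the finite sum of unit
    vectors below and to push it through \<open>p\<close>.\<close>
  have F: "comm_group ?F"
  proof (rule comm_groupI)
    fix f assume f: "f \<in> carrier ?F"
    show "\<one>\<^bsub>?F\<^esub> \<boxplus>\<^bsub>?F\<^esub> f = f"
      by (rule extensionalityI[of _ I]) (simp_all add: F_simps(2,3) FD[OF f])
    have neg: "(\<lambda>i\<in>I. \<ominus>\<^bsub>A\<^esub> f i) \<in> carrier ?F"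
    proof (rule FI)
      show "finite {i \<in> I. (\<lambda>i\<in>I. \<ominus>\<^bsub>A\<^esub> f i) i \<noteq> \<zero>\<^bsub>A\<^esub>}"
        by (rule finite_subset[OF _ FD(3)[OF f]]) auto
    qed (simp_all add: FD[OF f])
    have "(\<lambda>i\<in>I. \<ominus>\<^bsub>A\<^esub> f i) \<boxplus>\<^bsub>?F\<^esub> f = \<one>\<^bsub>?F\<^esub>"
      by (rule extensionalityI[of _ I]) (simp_all add: F_simps(2,3) FD[OF f] M.l_neg)
    with neg show "\<exists>g\<in>carrier ?F. g \<boxplus>\<^bsub>?F\<^esub> f = \<one>\<^bsub>?F\<^esub>" by blast
    fix g assume g: "g \<in> carrier ?F"
    show "f \<boxplus>\<^bsub>?F\<^esub> g \<in> carrier ?F"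
    proof (rule FI)
      have "finite ({i \<in> I. f i \<noteq> \<zero>\<^bsub>A\<^esub>} \<union> {i \<in> I. g i \<noteq> \<zero>\<^bsub>A\<^esub>})"
        using FD(3)[OF f] FD(3)[OF g] by simp
      then show "finite {i \<in> I. (f \<boxplus>\<^bsub>?F\<^esub> g) i \<noteq> \<zero>\<^bsub>A\<^esub>}"
        by (rule rev_finite_subset) (auto simp: F_simps(2))
    qed (simp_all add: F_simps(2) FD[OF f] FD[OF g])
    show "f \<boxplus>\<^bsub>?F\<^esub> g = g \<boxplus>\<^bsub>?F\<^esub> f"
      by (rule extensionalityI[of _ I]) (simp_all add: F_simps(2) FD[OF f] FD[OF g] M.a_ac)
    fix h assume h: "h \<in> carrier ?F"
    show "f \<boxplus>\<^bsub>?F\<^esub> g \<boxplus>\<^bsub>?F\<^esub> h = f \<boxplus>\<^bsub>?F\<^esub> (g \<boxplus>\<^bsub>?F\<^esub> h)"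
      by (rule extensionalityI[of _ I]) (simp_all add: F_simps(2) FD[OF f] FD[OF g] FD[OF h] M.a_ac)
  next
    show "\<one>\<^bsub>?F\<^esub> \<in> carrier ?F"
      by (rule FI) (simp_all add: F_simps(3))
  qed
  interpret F: comm_group ?F by (rule F)
  have ract_F: "ract ?F (e i) a \<in> carrier ?F" if "a \<in> carrier A" for i a
  proof -
    have "{j \<in> I. ract ?F (e i) a j \<noteq> \<zero>\<^bsub>A\<^esub>} \<subseteq> {i}"
      using that by (auto simp: e_def F_simps)
    then have "finite {j \<in> I. ract ?F (e i) a j \<noteq> \<zero>\<^bsub>A\<^esub>}" by (rule finite_subset) simp
    then show ?thesis using that by (auto simp: F_simps) (auto simp: e_def)
  qed
  \<comment> \<open>Compared coordinate by coordinate: inside \<open>J\<close> exactly one summand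
    survives, and outside \<open>J\<close> both sides vanish by \<open>supp\<close>.\<close>
  have expand: "s x = finprod ?F (\<lambda>i. ract ?F (e i) (s x i)) J" if x: "x \<in> carrier \<Omega>" for x
  proof (rule extensionalityI[of _ I])
    show "s x \<in> extensional I" using sF[OF x] by (simp add: F_simps PiE_def)
    have c: "ract ?F (e i) (s x i) \<in> carrier ?F" if "i \<in> J" for i
      using that J x by (intro ract_F sA) auto
    then have "finprod ?F (\<lambda>i. ract ?F (e i) (s x i)) J \<in> carrier ?F"
      by (intro F.finprod_closed) auto
    then show "finprod ?F (\<lambda>i. ract ?F (e i) (s x i)) J \<in> extensional I"
      by (simp add: F_simps PiE_def)
    fix j assume j: "j \<in> I"
    have evj: "(\<lambda>f. f j) \<in> hom ?F (add_monoid A)"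
      by (rule homI) (simp_all add: j F_simps(2) FD)
    have "finprod ?F (\<lambda>i. ract ?F (e i) (s x i)) J j = finprod (add_monoid A) (\<lambda>i. ract ?F (e i) (s x i) j) J"
      by (rule hom_finprod[OF F A.comm_group_add_monoid evj c])
    also have "\<dots> = finprod (add_monoid A) (\<lambda>i. if i = j then s x i else \<zero>\<^bsub>A\<^esub>) J"
      using J j x sA[OF x]
      by (intro comm_monoid.finprod_cong') (auto simp: F_simps e_def comm_group.axioms(1)[OF A.comm_group_add_monoid])
    also have "\<dots> = s x j"
    proof (cases "j \<in> J")
      case True
      then show ?thesis
        using J sA[OF x] comm_monoid.finprod_singleton_swap[of "add_monoid A" j J "s x"]
          comm_group.axioms(1)[OF A.comm_group_add_monoid] by (auto simp: Pi_iff subset_iff eq_commute cong: if_cong)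
    next
      case False
      then have "finprod (add_monoid A) (\<lambda>i. if i = j then s x i else \<zero>\<^bsub>A\<^esub>) J = finprod (add_monoid A) (\<lambda>i. \<zero>\<^bsub>A\<^esub>) J"
        by (intro comm_monoid.finprod_cong') (auto simp: comm_group.axioms(1)[OF A.comm_group_add_monoid])
      then show ?thesis
        using False j supp[OF x, of j] comm_monoid.finprod_one[of "add_monoid A"]
          comm_group.axioms(1)[OF A.comm_group_add_monoid] by simp
    qed
    finally show "s x j = finprod ?F (\<lambda>i. ract ?F (e i) (s x i)) J j" by simp
  qed
  have "calculus_with_dual_basis K A \<Omega> d J (\<lambda>i. p (e i)) coord"
  proof (intro calculus_with_dual_basis.intro differential_calculus_axioms calculus_with_dual_basis_axioms.intro J(1))
    show "p (e i) \<in> carrier \<Omega>" for i by (rule hom_in_carrier[OF ph eF])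
    show "coord i \<in> carrier (left_dual A \<Omega>)" if "i \<in> J" for i
      using coord_closed that J by blast
    fix x assume x: "x \<in> carrier \<Omega>"
    have "x = p (finprod ?F (\<lambda>i. ract ?F (e i) (s x i)) J)"
      using ps[OF x] expand[OF x] by simp
    also have "\<dots> = finprod \<Omega> (\<lambda>i. p (ract ?F (e i) (s x i))) J"
      by (rule hom_finprod[OF F M.comm_group_axioms ph]) (use J x in \<open>auto intro!: ract_F sA\<close>)
    also have "\<dots> = finprod \<Omega> (\<lambda>i. ract \<Omega> (p (e i)) (coord i x)) J"
      using J x sA[OF x] by (intro M.finprod_cong') (auto simp: pr eF coord_def intro!: ract_closed hom_in_carrier[OF ph])
    finally show "x = finprod \<Omega> (\<lambda>i. ract \<Omega> (p (e i)) (coord i x)) J" .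
  qed
  then show ?thesis by blast
qed

context calculus_with_dual_basis
begin

definition ev :: "('a, 'a, 'm) bimod \<Rightarrow> ('w \<Rightarrow> 'a) \<Rightarrow> ('w \<times> 'm \<Rightarrow>\<^sub>0 int) set \<Rightarrow> 'm" where
  "ev M x = tensor_lift A \<Omega> M M (\<lambda>\<omega> m. lact M (x \<omega>) m)"

text \<open>For left linear \<open>\<theta>\<close> the value does not depend on the dual basis: by
  \<open>ev_coev\<close> and \<open>ev_eqI\<close> it is the only element whose evaluation at each
  \<open>x\<close> is \<open>\<theta> x\<close>.\<close>

definition coev :: "('a, 'a, 'm) bimod \<Rightarrow> (('w \<Rightarrow> 'a) \<Rightarrow> 'm) \<Rightarrow> ('w \<times> 'm \<Rightarrow>\<^sub>0 int) set" where
  "coev M \<theta> = finprod (tensor A \<Omega> M) (\<lambda>i. tens A \<Omega> M (w i) (\<theta> (xs i))) J"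

lemma eval_add: "x \<in> carrier X \<Longrightarrow> \<omega> \<in> carrier \<Omega> \<Longrightarrow> \<eta> \<in> carrier \<Omega> \<Longrightarrow> x (\<omega> \<boxplus>\<^bsub>\<Omega>\<^esub> \<eta>) = x \<omega> \<oplus>\<^bsub>A\<^esub> x \<eta>"
  and eval_ract: "x \<in> carrier X \<Longrightarrow> \<omega> \<in> carrier \<Omega> \<Longrightarrow> a \<in> carrier A \<Longrightarrow> x (ract \<Omega> \<omega> a) = x \<omega> \<otimes>\<^bsub>A\<^esub> a"
  unfolding left_dual_iff by blast+

lemma
  assumes \<omega>: "\<omega> \<in> carrier \<Omega>"
  shows X_add_eval: "(x \<boxplus>\<^bsub>X\<^esub> y) \<omega> = x \<omega> \<oplus>\<^bsub>A\<^esub> y \<omega>"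
    and X_lact_eval: "lact X a x \<omega> = a \<otimes>\<^bsub>A\<^esub> x \<omega>"
    and X_ract_eval: "ract X x a \<omega> = x (lact \<Omega> a \<omega>)"
  using \<omega> by (simp_all add: left_dual_simps)

text \<open>Apply the right linear map \<open>x\<close> to the dual basis expansion of \<omega>. The
  coefficients \<open>xs i \<omega>\<close> come out on the right, which is the value at \<omega> of
  the sum on the left.\<close>

lemma dual_basis_X:
  assumes x: "x \<in> carrier X"
  shows "finprod X (\<lambda>i. lact X (x (w i)) (xs i)) J = x"
proof (rule left_dual_eqI)
  have c: "lact X (x (w i)) (xs i) \<in> carrier X" if "i \<in> J" for i
    using that x by (simp add: X.lact_closed xs_closed eval_closed w_closed)
  show "finprod X (\<lambda>i. lact X (x (w i)) (xs i)) J \<in> carrier X"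
    using c by (intro X.M.finprod_closed) auto
  fix \<omega> assume \<omega>: "\<omega> \<in> carrier \<Omega>"
  have h: "(\<lambda>x. x \<omega>) \<in> hom X (add_monoid A)"
    by (rule homI) (simp_all add: eval_closed X_add_eval \<omega>)
  have hx: "x \<in> hom \<Omega> (add_monoid A)"
    by (rule homI) (simp_all add: x eval_closed eval_add)
  note aA = A.comm_group_add_monoid
  have "finprod X (\<lambda>i. lact X (x (w i)) (xs i)) J \<omega>
      = finprod (add_monoid A) (\<lambda>i. lact X (x (w i)) (xs i) \<omega>) J"
    by (rule hom_finprod[OF X.M.comm_group_axioms aA h c])
  also have "\<dots> = finprod (add_monoid A) (\<lambda>i. x (ract \<Omega> (w i) (xs i \<omega>))) J"
    using x \<omega> by (intro comm_monoid.finprod_cong' comm_group.axioms(1)[OF aA])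
      (auto simp: X_lact_eval eval_ract w_closed eval_closed xs_closed ract_closed)
  also have "\<dots> = x (finprod \<Omega> (\<lambda>i. ract \<Omega> (w i) (xs i \<omega>)) J)"
    by (rule hom_finprod[symmetric, OF M.comm_group_axioms aA hx])
      (use \<omega> in \<open>simp add: w_closed eval_closed xs_closed ract_closed\<close>)
  also have "\<dots> = x \<omega>"
    using dual_basis[OF \<omega>] by simp
  finally show "finprod X (\<lambda>i. lact X (x (w i)) (xs i)) J \<omega> = x \<omega>" .
qed (rule x)

end

section \<open>Evaluation and coevaluation with values in a bimodule\<close>

locale module_over_calculus = calculus_with_dual_basis K A \<Omega> d J w xs + m: bimodule K A M
  for K :: "('k, 'z) ring_scheme" and A :: "('k, 'a) module" and \<Omega> :: "('a, 'a, 'w) bimod"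
    and d :: "'a \<Rightarrow> 'w" and J :: "'i set" and w :: "'i \<Rightarrow> 'w" and xs :: "'i \<Rightarrow> 'w \<Rightarrow> 'a"
    and M :: "('a, 'a, 'm) bimod"
begin

abbreviation "\<Omega>M \<equiv> tensor A \<Omega> M"
abbreviation "M\<Omega> \<equiv> tensor A M \<Omega>"

sublocale \<Omega>M: balanced_pair A \<Omega> M
  by (rule balanced_pair_bimodules[OF bimodule_axioms m.bimodule_axioms])

sublocale M\<Omega>: balanced_pair A M \<Omega>
  by (rule balanced_pair_bimodules[OF m.bimodule_axioms bimodule_axioms])

lemmas \<Omega>M_lact_hom = lact_tensor_hom[OF bimodule_axioms m.bimodule_axioms]
lemmas \<Omega>M_lact_tens = lact_tens[OF bimodule_axioms m.bimodule_axioms]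
lemmas \<Omega>M_ract_hom = ract_tensor_hom[OF bimodule_axioms m.bimodule_axioms]
lemmas \<Omega>M_ract_tens = ract_tens[OF bimodule_axioms m.bimodule_axioms]
lemmas M\<Omega>_lact_hom = lact_tensor_hom[OF m.bimodule_axioms bimodule_axioms]
lemmas M\<Omega>_lact_tens = lact_tens[OF m.bimodule_axioms bimodule_axioms]
lemmas M\<Omega>_ract_hom = ract_tensor_hom[OF m.bimodule_axioms bimodule_axioms]
lemmas M\<Omega>_ract_tens = ract_tens[OF m.bimodule_axioms bimodule_axioms]

lemma
  assumes x: "x \<in> carrier X"
  shows ev_hom: "ev M x \<in> hom \<Omega>M M"
    and ev_tens: "\<omega> \<in> carrier \<Omega> \<Longrightarrow> n \<in> carrier M \<Longrightarrow> ev M x (tens A \<Omega> M \<omega> n) = lact M (x \<omega>) n"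
proof -
  have "balanced A \<Omega> M M (\<lambda>\<omega> m. lact M (x \<omega>) m)"
    unfolding balanced_def
    using x by (simp add: m.lact_closed eval_closed eval_add eval_ract m.add_lact m.lact_add m.mult_lact)
  note e = \<Omega>M.tensor_lift_hom[OF m.M.comm_group_axioms this] \<Omega>M.tensor_lift_tens[OF m.M.comm_group_axioms this]
  show "ev M x \<in> hom \<Omega>M M"
    "\<omega> \<in> carrier \<Omega> \<Longrightarrow> n \<in> carrier M \<Longrightarrow> ev M x (tens A \<Omega> M \<omega> n) = lact M (x \<omega>) n"
    unfolding ev_def using e by simp_all
qed

lemma ev_closed: "x \<in> carrier X \<Longrightarrow> t \<in> carrier \<Omega>M \<Longrightarrow> ev M x t \<in> carrier M"
  by (rule hom_in_carrier[OF ev_hom])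

lemma ev_add: "x \<in> carrier X \<Longrightarrow> t \<in> carrier \<Omega>M \<Longrightarrow> u \<in> carrier \<Omega>M \<Longrightarrow>
    ev M x (t \<boxplus>\<^bsub>\<Omega>M\<^esub> u) = ev M x t \<boxplus>\<^bsub>M\<^esub> ev M x u"
  by (rule hom_mult[OF ev_hom])

lemma m_lact_hom: "a \<in> carrier A \<Longrightarrow> lact M a \<in> hom M M"
  by (rule homI) (simp_all add: m.lact_closed m.lact_add)

lemma m_ract_hom: "a \<in> carrier A \<Longrightarrow> (\<lambda>n. ract M n a) \<in> hom M M"
  by (rule homI) (simp_all add: m.ract_closed m.ract_add)

lemma \<Omega>M_lact_closed: "a \<in> carrier A \<Longrightarrow> t \<in> carrier \<Omega>M \<Longrightarrow> lact \<Omega>M a t \<in> carrier \<Omega>M"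
  by (rule hom_in_carrier[OF \<Omega>M_lact_hom])

lemma \<Omega>M_ract_closed: "a \<in> carrier A \<Longrightarrow> t \<in> carrier \<Omega>M \<Longrightarrow> ract \<Omega>M t a \<in> carrier \<Omega>M"
  by (rule hom_in_carrier[OF \<Omega>M_ract_hom])

lemma M\<Omega>_lact_closed: "a \<in> carrier A \<Longrightarrow> t \<in> carrier M\<Omega> \<Longrightarrow> lact M\<Omega> a t \<in> carrier M\<Omega>"
  by (rule hom_in_carrier[OF M\<Omega>_lact_hom])

lemma M\<Omega>_ract_closed: "a \<in> carrier A \<Longrightarrow> t \<in> carrier M\<Omega> \<Longrightarrow> ract M\<Omega> t a \<in> carrier M\<Omega>"
  by (rule hom_in_carrier[OF M\<Omega>_ract_hom])

text \<open>The right action on the dual is defined by (x a)(\<omega>) = x(a \<omega>). This is how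
  the term with the right action enters the relation for x followed by a when the left Leibniz rule
  is evaluated.\<close>

lemma ev_lact:
  assumes "a \<in> carrier A" "x \<in> carrier X" "t \<in> carrier \<Omega>M"
  shows "ev M x (lact \<Omega>M a t) = ev M (ract X x a) t"
  by (rule \<Omega>M.tensor_hom_eqI[where x = t, OF hom_compose'[OF \<Omega>M_lact_hom ev_hom] ev_hom m.M.is_group])
    (use assms in \<open>simp_all add: X.ract_closed \<Omega>M_lact_tens ev_tens lact_closed X_ract_eval\<close>)

text \<open>The right action of the tensor product sits on the factor \<open>M\<close> and passes
  through the evaluation, because the two actions on \<open>M\<close> commute. It leaves
  \<open>x\<close> untouched, in contrast to \<open>ev_lact\<close>.\<close>

lemma ev_ract:
  assumes "a \<in> carrier A" "x \<in> carrier X" "t \<in> carrier \<Omega>M"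
  shows "ev M x (ract \<Omega>M t a) = ract M (ev M x t) a"
  by (rule \<Omega>M.tensor_hom_eqI[where x = t, OF hom_compose'[OF \<Omega>M_ract_hom ev_hom] hom_compose'[OF ev_hom m_ract_hom] m.M.is_group])
    (use assms in \<open>simp_all add: \<Omega>M_ract_tens ev_tens m.ract_closed m.lact_ract eval_closed\<close>)

lemma lact_ev:
  assumes "a \<in> carrier A" "x \<in> carrier X" "t \<in> carrier \<Omega>M"
  shows "lact M a (ev M x t) = ev M (lact X a x) t"
  by (rule \<Omega>M.tensor_hom_eqI[where x = t, OF hom_compose'[OF ev_hom m_lact_hom] ev_hom m.M.is_group])
    (use assms in \<open>simp_all add: ev_tens X.lact_closed X_lact_eval m.mult_lact eval_closed\<close>)

lemma ev_add_left:
  assumes "x \<in> carrier X" "y \<in> carrier X" "t \<in> carrier \<Omega>M"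
  shows "ev M (x \<boxplus>\<^bsub>X\<^esub> y) t = ev M x t \<boxplus>\<^bsub>M\<^esub> ev M y t"
  by (rule \<Omega>M.tensor_hom_eqI[where x = t, OF ev_hom m.M.hom_mult_pointwise[OF ev_hom ev_hom] m.M.is_group])
    (use assms in \<open>simp_all add: ev_tens X_add_eval m.add_lact eval_closed\<close>)

lemma coev_closed:
  assumes "\<And>x. x \<in> carrier X \<Longrightarrow> \<theta> x \<in> carrier M"
  shows "coev M \<theta> \<in> carrier \<Omega>M"
  unfolding coev_def using assms by (intro \<Omega>M.T.finprod_closed) (auto simp: w_closed xs_closed)

text \<open>Left linearity draws the coefficients \<open>x (w i)\<close> into the argument of
  \<open>\<theta>\<close>, where the sum is \<open>x\<close> by \<open>dual_basis_X\<close>.\<close>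

lemma ev_coev:
  assumes \<theta>: "\<theta> \<in> left_homs A X M" and x: "x \<in> carrier X"
  shows "ev M x (coev M \<theta>) = \<theta> x"
proof -
  have h: "\<theta> \<in> hom X M" and l: "\<And>a y. a \<in> carrier A \<Longrightarrow> y \<in> carrier X \<Longrightarrow> \<theta> (lact X a y) = lact M a (\<theta> y)"
    using \<theta> by (auto simp: left_homs_def)
  have c: "\<theta> y \<in> carrier M" if "y \<in> carrier X" for y
    using hom_in_carrier[OF h that] .
  have "ev M x (coev M \<theta>) = finprod M (\<lambda>i. ev M x (tens A \<Omega> M (w i) (\<theta> (xs i)))) J"
    unfolding coev_def
    by (rule hom_finprod[OF \<Omega>M.comm_group_tensor m.M.comm_group_axioms ev_hom[OF x]])
      (simp add: w_closed c xs_closed)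
  also have "\<dots> = finprod M (\<lambda>i. \<theta> (lact X (x (w i)) (xs i))) J"
    using x by (intro m.M.finprod_cong') (auto simp: ev_tens w_closed c xs_closed l eval_closed X.lact_closed m.lact_closed)
  also have "\<dots> = \<theta> (finprod X (\<lambda>i. lact X (x (w i)) (xs i)) J)"
    by (rule hom_finprod[symmetric, OF X.M.comm_group_axioms m.M.comm_group_axioms h])
      (use x in \<open>simp add: w_closed xs_closed eval_closed X.lact_closed\<close>)
  finally show ?thesis
    by (simp add: dual_basis_X x)
qed

text \<open>On an elementary tensor the coefficient \<open>xs i \<omega>\<close> crosses the tensor
  sign, and the sum in the first factor is the dual basis expansion of \<omega>.\<close>

lemma coev_ev:
  assumes "t \<in> carrier \<Omega>M"
  shows "coev M (\<lambda>x. ev M x t) = t"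
  unfolding coev_def
proof (rule \<Omega>M.tensor_hom_eqI[where x = t])
  show "(\<lambda>t. finprod \<Omega>M (\<lambda>i. tens A \<Omega> M (w i) (ev M (xs i) t)) J) \<in> hom \<Omega>M \<Omega>M"
    by (rule \<Omega>M.T.hom_finprod_pointwise[OF \<Omega>M.T.is_group hom_compose'[OF ev_hom \<Omega>M.tens_hom_right]])
      (simp_all add: xs_closed w_closed)
  show "(\<lambda>t. t) \<in> hom \<Omega>M \<Omega>M" by (rule hom_ident)
  fix \<omega> n assume \<omega>: "\<omega> \<in> carrier \<Omega>" and n: "n \<in> carrier M"
  have "finprod \<Omega>M (\<lambda>i. tens A \<Omega> M (w i) (ev M (xs i) (tens A \<Omega> M \<omega> n))) J
      = finprod \<Omega>M (\<lambda>i. tens A \<Omega> M (ract \<Omega> (w i) (xs i \<omega>)) n) J"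
    using \<omega> n by (intro \<Omega>M.T.finprod_cong')
      (auto simp: ev_tens xs_closed w_closed eval_closed \<Omega>M.tens_balanced ract_closed)
  also have "\<dots> = tens A \<Omega> M (finprod \<Omega> (\<lambda>i. ract \<Omega> (w i) (xs i \<omega>)) J) n"
    by (rule hom_finprod[symmetric, OF M.comm_group_axioms \<Omega>M.comm_group_tensor \<Omega>M.tens_hom_left[OF n]])
      (use \<omega> in \<open>simp add: w_closed xs_closed eval_closed ract_closed\<close>)
  also have "\<dots> = tens A \<Omega> M \<omega> n"
    using dual_basis[OF \<omega>] by simp
  finally show "finprod \<Omega>M (\<lambda>i. tens A \<Omega> M (w i) (ev M (xs i) (tens A \<Omega> M \<omega> n))) J = tens A \<Omega> M \<omega> n" .
qed (use assms \<Omega>M.T.is_group in simp_all)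

text \<open>An element is rebuilt by \<open>coev\<close> from its evaluations, so these separate
  points. Equations in \<Omega> \<otimes> M are reduced in this way to equations in
  \<open>M\<close>, where the relations of the algebra can be applied.\<close>

lemma ev_eqI:
  assumes "t \<in> carrier \<Omega>M" "u \<in> carrier \<Omega>M" "\<And>x. x \<in> carrier X \<Longrightarrow> ev M x t = ev M x u"
  shows "t = u"
proof -
  have "coev M (\<lambda>x. ev M x t) = coev M (\<lambda>x. ev M x u)"
    unfolding coev_def using assms
    by (intro \<Omega>M.T.finprod_cong') (auto simp: xs_closed w_closed ev_closed)
  then show ?thesis using assms by (simp add: coev_ev)
qed

end

context calculus_with_dual_basis
begin

lemma module_over_calculusI: "bimodule K A M \<Longrightarrow> module_over_calculus K A \<Omega> d J w xs M"
  by (intro module_over_calculus.intro calculus_with_dual_basis_axioms)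

text \<open>Evaluation multiplies the component in \<open>M\<close> from the left by an element of
  \<open>A\<close>, and \<open>f\<close> commutes with that. Compatibility of a morphism with a
  connection thereby becomes commutation with operators on the modules.\<close>

lemma ev_tensor_map:
  assumes M: "bimodule K A M" and N: "bimodule K A N" and f: "f \<in> bimod_homs A M N"
    and x: "x \<in> carrier X" and t: "t \<in> carrier (tensor A \<Omega> M)"
  shows "ev N x (tensor_map A \<Omega> N id f t) = f (ev M x t)"
proof -
  interpret m: module_over_calculus K A \<Omega> d J w xs M by (rule module_over_calculusI[OF M])
  interpret n: module_over_calculus K A \<Omega> d J w xs N by (rule module_over_calculusI[OF N])
  note f' = bimod_homsD[OF f]
  note tm = tensor_map_right_hom[OF bimodule_axioms M N f] tensor_map_right_tens[OF bimodule_axioms M N f]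
  show ?thesis
    by (rule m.\<Omega>M.tensor_hom_eqI[where x = t, OF hom_compose'[OF tm(1) n.ev_hom] hom_compose'[OF m.ev_hom f'(1)] n.m.M.is_group])
      (use x t in \<open>simp_all add: tm(2) m.ev_tens n.ev_tens hom_in_carrier[OF f'(1)] f'(2) eval_closed\<close>)
qed


end

section \<open>From modules to connections\<close>

context calculus_with_dual_basis
begin

interpretation bx: vector_field_rep K A \<Omega> d BXA gA gB gM gX
  by (rule vector_field_rep_BX)

text \<open>The value \<open>undefined\<close> outside the carriers is what membership in the
  category of connections requires; with any other value the round trip would not return the same
  object.\<close>

definition conn_bimod where
  "conn_bimod N = \<lparr>carrier = carrier N, monoid.mult = monoid.mult N, monoid.one = monoid.one N,
     lact = (\<lambda>a m. if a \<in> carrier A \<and> m \<in> carrier N then lact N (gA a) m else undefined),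
     ract = (\<lambda>m a. if a \<in> carrier A \<and> m \<in> carrier N then lact N (gB a) m else undefined)\<rparr>"

definition conn_nabla where
  "conn_nabla N = (\<lambda>m\<in>carrier N. coev (conn_bimod N) (\<lambda>x. lact N (gX x) m))"

definition conn_sigma where
  "conn_sigma N = restrict
     (tensor_lift A (conn_bimod N) \<Omega> (tensor A \<Omega> (conn_bimod N))
       (\<lambda>m \<omega>. coev (conn_bimod N) (\<lambda>x. lact N (gM x \<omega>) m)))
     (carrier (tensor A (conn_bimod N) \<Omega>))"

lemma conn_bimod_simps [simp]:
  "carrier (conn_bimod N) = carrier N" "monoid.mult (conn_bimod N) = monoid.mult N"
  "monoid.one (conn_bimod N) = monoid.one N"
  "a \<in> carrier A \<Longrightarrow> m \<in> carrier N \<Longrightarrow> lact (conn_bimod N) a m = lact N (gA a) m"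
  "a \<in> carrier A \<Longrightarrow> m \<in> carrier N \<Longrightarrow> ract (conn_bimod N) m a = lact N (gB a) m"
  by (simp_all add: conn_bimod_def)

lemmas gA_closed = ring_hom_closed[OF bx.alpha]
lemmas gB_closed = ring_hom_closed[OF bx.beta, simplified]

text \<open>\<open>gB\<close> is a homomorphism on the opposite algebra, so acting by it from the
  left is a right action of \<open>A\<close>. The relations \<open>alpha_beta\<close> and
  \<open>alpha_scalar\<close> supply the two compatibilities between the actions.\<close>

lemma bimodule_conn_bimod:
  assumes "left_module BXA N"
  shows "bimodule K A (conn_bimod N)"
proof -
  interpret n: left_module BXA N by fact
  have grp: "comm_group (conn_bimod N)"
    by (rule comm_group_cong[OF n.M.comm_group_axioms]) simp_all
  note c = n.lact_closed gA_closed gB_closed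
  have ring: "ring A" by (rule A.ring_axioms)
  have bm: "gB (a \<otimes>\<^bsub>A\<^esub> b) = gB b \<otimes>\<^bsub>BXA\<^esub> gB a" if "a \<in> carrier A" "b \<in> carrier A" for a b
    using ring_hom_mult[OF bx.beta, of b a] that by simp
  have ba: "gB (a \<oplus>\<^bsub>A\<^esub> b) = gB a \<oplus>\<^bsub>BXA\<^esub> gB b" if "a \<in> carrier A" "b \<in> carrier A" for a b
    using ring_hom_add[OF bx.beta, of a b] that by simp
  have b1: "gB \<one>\<^bsub>A\<^esub> = \<one>\<^bsub>BXA\<^esub>"
    using ring_hom_one[OF bx.beta] by simp
  show ?thesis
  proof (intro bimodule.intro left_module.intro bimodule_axioms.intro left_module_axioms.intro
      unital_algebra_axioms ring grp)
    fix a b m assume a: "a \<in> carrier A" "b \<in> carrier A" and m: "m \<in> carrier (conn_bimod N)"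
    show "lact (conn_bimod N) (a \<oplus>\<^bsub>A\<^esub> b) m = lact (conn_bimod N) a m \<boxplus>\<^bsub>conn_bimod N\<^esub> lact (conn_bimod N) b m"
      "ract (conn_bimod N) m (a \<oplus>\<^bsub>A\<^esub> b) = ract (conn_bimod N) m a \<boxplus>\<^bsub>conn_bimod N\<^esub> ract (conn_bimod N) m b"
      using a m by (simp_all add: c ring_hom_add[OF bx.alpha] ba n.add_lact)
    show "lact (conn_bimod N) (a \<otimes>\<^bsub>A\<^esub> b) m = lact (conn_bimod N) a (lact (conn_bimod N) b m)"
      "ract (conn_bimod N) m (a \<otimes>\<^bsub>A\<^esub> b) = ract (conn_bimod N) (ract (conn_bimod N) m a) b"
      using a m by (simp_all add: c ring_hom_mult[OF bx.alpha] bm n.mult_lact)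
    show "ract (conn_bimod N) (lact (conn_bimod N) a m) b = lact (conn_bimod N) a (ract (conn_bimod N) m b)"
      using a m bx.alpha_beta[of a b] by (simp add: c flip: n.mult_lact)
  next
    fix k m assume "k \<in> carrier K" "m \<in> carrier (conn_bimod N)"
    then show "lact (conn_bimod N) (k \<odot>\<^bsub>A\<^esub> \<one>\<^bsub>A\<^esub>) m = ract (conn_bimod N) m (k \<odot>\<^bsub>A\<^esub> \<one>\<^bsub>A\<^esub>)"
      by (simp add: bx.alpha_scalar)
  qed (simp_all add: c n.lact_add n.one_lact ring_hom_one[OF bx.alpha] b1)
qed

context
  fixes N :: "(_, 'm) lmod"
  assumes N: "left_module BXA N"
begin

interpretation n: left_module BXA N by (rule N)

interpretation m: module_over_calculus K A \<Omega> d J w xs "conn_bimod N"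
  by (rule module_over_calculusI[OF bimodule_conn_bimod[OF N]])

lemma gX_left_homs: "n \<in> carrier N \<Longrightarrow> (\<lambda>x. lact N (gX x) n) \<in> left_homs A X (conn_bimod N)"
  unfolding left_homs_def
  by (simp add: hom_def n.lact_closed bx.xi_closed bx.xi_add n.add_lact gA_closed
      bx.alpha_xi[symmetric] n.mult_lact)

lemma gM_left_homs: "n \<in> carrier N \<Longrightarrow> \<omega> \<in> carrier \<Omega> \<Longrightarrow>
    (\<lambda>x. lact N (gM x \<omega>) n) \<in> left_homs A X (conn_bimod N)"
  unfolding left_homs_def
  by (simp add: hom_def n.lact_closed bx.mu_closed bx.mu_add_left n.add_lact gA_closed
      bx.alpha_mu[symmetric] n.mult_lact)

lemma conn_nabla_closed: "n \<in> carrier N \<Longrightarrow> conn_nabla N n \<in> carrier m.\<Omega>M"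
  by (simp add: conn_nabla_def m.coev_closed n.lact_closed bx.xi_closed)

lemma ev_conn_nabla: "n \<in> carrier N \<Longrightarrow> x \<in> carrier X \<Longrightarrow> ev (conn_bimod N) x (conn_nabla N n) = lact N (gX x) n"
  by (simp add: conn_nabla_def m.ev_coev gX_left_homs)

lemma
  shows conn_sigma_hom: "conn_sigma N \<in> hom m.M\<Omega> m.\<Omega>M"
    and ev_conn_sigma: "n \<in> carrier N \<Longrightarrow> \<omega> \<in> carrier \<Omega> \<Longrightarrow> x \<in> carrier X \<Longrightarrow>
      ev (conn_bimod N) x (conn_sigma N (tens A (conn_bimod N) \<Omega> n \<omega>)) = lact N (gM x \<omega>) n"
proof -
  let ?f = "\<lambda>m \<omega>. coev (conn_bimod N) (\<lambda>x. lact N (gM x \<omega>) m)"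
  have c: "?f n \<omega> \<in> carrier m.\<Omega>M" if "n \<in> carrier N" "\<omega> \<in> carrier \<Omega>" for n \<omega>
    using that by (intro m.coev_closed) (simp add: n.lact_closed bx.mu_closed)
  have e: "ev (conn_bimod N) x (?f n \<omega>) = lact N (gM x \<omega>) n"
    if "n \<in> carrier N" "\<omega> \<in> carrier \<Omega>" "x \<in> carrier X" for n \<omega> x
    using that by (simp add: m.ev_coev gM_left_homs)
  \<comment> \<open>Every clause is an equation in the tensor product and is checked after
    evaluation. That the map descends to tensors over \<open>A\<close> is the relation
    \<open>mu_beta\<close>.\<close>
  have bal: "balanced A (conn_bimod N) \<Omega> m.\<Omega>M ?f"
    unfolding balanced_def
  proof (intro conjI ballI)
    fix n n' \<omega> assume "n \<in> carrier (conn_bimod N)" "n' \<in> carrier (conn_bimod N)" "\<omega> \<in> carrier \<Omega>"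
    then show "?f (n \<boxplus>\<^bsub>conn_bimod N\<^esub> n') \<omega> = ?f n \<omega> \<boxplus>\<^bsub>m.\<Omega>M\<^esub> ?f n' \<omega>"
      by (intro m.ev_eqI m.\<Omega>M.T.m_closed c) (simp_all add: e c m.ev_add n.lact_add bx.mu_closed)
  next
    fix n \<omega> \<eta> assume "n \<in> carrier (conn_bimod N)" "\<omega> \<in> carrier \<Omega>" "\<eta> \<in> carrier \<Omega>"
    then show "?f n (\<omega> \<boxplus>\<^bsub>\<Omega>\<^esub> \<eta>) = ?f n \<omega> \<boxplus>\<^bsub>m.\<Omega>M\<^esub> ?f n \<eta>"
      by (intro m.ev_eqI m.\<Omega>M.T.m_closed c) (simp_all add: e c m.ev_add n.add_lact bx.mu_closed bx.mu_add_right)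
  next
    fix n a \<omega> assume "n \<in> carrier (conn_bimod N)" "a \<in> carrier A" "\<omega> \<in> carrier \<Omega>"
    then show "?f (ract (conn_bimod N) n a) \<omega> = ?f n (lact \<Omega> a \<omega>)"
      by (intro m.ev_eqI c)
        (simp_all add: e n.lact_closed gB_closed lact_closed bx.mu_closed bx.mu_beta flip: n.mult_lact)
  qed (simp add: c)
  note t = m.M\<Omega>.tensor_lift_hom[OF m.\<Omega>M.comm_group_tensor bal] m.M\<Omega>.tensor_lift_tens[OF m.\<Omega>M.comm_group_tensor bal]
  show "conn_sigma N \<in> hom m.M\<Omega> m.\<Omega>M"
    unfolding conn_sigma_def hom_restrict[OF m.M\<Omega>.T.is_group] by (rule t(1))
  show "n \<in> carrier N \<Longrightarrow> \<omega> \<in> carrier \<Omega> \<Longrightarrow> x \<in> carrier X \<Longrightarrow>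
      ev (conn_bimod N) x (conn_sigma N (tens A (conn_bimod N) \<Omega> n \<omega>)) = lact N (gM x \<omega>) n"
    unfolding conn_sigma_def using m.M\<Omega>.tens_closed[of n \<omega>] t(2)[of n \<omega>] by (simp add: e)
qed

lemma conn_sigma_closed: "t \<in> carrier m.M\<Omega> \<Longrightarrow> conn_sigma N t \<in> carrier m.\<Omega>M"
  by (rule hom_in_carrier[OF conn_sigma_hom])

text \<open>After evaluation at \<open>x\<close> the axioms and the relations correspond as follows:
  \<open>xi_alpha\<close> is the left Leibniz rule, \<open>xi_beta\<close> is the right one,
  \<open>mu_alpha\<close> is left linearity of \<sigma>, and \<open>beta_mu\<close> is its right
  linearity.\<close>

lemma bimodule_connection_conn: "bimodule_connection K A \<Omega> d (conn_bimod N, conn_nabla N, conn_sigma N)"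
proof -
  let ?M = "conn_bimod N"
  note c = n.lact_closed gA_closed gB_closed bx.xi_closed bx.mu_closed conn_nabla_closed
    conn_sigma_closed m.\<Omega>M_lact_closed m.\<Omega>M_ract_closed m.M\<Omega>_lact_closed m.M\<Omega>_ract_closed
    X.lact_closed X.ract_closed lact_closed ract_closed d_closed
  have hom: "conn_nabla N \<in> hom ?M m.\<Omega>M"
    by (rule homI; (rule m.ev_eqI)?) (simp_all add: c ev_conn_nabla m.ev_add n.lact_add)
  have left: "conn_nabla N (lact ?M a n) = lact m.\<Omega>M a (conn_nabla N n) \<boxplus>\<^bsub>m.\<Omega>M\<^esub> tens A \<Omega> ?M (d a) n"
    if an: "a \<in> carrier A" "n \<in> carrier N" for a n
  proof (rule m.ev_eqI)
    fix x assume x: "x \<in> carrier X"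
    have "lact N (gX x \<otimes>\<^bsub>BXA\<^esub> gA a) n = lact N (gX (ract X x a) \<oplus>\<^bsub>BXA\<^esub> gA (x (d a))) n"
      using an x by (simp add: bx.xi_alpha)
    then show "ev ?M x (conn_nabla N (lact ?M a n))
        = ev ?M x (lact m.\<Omega>M a (conn_nabla N n) \<boxplus>\<^bsub>m.\<Omega>M\<^esub> tens A \<Omega> ?M (d a) n)"
      using an x by (simp add: c ev_conn_nabla m.ev_add m.ev_lact m.ev_tens n.mult_lact n.add_lact eval_closed)
  qed (use an in \<open>simp_all add: c\<close>)
  have right: "conn_nabla N (ract ?M n a) = ract m.\<Omega>M (conn_nabla N n) a \<boxplus>\<^bsub>m.\<Omega>M\<^esub> conn_sigma N (tens A ?M \<Omega> n (d a))"
    if an: "a \<in> carrier A" "n \<in> carrier N" for a n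
  proof (rule m.ev_eqI)
    fix x assume x: "x \<in> carrier X"
    have "lact N (gX x \<otimes>\<^bsub>BXA\<^esub> gB a) n = lact N (gB a \<otimes>\<^bsub>BXA\<^esub> gX x \<oplus>\<^bsub>BXA\<^esub> gM x (d a)) n"
      using an x by (simp add: bx.xi_beta)
    then show "ev ?M x (conn_nabla N (ract ?M n a))
        = ev ?M x (ract m.\<Omega>M (conn_nabla N n) a \<boxplus>\<^bsub>m.\<Omega>M\<^esub> conn_sigma N (tens A ?M \<Omega> n (d a)))"
      using an x by (simp add: c ev_conn_nabla ev_conn_sigma m.ev_add m.ev_ract n.mult_lact n.add_lact
          bx.E.m_closed)
  qed (use an in \<open>simp_all add: c\<close>)
  \<comment> \<open>\<open>K\<close>-linearity of the connection is the left Leibniz rule for a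
    scalar, whose differential vanishes.\<close>
  have scal: "conn_nabla N (kact A ?M k n) = kact A m.\<Omega>M k (conn_nabla N n)"
    if k: "k \<in> carrier K" and n: "n \<in> carrier N" for k n
  proof -
    have "tens A \<Omega> ?M \<one>\<^bsub>\<Omega>\<^esub> n = \<one>\<^bsub>m.\<Omega>M\<^esub>"
      using hom_one[OF m.\<Omega>M.tens_hom_left[of n] M.is_group m.\<Omega>M.T.is_group] n by simp
    then show ?thesis
      using left[of "k \<odot>\<^bsub>A\<^esub> \<one>\<^bsub>A\<^esub>" n] k n unfolding kact_def by (simp add: d_scalar c)
  qed
  have sl: "conn_sigma N (lact m.M\<Omega> a t) = lact m.\<Omega>M a (conn_sigma N t)"
    if a: "a \<in> carrier A" and t: "t \<in> carrier m.M\<Omega>" for a t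
  proof (rule m.M\<Omega>.tensor_hom_eqI[where x = t, OF hom_compose'[OF m.M\<Omega>_lact_hom conn_sigma_hom]
        hom_compose'[OF conn_sigma_hom m.\<Omega>M_lact_hom] m.\<Omega>M.T.is_group])
    fix n \<omega> assume nw: "n \<in> carrier ?M" "\<omega> \<in> carrier \<Omega>"
    show "conn_sigma N (lact m.M\<Omega> a (tens A ?M \<Omega> n \<omega>)) = lact m.\<Omega>M a (conn_sigma N (tens A ?M \<Omega> n \<omega>))"
      by (rule m.ev_eqI)
        (use a nw in \<open>simp_all add: c m.M\<Omega>_lact_tens ev_conn_sigma m.ev_lact bx.mu_alpha flip: n.mult_lact\<close>)
  qed (use a t in simp_all)
  have sr: "conn_sigma N (ract m.M\<Omega> t a) = ract m.\<Omega>M (conn_sigma N t) a"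
    if a: "a \<in> carrier A" and t: "t \<in> carrier m.M\<Omega>" for a t
  proof (rule m.M\<Omega>.tensor_hom_eqI[where x = t, OF hom_compose'[OF m.M\<Omega>_ract_hom conn_sigma_hom]
        hom_compose'[OF conn_sigma_hom m.\<Omega>M_ract_hom] m.\<Omega>M.T.is_group])
    fix n \<omega> assume nw: "n \<in> carrier ?M" "\<omega> \<in> carrier \<Omega>"
    show "conn_sigma N (ract m.M\<Omega> (tens A ?M \<Omega> n \<omega>) a) = ract m.\<Omega>M (conn_sigma N (tens A ?M \<Omega> n \<omega>)) a"
      by (rule m.ev_eqI)
        (use a nw in \<open>simp_all add: c m.M\<Omega>_ract_tens ev_conn_sigma m.ev_ract bx.beta_mu flip: n.mult_lact\<close>)
  qed (use a t in simp_all)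
  show ?thesis
    unfolding bimodule_connection_def Let_def
    using hom left right scal sl sr conn_sigma_hom bimodule_conn_bimod[OF N]
    by (simp add: bimod_homs_def left_homs_def right_homs_def)
qed

end

text \<open>Commuting with \<open>gA\<close> and \<open>gB\<close> makes \<open>f\<close> a bimodule
  map. By \<open>ev_tensor_map\<close> and injectivity of evaluation, commuting with
  \<open>gX\<close> is compatibility with \<nabla>, and commuting with \<open>gM\<close> is
  compatibility with \<sigma>.\<close>

lemma conn_hom_of_left_hom:
  fixes N N' :: "(_, 'm) lmod"
  assumes N: "left_module BXA N" and N': "left_module BXA N'" and f: "f \<in> left_homs BXA N N'"
  shows "f \<in> conn_homs A \<Omega> (conn_bimod N, conn_nabla N, conn_sigma N)
    (conn_bimod N', conn_nabla N', conn_sigma N')"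
proof -
  let ?M = "conn_bimod N" and ?M' = "conn_bimod N'"
  interpret n: left_module BXA N by fact
  interpret n': left_module BXA N' by fact
  interpret m: module_over_calculus K A \<Omega> d J w xs ?M
    by (rule module_over_calculusI[OF bimodule_conn_bimod[OF N]])
  interpret m': module_over_calculus K A \<Omega> d J w xs ?M'
    by (rule module_over_calculusI[OF bimodule_conn_bimod[OF N']])
  have fh: "f \<in> hom N N'" and fl: "\<And>b n. b \<in> carrier BXA \<Longrightarrow> n \<in> carrier N \<Longrightarrow> f (lact N b n) = lact N' b (f n)"
    using f by (auto simp: left_homs_def)
  have fc: "f n \<in> carrier N'" if "n \<in> carrier N" for n using hom_in_carrier[OF fh that] .
  have fh': "f \<in> hom ?M ?M'" using fh by (simp add: hom_def)
  have fb: "f \<in> bimod_homs A ?M ?M'"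
    using fh' by (simp add: bimod_homs_def left_homs_def right_homs_def fl fc gA_closed gB_closed)
  note tr = tensor_map_right_hom[OF bimodule_axioms m.m.bimodule_axioms m'.m.bimodule_axioms fb]
    tensor_map_right_tens[OF bimodule_axioms m.m.bimodule_axioms m'.m.bimodule_axioms fb]
  note tl = tensor_map_left_hom[OF bimodule_axioms m.m.bimodule_axioms m'.m.bimodule_axioms fb]
    tensor_map_left_tens[OF bimodule_axioms m.m.bimodule_axioms m'.m.bimodule_axioms fb]
  note e = ev_tensor_map[OF m.m.bimodule_axioms m'.m.bimodule_axioms fb]
  note c = hom_in_carrier[OF tr(1)] hom_in_carrier[OF tl(1)] conn_nabla_closed[OF N] conn_nabla_closed[OF N']
    conn_sigma_closed[OF N] conn_sigma_closed[OF N'] fc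
  have nab: "tensor_map A \<Omega> ?M' id f (conn_nabla N n) = conn_nabla N' (f n)" if n: "n \<in> carrier N" for n
    by (rule m'.ev_eqI) (use n in \<open>simp_all add: c e ev_conn_nabla[OF N] ev_conn_nabla[OF N'] fl bx.xi_closed\<close>)
  have sig: "conn_sigma N' (tensor_map A ?M' \<Omega> f id t) = tensor_map A \<Omega> ?M' id f (conn_sigma N t)"
    if t: "t \<in> carrier m.M\<Omega>" for t
  proof (rule m.M\<Omega>.tensor_hom_eqI[where x = t, OF hom_compose'[OF tl(1) conn_sigma_hom[OF N']]
        hom_compose'[OF conn_sigma_hom[OF N] tr(1)] m'.\<Omega>M.T.is_group])
    fix n \<omega> assume nw: "n \<in> carrier ?M" "\<omega> \<in> carrier \<Omega>"
    show "conn_sigma N' (tensor_map A ?M' \<Omega> f id (tens A ?M \<Omega> n \<omega>))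
        = tensor_map A \<Omega> ?M' id f (conn_sigma N (tens A ?M \<Omega> n \<omega>))"
      by (rule m'.ev_eqI)
        (use nw in \<open>simp_all add: tl(2) c e ev_conn_sigma[OF N] ev_conn_sigma[OF N'] fl bx.mu_closed\<close>)
  qed (rule t)
  show ?thesis
    unfolding conn_homs_def using fb nab sig by simp
qed

end

section \<open>From connections to modules\<close>

text \<open>Together with \<open>BX_generated\<close> this reduces linearity over the whole algebra
  to the four families of generators.\<close>

lemma subring_intertwined:
  assumes "left_module R M" "left_module R N" and f: "f \<in> hom M N"
  shows "subring {r \<in> carrier R. \<forall>m\<in>carrier M. f (lact M r m) = lact N r (f m)} R"
proof -
  interpret m: left_module R M by fact
  interpret n: left_module R N by fact
  have fc: "f m \<in> carrier N" if "m \<in> carrier M" for m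
    using hom_in_carrier[OF f that] .
  have fm: "f (x \<boxplus>\<^bsub>M\<^esub> y) = f x \<boxplus>\<^bsub>N\<^esub> f y" if "x \<in> carrier M" "y \<in> carrier M" for x y
    using hom_mult[OF f that] .
  interpret f: group_hom M N f
    using f m.M.is_group n.M.is_group by (simp add: group_hom_def group_hom_axioms_def)
  have minv: "lact M (\<ominus>\<^bsub>R\<^esub> r) x = inv\<^bsub>M\<^esub> (lact M r x)" if "r \<in> carrier R" "x \<in> carrier M" for r x
  proof -
    have "(\<lambda>r. lact M r x) \<in> hom (add_monoid R) M"
      using that by (intro homI) (simp_all add: m.lact_closed m.add_lact)
    then interpret h: group_hom "add_monoid R" M "\<lambda>r. lact M r x"
      using m.M.is_group m.R.a_group by (simp add: group_hom_def group_hom_axioms_def)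
    show ?thesis using h.hom_inv[of r] that by (simp add: a_inv_def)
  qed
  have ninv: "lact N (\<ominus>\<^bsub>R\<^esub> r) x = inv\<^bsub>N\<^esub> (lact N r x)" if "r \<in> carrier R" "x \<in> carrier N" for r x
  proof -
    have "(\<lambda>r. lact N r x) \<in> hom (add_monoid R) N"
      using that by (intro homI) (simp_all add: n.lact_closed n.add_lact)
    then interpret h: group_hom "add_monoid R" N "\<lambda>r. lact N r x"
      using n.M.is_group m.R.a_group by (simp add: group_hom_def group_hom_axioms_def)
    show ?thesis using h.hom_inv[of r] that by (simp add: a_inv_def)
  qed
  show ?thesis
    by (rule m.R.subringI)
      (auto simp: m.one_lact n.one_lact m.mult_lact n.mult_lact m.add_lact n.add_lact minv ninv
        m.lact_closed fc fm f.hom_inv)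
qed

context calculus_with_dual_basis
begin

interpretation bx: vector_field_rep K A \<Omega> d BXA gA gB gM gX
  by (rule vector_field_rep_BX)

definition conn_rep_op where
  "conn_rep_op M a = (\<lambda>m\<in>carrier M. ract M m a)"

definition conn_rep_M where
  "conn_rep_M M \<sigma> x \<omega> = (\<lambda>m\<in>carrier M. ev M x (\<sigma> (tens A M \<Omega> m \<omega>)))"

definition conn_rep_X where
  "conn_rep_X M nabla x = (\<lambda>m\<in>carrier M. ev M x (nabla m))"

text \<open>\<open>BX_universal\<close>, applied to the operators of the connection, guarantees that
  the description is satisfiable. Afterwards only its values on the generators are used, along with
  the fact that it is a ring homomorphism.\<close>

definition conn_act where
  "conn_act M nabla \<sigma> = (SOME h. h \<in> ring_hom BXA (End_ring M) \<and>
     (\<forall>a\<in>carrier A. h (gA a) = end_of M a) \<and> (\<forall>a\<in>carrier A. h (gB a) = conn_rep_op M a) \<and>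
     (\<forall>x\<in>carrier X. \<forall>\<omega>\<in>carrier \<Omega>. h (gM x \<omega>) = conn_rep_M M \<sigma> x \<omega>) \<and>
     (\<forall>x\<in>carrier X. h (gX x) = conn_rep_X M nabla x))"

definition mod_of where
  "mod_of M nabla \<sigma> = \<lparr>carrier = carrier M, monoid.mult = monoid.mult M, monoid.one = monoid.one M,
     lact = (\<lambda>b m. if b \<in> carrier BXA \<and> m \<in> carrier M then conn_act M nabla \<sigma> b m else undefined)\<rparr>"

lemma mod_of_simps [simp]:
  "carrier (mod_of M nabla \<sigma>) = carrier M" "monoid.mult (mod_of M nabla \<sigma>) = monoid.mult M"
  "monoid.one (mod_of M nabla \<sigma>) = monoid.one M"
  "b \<in> carrier BXA \<Longrightarrow> m \<in> carrier M \<Longrightarrow> lact (mod_of M nabla \<sigma>) b m = conn_act M nabla \<sigma> b m"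
  by (simp_all add: mod_of_def)

lemma bimodule_connectionD:
  assumes "bimodule_connection K A \<Omega> d (M, nabla, \<sigma>)"
  shows "bimodule K A M" "nabla \<in> hom M (tensor A \<Omega> M)"
    "\<sigma> \<in> bimod_homs A (tensor A M \<Omega>) (tensor A \<Omega> M)"
    "a \<in> carrier A \<Longrightarrow> m \<in> carrier M \<Longrightarrow> nabla (lact M a m) =
      lact (tensor A \<Omega> M) a (nabla m) \<boxplus>\<^bsub>tensor A \<Omega> M\<^esub> tens A \<Omega> M (d a) m"
    "a \<in> carrier A \<Longrightarrow> m \<in> carrier M \<Longrightarrow> nabla (ract M m a) =
      ract (tensor A \<Omega> M) (nabla m) a \<boxplus>\<^bsub>tensor A \<Omega> M\<^esub> \<sigma> (tens A M \<Omega> m (d a))"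
  using assms unfolding bimodule_connection_def Let_def prod.case by blast+

context
  fixes M :: "('a, 'a, 'm) bimod" and nabla \<sigma>
  assumes conn: "bimodule_connection K A \<Omega> d (M, nabla, \<sigma>)"
begin

interpretation m: module_over_calculus K A \<Omega> d J w xs M
  by (rule module_over_calculusI[OF bimodule_connectionD(1)[OF conn]])

lemma nabla_closed: "m \<in> carrier M \<Longrightarrow> nabla m \<in> carrier m.\<Omega>M"
  using hom_in_carrier[OF bimodule_connectionD(2)[OF conn]] .

lemma sigma_hom: "\<sigma> \<in> hom m.M\<Omega> m.\<Omega>M"
  and sigma_lact: "a \<in> carrier A \<Longrightarrow> t \<in> carrier m.M\<Omega> \<Longrightarrow> \<sigma> (lact m.M\<Omega> a t) = lact m.\<Omega>M a (\<sigma> t)"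
  and sigma_ract: "a \<in> carrier A \<Longrightarrow> t \<in> carrier m.M\<Omega> \<Longrightarrow> \<sigma> (ract m.M\<Omega> t a) = ract m.\<Omega>M (\<sigma> t) a"
  using bimod_homsD[OF bimodule_connectionD(3)[OF conn]] by auto

lemma sigma_closed: "t \<in> carrier m.M\<Omega> \<Longrightarrow> \<sigma> t \<in> carrier m.\<Omega>M"
  using hom_in_carrier[OF sigma_hom] .

text \<open>The correspondence in \<open>bimodule_connection_conn\<close> read backwards, as
  equations of endomorphisms checked pointwise. The relation \<open>mu_beta\<close> comes from the
  tensor product over \<open>A\<close>, and left linearity in \<open>x\<close> comes from
  \<open>lact_ev\<close>.\<close>

lemma vector_field_rep_conn:
  "vector_field_rep K A \<Omega> d (End_ring M) (end_of M) (conn_rep_op M) (conn_rep_M M \<sigma>) (conn_rep_X M nabla)"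
proof -
  interpret E: ring "End_ring M" by (rule m.m.M.ring_End_ring)
  have res: "restrict f (carrier M) \<in> carrier (End_ring M)" if "f \<in> hom M M" for f
    using that by (simp add: End_ring_simps hom_restrict m.m.M.is_group)
  have cA: "end_of M a \<in> carrier (End_ring M)" if "a \<in> carrier A" for a
    unfolding end_of_def by (intro res m.m_lact_hom that)
  have cB: "conn_rep_op M a \<in> carrier (End_ring M)" if "a \<in> carrier A" for a
    unfolding conn_rep_op_def by (intro res m.m_ract_hom that)
  have cM: "conn_rep_M M \<sigma> x \<omega> \<in> carrier (End_ring M)" if "x \<in> carrier X" "\<omega> \<in> carrier \<Omega>" for x \<omega>
    unfolding conn_rep_M_def
    by (rule res, rule hom_compose'[OF m.M\<Omega>.tens_hom_left[OF that(2)] hom_compose'[OF sigma_hom m.ev_hom[OF that(1)]]])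
  have cX: "conn_rep_X M nabla x \<in> carrier (End_ring M)" if "x \<in> carrier X" for x
    unfolding conn_rep_X_def
    by (rule res, rule hom_compose'[OF bimodule_connectionD(2)[OF conn] m.ev_hom[OF that]])
  have vA: "end_of M a m = lact M a m" if "m \<in> carrier M" for a m
    using that by (simp add: end_of_def)
  have vB: "conn_rep_op M a m = ract M m a" if "m \<in> carrier M" for a m
    using that by (simp add: conn_rep_op_def)
  have vM: "conn_rep_M M \<sigma> x \<omega> m = ev M x (\<sigma> (tens A M \<Omega> m \<omega>))" if "m \<in> carrier M" for x \<omega> m
    using that by (simp add: conn_rep_M_def)
  have vX: "conn_rep_X M nabla x m = ev M x (nabla m)" if "m \<in> carrier M" for x m
    using that by (simp add: conn_rep_X_def)
  note v = vA vB vM vX End_ring_simps(2-)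
  note c = cA cB cM cX E.m_closed E.a_closed m.m.lact_closed m.m.ract_closed X.lact_closed X.ract_closed
    lact_closed ract_closed d_closed eval_closed nabla_closed sigma_closed m.ev_closed
    m.\<Omega>M_lact_closed m.\<Omega>M_ract_closed X.M.m_closed M.m_closed
  note Q = End_ring_eqI[where M = M]
  show ?thesis
  proof (intro vector_field_rep.intro vector_field_rep_axioms.intro differential_calculus_axioms E.ring_axioms)
    show "end_of M \<in> ring_hom A (End_ring M)" by (rule m.m.end_of_ring_hom)
    show "conn_rep_op M \<in> ring_hom (op_alg A) (End_ring M)"
    proof (rule ring_hom_memI)
      fix a b assume ab: "a \<in> carrier (op_alg A)" "b \<in> carrier (op_alg A)"
      show "conn_rep_op M (a \<otimes>\<^bsub>op_alg A\<^esub> b) = conn_rep_op M a \<otimes>\<^bsub>End_ring M\<^esub> conn_rep_op M b"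
        by (rule Q) (use ab in \<open>simp_all add: c v m.m.mult_ract\<close>)
      show "conn_rep_op M (a \<oplus>\<^bsub>op_alg A\<^esub> b) = conn_rep_op M a \<oplus>\<^bsub>End_ring M\<^esub> conn_rep_op M b"
        by (rule Q) (use ab in \<open>simp_all add: c v m.m.add_ract\<close>)
    next
      show "conn_rep_op M \<one>\<^bsub>op_alg A\<^esub> = \<one>\<^bsub>End_ring M\<^esub>"
        by (rule Q) (simp_all add: c v m.m.one_ract)
    qed (simp add: cB)
  next
    fix a b assume ab: "a \<in> carrier A" "b \<in> carrier A"
    show "end_of M a \<otimes>\<^bsub>End_ring M\<^esub> conn_rep_op M b = conn_rep_op M b \<otimes>\<^bsub>End_ring M\<^esub> end_of M a"
      by (rule Q) (use ab in \<open>simp_all add: c v m.m.lact_ract\<close>)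
  next
    fix k assume k: "k \<in> carrier K"
    show "end_of M (k \<odot>\<^bsub>A\<^esub> \<one>\<^bsub>A\<^esub>) = conn_rep_op M (k \<odot>\<^bsub>A\<^esub> \<one>\<^bsub>A\<^esub>)"
      by (rule Q) (use k in \<open>simp_all add: c v m.m.scalar_central\<close>)
  next
    fix x y \<omega> assume "x \<in> carrier X" "y \<in> carrier X" "\<omega> \<in> carrier \<Omega>"
    then show "conn_rep_M M \<sigma> (x \<boxplus>\<^bsub>X\<^esub> y) \<omega> = conn_rep_M M \<sigma> x \<omega> \<oplus>\<^bsub>End_ring M\<^esub> conn_rep_M M \<sigma> y \<omega>"
      by (intro Q) (simp_all add: c v m.ev_add_left)
  next
    fix x \<omega> \<eta> assume "x \<in> carrier X" "\<omega> \<in> carrier \<Omega>" "\<eta> \<in> carrier \<Omega>"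
    then show "conn_rep_M M \<sigma> x (\<omega> \<boxplus>\<^bsub>\<Omega>\<^esub> \<eta>) = conn_rep_M M \<sigma> x \<omega> \<oplus>\<^bsub>End_ring M\<^esub> conn_rep_M M \<sigma> x \<eta>"
      by (intro Q) (simp_all add: c v m.M\<Omega>.tens_add_right hom_mult[OF sigma_hom] m.ev_add)
  next
    fix a x \<omega> assume axw: "a \<in> carrier A" "x \<in> carrier X" "\<omega> \<in> carrier \<Omega>"
    show "end_of M a \<otimes>\<^bsub>End_ring M\<^esub> conn_rep_M M \<sigma> x \<omega> = conn_rep_M M \<sigma> (lact X a x) \<omega>"
      by (rule Q) (use axw in \<open>simp_all add: c v m.lact_ev\<close>)
    show "conn_rep_op M a \<otimes>\<^bsub>End_ring M\<^esub> conn_rep_M M \<sigma> x \<omega> = conn_rep_M M \<sigma> x (ract \<Omega> \<omega> a)"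
      by (rule Q) (use axw in \<open>simp_all add: c v m.ev_ract[symmetric] sigma_ract[symmetric] m.M\<Omega>_ract_tens\<close>)
    show "conn_rep_M M \<sigma> x \<omega> \<otimes>\<^bsub>End_ring M\<^esub> end_of M a = conn_rep_M M \<sigma> (ract X x a) \<omega>"
      by (rule Q) (use axw in \<open>simp_all add: c v m.ev_lact[symmetric] sigma_lact[symmetric] m.M\<Omega>_lact_tens\<close>)
    show "conn_rep_M M \<sigma> x \<omega> \<otimes>\<^bsub>End_ring M\<^esub> conn_rep_op M a = conn_rep_M M \<sigma> x (lact \<Omega> a \<omega>)"
      by (rule Q) (use axw in \<open>simp_all add: c v m.M\<Omega>.tens_balanced\<close>)
  next
    fix x y assume xy: "x \<in> carrier X" "y \<in> carrier X"
    show "conn_rep_X M nabla (x \<boxplus>\<^bsub>X\<^esub> y) = conn_rep_X M nabla x \<oplus>\<^bsub>End_ring M\<^esub> conn_rep_X M nabla y"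
      by (rule Q) (use xy in \<open>simp_all add: c v m.ev_add_left\<close>)
  next
    fix a x assume ax: "a \<in> carrier A" "x \<in> carrier X"
    show "end_of M a \<otimes>\<^bsub>End_ring M\<^esub> conn_rep_X M nabla x = conn_rep_X M nabla (lact X a x)"
      by (rule Q) (use ax in \<open>simp_all add: c v m.lact_ev\<close>)
    show "conn_rep_X M nabla x \<otimes>\<^bsub>End_ring M\<^esub> end_of M a
        = conn_rep_X M nabla (ract X x a) \<oplus>\<^bsub>End_ring M\<^esub> end_of M (x (d a))"
      by (rule Q) (use ax in \<open>simp_all add: c v bimodule_connectionD(4)[OF conn] m.ev_add m.ev_lact m.ev_tens\<close>)
    show "conn_rep_X M nabla x \<otimes>\<^bsub>End_ring M\<^esub> conn_rep_op M a
        = conn_rep_op M a \<otimes>\<^bsub>End_ring M\<^esub> conn_rep_X M nabla x \<oplus>\<^bsub>End_ring M\<^esub> conn_rep_M M \<sigma> x (d a)"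
      by (rule Q) (use ax in \<open>simp_all add: c v bimodule_connectionD(5)[OF conn] m.ev_add m.ev_ract\<close>)
  qed (simp_all add: cM cX)
qed

lemma conn_act_ring_hom: "conn_act M nabla \<sigma> \<in> ring_hom BXA (End_ring M)"
  and conn_act_gA: "a \<in> carrier A \<Longrightarrow> conn_act M nabla \<sigma> (gA a) = end_of M a"
  and conn_act_gB: "a \<in> carrier A \<Longrightarrow> conn_act M nabla \<sigma> (gB a) = conn_rep_op M a"
  and conn_act_gM: "x \<in> carrier X \<Longrightarrow> \<omega> \<in> carrier \<Omega> \<Longrightarrow> conn_act M nabla \<sigma> (gM x \<omega>) = conn_rep_M M \<sigma> x \<omega>"
  and conn_act_gX: "x \<in> carrier X \<Longrightarrow> conn_act M nabla \<sigma> (gX x) = conn_rep_X M nabla x"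
  using someI_ex[OF vector_field_rep.BX_universal[OF vector_field_rep_conn, unfolded Bex_def]]
  unfolding conn_act_def[symmetric] by blast+

lemma left_module_mod_of: "left_module BXA (mod_of M nabla \<sigma>)"
proof (rule left_module_of_ring_hom[OF ring_BX])
  show "comm_group (mod_of M nabla \<sigma>)"
    by (rule comm_group_cong[OF m.m.M.comm_group_axioms]) simp_all
  \<comment> \<open>The endomorphism ring depends only on the group fields, which the new module
    shares with \<open>M\<close>.\<close>
  have "End_ring (mod_of M nabla \<sigma>) = End_ring M"
    by (simp add: End_ring_def hom_def)
  then show "conn_act M nabla \<sigma> \<in> ring_hom BXA (End_ring (mod_of M nabla \<sigma>))"
    using conn_act_ring_hom by simp
qed simp

lemma mod_of_generators:
  assumes "m \<in> carrier M"
  shows "a \<in> carrier A \<Longrightarrow> lact (mod_of M nabla \<sigma>) (gA a) m = lact M a m"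
    and "a \<in> carrier A \<Longrightarrow> lact (mod_of M nabla \<sigma>) (gB a) m = ract M m a"
    and "x \<in> carrier X \<Longrightarrow> \<omega> \<in> carrier \<Omega> \<Longrightarrow>
      lact (mod_of M nabla \<sigma>) (gM x \<omega>) m = ev M x (\<sigma> (tens A M \<Omega> m \<omega>))"
    and "x \<in> carrier X \<Longrightarrow> lact (mod_of M nabla \<sigma>) (gX x) m = ev M x (nabla m)"
proof -
  show "lact (mod_of M nabla \<sigma>) (gA a) m = lact M a m" if "a \<in> carrier A"
    unfolding mod_of_simps(4)[OF gA_closed[OF that] assms] conn_act_gA[OF that]
    using assms by (simp add: end_of_def)
  show "lact (mod_of M nabla \<sigma>) (gB a) m = ract M m a" if "a \<in> carrier A"
    unfolding mod_of_simps(4)[OF gB_closed[OF that] assms] conn_act_gB[OF that]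
    using assms by (simp add: conn_rep_op_def)
  show "lact (mod_of M nabla \<sigma>) (gM x \<omega>) m = ev M x (\<sigma> (tens A M \<Omega> m \<omega>))"
    if "x \<in> carrier X" "\<omega> \<in> carrier \<Omega>"
    unfolding mod_of_simps(4)[OF bx.mu_closed[OF that] assms] conn_act_gM[OF that]
    using assms by (simp add: conn_rep_M_def)
  show "lact (mod_of M nabla \<sigma>) (gX x) m = ev M x (nabla m)" if "x \<in> carrier X"
    unfolding mod_of_simps(4)[OF bx.xi_closed[OF that] assms] conn_act_gX[OF that]
    using assms by (simp add: conn_rep_X_def)
qed

end

lemma left_hom_of_generators:
  assumes N: "left_module BXA N" and N': "left_module BXA N'" and f: "f \<in> hom N N'"
    and "\<And>a n. a \<in> carrier A \<Longrightarrow> n \<in> carrier N \<Longrightarrow> f (lact N (gA a) n) = lact N' (gA a) (f n)"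
    and "\<And>a n. a \<in> carrier A \<Longrightarrow> n \<in> carrier N \<Longrightarrow> f (lact N (gB a) n) = lact N' (gB a) (f n)"
    and "\<And>x \<omega> n. x \<in> carrier X \<Longrightarrow> \<omega> \<in> carrier \<Omega> \<Longrightarrow> n \<in> carrier N \<Longrightarrow>
      f (lact N (gM x \<omega>) n) = lact N' (gM x \<omega>) (f n)"
    and "\<And>x n. x \<in> carrier X \<Longrightarrow> n \<in> carrier N \<Longrightarrow> f (lact N (gX x) n) = lact N' (gX x) (f n)"
  shows "f \<in> left_homs BXA N N'"
proof -
  have "carrier BXA \<subseteq> {b \<in> carrier BXA. \<forall>n\<in>carrier N. f (lact N b n) = lact N' b (f n)}"
    by (rule BX_generated[OF subring_intertwined[OF N N' f]])
      (simp_all add: assms gA_closed gB_closed bx.mu_closed bx.xi_closed)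
  then show ?thesis
    using f by (auto simp: left_homs_def)
qed

text \<open>A morphism of connections commutes with each generator: with \<open>gA\<close> and
  \<open>gB\<close> as a bimodule map, with \<open>gX\<close> and \<open>gM\<close> by evaluating
  its two compatibility conditions. Linearity over the whole algebra follows by generation.\<close>

lemma left_hom_of_conn_hom:
  assumes M: "bimodule_connection K A \<Omega> d (M, nabla, \<sigma>)"
    and M': "bimodule_connection K A \<Omega> d (M', nabla', \<sigma>')"
    and f: "f \<in> conn_homs A \<Omega> (M, nabla, \<sigma>) (M', nabla', \<sigma>')"
  shows "f \<in> left_homs BXA (mod_of M nabla \<sigma>) (mod_of M' nabla' \<sigma>')"
proof -
  interpret m: module_over_calculus K A \<Omega> d J w xs M
    by (rule module_over_calculusI[OF bimodule_connectionD(1)[OF M]])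
  interpret m': module_over_calculus K A \<Omega> d J w xs M'
    by (rule module_over_calculusI[OF bimodule_connectionD(1)[OF M']])
  have fb: "f \<in> bimod_homs A M M'"
    and fn: "\<And>m. m \<in> carrier M \<Longrightarrow> nabla' (f m) = tensor_map A \<Omega> M' id f (nabla m)"
    and fs: "\<And>t. t \<in> carrier (tensor A M \<Omega>) \<Longrightarrow>
      \<sigma>' (tensor_map A M' \<Omega> f id t) = tensor_map A \<Omega> M' id f (\<sigma> t)"
    using f by (auto simp: conn_homs_def)
  note fb' = bimod_homsD[OF fb]
  have fc: "f m \<in> carrier M'" if "m \<in> carrier M" for m using hom_in_carrier[OF fb'(1) that] .
  note e = ev_tensor_map[OF m.m.bimodule_axioms m'.m.bimodule_axioms fb]
  note tl = tensor_map_left_tens[OF bimodule_axioms m.m.bimodule_axioms m'.m.bimodule_axioms fb]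
  have fs': "\<sigma>' (tens A M' \<Omega> (f m) \<omega>) = tensor_map A \<Omega> M' id f (\<sigma> (tens A M \<Omega> m \<omega>))"
    if "m \<in> carrier M" "\<omega> \<in> carrier \<Omega>" for m \<omega>
    using fs[of "tens A M \<Omega> m \<omega>"] that by (simp add: tl)
  show ?thesis
  proof (rule left_hom_of_generators[OF left_module_mod_of[OF M] left_module_mod_of[OF M']])
    show "f \<in> hom (mod_of M nabla \<sigma>) (mod_of M' nabla' \<sigma>')"
      using fb'(1) by (simp add: hom_def)
  qed (simp_all add: mod_of_generators[OF M] mod_of_generators[OF M'] fc fb' fn fs' e
      nabla_closed[OF M] sigma_closed[OF M])
qed


section \<open>The two constructions are mutually inverse\<close>

text \<open>The two actions agree on generators, so the identity map of the carrier commutes with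
  the generators and is therefore linear. Linearity of the identity says that the actions agree on
  the whole algebra.\<close>

lemma mod_of_conn:
  fixes N :: "(_, 'm) lmod"
  assumes N: "left_module BXA N" and ext: "ext_lmod BXA N"
  shows "mod_of (conn_bimod N) (conn_nabla N) (conn_sigma N) = N"
proof -
  let ?N' = "mod_of (conn_bimod N) (conn_nabla N) (conn_sigma N)"
  note C = bimodule_connection_conn[OF N]
  have "(\<lambda>n. n) \<in> left_homs BXA ?N' N"
    by (rule left_hom_of_generators[OF left_module_mod_of[OF C] N])
      (simp_all add: mod_of_generators[OF C] ev_conn_nabla[OF N] ev_conn_sigma[OF N] hom_def Pi_iff
        group.is_monoid monoid.m_closed comm_group.axioms(2)[OF left_module.axioms(2)[OF N]])
  then have "lact ?N' b n = lact N b n" if "b \<in> carrier BXA" "n \<in> carrier N" for b n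
    using that by (simp add: left_homs_def)
  \<comment> \<open>Outside the carriers both actions are \<open>undefined\<close>, one by
    construction and the other by \<open>ext_lmod\<close>. Without this the records would not be
    equal.\<close>
  moreover have "lact ?N' b n = lact N b n" if "\<not> (b \<in> carrier BXA \<and> n \<in> carrier N)" for b n
    using that ext by (auto simp: mod_of_def ext_lmod_def extensional_def)
  ultimately have "lact ?N' = lact N" by blast
  then show ?thesis by (cases N) (simp add: mod_of_def)
qed

text \<open>The bimodules are compared first, since the types of tensors and the evaluations for
  \<nabla> and \<sigma> refer to them. The remaining two components have the same evaluations by
  \<open>mod_of_generators\<close>, and extensionality settles their values elsewhere.\<close>

lemma conn_of_mod:
  fixes M :: "('a, 'a, 'm) bimod"
  assumes C: "bimodule_connection K A \<Omega> d (M, nabla, \<sigma>)" and eb: "ext_bimod A M"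
    and en: "nabla \<in> extensional (carrier M)" and es: "\<sigma> \<in> extensional (carrier (tensor A M \<Omega>))"
  shows "conn_bimod (mod_of M nabla \<sigma>) = M" "conn_nabla (mod_of M nabla \<sigma>) = nabla"
    "conn_sigma (mod_of M nabla \<sigma>) = \<sigma>"
proof -
  let ?N = "mod_of M nabla \<sigma>"
  note N = left_module_mod_of[OF C]
  interpret m: module_over_calculus K A \<Omega> d J w xs M
    by (rule module_over_calculusI[OF bimodule_connectionD(1)[OF C]])
  have "lact (conn_bimod ?N) = lact M"
  proof (intro ext)
    show "lact (conn_bimod ?N) a m = lact M a m" for a m
      using eb by (cases "a \<in> carrier A \<and> m \<in> carrier M")
        (auto simp: mod_of_generators[OF C] conn_bimod_def ext_bimod_def ext_lmod_def extensional_def)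
  qed
  moreover have "ract (conn_bimod ?N) = ract M"
  proof (intro ext)
    show "ract (conn_bimod ?N) m a = ract M m a" for a m
      using eb by (cases "a \<in> carrier A \<and> m \<in> carrier M")
        (auto simp: mod_of_generators[OF C] conn_bimod_def ext_bimod_def extensional_def)
  qed
  ultimately show M: "conn_bimod ?N = M"
    by (cases M) (simp add: conn_bimod_def)
  show "conn_nabla ?N = nabla"
  proof (rule extensionalityI[OF _ en])
    show "conn_nabla ?N \<in> extensional (carrier M)" by (simp add: conn_nabla_def)
    fix n assume n: "n \<in> carrier M"
    show "conn_nabla ?N n = nabla n"
    proof (rule m.ev_eqI)
      show "conn_nabla ?N n \<in> carrier m.\<Omega>M"
        using conn_nabla_closed[OF N, of n] n by (simp add: M)
      show "nabla n \<in> carrier m.\<Omega>M" using nabla_closed[OF C n] .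
      show "ev M x (conn_nabla ?N n) = ev M x (nabla n)" if "x \<in> carrier X" for x
        using ev_conn_nabla[OF N, of n x] n that by (simp add: M mod_of_generators[OF C])
    qed
  qed
  have sh: "conn_sigma ?N \<in> hom m.M\<Omega> m.\<Omega>M"
    using conn_sigma_hom[OF N] by (simp add: M)
  show "conn_sigma ?N = \<sigma>"
  proof (rule extensionalityI[OF _ es])
    show "conn_sigma ?N \<in> extensional (carrier m.M\<Omega>)" by (simp add: conn_sigma_def M)
    fix t assume t: "t \<in> carrier m.M\<Omega>"
    show "conn_sigma ?N t = \<sigma> t"
    proof (rule m.M\<Omega>.tensor_hom_eqI[OF sh sigma_hom[OF C] m.\<Omega>M.T.is_group _ t])
      fix n \<omega> assume nw: "n \<in> carrier M" "\<omega> \<in> carrier \<Omega>"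
      show "conn_sigma ?N (tens A M \<Omega> n \<omega>) = \<sigma> (tens A M \<Omega> n \<omega>)"
      proof (rule m.ev_eqI)
        show "conn_sigma ?N (tens A M \<Omega> n \<omega>) \<in> carrier m.\<Omega>M"
          using nw by (intro hom_in_carrier[OF sh]) simp
        show "\<sigma> (tens A M \<Omega> n \<omega>) \<in> carrier m.\<Omega>M"
          using nw by (intro sigma_closed[OF C]) simp
        show "ev M x (conn_sigma ?N (tens A M \<Omega> n \<omega>)) = ev M x (\<sigma> (tens A M \<Omega> n \<omega>))" if "x \<in> carrier X" for x
          using ev_conn_sigma[OF N, of n \<omega> x] nw that by (simp add: M mod_of_generators[OF C])
      qed
    qed
  qed
qed

end

section \<open>The isomorphism of categories\<close>

lemma hom_compose_restrict:
  assumes "group M" "f \<in> hom M N" "g \<in> hom N L"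
  shows "compose (carrier M) g f \<in> hom M L"
  using hom_compose'[OF assms(2,3)] hom_restrict[OF assms(1)] unfolding compose_def by blast

lemma left_homs_compose:
  assumes "left_module R M" "f \<in> left_homs R M N" "g \<in> left_homs R N L"
  shows "compose (carrier M) g f \<in> left_homs R M L"
proof -
  interpret m: left_module R M by fact
  show ?thesis
    using assms(2,3) hom_compose_restrict[OF m.M.is_group, of f N g L]
    by (auto simp: left_homs_def compose_eq m.lact_closed hom_in_carrier)
qed

lemma category_lmod_cat: "category (lmod_cat B)"
proof -
  have 1: "(\<lambda>m\<in>carrier M. m) \<in> left_homs B M M" if "left_module B M" for M :: "(_, 'm) lmod"
  proof -
    interpret m: left_module B M by fact
    show ?thesis
      by (simp add: left_homs_def m.lact_closed hom_def)
  qed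
  have f: "f \<in> carrier M \<rightarrow> carrier N" if "f \<in> left_homs B M N" for f and M N :: "(_, 'm) lmod"
    using that by (auto simp: left_homs_def hom_def)
  show ?thesis
    unfolding category_def
  proof (intro conjI ballI)
    fix W X Y Z f g h
    assume "f \<in> Hom (lmod_cat B) W X" "g \<in> Hom (lmod_cat B) X Y" "h \<in> Hom (lmod_cat B) Y Z"
    then show "Cmp (lmod_cat B) W X Z (Cmp (lmod_cat B) X Y Z h g) f
        = Cmp (lmod_cat B) W Y Z h (Cmp (lmod_cat B) W X Y g f)"
      using compose_assoc[OF f[of f W X], of h g] by (simp add: lmod_cat_def)
  qed (auto simp: lmod_cat_def 1 left_homs_compose intro!: compose_Id Id_compose dest: f)
qed

lemma bimod_homs_compose:
  assumes "bimodule K A M" "f \<in> bimod_homs A M N" "g \<in> bimod_homs A N L"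
  shows "compose (carrier M) g f \<in> bimod_homs A M L"
proof -
  interpret m: bimodule K A M by fact
  note f = bimod_homsD[OF assms(2)] and g = bimod_homsD[OF assms(3)]
  show ?thesis
    using hom_compose_restrict[OF m.M.is_group f(1) g(1)]
    by (simp add: bimod_homs_def left_homs_def right_homs_def compose_eq m.lact_closed m.ract_closed
        f(2,3) g(2,3) hom_in_carrier[OF f(1)])
qed

lemma
  assumes L: "bimodule K A L" and M: "bimodule K A M" and N: "bimodule K A N" and Q: "bimodule K A Q"
    and f: "f \<in> bimod_homs A M N" and g: "g \<in> bimod_homs A N Q"
  shows tensor_map_right_compose: "t \<in> carrier (tensor A L M) \<Longrightarrow>
      tensor_map A L Q id (compose (carrier M) g f) t = tensor_map A L Q id g (tensor_map A L N id f t)"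
    and tensor_map_left_compose: "u \<in> carrier (tensor A M L) \<Longrightarrow>
      tensor_map A Q L (compose (carrier M) g f) id u = tensor_map A Q L g id (tensor_map A N L f id u)"
proof -
  note c = bimod_homs_compose[OF M f g]
  interpret lm: balanced_pair A L M by (rule balanced_pair_bimodules[OF L M])
  interpret ml: balanced_pair A M L by (rule balanced_pair_bimodules[OF M L])
  interpret lq: balanced_pair A L Q by (rule balanced_pair_bimodules[OF L Q])
  interpret ql: balanced_pair A Q L by (rule balanced_pair_bimodules[OF Q L])
  note fc = hom_in_carrier[OF bimod_homsD(1)[OF f]]
  show "t \<in> carrier (tensor A L M) \<Longrightarrow>
      tensor_map A L Q id (compose (carrier M) g f) t = tensor_map A L Q id g (tensor_map A L N id f t)"
    by (rule lm.tensor_hom_eqI[OF tensor_map_right_hom[OF L M Q c]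
          hom_compose'[OF tensor_map_right_hom[OF L M N f] tensor_map_right_hom[OF L N Q g]] lq.T.is_group])
      (simp_all add: tensor_map_right_tens[OF L M Q c] tensor_map_right_tens[OF L M N f]
        tensor_map_right_tens[OF L N Q g] fc compose_eq)
  show "u \<in> carrier (tensor A M L) \<Longrightarrow>
      tensor_map A Q L (compose (carrier M) g f) id u = tensor_map A Q L g id (tensor_map A N L f id u)"
    by (rule ml.tensor_hom_eqI[OF tensor_map_left_hom[OF L M Q c]
          hom_compose'[OF tensor_map_left_hom[OF L M N f] tensor_map_left_hom[OF L N Q g]] ql.T.is_group])
      (simp_all add: tensor_map_left_tens[OF L M Q c] tensor_map_left_tens[OF L M N f]
        tensor_map_left_tens[OF L N Q g] fc compose_eq)
qed

lemma id_bimod_homs: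
  assumes "bimodule K A M"
  shows "(\<lambda>m\<in>carrier M. m) \<in> bimod_homs A M M"
proof -
  interpret m: bimodule K A M by fact
  show ?thesis
    by (simp add: bimod_homs_def left_homs_def right_homs_def hom_def m.lact_closed m.ract_closed)
qed

text \<open>Morphisms are extensional, so the identity of the category is the restricted identity;
  its tensor product with \<open>id\<close> has to be computed for this restriction.\<close>

lemma
  assumes L: "bimodule K A L" and M: "bimodule K A M"
  shows tensor_map_right_id: "t \<in> carrier (tensor A L M) \<Longrightarrow> tensor_map A L M id (\<lambda>m\<in>carrier M. m) t = t"
    and tensor_map_left_id: "u \<in> carrier (tensor A M L) \<Longrightarrow> tensor_map A M L (\<lambda>m\<in>carrier M. m) id u = u"
proof -
  note i = id_bimod_homs[OF M]
  interpret lm: balanced_pair A L M by (rule balanced_pair_bimodules[OF L M])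
  interpret ml: balanced_pair A M L by (rule balanced_pair_bimodules[OF M L])
  show "t \<in> carrier (tensor A L M) \<Longrightarrow> tensor_map A L M id (\<lambda>m\<in>carrier M. m) t = t"
    by (rule lm.tensor_hom_eqI[OF tensor_map_right_hom[OF L M M i] hom_ident lm.T.is_group])
      (simp_all add: tensor_map_right_tens[OF L M M i])
  show "u \<in> carrier (tensor A M L) \<Longrightarrow> tensor_map A M L (\<lambda>m\<in>carrier M. m) id u = u"
    by (rule ml.tensor_hom_eqI[OF tensor_map_left_hom[OF L M M i] hom_ident ml.T.is_group])
      (simp_all add: tensor_map_left_tens[OF L M M i])
qed

context differential_calculus
begin

lemma conn_homsD:
  assumes "f \<in> conn_homs A \<Omega> (M, nabla, \<sigma>) (N, nabla', \<sigma>')"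
  shows "f \<in> bimod_homs A M N"
    and "m \<in> carrier M \<Longrightarrow> tensor_map A \<Omega> N id f (nabla m) = nabla' (f m)"
    and "t \<in> carrier (tensor A M \<Omega>) \<Longrightarrow>
      \<sigma>' (tensor_map A N \<Omega> f id t) = tensor_map A \<Omega> N id f (\<sigma> t)"
  using assms by (simp_all add: conn_homs_def)

lemma bimodule_connection_carrier:
  assumes "bimodule_connection K A \<Omega> d (M, nabla, \<sigma>)"
  shows "bimodule K A M"
    and "m \<in> carrier M \<Longrightarrow> nabla m \<in> carrier (tensor A \<Omega> M)"
    and "t \<in> carrier (tensor A M \<Omega>) \<Longrightarrow> \<sigma> t \<in> carrier (tensor A \<Omega> M)"
  using assms unfolding bimodule_connection_def Let_def prod.case
  by (blast intro: hom_in_carrier dest: bimod_homsD(1))+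

lemma conn_homs_id:
  assumes M: "bimodule_connection K A \<Omega> d (M, nabla, \<sigma>)"
  shows "(\<lambda>m\<in>carrier M. m) \<in> conn_homs A \<Omega> (M, nabla, \<sigma>) (M, nabla, \<sigma>)"
  using bimodule_connection_carrier[OF M] id_bimod_homs[of K A M]
  by (simp add: conn_homs_def tensor_map_right_id[OF bimodule_axioms] tensor_map_left_id[OF bimodule_axioms])

lemma conn_homs_compose:
  assumes M: "bimodule_connection K A \<Omega> d (M, nabla, \<sigma>)"
    and N: "bimodule_connection K A \<Omega> d (N, nabla', \<sigma>')"
    and L: "bimodule_connection K A \<Omega> d (L, nabla'', \<sigma>'')"
    and f: "f \<in> conn_homs A \<Omega> (M, nabla, \<sigma>) (N, nabla', \<sigma>')"
    and g: "g \<in> conn_homs A \<Omega> (N, nabla', \<sigma>') (L, nabla'', \<sigma>'')"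
  shows "compose (carrier M) g f \<in> conn_homs A \<Omega> (M, nabla, \<sigma>) (L, nabla'', \<sigma>'')"
proof -
  note m = bimodule_connection_carrier[OF M] and n = bimodule_connection_carrier[OF N]
    and l = bimodule_connection_carrier[OF L]
  note f' = conn_homsD[OF f] and g' = conn_homsD[OF g]
  note r = tensor_map_right_compose[OF bimodule_axioms m(1) n(1) l(1) f'(1) g'(1)]
    tensor_map_left_compose[OF bimodule_axioms m(1) n(1) l(1) f'(1) g'(1)]
  note tc = hom_in_carrier[OF tensor_map_left_hom[OF bimodule_axioms m(1) n(1) f'(1)]]
  show ?thesis
    using bimod_homs_compose[OF m(1) f'(1) g'(1)]
    by (simp add: conn_homs_def r compose_eq m f' g' hom_in_carrier[OF bimod_homsD(1)[OF f'(1)]] tc)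
qed

lemma category_conn_cat: "category (conn_cat K A \<Omega> d :: (('a, 'w, 'm) conn, 'm \<Rightarrow> 'm) cat)"
proof -
  have f: "f \<in> carrier M \<rightarrow> carrier N" if "f \<in> conn_homs A \<Omega> (M, nabla, \<sigma>) (N, nabla', \<sigma>')"
    for f nabla \<sigma> nabla' \<sigma>' and M N :: "('a, 'a, 'm) bimod"
    using bimod_homsD(1)[OF conn_homsD(1)[OF that]] by (simp add: hom_def)
  show ?thesis
    unfolding category_def
  proof (intro conjI ballI)
    fix W X Y Z :: "('a, 'w, 'm) conn" and f g h
    assume "f \<in> Hom (conn_cat K A \<Omega> d) W X" "g \<in> Hom (conn_cat K A \<Omega> d) X Y" "h \<in> Hom (conn_cat K A \<Omega> d) Y Z"
    then show "Cmp (conn_cat K A \<Omega> d) W X Z (Cmp (conn_cat K A \<Omega> d) X Y Z h g) f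
        = Cmp (conn_cat K A \<Omega> d) W Y Z h (Cmp (conn_cat K A \<Omega> d) W X Y g f)"
      by (cases W; cases X; cases Y; cases Z) (auto simp: conn_cat_def dest: f intro!: compose_assoc[symmetric])
  next
    fix X Y Z :: "('a, 'w, 'm) conn" and f g
    assume "X \<in> Ob (conn_cat K A \<Omega> d)" "Y \<in> Ob (conn_cat K A \<Omega> d)" "Z \<in> Ob (conn_cat K A \<Omega> d)"
      "f \<in> Hom (conn_cat K A \<Omega> d) X Y" "g \<in> Hom (conn_cat K A \<Omega> d) Y Z"
    then show "Cmp (conn_cat K A \<Omega> d) X Y Z g f \<in> Hom (conn_cat K A \<Omega> d) X Z"
      by (cases X; cases Y; cases Z) (auto simp: conn_cat_def intro: conn_homs_compose)
  next
    fix X :: "('a, 'w, 'm) conn"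
    assume "X \<in> Ob (conn_cat K A \<Omega> d)"
    then show "Idt (conn_cat K A \<Omega> d) X \<in> Hom (conn_cat K A \<Omega> d) X X"
      by (cases X) (auto simp: conn_cat_def intro: conn_homs_id)
  next
    fix X Y :: "('a, 'w, 'm) conn" and f
    assume "f \<in> Hom (conn_cat K A \<Omega> d) X Y"
    then show "Cmp (conn_cat K A \<Omega> d) X X Y f (Idt (conn_cat K A \<Omega> d) X) = f"
      "Cmp (conn_cat K A \<Omega> d) X Y Y (Idt (conn_cat K A \<Omega> d) Y) f = f"
      by (cases X; cases Y; auto simp: conn_cat_def dest: f intro!: compose_Id Id_compose)+
  qed
qed

end

context calculus_with_dual_basis
begin

lemma ext_conn_bimod:
  assumes "ext_lmod BXA N"
  shows "ext_bimod A (conn_bimod N)"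
  using assms unfolding ext_bimod_def ext_lmod_def
  by (auto simp: extensional_def) (auto simp: conn_bimod_def)

lemma ext_mod_of:
  assumes "ext_bimod A M"
  shows "ext_lmod BXA (mod_of M nabla \<sigma>)"
  using assms unfolding ext_bimod_def ext_lmod_def
  by (auto simp: extensional_def) (auto simp: mod_of_def)

lemma isomorphic_module_connection_categories:
  "isomorphic_categories (lmod_cat BXA :: (_, 'm \<Rightarrow> 'm) cat)
     (conn_cat K A \<Omega> d :: (('a, 'w, 'm) conn, 'm \<Rightarrow> 'm) cat)"
proof -
  let ?C = "lmod_cat BXA :: (_, 'm \<Rightarrow> 'm) cat"
  let ?D = "conn_cat K A \<Omega> d :: (('a, 'w, 'm) conn, 'm \<Rightarrow> 'm) cat"
  let ?F = "\<lambda>N. (conn_bimod N, conn_nabla N, conn_sigma N)"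
  let ?G = "\<lambda>(M, nabla, \<sigma>). mod_of M nabla \<sigma>"
  \<comment> \<open>The functors leave the underlying maps alone. This is possible because neither
    construction changes the carrier, so identities and composites are literally the same
    functions.\<close>
  let ?id = "\<lambda>X Y f. f"
  have obC: "N \<in> Ob ?C \<longleftrightarrow> left_module BXA N \<and> ext_lmod BXA N" for N
    by (simp add: lmod_cat_def)
  have obD: "(M, nabla, \<sigma>) \<in> Ob ?D \<longleftrightarrow> bimodule_connection K A \<Omega> d (M, nabla, \<sigma>) \<and> ext_bimod A M \<and>
      nabla \<in> extensional (carrier M) \<and> \<sigma> \<in> extensional (carrier (tensor A M \<Omega>))" for M nabla \<sigma>
    by (simp add: conn_cat_def)
  have FOb: "?F N \<in> Ob ?D" if "N \<in> Ob ?C" for N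
    using that bimodule_connection_conn[of N] ext_conn_bimod[of N]
    unfolding obC obD by (simp add: conn_nabla_def conn_sigma_def)
  have GOb: "?G Y \<in> Ob ?C" if "Y \<in> Ob ?D" for Y
    using that left_module_mod_of ext_mod_of by (cases Y) (auto simp: obC obD)
  have GF: "?G (?F N) = N" if "N \<in> Ob ?C" for N
    using that mod_of_conn[of N] by (simp add: obC)
  have FG: "?F (?G Y) = Y" if "Y \<in> Ob ?D" for Y
    using that conn_of_mod by (cases Y) (auto simp: obD)
  have Fhom: "f \<in> Hom ?D (?F N) (?F N')" if "N \<in> Ob ?C" "N' \<in> Ob ?C" "f \<in> Hom ?C N N'" for f N N'
    using that conn_hom_of_left_hom[of N N' f] unfolding obC by (auto simp: lmod_cat_def conn_cat_def)
  have Ghom: "f \<in> Hom ?C (?G Y) (?G Y')" if "Y \<in> Ob ?D" "Y' \<in> Ob ?D" "f \<in> Hom ?D Y Y'" for f Y Y'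
    using that left_hom_of_conn_hom by (cases Y; cases Y') (auto simp: lmod_cat_def conn_cat_def)
  have F: "is_functor ?C ?D ?F ?id"
    unfolding is_functor_def using FOb Fhom by (auto simp: lmod_cat_def conn_cat_def)
  have G: "is_functor ?D ?C ?G ?id"
    unfolding is_functor_def using GOb Ghom by (auto simp: lmod_cat_def conn_cat_def)
  show ?thesis
    unfolding isomorphic_categories_def
    by (intro conjI category_lmod_cat category_conn_cat exI[of _ ?F] exI[of _ ?id] exI[of _ ?G] F G ballI GF FG refl)
qed

end

theorem theorem3p5:
  fixes K :: "('k, 'z) ring_scheme"
    and A :: "('k, 'a) module"
    and \<Omega> :: "('a, 'a, 'w) bimod"
    and d :: "'a \<Rightarrow> 'w"
  assumes "differential_calculus K A \<Omega> d"
    and "finitely_generated_right A \<Omega>"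
    and "projective_right A \<Omega>"
  shows "isomorphic_categories
           (lmod_cat (BX K A \<Omega> d) :: (_, 'm \<Rightarrow> 'm) cat)
           (conn_cat K A \<Omega> d :: (('a, 'w, 'm) conn, 'm \<Rightarrow> 'm) cat)"
proof -
  \<comment> \<open>The statement does not mention a dual basis, so any one may be fixed for the
    construction of the functors.\<close>
  obtain J :: "'w set" and w xs where "calculus_with_dual_basis K A \<Omega> d J w xs"
    using differential_calculus.dual_basis_exists[OF assms] by blast
  then show ?thesis
    by (rule calculus_with_dual_basis.isomorphic_module_connection_categories)
qed

end
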